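(* Let $(M,g)$ be an $(n+1)$-dimensional smooth compact Riemannian manifold with boundary $\partial M$, $n\ge 2$. Let $\sigma\in(0,1)$, let $p=\frac{2n}{n-2\sigma}$, and let $\rho$ be a defining function of $M$ with $|\nabla_g\rho|=1$ on $\partial M$. Let $$\mu:=\inf_{u\in\Lambda}\frac{\int_M\rho^{1-2\sigma}|\nabla_g u|^2\,dv_g}{\left(\int_{\partial M}|u|^p\,ds_g\right)^{2/p}},\qquad \Lambda:=\Big\{u\in W^{1,2}(\rho^{1-2\sigma},M)\ \Big|\ \int_{\partial M}|u|^{p-2}u\,ds_g=0,\ u\not\equiv 0\text{ on }\partial M\Big\}.$$ Suppose that one of the following conditions holds: (1) $n=3$, $\sigma\in(0,1/2)$, and $H(P)>0$ at some point $P\in\partial M$; (2) $n\ge4$, $\sigma\in(0,1)$, and $H(P)>0$ at some point $P\in\partial M$; (3) $n\ge5$, $\sigma\in(0,1)$, and at some point $P\in\partial M$ one has $H(P)=0$ and $$\frac{3n^2-6n-4\sigma^2+4}{12(1-\sigma)(n-1)(n-2-2\sigma)}\bar R(P)+\|\pi\|^2(P)+\frac{3n-2-2\sigma}{3n-6-6\sigma}R_{tt}(P)>0.$$ Then there exists a constant $B>0$ such that, for all $u\in W^{1,2}(\rho^{1-2\sigma},M)$, $$\left(\int_{\partial M}|u|^p\,ds_g\right)^{2/p}\le\mu^{-1}\int_M\rho^{1-2\sigma}|\nabla_g u|^2\,dv_g+B\left|\int_{\partial M}|u|^{p-2}u\,ds_g\right|^{2/(p-1)}.$$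
   Context: A function $\rho\in C^\infty(\overline M)$ is a defining function of $M$ if $\rho>0$ in (the interior of) $M$, $\rho=0$ on $\partial M$, and $\nabla_g\rho\ne0$ on $\partial M$. The weighted Sobolev space $W^{1,2}(\rho^{1-2\sigma},M)$ is the closure of $C^\infty(\overline M)$ under the norm $$\|U\|_{W^{1,2}(\rho^{1-2\sigma},M)}=\left(\int_M\rho^{1-2\sigma}|\nabla_gU|^2\,dv_g+\int_{\partial M}U^2\,ds_g\right)^{1/2}.$$ Here $dv_g$ is the volume form of $(M,g)$ and $ds_g$ the induced volume form on $\partial M$; values of $u$ on $\partial M$ are in the sense of traces. Curvature notation on $\partial M$: let $\nu$ be the inward unit normal, which is the direction $\partial_t$ of the Fermi coordinates $(x,t)$ at $P$ ($x$ normal coordinates on $\partial M$ at $P$, $t=\rho$). $\pi$ is the second fundamental form of $\partial M$ with components $\pi_{ij}$, with the sign convention that the inverse metric satisfies $g^{ij}=\delta^{ij}+2\pi^{ij}t+\dots$ near $P$ (equivalently $\pi(X,Y)=g(\nabla_XY,\nu)$, so that $\pi$ is positive for a Euclidean ball); $\|\pi\|^2=g^{ik}g^{jl}\pi_{ij}\pi_{kl}$; $H=g^{ij}\pi_{ij}$ is the mean curvature (the trace of $\pi$, so $\sqrt{|g|}=1-Ht+\dots$). $\bar R$ is the scalar curvature of the metric induced by $g$ on $\partial M$. $R_{tt}=\mathrm{Ric}_g(\nu,\nu)$ is the $tt$-component of the Ricci tensor of $(M,g)$ (with the convention that Ricci is positive on round spheres).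
   Formalization: The manifold M is assumed connected; if two components of M have boundary, balanced locally constant functions lie in Λ with zero energy, so μ = 0 and μ^{-1} is undefined. *)

theory Defs
  imports "HOL-Analysis.Analysis"
begin

section \<open>Smooth functions on subsets of Euclidean space\<close>

primrec Ck_on :: "nat \<Rightarrow> ('a::euclidean_space \<Rightarrow> 'b::real_normed_vector) \<Rightarrow> 'a set \<Rightarrow> bool" where
  "Ck_on 0 f S \<longleftrightarrow> continuous_on S f"
| "Ck_on (Suc k) f S \<longleftrightarrow>
     (\<forall>x\<in>S. f differentiable (at x)) \<and>
     (\<forall>v. Ck_on k (\<lambda>x. frechet_derivative f (at x) v) S)"

text \<open>On a set that need not be open, smoothness means having local smooth extensions to open
  sets; for relatively open subsets of a half-space this is smoothness up to the boundary.\<close>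

definition smooth_on :: "('a::euclidean_space \<Rightarrow> 'b::real_normed_vector) \<Rightarrow> 'a set \<Rightarrow> bool" where
  "smooth_on f A \<longleftrightarrow>
     (\<forall>x\<in>A. \<exists>S h. open S \<and> x \<in> S \<and> (\<forall>k. Ck_on k h S) \<and> (\<forall>y\<in>A \<inter> S. f y = h y))"


section \<open>Manifolds with boundary\<close>

text \<open>The model space of dimension n + 1, with n = CARD('n): coordinate \<open>Some i\<close> is the i-th
  tangential coordinate, and \<open>None\<close> is the coordinate t that is nonnegative on the half-space.\<close>

type_synonym 'n model = "(real, 'n option) vec"

definition half_space :: "('n::finite) model set" where
  "half_space = {x. 0 \<le> x $ None}"

definition bdry_pt :: "real ^ 'n \<Rightarrow> ('n::finite) model" where
  "bdry_pt y = (\<chi> a. case a of None \<Rightarrow> 0 | Some i \<Rightarrow> y $ i)"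

definition tang_part :: "('n::finite) model \<Rightarrow> real ^ 'n" where
  "tang_part x = (\<chi> i. x $ Some i)"

type_synonym ('a, 'n) chart = "'a set \<times> ('a \<Rightarrow> 'n model)"

definition chart_img :: "('a, 'n::finite) chart \<Rightarrow> 'n model set" where
  "chart_img c = snd c ` fst c"

definition chart_inv :: "('a, 'n::finite) chart \<Rightarrow> 'n model \<Rightarrow> 'a" where
  "chart_inv c = inv_into (fst c) (snd c)"

text \<open>Tensor fields are given by their components in every chart of the atlas: \<open>mfd_metric M c p\<close> is
  the matrix of the metric at p with respect to the coordinate frame of the chart c.\<close>

record ('a, 'n) riem_data =
  mfd_top :: "'a topology"
  mfd_atlas :: "('a, 'n) chart set"
  mfd_metric :: "('a, 'n) chart \<Rightarrow> 'a \<Rightarrow> ((real, 'n option) vec, 'n option) vec"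

text \<open>Jacobian matrix at p of the transition map from the chart c to the chart c'. Derivatives are
  taken within the half-space, where they are unique, also at boundary points.\<close>

definition transition_jac ::
    "('a, 'n::finite) chart \<Rightarrow> ('a, 'n) chart \<Rightarrow> 'a \<Rightarrow> real ^ ('n option) ^ ('n option)" where
  "transition_jac c c' p = jacobian (snd c' \<circ> chart_inv c) (at (snd c p) within half_space)"

definition is_chart :: "'a topology \<Rightarrow> ('a, 'n::finite) chart \<Rightarrow> bool" where
  "is_chart X c \<longleftrightarrow>
     openin X (fst c) \<and>
     openin (top_of_set half_space) (chart_img c) \<and>
     homeomorphic_map (subtopology X (fst c)) (top_of_set (chart_img c)) (snd c)"

text \<open>Second countability is automatic from compactness and the existence of charts.\<close>

definition compact_connected_riemannian_manifold_with_boundary ::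
    "('a, 'n::finite) riem_data \<Rightarrow> bool" where
  "compact_connected_riemannian_manifold_with_boundary M \<longleftrightarrow>
     Hausdorff_space (mfd_top M) \<and> compact_space (mfd_top M) \<and> connected_space (mfd_top M) \<and>
     (\<forall>c\<in>mfd_atlas M. is_chart (mfd_top M) c) \<and>
     (\<Union>c\<in>mfd_atlas M. fst c) = topspace (mfd_top M) \<and>
     (\<forall>c\<in>mfd_atlas M. \<forall>c'\<in>mfd_atlas M.
        smooth_on (snd c' \<circ> chart_inv c) (snd c ` (fst c \<inter> fst c'))) \<and>
     (\<forall>c\<in>mfd_atlas M. smooth_on (mfd_metric M c \<circ> chart_inv c) (chart_img c)) \<and>
     (\<forall>c\<in>mfd_atlas M. \<forall>p\<in>fst c.
        transpose (mfd_metric M c p) = mfd_metric M c p \<and>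
        (\<forall>v. v \<noteq> 0 \<longrightarrow> 0 < v \<bullet> (mfd_metric M c p *v v))) \<and>
     (\<forall>c\<in>mfd_atlas M. \<forall>c'\<in>mfd_atlas M. \<forall>p\<in>fst c \<inter> fst c'.
        mfd_metric M c p =
          transpose (transition_jac c c' p) ** mfd_metric M c' p ** transition_jac c c' p)"

definition mfd_pts :: "('a, 'n::finite) riem_data \<Rightarrow> 'a set" where
  "mfd_pts M = topspace (mfd_top M)"

definition mfd_bdry :: "('a, 'n::finite) riem_data \<Rightarrow> 'a set" where
  "mfd_bdry M = {p \<in> mfd_pts M. \<exists>c\<in>mfd_atlas M. p \<in> fst c \<and> snd c p $ None = 0}"

text \<open>An arbitrary chart around p; it is only used to evaluate chart-independent expressions.\<close>

definition chart_at :: "('a, 'n::finite) riem_data \<Rightarrow> 'a \<Rightarrow> ('a, 'n) chart" where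
  "chart_at M p = (SOME c. c \<in> mfd_atlas M \<and> p \<in> fst c)"

definition smooth_fun :: "('a, 'n::finite) riem_data \<Rightarrow> ('a \<Rightarrow> real) \<Rightarrow> bool" where
  "smooth_fun M u \<longleftrightarrow> (\<forall>c\<in>mfd_atlas M. smooth_on (u \<circ> chart_inv c) (chart_img c))"

definition pderiv_within ::
    "(real ^ 'm) set \<Rightarrow> 'm::finite \<Rightarrow> (real ^ 'm \<Rightarrow> real) \<Rightarrow> real ^ 'm \<Rightarrow> real" where
  "pderiv_within S i f x = frechet_derivative f (at x within S) (axis i 1)"


section \<open>Vector fields and gradients\<close>

type_synonym ('a, 'n) vfield = "('a, 'n) chart \<Rightarrow> 'a \<Rightarrow> 'n model"

definition is_vector_field :: "('a, 'n::finite) riem_data \<Rightarrow> ('a, 'n) vfield \<Rightarrow> bool" where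
  "is_vector_field M Y \<longleftrightarrow>
     (\<forall>c\<in>mfd_atlas M. \<forall>c'\<in>mfd_atlas M. \<forall>p\<in>fst c \<inter> fst c'.
        Y c' p = transition_jac c c' p *v Y c p)"

definition vnorm_sq :: "('a, 'n::finite) riem_data \<Rightarrow> ('a, 'n) vfield \<Rightarrow> 'a \<Rightarrow> real" where
  "vnorm_sq M Y p =
     (let c = chart_at M p in Y c p \<bullet> (mfd_metric M c p *v Y c p))"

definition gradient :: "('a, 'n::finite) riem_data \<Rightarrow> ('a \<Rightarrow> real) \<Rightarrow> ('a, 'n) vfield" where
  "gradient M u c p =
     matrix_inv (mfd_metric M c p) *v
       (\<chi> a. pderiv_within half_space a (u \<circ> chart_inv c) (snd c p))"

definition defining_function :: "('a, 'n::finite) riem_data \<Rightarrow> ('a \<Rightarrow> real) \<Rightarrow> bool" where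
  "defining_function M \<rho> \<longleftrightarrow>
     smooth_fun M \<rho> \<and>
     (\<forall>p \<in> mfd_pts M - mfd_bdry M. 0 < \<rho> p) \<and>
     (\<forall>p \<in> mfd_bdry M. \<rho> p = 0) \<and>
     (\<forall>p \<in> mfd_bdry M. gradient M \<rho> (chart_at M p) p \<noteq> 0)"


section \<open>Volume measures\<close>

definition borel_of_mfd :: "('a, 'n::finite) riem_data \<Rightarrow> 'a measure" where
  "borel_of_mfd M = sigma (mfd_pts M) {S. openin (mfd_top M) S}"

definition borel_of_bdry :: "('a, 'n::finite) riem_data \<Rightarrow> 'a measure" where
  "borel_of_bdry M = sigma (mfd_bdry M) {S. openin (subtopology (mfd_top M) (mfd_bdry M)) S}"

definition bdry_metric ::
    "('a, 'n::finite) riem_data \<Rightarrow> ('a, 'n) chart \<Rightarrow> 'a \<Rightarrow> real ^ 'n ^ 'n" where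
  "bdry_metric M c p = (\<chi> i j. mfd_metric M c p $ Some i $ Some j)"

text \<open>The Borel measure on M that in every chart is the square root of det g times Lebesgue measure;
  it exists by the change-of-variables formula and is unique because the charts cover M.\<close>

definition vol :: "('a, 'n::finite) riem_data \<Rightarrow> 'a measure" where
  "vol M = (THE m.
     space m = mfd_pts M \<and> sets m = sets (borel_of_mfd M) \<and>
     (\<forall>c\<in>mfd_atlas M. \<forall>E\<in>sets (borel_of_mfd M). E \<subseteq> fst c \<longrightarrow>
        emeasure m E =
          (\<integral>\<^sup>+x. indicator (snd c ` E) x * ennreal (sqrt (det (mfd_metric M c (chart_inv c x)))) \<partial>lborel)))"

text \<open>The same for the induced metric on the boundary, as a measure on the boundary.\<close>

definition bdry_vol :: "('a, 'n::finite) riem_data \<Rightarrow> 'a measure" where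
  "bdry_vol M = (THE m.
     space m = mfd_bdry M \<and> sets m = sets (borel_of_bdry M) \<and>
     (\<forall>c\<in>mfd_atlas M. \<forall>E\<in>sets (borel_of_bdry M). E \<subseteq> fst c \<longrightarrow>
        emeasure m E =
          (\<integral>\<^sup>+y. indicator (snd c ` E) (bdry_pt y) *
                ennreal (sqrt (det (bdry_metric M c (chart_inv c (bdry_pt y))))) \<partial>lborel)))"


section \<open>The weighted Sobolev space\<close>

text \<open>The norm of U depends only on the gradient of U, measured in the weighted space of square
  integrable vector fields, and on the boundary values of U, measured in the square integrable
  functions on the boundary. The closure of the smooth functions under this norm is therefore their
  closure in the product of these two (complete) spaces: an element is the pair of a gradient field
  and a trace. Convergence is expressed with nonnegative integrals, so that no integrability has to
  be presupposed.\<close>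

type_synonym ('a, 'n) sobolev = "('a, 'n) vfield \<times> ('a \<Rightarrow> real)"

abbreviation weak_grad :: "('a, 'n) sobolev \<Rightarrow> ('a, 'n) vfield" where
  "weak_grad u \<equiv> fst u"

abbreviation trace_of :: "('a, 'n) sobolev \<Rightarrow> 'a \<Rightarrow> real" where
  "trace_of u \<equiv> snd u"

definition sobolev_dist_sq ::
    "('a, 'n::finite) riem_data \<Rightarrow> ('a \<Rightarrow> real) \<Rightarrow> real \<Rightarrow> ('a \<Rightarrow> real) \<Rightarrow> ('a, 'n) sobolev \<Rightarrow> ennreal" where
  "sobolev_dist_sq M \<rho> \<sigma> U u =
     (\<integral>\<^sup>+p. ennreal (\<rho> p powr (1 - 2 * \<sigma>) *
             vnorm_sq M (\<lambda>c q. gradient M U c q - weak_grad u c q) p) \<partial>vol M) +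
     (\<integral>\<^sup>+p. ennreal ((U p - trace_of u p)\<^sup>2) \<partial>bdry_vol M)"

definition weighted_sobolev ::
    "('a, 'n::finite) riem_data \<Rightarrow> ('a \<Rightarrow> real) \<Rightarrow> real \<Rightarrow> ('a, 'n) sobolev set" where
  "weighted_sobolev M \<rho> \<sigma> = {u.
     is_vector_field M (weak_grad u) \<and>
     (\<forall>c\<in>mfd_atlas M. weak_grad u c \<in> borel_measurable (restrict_space (borel_of_mfd M) (fst c))) \<and>
     trace_of u \<in> borel_measurable (borel_of_bdry M) \<and>
     (\<exists>U :: nat \<Rightarrow> 'a \<Rightarrow> real.
        (\<forall>k. smooth_fun M (U k)) \<and>
        (\<lambda>k. sobolev_dist_sq M \<rho> \<sigma> (U k) u) \<longlonglongrightarrow> 0)}"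

definition weighted_energy ::
    "('a, 'n::finite) riem_data \<Rightarrow> ('a \<Rightarrow> real) \<Rightarrow> real \<Rightarrow> ('a, 'n) sobolev \<Rightarrow> real" where
  "weighted_energy M \<rho> \<sigma> u =
     (\<integral>p. \<rho> p powr (1 - 2 * \<sigma>) * vnorm_sq M (weak_grad u) p \<partial>vol M)"


section \<open>Curvature\<close>

text \<open>Here G is a metric in local coordinates, and derivatives are taken within S (the half-space for
  M itself, everything for its boundary). The arguments of \<open>christoffel\<close> are the upper index k
  followed by the lower indices i and j.\<close>

definition christoffel ::
    "(real ^ 'm) set \<Rightarrow> (real ^ 'm \<Rightarrow> real ^ 'm ^ 'm) \<Rightarrow> real ^ 'm \<Rightarrow> 'm::finite \<Rightarrow> 'm \<Rightarrow> 'm \<Rightarrow> real" where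
  "christoffel S G x k i j =
     (1/2) * (\<Sum>l\<in>UNIV. matrix_inv (G x) $ k $ l *
       (pderiv_within S i (\<lambda>y. G y $ j $ l) x +
        pderiv_within S j (\<lambda>y. G y $ i $ l) x -
        pderiv_within S l (\<lambda>y. G y $ i $ j) x))"

text \<open>Trace of the map sending X to R(X, Z)Y, which is positive on round spheres.\<close>

definition ricci ::
    "(real ^ 'm) set \<Rightarrow> (real ^ 'm \<Rightarrow> real ^ 'm ^ 'm) \<Rightarrow> real ^ 'm \<Rightarrow> real ^ 'm ^ ('m::finite)" where
  "ricci S G x = (\<chi> j k. \<Sum>i\<in>UNIV.
       pderiv_within S i (\<lambda>y. christoffel S G y i j k) x -
       pderiv_within S k (\<lambda>y. christoffel S G y i i j) x +
       (\<Sum>l\<in>UNIV. christoffel S G x i i l * christoffel S G x l j k -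
                  christoffel S G x i k l * christoffel S G x l i j))"

definition scalar_curv ::
    "(real ^ 'm) set \<Rightarrow> (real ^ 'm \<Rightarrow> real ^ 'm ^ ('m::finite)) \<Rightarrow> real ^ 'm \<Rightarrow> real" where
  "scalar_curv S G x = (\<Sum>j\<in>UNIV. \<Sum>k\<in>UNIV. matrix_inv (G x) $ j $ k * ricci S G x $ j $ k)"

definition inward_normal ::
    "('a, 'n::finite) riem_data \<Rightarrow> ('a, 'n) chart \<Rightarrow> 'a \<Rightarrow> 'n model" where
  "inward_normal M c p = (THE v.
     (\<forall>i. axis (Some i) 1 \<bullet> (mfd_metric M c p *v v) = 0) \<and>
     v \<bullet> (mfd_metric M c p *v v) = 1 \<and> 0 < v $ None)"

text \<open>The matrix with entries \<open>g(\<nabla>\<^sub>i \<partial>\<^sub>j, \<nu>)\<close> for tangential i and j, where \<open>\<nu>\<close> is the inward unit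
  normal.\<close>

definition second_ff ::
    "('a, 'n::finite) riem_data \<Rightarrow> ('a, 'n) chart \<Rightarrow> 'a \<Rightarrow> real ^ 'n ^ 'n" where
  "second_ff M c p = (\<chi> i j.
     (\<chi> a. christoffel half_space (mfd_metric M c \<circ> chart_inv c) (snd c p) a (Some i) (Some j))
       \<bullet> (mfd_metric M c p *v inward_normal M c p))"

definition mean_curv :: "('a, 'n::finite) riem_data \<Rightarrow> 'a \<Rightarrow> real" where
  "mean_curv M p =
     (let c = chart_at M p; h = matrix_inv (bdry_metric M c p)
      in \<Sum>i\<in>UNIV. \<Sum>j\<in>UNIV. h $ i $ j * second_ff M c p $ i $ j)"

definition second_ff_norm_sq :: "('a, 'n::finite) riem_data \<Rightarrow> 'a \<Rightarrow> real" where
  "second_ff_norm_sq M p =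
     (let c = chart_at M p; h = matrix_inv (bdry_metric M c p); b = second_ff M c p
      in \<Sum>i\<in>UNIV. \<Sum>j\<in>UNIV. \<Sum>k\<in>UNIV. \<Sum>l\<in>UNIV. h $ i $ k * h $ j $ l * b $ i $ j * b $ k $ l)"

definition bdry_scalar_curv :: "('a, 'n::finite) riem_data \<Rightarrow> 'a \<Rightarrow> real" where
  "bdry_scalar_curv M p =
     (let c = chart_at M p
      in scalar_curv UNIV (\<lambda>y. bdry_metric M c (chart_inv c (bdry_pt y))) (tang_part (snd c p)))"

definition ricci_normal :: "('a, 'n::finite) riem_data \<Rightarrow> 'a \<Rightarrow> real" where
  "ricci_normal M p =
     (let c = chart_at M p; \<nu> = inward_normal M c p
      in \<nu> \<bullet> (ricci half_space (mfd_metric M c \<circ> chart_inv c) (snd c p) *v \<nu>))"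

end

theory Submission imports Defs begin

text \<open>The energy does not change when a constant is added to u. Choose c with
  \<open>\<integral>|u + c|\<^sup>p\<^sup>-\<^sup>2 (u + c) = 0\<close>. Then u + c is admissible for \<open>\<mu>\<close>, and Young's inequality, together with the growth
  of \<open>c \<mapsto> \<integral>|u + c|\<^sup>p\<^sup>-\<^sup>2 (u + c)\<close>, bounds \<open>\<parallel>u\<parallel>\<^sub>p\<^sup>2 - \<parallel>u + c\<parallel>\<^sub>p\<^sup>2\<close> by a constant times the
  remainder term. What is needed besides is that \<open>\<mu>\<close> is positive and is not an infimum over the
  empty set. The latter follows from a bump function at a boundary point. The former is a trace inequality
  \<open>\<parallel>u - m\<parallel>\<^sub>p\<^sup>2 \<le> C \<integral>\<rho>\<^sup>1\<^sup>-\<^sup>2\<^sup>\<sigma> |\<nabla>u|\<^sup>2\<close> on the boundary: on a coordinate box it follows by integrating the gradient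
  along oblique rays from a boundary point to the opposite face, estimating the parts below and
  above a height h separately and optimising in h; connectedness links the constants m of
  different boxes.\<close>

text \<open>Let A be the absolute value of the constraint integral of u. Growth gives |c| \<le>
  const A^(1/(p-1)), convexity of |x|^p then costs p |c| A, and the power 2/p of A^(p/(p-1)) is the
  exponent 2/(p-1) of the remainder; the factor of the energy is never touched.

  Since p is the critical trace exponent, positivity of \<mu> comes from an explicit estimate and
  not from compactness. For a boundary point x let G(x) be the weighted L^2 size of the gradient
  along the rays from x, and e that on the whole box. Below height h, Cauchy-Schwarz gives
  h^\<sigma> G(x); above h, the rays at height t fill a cube of side t, which gives h^(\<sigma> -
  n/2) e. The best h yields |u(x) - m|^p \<le> const e^(p-2) G(x)^2, and G^2 has integral at most
  const e^2. Overlaps of boxes may miss the boundary, so an L^1 bound on the volume is carried along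
  to compare the constants m.

  Two encodings shape the rest: the measures are definite descriptions, so a unique glued measure
  must be exhibited, and a Sobolev element is a pair of gradient and trace, reached only as a limit
  of smooth functions.\<close>

section \<open>Change of variables for nonnegative integrals\<close>

text \<open>The change-of-variables theorem of the library requires a well-ordered index type; the type
  \<open>'n index\<close> is a well-ordered copy of an arbitrary finite type \<open>'n\<close>.\<close>

typedef (overloaded) 'n index = "{..<CARD('n::finite)}"
  by (rule exI[of _ 0]) simp

instantiation index :: (finite) wellorder
begin

definition less_eq_index :: "'a index \<Rightarrow> 'a index \<Rightarrow> bool" where
  "less_eq_index a b \<longleftrightarrow> Rep_index a \<le> Rep_index b"

definition less_index :: "'a index \<Rightarrow> 'a index \<Rightarrow> bool" where
  "less_index a b \<longleftrightarrow> Rep_index a < Rep_index b"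

instance
proof
  fix P :: "'a index \<Rightarrow> bool" and a
  assume step: "\<And>x. (\<And>y. y < x \<Longrightarrow> P y) \<Longrightarrow> P x"
  show "P a"
  proof (induction a rule: measure_induct_rule[of Rep_index])
    case (less x)
    show ?case
      by (rule step, rule less) (simp add: less_index_def)
  qed
qed (auto simp: less_eq_index_def less_index_def Rep_index_inject)

end

instance index :: (finite) finite
proof
  have "finite (Abs_index ` {..<CARD('a)} :: 'a index set)"
    by simp
  also have "Abs_index ` {..<CARD('a)} = (UNIV :: 'a index set)"
    using type_definition.Abs_image[OF type_definition_index] .
  finally show "finite (UNIV :: 'a index set)" .
qed

lemma ex_bij_index: "\<exists>e :: 'n::finite index \<Rightarrow> 'n. bij e"
proof -
  have "CARD('n index) = CARD('n)"
    using type_definition.card[OF type_definition_index] by (metis card_lessThan)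
  then show ?thesis
    using finite_same_card_bij[of "UNIV :: 'n index set" "UNIV :: 'n set"] by auto
qed

text \<open>Leibniz formula: conjugation with \<open>e\<close> is a sign-preserving bijection
  between the permutations of the two index types, and it only reorders the factors of each
  product.\<close>

lemma det_reindex:
  fixes A :: "'b::comm_ring_1 ^ 'n ^ 'n" and e :: "'m::finite \<Rightarrow> 'n::finite"
  assumes e: "bij e"
  shows "det (\<chi> i j. A $ e i $ e j) = det A"
proof -
  let ?M = "map_permutation UNIV e"
  have M: "?M p i = e (p (inv e i))" for p i
    using e by (simp add: map_permutation_def bij_is_surj restrict_id_def)
  have bij: "bij_betw ?M {p. p permutes UNIV} {p. p permutes UNIV}"
  proof (rule bij_betwI[where g = "map_permutation UNIV (inv e)"])
    show "?M \<in> {p. p permutes UNIV} \<rightarrow> {p. p permutes UNIV}"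
      using map_permutation_permutes[of e UNIV UNIV] e by auto
    show "map_permutation UNIV (inv e) \<in> {p. p permutes UNIV} \<rightarrow> {p. p permutes UNIV}"
      using map_permutation_permutes[of "inv e" UNIV UNIV] bij_imp_bij_inv[OF e] by auto
    show "map_permutation UNIV (inv e) (?M p) = p" for p
      using e bij_imp_bij_inv[OF e]
      by (auto simp: fun_eq_iff map_permutation_def bij_is_surj restrict_id_def inv_inv_eq
            bij_is_inj)
    show "?M (map_permutation UNIV (inv e) p) = p" for p
      using e bij_imp_bij_inv[OF e]
      by (auto simp: fun_eq_iff map_permutation_def bij_is_surj restrict_id_def inv_inv_eq
            bij_is_inj surj_f_inv_f)
  qed
  have "det A = (\<Sum>p | p permutes UNIV. of_int (sign (?M p)) * (\<Prod>i\<in>UNIV. A $ i $ ?M p i))"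
    unfolding det_def by (rule sum.reindex_bij_betw[OF bij, symmetric])
  also have "\<dots> = (\<Sum>p | p permutes UNIV. of_int (sign p) * (\<Prod>i\<in>UNIV. A $ e i $ e (p i)))"
  proof (rule sum.cong[OF refl])
    fix p :: "'m \<Rightarrow> 'm" assume "p \<in> {p. p permutes UNIV}"
    then have "sign (?M p) = sign p"
      using e by (intro sign_map_permutation) (auto simp: bij_is_inj)
    moreover have "(\<Prod>i\<in>UNIV. A $ i $ ?M p i) = (\<Prod>i\<in>UNIV. A $ e i $ e (p i))"
      using e by (subst prod.reindex_bij_betw[OF e, symmetric]) (simp add: M bij_is_inj)
    ultimately show "of_int (sign (?M p)) * (\<Prod>i\<in>UNIV. A $ i $ ?M p i) =
        of_int (sign p) * (\<Prod>i\<in>UNIV. A $ e i $ e (p i))"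
      by simp
  qed
  finally show ?thesis
    by (simp add: det_def)
qed

definition reindex_vec :: "('m \<Rightarrow> 'n) \<Rightarrow> 'b ^ 'n \<Rightarrow> 'b ^ 'm" where
  "reindex_vec e x = (\<chi> i. x $ e i)"

lemma linear_reindex_vec: "linear (reindex_vec e :: real ^ 'n \<Rightarrow> real ^ 'm::finite)"
  by (rule linearI) (auto simp: reindex_vec_def vec_eq_iff)

lemma measurable_reindex_vec [measurable]:
  "(reindex_vec e :: real ^ 'n \<Rightarrow> real ^ 'm::finite) \<in> borel_measurable borel"
  by (intro borel_measurable_continuous_onI linear_continuous_on linear_conv_bounded_linear[THEN iffD1]
      linear_reindex_vec)

lemma reindex_vec_inverse:
  assumes "bij e"
  shows "reindex_vec (inv e) (reindex_vec e x) = x" "reindex_vec e (reindex_vec (inv e) y) = y"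
  using assms by (auto simp: reindex_vec_def vec_eq_iff surj_f_inv_f bij_is_surj bij_is_inj)

text \<open>Relabelling coordinates takes boxes to boxes and permutes their side lengths, so box
  volumes are unchanged; these determine \<open>lborel\<close>.\<close>

lemma distr_lborel_reindex_vec:
  fixes e :: "'m::finite \<Rightarrow> 'n::finite"
  assumes e: "bij e"
  shows "distr lborel borel (reindex_vec e :: real ^ 'n \<Rightarrow> real ^ 'm) = lborel"
proof (rule lborel_eqI[symmetric])
  fix l u :: "real ^ 'm"
  assume lu: "\<And>b. b \<in> Basis \<Longrightarrow> l \<bullet> b \<le> u \<bullet> b"
  let ?l = "reindex_vec (inv e) l" and ?u = "reindex_vec (inv e) u"
  have le: "l $ i \<le> u $ i" for i
    using lu[of "axis i 1"] by (auto simp: inner_axis Basis_vec_def)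
  have "reindex_vec e -` box l u = box ?l ?u"
  proof (intro set_eqI iffI)
    fix x :: "real ^ 'n"
    assume "x \<in> reindex_vec e -` box l u"
    then have *: "l $ i < x $ e i \<and> x $ e i < u $ i" for i
      by (simp add: mem_box_cart reindex_vec_def)
    show "x \<in> box ?l ?u"
      using *[of "inv e _"] e by (auto simp: mem_box_cart reindex_vec_def surj_f_inv_f bij_is_surj)
  next
    fix x :: "real ^ 'n"
    assume "x \<in> box ?l ?u"
    then have *: "l $ inv e i < x $ i \<and> x $ i < u $ inv e i" for i
      by (simp add: mem_box_cart reindex_vec_def)
    show "x \<in> reindex_vec e -` box l u"
      using *[of "e _"] e by (auto simp: mem_box_cart reindex_vec_def bij_is_inj)
  qed
  then have "emeasure (distr lborel borel (reindex_vec e)) (box l u) = emeasure lborel (box ?l ?u)"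
    by (simp add: emeasure_distr)
  also have "\<dots> = (\<Prod>b\<in>Basis. (?u - ?l) \<bullet> b)"
    using le by (subst emeasure_lborel_box)
      (auto simp: Basis_vec_def inner_axis reindex_vec_def)
  also have "(\<Prod>b\<in>Basis. (?u - ?l) \<bullet> b) = (\<Prod>i\<in>UNIV. u $ inv e i - l $ inv e i)"
    by (simp add: Basis_vec_def UNION_singleton_eq_range prod.reindex inj_on_def axis_eq_axis
        inner_axis reindex_vec_def)
  also have "\<dots> = (\<Prod>i\<in>UNIV. u $ i - l $ i)"
    using prod.reindex_bij_betw[OF bij_imp_bij_inv[OF e]] by fast
  also have "\<dots> = (\<Prod>b\<in>Basis. (u - l) \<bullet> b)"
    by (simp add: Basis_vec_def UNION_singleton_eq_range prod.reindex inj_on_def axis_eq_axis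
        inner_axis)
  finally show "emeasure (distr lborel borel (reindex_vec e)) (box l u) = (\<Prod>b\<in>Basis. (u - l) \<bullet> b)" .
qed simp

text \<open>The Jacobian-weighted integrand is a separate Borel function \<open>h\<close>, tied to
  \<open>f\<close> and \<open>g\<close> only on \<open>S\<close>, so that no measurability of the
  derivative has to be established. Nonnegativity turns absolute integrability into integrability,
  and real functions are read as functions into \<open>real^1\<close> to match the vector-valued
  theorem on absolutely integrable functions.\<close>

lemma nn_integral_change_of_variables_wellorder:
  fixes g :: "real ^ 'm::{finite,wellorder} \<Rightarrow> real ^ 'm::_" and f h :: "real ^ 'm::_ \<Rightarrow> real"
  assumes S[measurable]: "S \<in> sets borel" and gS[measurable]: "g ` S \<in> sets borel"
    and der: "\<And>x. x \<in> S \<Longrightarrow> (g has_derivative g' x) (at x within S)"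
    and inj: "inj_on g S"
    and f[measurable]: "f \<in> borel_measurable borel" "\<And>y. 0 \<le> f y"
    and h[measurable]: "h \<in> borel_measurable borel" "\<And>y. 0 \<le> h y"
    and hf: "\<And>x. x \<in> S \<Longrightarrow> h x = \<bar>det (matrix (g' x))\<bar> * f (g x)"
  shows "(\<integral>\<^sup>+x. indicator S x * ennreal (h x) \<partial>lborel) = (\<integral>\<^sup>+y. indicator (g ` S) y * ennreal (f y) \<partial>lborel)"
proof -
  let ?P = "\<lambda>b. (h has_integral b) S" and ?Q = "\<lambda>b. (f has_integral b) (g ` S)"
  have "((\<lambda>x. \<bar>det (matrix (g' x))\<bar> *\<^sub>R (vec (f (g x)) :: real^1)) absolutely_integrable_on S \<and>
         integral S (\<lambda>x. \<bar>det (matrix (g' x))\<bar> *\<^sub>R (vec (f (g x)) :: real^1)) = vec b \<longleftrightarrow>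
       (\<lambda>x. vec (f x) :: real^1) absolutely_integrable_on (g ` S) \<and>
         integral (g ` S) (\<lambda>x. vec (f x) :: real^1) = vec b)" for b
    using has_absolute_integral_change_of_variables[OF _ der inj, of "\<lambda>x. vec (f x) :: real^1" "vec b"] S
    by simp
  moreover have "(\<lambda>x. \<bar>det (matrix (g' x))\<bar> *\<^sub>R (vec (f (g x)) :: real^1)) absolutely_integrable_on S \<longleftrightarrow>
     h absolutely_integrable_on S"
    unfolding absolutely_integrable_on_1_iff
    by (rule set_integrable_cong) (auto simp: hf)
  moreover have "integral S (\<lambda>x. \<bar>det (matrix (g' x))\<bar> *\<^sub>R (vec (f (g x)) :: real^1)) = vec b \<longleftrightarrow>
      integral S h = b" for b
    unfolding integral_on_1_eq
    by (subst Henstock_Kurzweil_Integration.integral_cong[of S _ h]) (auto simp: hf)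
  moreover have "h absolutely_integrable_on S \<longleftrightarrow> h integrable_on S"
    by (simp add: absolutely_integrable_on_def h)
  moreover have "(\<lambda>x. vec (f x) :: real^1) absolutely_integrable_on (g ` S) \<longleftrightarrow> f integrable_on (g ` S)"
    unfolding absolutely_integrable_on_1_iff by (simp add: absolutely_integrable_on_def f)
  moreover have "integral (g ` S) (\<lambda>x. vec (f x) :: real^1) = vec b \<longleftrightarrow> integral (g ` S) f = b" for b
    unfolding integral_on_1_eq by simp
  ultimately have eq: "?P b \<longleftrightarrow> ?Q b" for b
    by (simp add: has_integral_iff)
  have *: "(k has_integral r) A \<longleftrightarrow> (\<integral>\<^sup>+x. indicator A x * ennreal (k x) \<partial>lborel) = ennreal r"
    if [measurable]: "A \<in> sets borel" "k \<in> borel_measurable borel" and k: "\<And>x. 0 \<le> k x" and "0 \<le> r" 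
    for A and k :: "real ^ 'm::_ \<Rightarrow> real" and r
  proof -
    have "(\<lambda>x. indicat_real A x * k x) \<in> borel_measurable lborel"
      by measurable
    then have meas: "(\<lambda>x. indicat_real A x * k x) \<in> borel_measurable lebesgue"
      by (rule measurable_completion)
    have "(k has_integral r) A \<longleftrightarrow> ((\<lambda>x. indicator A x * k x) has_integral r) UNIV"
      unfolding has_integral_restrict_UNIV[of A, symmetric]
      by (rule arg_cong[where f = "\<lambda>f. (f has_integral r) UNIV"]) (auto simp: indicator_def)
    also have "\<dots> \<longleftrightarrow> integral\<^sup>N lebesgue (\<lambda>x. indicator A x * k x) = r \<and> 0 \<le> r"
      using k meas by (subst has_integral_iff_nn_integral_lebesgue) auto
    also have "integral\<^sup>N lebesgue (\<lambda>x. indicator A x * k x) = (\<integral>\<^sup>+x. indicator A x * ennreal (k x) \<partial>lborel)"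
      by (subst nn_integral_completion) (auto intro!: nn_integral_cong simp: indicator_def)
    finally show ?thesis
      using that by simp
  qed
  have hP: "?P b \<longleftrightarrow> (\<integral>\<^sup>+x. indicator S x * ennreal (h x) \<partial>lborel) = ennreal b" if "0 \<le> b" for b
    using that h by (intro *) auto
  have fQ: "?Q b \<longleftrightarrow> (\<integral>\<^sup>+x. indicator (g ` S) x * ennreal (f x) \<partial>lborel) = ennreal b" if "0 \<le> b" for b
    using that f by (intro *) auto
  let ?p = "\<integral>\<^sup>+x. indicator S x * ennreal (h x) \<partial>lborel"
  let ?q = "\<integral>\<^sup>+x. indicator (g ` S) x * ennreal (f x) \<partial>lborel"
  have pq: "?p = ennreal b \<longleftrightarrow> ?q = ennreal b" if "0 \<le> b" for b
    using that eq hP fQ by simp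
  \<comment> \<open>The two sides agree as soon as one of them is finite; if one is infinite, no
    finite value is left for the other.\<close>
  show ?thesis
  proof (cases ?p)
    case (real r)
    then show ?thesis using pq[of r] by simp
  next
    case top
    then have "?q \<noteq> ennreal b" if "0 \<le> b" for b
      using pq[OF that] by simp
    then show ?thesis
      using top by (cases ?q) auto
  qed
qed

text \<open>Transport to the index type \<open>'n index\<close> along a relabelling of coordinates,
  which preserves Lebesgue measure and, by \<open>det_reindex\<close>, the Jacobian
  determinant.\<close>

lemma nn_integral_change_of_variables:
  fixes g :: "real ^ 'n::finite \<Rightarrow> real ^ 'n" and f h :: "real ^ 'n \<Rightarrow> real"
  assumes S[measurable]: "S \<in> sets borel" and gS[measurable]: "g ` S \<in> sets borel"
    and der: "\<And>x. x \<in> S \<Longrightarrow> (g has_derivative g' x) (at x within S)"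
    and inj: "inj_on g S"
    and f[measurable]: "f \<in> borel_measurable borel" "\<And>y. 0 \<le> f y"
    and h[measurable]: "h \<in> borel_measurable borel" "\<And>y. 0 \<le> h y"
    and hf: "\<And>x. x \<in> S \<Longrightarrow> h x = \<bar>det (matrix (g' x))\<bar> * f (g x)"
  shows "(\<integral>\<^sup>+x. indicator S x * ennreal (h x) \<partial>lborel) = (\<integral>\<^sup>+y. indicator (g ` S) y * ennreal (f y) \<partial>lborel)"
proof -
  obtain e :: "'n index \<Rightarrow> 'n" where e: "bij e"
    using ex_bij_index by blast
  define L :: "real ^ 'n index \<Rightarrow> real ^ 'n" where "L = reindex_vec (inv e)"
  define L' :: "real ^ 'n \<Rightarrow> real ^ 'n index" where "L' = reindex_vec e"
  have inv: "L (L' x) = x" "L' (L y) = y" for x y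
    using reindex_vec_inverse[OF e] by (auto simp: L_def L'_def)
  have [measurable]: "L \<in> borel_measurable borel" "L' \<in> borel_measurable borel"
    by (auto simp: L_def L'_def)
  have lin: "linear L" "linear L'"
    by (auto simp: L_def L'_def linear_reindex_vec)
  have bl: "bounded_linear L" "bounded_linear L'"
    using lin by (auto simp: linear_conv_bounded_linear)
  have vim: "L' ` A = L -` A" for A
  proof (intro set_eqI iffI)
    show "x \<in> L -` A" if "x \<in> L' ` A" for x
      using that by (auto simp: inv)
    show "x \<in> L' ` A" if "x \<in> L -` A" for x
      using that by (intro image_eqI[of _ _ "L x"]) (auto simp: inv)
  qed
  have distr: "distr lborel borel L = lborel"
    unfolding L_def by (rule distr_lborel_reindex_vec) (rule bij_imp_bij_inv[OF e])
  define G where "G = L' \<circ> g \<circ> L"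
  have GS: "G ` (L' ` S) = L' ` (g ` S)"
    by (simp add: G_def image_comp[symmetric] image_image inv)
  have main: "(\<integral>\<^sup>+x. indicator (L' ` S) x * ennreal (h (L x)) \<partial>lborel) =
      (\<integral>\<^sup>+y. indicator (G ` (L' ` S)) y * ennreal (f (L y)) \<partial>lborel)"
  proof (rule nn_integral_change_of_variables_wellorder[where g' = "\<lambda>x. L' \<circ> g' (L x) \<circ> L"])
    show "L' ` S \<in> sets borel" "G ` (L' ` S) \<in> sets borel"
      using measurable_sets[of L borel borel S] measurable_sets[of L borel borel "g ` S"]
      unfolding GS unfolding vim by auto
    show "inj_on G (L' ` S)"
    proof (rule inj_onI)
      fix x y assume "x \<in> L' ` S" "y \<in> L' ` S" "G x = G y"
      then obtain a b where ab: "x = L' a" "y = L' b" "a \<in> S" "b \<in> S"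
        by blast
      have "L (G x) = L (G y)"
        using \<open>G x = G y\<close> by simp
      then have "g a = g b"
        by (simp add: G_def inv ab)
      with ab inj show "x = y"
        by (auto dest: inj_onD)
    qed
    fix x assume "x \<in> L' ` S"
    then obtain z where z: "z \<in> S" "x = L' z" by auto
    have 1: "(L has_derivative L) (at x within L' ` S)"
      by (rule bounded_linear_imp_has_derivative[OF bl(1)])
    have 2: "(g has_derivative g' (L x)) (at (L x) within L ` L' ` S)"
      using der[OF z(1)] z inv by (simp add: image_image)
    show d: "(G has_derivative (L' \<circ> g' (L x) \<circ> L)) (at x within L' ` S)"
      unfolding G_def o_assoc[symmetric]
      by (intro diff_chain_within 1 2 bounded_linear_imp_has_derivative[OF bl(2)])
    have Lx: "L x = z"
      using z inv by simp
    have L_axis: "L (axis j 1) = axis (e j) 1" for j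
      using e by (auto simp: L_def reindex_vec_def axis_def vec_eq_iff bij_is_inj bij_is_surj
          surj_f_inv_f dest: bij_inv_eq_iff[THEN iffD1])
    have "matrix (L' \<circ> g' (L x) \<circ> L) = (\<chi> i j. matrix (g' z) $ e i $ e j)"
      using z inv e
      unfolding Lx by (simp add: matrix_def vec_eq_iff L'_def reindex_vec_def L_axis)
    then show "h (L x) = \<bar>det (matrix (L' \<circ> g' (L x) \<circ> L))\<bar> * f (L (G x))"
      using hf[OF z(1)] by (simp add: det_reindex[OF e] G_def inv Lx)
  qed (simp_all add: f h)
  have tr: "(\<integral>\<^sup>+x. indicator (L' ` A) x * ennreal (k (L x)) \<partial>lborel) = (\<integral>\<^sup>+x. indicator A x * ennreal (k x) \<partial>lborel)"
    if [measurable]: "A \<in> sets borel" "k \<in> borel_measurable borel" for A k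
  proof -
    have "(\<integral>\<^sup>+x. indicator A x * ennreal (k x) \<partial>lborel) = (\<integral>\<^sup>+x. indicator A x * ennreal (k x) \<partial>distr lborel borel L)"
      by (simp add: distr)
    also have "\<dots> = (\<integral>\<^sup>+x. indicator A (L x) * ennreal (k (L x)) \<partial>lborel)"
      by (rule nn_integral_distr) auto
    also have "\<dots> = (\<integral>\<^sup>+x. indicator (L' ` A) x * ennreal (k (L x)) \<partial>lborel)"
      unfolding vim by (simp add: indicator_def)
    finally show ?thesis
      by simp
  qed
  show ?thesis
    using main unfolding GS by (simp only: tr[OF S h(1)] tr[OF gS f(1)])
qed

section \<open>Gluing measures\<close>

text \<open>The cover is peeled off one set at a time, splitting \<open>E\<close> into the parts
  inside and outside of it. Only additivity enters, so infinite values are harmless.\<close>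

lemma emeasure_eq_on_union:
  assumes F: "finite F" and sets: "sets \<mu> = sets N" "sets \<nu> = sets N"
    and A: "\<And>i. i \<in> F \<Longrightarrow> A i \<in> sets N"
    and eq: "\<And>i E. i \<in> F \<Longrightarrow> E \<in> sets N \<Longrightarrow> E \<subseteq> A i \<Longrightarrow> emeasure \<mu> E = emeasure \<nu> E"
    and E: "E \<in> sets N" "E \<subseteq> (\<Union>i\<in>F. A i)"
  shows "emeasure \<mu> E = emeasure \<nu> E"
  using F A eq E
proof (induction F arbitrary: E rule: finite_induct)
  case (insert k F)
  let ?E1 = "E \<inter> A k" and ?E2 = "E - A k"
  have Ak: "A k \<in> sets N" and E: "E \<in> sets N" "E \<subseteq> (\<Union>i\<in>insert k F. A i)"
    using insert.prems(1,3,4) by auto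
  have meas: "?E1 \<in> sets N" "?E2 \<in> sets N"
    using Ak E by auto
  have "emeasure \<mu> ?E1 = emeasure \<nu> ?E1"
    by (rule insert.prems(2)[of k]) (use meas in auto)
  moreover have "emeasure \<mu> ?E2 = emeasure \<nu> ?E2"
  proof (rule insert.IH)
    show "A i \<in> sets N" if "i \<in> F" for i
      using insert.prems(1) that by simp
    show "emeasure \<mu> S = emeasure \<nu> S" if "i \<in> F" "S \<in> sets N" "S \<subseteq> A i" for i S
      by (rule insert.prems(2)[of i]) (use that in auto)
  qed (use meas E in auto)
  moreover have "emeasure \<mu> E = emeasure \<mu> ?E1 + emeasure \<mu> ?E2" "emeasure \<nu> E = emeasure \<nu> ?E1 + emeasure \<nu> ?E2"
    using meas sets by (subst plus_emeasure, auto intro!: arg_cong2[where f = emeasure])+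
  ultimately show ?case by simp
qed simp

text \<open>Restricting to \<open>B\<close> and \<open>C\<close> before adding is what allows
  disjoint pieces to be joined in the gluing below.\<close>

lemma ex_sum_measure:
  assumes "sets \<mu> = sets N" "sets \<nu> = sets N" and B: "B \<in> sets N" "C \<in> sets N"
  shows "\<exists>\<kappa>. sets \<kappa> = sets N \<and> (\<forall>E\<in>sets N. emeasure \<kappa> E = emeasure \<mu> (E \<inter> B) + emeasure \<nu> (E \<inter> C))"
proof (intro exI conjI ballI)
  let ?f = "\<lambda>E. emeasure \<mu> (E \<inter> B) + emeasure \<nu> (E \<inter> C)"
  let ?k = "measure_of (space N) (sets N) ?f"
  show sets: "sets ?k = sets N"
    by simp
  fix E assume E: "E \<in> sets N"
  show "emeasure ?k E = ?f E"
  proof (rule emeasure_measure_of_sigma[OF sets.sigma_algebra_axioms _ _ E])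
    show "positive (sets N) ?f"
      by (simp add: positive_def)
    show "countably_additive (sets N) ?f"
    proof (rule countably_additiveI)
      fix S :: "nat \<Rightarrow> 'a set"
      assume S: "range S \<subseteq> sets N" "disjoint_family S"
      have "(\<Sum>i. emeasure \<kappa> (S i \<inter> D)) = emeasure \<kappa> ((\<Union>i. S i) \<inter> D)"
        if "sets \<kappa> = sets N" "D \<in> sets N" for \<kappa> D
      proof -
        have "(\<Sum>i. emeasure \<kappa> (S i \<inter> D)) = emeasure \<kappa> (\<Union>i. S i \<inter> D)"
          using S that by (intro suminf_emeasure) (auto simp: disjoint_family_on_def)
        then show ?thesis by simp
      qed
      then show "(\<Sum>i. ?f (S i)) = ?f (\<Union>i. S i)"
        using assms by (subst suminf_add[symmetric]) auto
    qed
  qed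
qed

text \<open>Existence makes the finite cover disjoint: each new set contributes its own measure only
  on the part not yet covered, and compatibility shows that this choice does not matter.
  \<open>I\<close> may be infinite, as an atlas may be; only the subfamily \<open>F\<close> has to
  be finite. Unique existence is what evaluates the definite descriptions of \<open>vol\<close> and
  \<open>bdry_vol\<close>.\<close>

lemma ex1_glued_measure:
  assumes F: "finite F" "F \<subseteq> I" "(\<Union>i\<in>F. A i) = space N"
    and A: "\<And>i. i \<in> I \<Longrightarrow> A i \<in> sets N"
    and m: "\<And>i. i \<in> I \<Longrightarrow> sets (m i) = sets N"
    and compat: "\<And>i j E. i \<in> I \<Longrightarrow> j \<in> I \<Longrightarrow> E \<in> sets N \<Longrightarrow> E \<subseteq> A i \<inter> A j \<Longrightarrow> emeasure (m i) E = emeasure (m j) E"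
  shows "\<exists>!\<mu>. space \<mu> = space N \<and> sets \<mu> = sets N \<and>
    (\<forall>i\<in>I. \<forall>E\<in>sets N. E \<subseteq> A i \<longrightarrow> emeasure \<mu> E = emeasure (m i) E)"
proof (rule ex_ex1I)
  have "\<exists>\<mu>. sets \<mu> = sets N \<and>
      (\<forall>i\<in>I. \<forall>E\<in>sets N. E \<subseteq> A i \<longrightarrow> E \<subseteq> (\<Union>i\<in>F. A i) \<longrightarrow> emeasure \<mu> E = emeasure (m i) E)"
    using F(1,2)
  proof (induction F rule: finite_induct)
    case empty
    \<comment> \<open>Any measure on the right sets works here, because only the empty set lies in
      the empty union.\<close>
    show ?case
      by (rule exI[of _ N]) (metis Union_empty image_empty subset_empty emeasure_empty)
  next
    case (insert k F)
    then obtain \<mu> where \<mu>: "sets \<mu> = sets N"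
      "\<And>i E. i \<in> I \<Longrightarrow> E \<in> sets N \<Longrightarrow> E \<subseteq> A i \<Longrightarrow> E \<subseteq> (\<Union>i\<in>F. A i) \<Longrightarrow> emeasure \<mu> E = emeasure (m i) E"
      by auto
    let ?U = "\<Union>i\<in>F. A i"
    have k: "k \<in> I" and U: "?U \<in> sets N"
      using insert A by auto
    \<comment> \<open>The old measure is kept on the union \<open>?U\<close>, and \<open>m k\<close>
      is used only on the rest of \<open>A k\<close>.\<close>
    obtain \<kappa> where \<kappa>: "sets \<kappa> = sets N"
      "\<And>E. E \<in> sets N \<Longrightarrow> emeasure \<kappa> E = emeasure \<mu> (E \<inter> ?U) + emeasure (m k) (E \<inter> (A k - ?U))"
      using ex_sum_measure[of \<mu> N "m k" ?U "A k - ?U"] \<mu>(1) m[OF k] U A[OF k] by auto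
    have "emeasure \<kappa> E = emeasure (m i) E"
      if i: "i \<in> I" and E: "E \<in> sets N" "E \<subseteq> A i" "E \<subseteq> (\<Union>i\<in>insert k F. A i)" for i E
    proof -
      have "emeasure \<mu> (E \<inter> ?U) = emeasure (m i) (E \<inter> ?U)"
        by (rule \<mu>(2)) (use i E U in auto)
      moreover have "emeasure (m k) (E \<inter> (A k - ?U)) = emeasure (m i) (E \<inter> (A k - ?U))"
        by (rule compat) (use i E U A[OF k] k in auto)
      moreover have "emeasure (m i) (E \<inter> ?U) + emeasure (m i) (E \<inter> (A k - ?U)) = emeasure (m i) E"
        using E U A[OF k] m[OF i] by (subst plus_emeasure) (auto intro!: arg_cong2[where f = emeasure])
      ultimately show ?thesis
        using \<kappa>(2)[OF E(1)] by simp
    qed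
    then show ?case
      using \<kappa>(1) by blast
  qed
  then obtain \<mu> where \<mu>0: "sets \<mu> = sets N \<and>
      (\<forall>i\<in>I. \<forall>E\<in>sets N. E \<subseteq> A i \<longrightarrow> E \<subseteq> (\<Union>i\<in>F. A i) \<longrightarrow> emeasure \<mu> E = emeasure (m i) E)"
    by (rule exE)
  then have \<mu>: "sets \<mu> = sets N"
    by simp
  have \<mu>2: "emeasure \<mu> E = emeasure (m i) E" if "i \<in> I" "E \<in> sets N" "E \<subseteq> A i" for i E
  proof -
    have "E \<subseteq> (\<Union>i\<in>F. A i)"
      using sets.sets_into_space[OF that(2)] F(3) by simp
    then show ?thesis
      using \<mu>0 that by simp
  qed
  show "\<exists>\<mu>. space \<mu> = space N \<and> sets \<mu> = sets N \<and>
    (\<forall>i\<in>I. \<forall>E\<in>sets N. E \<subseteq> A i \<longrightarrow> emeasure \<mu> E = emeasure (m i) E)"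
    using \<mu> \<mu>2 sets_eq_imp_space_eq[OF \<mu>] by (intro exI[of _ \<mu>] conjI ballI impI)
next
  fix \<mu> \<nu>
  assume *: "space \<mu> = space N \<and> sets \<mu> = sets N \<and>
      (\<forall>i\<in>I. \<forall>E\<in>sets N. E \<subseteq> A i \<longrightarrow> emeasure \<mu> E = emeasure (m i) E)"
    "space \<nu> = space N \<and> sets \<nu> = sets N \<and>
      (\<forall>i\<in>I. \<forall>E\<in>sets N. E \<subseteq> A i \<longrightarrow> emeasure \<nu> E = emeasure (m i) E)"
  have sets: "sets \<mu> = sets N" "sets \<nu> = sets N"
    using * by blast+
  show "\<mu> = \<nu>"
  proof (rule measure_eqI)
    fix E assume "E \<in> sets \<mu>"
    then have E: "E \<in> sets N" using sets by simp
    show "emeasure \<mu> E = emeasure \<nu> E"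
    proof (rule emeasure_eq_on_union[OF F(1) sets _ _ E, of A])
      show "A i \<in> sets N" if "i \<in> F" for i
        using A F(2) that by blast
      show "E \<subseteq> (\<Union>i\<in>F. A i)"
        using sets.sets_into_space[OF E] F(3) by simp
      show "emeasure \<mu> S = emeasure \<nu> S" if "i \<in> F" "S \<in> sets N" "S \<subseteq> A i" for i S
      proof -
        have "i \<in> I" using F(2) that by blast
        then have "emeasure \<mu> S = emeasure (m i) S" "emeasure \<nu> S = emeasure (m i) S"
          using * that by blast+
        then show ?thesis by simp
      qed
    qed
  qed (use sets in simp)
qed

text \<open>Multiplying both measures by the indicator of \<open>A\<close> turns agreement on
  subsets of \<open>A\<close> into equality of two measures.\<close>

lemma nn_integral_eq_on_subset:
  assumes sets: "sets \<mu> = sets N" "sets \<nu> = sets N" and A: "A \<in> sets N"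
    and eq: "\<And>E. E \<in> sets N \<Longrightarrow> E \<subseteq> A \<Longrightarrow> emeasure \<mu> E = emeasure \<nu> E"
    and f: "f \<in> borel_measurable N"
  shows "(\<integral>\<^sup>+x. f x * indicator A x \<partial>\<mu>) = (\<integral>\<^sup>+x. f x * indicator A x \<partial>\<nu>)"
proof -
  have [measurable]: "A \<in> sets \<mu>" "A \<in> sets \<nu>" "f \<in> borel_measurable \<mu>" "f \<in> borel_measurable \<nu>"
    using sets A f by (auto cong: measurable_cong_sets)
  have "density \<mu> (indicator A) = density \<nu> (indicator A)"
  proof (rule measure_eqI)
    fix E assume "E \<in> sets (density \<mu> (indicator A))"
    then have E: "E \<in> sets N" using sets by simp
    have "emeasure \<kappa> (A \<inter> E) = emeasure (density \<kappa> (indicator A)) E" if "sets \<kappa> = sets N" for \<kappa>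
      using that E A by (subst emeasure_density)
        (auto simp: indicator_inter_arith[symmetric] sets.Int)
    then show "emeasure (density \<mu> (indicator A)) E = emeasure (density \<nu> (indicator A)) E"
      using eq[of "A \<inter> E"] E A sets by (metis Int_lower1 sets.Int)
  qed (use sets in simp)
  then have "(\<integral>\<^sup>+x. f x \<partial>density \<mu> (indicator A)) = (\<integral>\<^sup>+x. f x \<partial>density \<nu> (indicator A))"
    by simp
  then show ?thesis
    by (simp add: nn_integral_density mult.commute)
qed

text \<open>The pushforward of w dx on \<open>W\<close>. It lives on the sigma-algebra of
  \<open>N\<close> and puts all its mass on the image of \<open>W\<close>, so that a single chart
  yields a measure on the whole manifold.\<close>

definition param_measure ::
    "'a measure \<Rightarrow> 'b::euclidean_space set \<Rightarrow> ('b \<Rightarrow> 'a) \<Rightarrow> ('b \<Rightarrow> ennreal) \<Rightarrow> 'a measure" where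
  "param_measure N W \<iota> w = distr (density (restrict_space lborel W) w) N \<iota>"

lemma sets_param_measure: "sets (param_measure N W \<iota> w) = sets N"
  by (simp add: param_measure_def)

lemma nn_integral_param_measure:
  assumes W: "W \<in> sets borel" and \<iota>: "\<iota> \<in> restrict_space borel W \<rightarrow>\<^sub>M N"
    and w: "w \<in> borel_measurable (restrict_space borel W)" and f: "f \<in> borel_measurable N"
  shows "(\<integral>\<^sup>+p. f p \<partial>param_measure N W \<iota> w) = (\<integral>\<^sup>+x. f (\<iota> x) * w x * indicator W x \<partial>lborel)"
proof -
  have cong: "measurable (restrict_space lborel W) K = measurable (restrict_space borel W) K" for K :: "'c measure"
    by (rule measurable_cong_sets) (auto simp: sets_restrict_space)
  have [measurable]: "\<iota> \<in> restrict_space lborel W \<rightarrow>\<^sub>M N" "w \<in> borel_measurable (restrict_space lborel W)"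
    using \<iota> w by (auto simp: sets_restrict_space cong: measurable_cong_sets)
  have [measurable]: "(\<lambda>x. f (\<iota> x)) \<in> borel_measurable (restrict_space lborel W)"
    using f by measurable
  have "(\<integral>\<^sup>+p. f p \<partial>param_measure N W \<iota> w) = (\<integral>\<^sup>+x. f (\<iota> x) \<partial>density (restrict_space lborel W) w)"
    unfolding param_measure_def using f by (subst nn_integral_distr) auto
  also have "\<dots> = (\<integral>\<^sup>+x. w x * f (\<iota> x) \<partial>restrict_space lborel W)"
    by (rule nn_integral_density) measurable
  also have "\<dots> = (\<integral>\<^sup>+x. w x * f (\<iota> x) * indicator W x \<partial>lborel)"
    using W by (subst nn_integral_restrict_space) auto
  finally show ?thesis
    by (simp add: mult.commute)
qed

lemma emeasure_param_measure:
  assumes W: "W \<in> sets borel" and \<iota>: "\<iota> \<in> restrict_space borel W \<rightarrow>\<^sub>M N"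
    and w: "w \<in> borel_measurable (restrict_space borel W)" and E: "E \<in> sets N"
  shows "emeasure (param_measure N W \<iota> w) E = (\<integral>\<^sup>+x. indicator E (\<iota> x) * w x * indicator W x \<partial>lborel)"
  using nn_integral_param_measure[OF W \<iota> w, of "indicator E"] E
  by (simp add: sets_param_measure)

section \<open>The weighted trace estimate in the flat model\<close>

section \<open>A weighted trace inequality on a box\<close>

definition unit_cube :: "(real ^ 'n::finite) set" where
  "unit_cube = cbox 0 (\<chi> i. 1)"

lemma mem_unit_cube: "x \<in> unit_cube \<longleftrightarrow> (\<forall>i. 0 \<le> x $ i \<and> x $ i \<le> 1)"
  by (simp add: unit_cube_def mem_box_cart)

lemma sets_unit_cube [measurable]: "unit_cube \<in> sets borel"
  by (simp add: unit_cube_def)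

lemma emeasure_unit_cube: "emeasure lborel (unit_cube :: (real ^ 'n::finite) set) = 1"
proof -
  have "emeasure lborel (unit_cube :: (real ^ 'n) set) = (\<Prod>b\<in>Basis. ((\<chi> i. 1) - 0 :: real ^ 'n) \<bullet> b)"
    unfolding unit_cube_def
    by (rule emeasure_lborel_cbox) (auto simp: Basis_vec_def inner_axis)
  also have "(\<Prod>b\<in>Basis. ((\<chi> i. 1) - 0 :: real ^ 'n) \<bullet> b) = 1"
    by (rule prod.neutral) (auto simp: Basis_vec_def inner_axis)
  finally show ?thesis by simp
qed

lemma convex_comb_unit_cube:
  fixes x :: "real ^ 'n::finite"
  assumes "x \<in> unit_cube" "y \<in> unit_cube" "0 \<le> t" "t \<le> 1"
  shows "(1 - t) *\<^sub>R x + t *\<^sub>R y \<in> unit_cube"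
proof -
  have "convex (unit_cube :: (real ^ 'n) set)"
    unfolding unit_cube_def by (rule convex_box)
  then show ?thesis
    using assms unfolding convex_def by simp
qed

text \<open>The dilation about \<open>a\<close> maps the cube into itself by convexity and scales
  volume by \<open>t ^ CARD('n)\<close>. The factor on the right blows up as t tends to 0, where the
  rays from \<open>a\<close> concentrate.\<close>

lemma nn_integral_cube_dilate:
  fixes F :: "real ^ 'n::finite \<Rightarrow> ennreal"
  assumes [measurable]: "F \<in> borel_measurable borel" and a: "a \<in> unit_cube" and t: "0 < t" "t \<le> 1"
  shows "(\<integral>\<^sup>+y. F ((1 - t) *\<^sub>R a + t *\<^sub>R y) * indicator unit_cube y \<partial>lborel)
    \<le> ennreal (1 / t ^ CARD('n)) * (\<integral>\<^sup>+z. F z * indicator unit_cube z \<partial>lborel)"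
proof -
  let ?T = "\<lambda>y. (1 - t) *\<^sub>R a + t *\<^sub>R y"
  have "(\<integral>\<^sup>+z. F z * indicator unit_cube z \<partial>lborel) =
      (\<integral>\<^sup>+z. F z * indicator unit_cube z \<partial>density (distr lborel borel ?T) (\<lambda>_. ennreal (\<bar>t\<bar> ^ DIM(real ^ 'n))))"
    using t by (subst lborel_affine[of t "(1 - t) *\<^sub>R a"]) auto
  also have "\<dots> = ennreal (t ^ CARD('n)) * (\<integral>\<^sup>+y. F (?T y) * indicator unit_cube (?T y) \<partial>lborel)"
    using t by (simp add: nn_integral_density nn_integral_distr nn_integral_cmult)
  finally have eq: "(\<integral>\<^sup>+z. F z * indicator unit_cube z \<partial>lborel) =
      ennreal (t ^ CARD('n)) * (\<integral>\<^sup>+y. F (?T y) * indicator unit_cube (?T y) \<partial>lborel)" .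
  have "(\<integral>\<^sup>+y. F (?T y) * indicator unit_cube y \<partial>lborel) \<le> (\<integral>\<^sup>+y. F (?T y) * indicator unit_cube (?T y) \<partial>lborel)"
    using convex_comb_unit_cube[OF a _ less_imp_le[OF t(1)] t(2)]
    by (intro nn_integral_mono) (auto simp: indicator_def)
  also have "\<dots> = ennreal (1 / t ^ CARD('n)) * (\<integral>\<^sup>+z. F z * indicator unit_cube z \<partial>lborel)"
    unfolding eq mult.assoc[symmetric] using t by (simp add: ennreal_mult[symmetric])
  finally show ?thesis .
qed

text \<open>Cauchy-Schwarz with \<open>sqrt (w x)\<close> inserted and divided out. Positivity is
  asked on \<open>I\<close> only, since the power weights below are considered at positive
  heights.\<close>

lemma weighted_Cauchy_Schwarz:
  fixes w :: "'a \<Rightarrow> real"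
  assumes [measurable]: "\<phi> \<in> borel_measurable M" "w \<in> borel_measurable M" "I \<in> sets M"
    and w: "\<And>x. x \<in> I \<Longrightarrow> 0 < w x"
  shows "(\<integral>\<^sup>+x. \<phi> x * indicator I x \<partial>M)\<^sup>2 \<le>
    (\<integral>\<^sup>+x. ennreal (w x) * (\<phi> x)\<^sup>2 * indicator I x \<partial>M) * (\<integral>\<^sup>+x. ennreal (1 / w x) * indicator I x \<partial>M)"
proof -
  let ?f = "\<lambda>x. \<phi> x * ennreal (sqrt (w x)) * indicator I x"
  let ?g = "\<lambda>x. ennreal (1 / sqrt (w x)) * indicator I x"
  have "\<phi> x * indicator I x = ?f x * ?g x" for x
    using w[of x] by (auto simp: indicator_def mult.assoc ennreal_mult[symmetric])
  then have "(\<integral>\<^sup>+x. \<phi> x * indicator I x \<partial>M)\<^sup>2 = (\<integral>\<^sup>+x. ?f x * ?g x \<partial>M)\<^sup>2"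
    by simp
  also have "\<dots> \<le> (\<integral>\<^sup>+x. (?f x)\<^sup>2 \<partial>M) * (\<integral>\<^sup>+x. (?g x)\<^sup>2 \<partial>M)"
    by (rule Cauchy_Schwarz_nn_integral) measurable
  also have "(\<integral>\<^sup>+x. (?f x)\<^sup>2 \<partial>M) = (\<integral>\<^sup>+x. ennreal (w x) * (\<phi> x)\<^sup>2 * indicator I x \<partial>M)"
    using w by (intro nn_integral_cong)
      (auto simp: indicator_def power_mult_distrib ennreal_power mult_ac less_imp_le)
  also have "(\<integral>\<^sup>+x. (?g x)\<^sup>2 \<partial>M) = (\<integral>\<^sup>+x. ennreal (1 / w x) * indicator I x \<partial>M)"
    using w by (intro nn_integral_cong)
      (auto simp: indicator_def ennreal_power power_divide less_imp_le)
  finally show ?thesis .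
qed

lemma ennreal_le_of_square_le:
  assumes "x\<^sup>2 \<le> ennreal (r\<^sup>2)" "0 \<le> r"
  shows "x \<le> ennreal r"
proof (cases x)
  case (real s)
  then have "s\<^sup>2 \<le> r\<^sup>2"
    using assms by (simp add: ennreal_power)
  then have "s \<le> r"
    using assms(2) by (rule power2_le_imp_le)
  then show ?thesis
    using real by (simp add: ennreal_leI)
next
  case top
  then have "ennreal (r\<^sup>2) = top"
    using assms(1) by (simp add: power2_eq_square top_unique)
  then show ?thesis
    by simp
qed

text \<open>Jensen's inequality; the cube has volume 1.\<close>

lemma nn_integral_square_le_unit_cube:
  fixes F :: "real ^ 'n::finite \<Rightarrow> ennreal"
  assumes [measurable]: "F \<in> borel_measurable borel"
  shows "(\<integral>\<^sup>+y. F y * indicator unit_cube y \<partial>lborel)\<^sup>2 \<le> (\<integral>\<^sup>+y. (F y)\<^sup>2 * indicator unit_cube y \<partial>lborel)"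
  using weighted_Cauchy_Schwarz[of F lborel "\<lambda>_. 1" unit_cube] by (simp add: emeasure_unit_cube)

lemma nn_integral_powr_from_0:
  assumes "0 < a" "0 < h"
  shows "(\<integral>\<^sup>+t. ennreal (t powr (a - 1)) * indicator {0<..<h} t \<partial>lborel) \<le> ennreal (h powr a / a)"
proof -
  have "((\<lambda>t. t powr (a - 1)) has_integral (h powr (a - 1 + 1) / (a - 1 + 1))) {0..h}"
    using assms by (intro has_integral_powr_from_0) auto
  then have "(\<integral>\<^sup>+t. ennreal (t powr (a - 1)) * indicator {0..h} t \<partial>lborel) = ennreal (h powr a / a)"
    using nn_integral_has_integral_lebesgue'[of "{0..h}" "\<lambda>t. t powr (a - 1)"] by simp
  moreover have "(\<integral>\<^sup>+t. ennreal (t powr (a - 1)) * indicator {0<..<h} t \<partial>lborel) \<le>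
      (\<integral>\<^sup>+t. ennreal (t powr (a - 1)) * indicator {0..h} t \<partial>lborel)"
    by (intro nn_integral_mono) (auto simp: indicator_def)
  ultimately show ?thesis by simp
qed

lemma nn_integral_powr_to_1:
  assumes a: "0 < a" and h: "0 < h" "h < 1"
  shows "(\<integral>\<^sup>+t. ennreal (t powr (- a - 1)) * indicator {h..<1} t \<partial>lborel) \<le> ennreal (h powr (- a) / a)"
proof -
  have "((\<lambda>t. t powr (- a - 1)) has_integral (- (1 powr (- a) / a) - - (h powr (- a) / a))) {h..1}"
  proof (rule fundamental_theorem_of_calculus)
    show "((\<lambda>t. - (t powr (- a) / a)) has_vector_derivative t powr (- a - 1)) (at t within {h..1})"
      if "t \<in> {h..1}" for t
      using that a h unfolding has_real_derivative_iff_has_vector_derivative[symmetric]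
      by (auto intro!: derivative_eq_intros)
  qed (use h in auto)
  then have "(\<integral>\<^sup>+t. ennreal (t powr (- a - 1)) * indicator {h..1} t \<partial>lborel) = ennreal (h powr (- a) / a - 1 / a)"
    using nn_integral_has_integral_lebesgue'[of "{h..1}" "\<lambda>t. t powr (- a - 1)"] by simp
  also have "\<dots> \<le> ennreal (h powr (- a) / a)"
    using a by (intro ennreal_leI) simp
  finally show ?thesis
    by (rule order_trans[rotated]) (intro nn_integral_mono, auto simp: indicator_def)
qed

text \<open>Optimising the splitting height h between the two terms.\<close>

lemma split_height_bound:
  fixes n \<sigma> p A B G e d :: real
  assumes \<sigma>: "0 < \<sigma>" "2 * \<sigma> < n" and p: "p = 2 * n / (n - 2 * \<sigma>)"
    and pos: "0 \<le> A" "0 \<le> B" "0 \<le> G" "0 < e" "0 \<le> d"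
    and full: "d \<le> A * G"
    and split: "\<And>h. 0 < h \<Longrightarrow> h < 1 \<Longrightarrow> d \<le> A * h powr \<sigma> * G + B * h powr (\<sigma> - n / 2) * e"
  shows "d powr p \<le> (A + B) powr p * e powr (p - 2) * G\<^sup>2"
proof -
  have n: "0 < n" using \<sigma> by simp
  have p2: "2 < p"
    using \<sigma> by (simp add: p field_simps)
  show ?thesis
  \<comment> \<open>For \<open>G \<le> e\<close> the balancing height would not lie below 1; there
    the bound \<open>d \<le> A * G\<close> is enough, because
    \<open>G powr (p - 2) \<le> e powr (p - 2)\<close>.\<close>
  proof (cases "G \<le> e")
    case True
    have "d powr p \<le> ((A + B) * G) powr p"
      using full pos p2 by (intro powr_mono2) (auto intro: order_trans[OF _ mult_right_mono])
    also have "\<dots> = (A + B) powr p * (G powr (p - 2) * G\<^sup>2)"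
      using pos by (cases "G = 0") (auto simp: powr_mult powr_diff)
    also have "\<dots> \<le> (A + B) powr p * (e powr (p - 2) * G\<^sup>2)"
      using True pos p2 by (intro mult_left_mono mult_right_mono powr_mono2) auto
    finally show ?thesis by (simp add: mult_ac)
  next
    case False
    then have G: "e < G" "0 < G" using pos by auto
    \<comment> \<open>The height at which \<open>h powr \<sigma> * G\<close> and
      \<open>h powr (\<sigma> - n / 2) * e\<close> coincide; \<open>K\<close> is their common
      value.\<close>
    define h where "h = (e / G) powr (2 / n)"
    have h: "0 < h" "h < 1"
      using G pos n powr_less_mono2[of "2 / n" "e / G" 1] by (auto simp: h_def)
    define K where "K = e powr (2 * \<sigma> / n) * G powr (1 - 2 * \<sigma> / n)"
    have "h powr \<sigma> * G = K"
      using G pos n by (simp add: h_def K_def powr_powr powr_divide powr_diff mult_ac)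
    moreover have "h powr (\<sigma> - n / 2) * e = K"
    proof -
      have "2 / n * (\<sigma> - n / 2) = 2 * \<sigma> / n - 1"
        using n by (simp add: field_simps)
      then show ?thesis
        using G pos n by (simp add: h_def K_def powr_powr powr_divide powr_diff mult_ac)
    qed
    ultimately have "d \<le> (A + B) * K"
      using split[OF h] by (simp add: algebra_simps)
    then have "d powr p \<le> ((A + B) * K) powr p"
      using pos p2 by (intro powr_mono2) auto
    also have "\<dots> = (A + B) powr p * K powr p"
      by (simp add: powr_mult)
    also have "K powr p = e powr (2 * \<sigma> / n * p) * G powr ((1 - 2 * \<sigma> / n) * p)"
      by (simp add: K_def powr_mult powr_powr)
    \<comment> \<open>Here the critical exponent enters: it makes the powers of \<open>e\<close> and
      \<open>G\<close> equal to p - 2 and 2.\<close>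
    also have "2 * \<sigma> / n * p = p - 2"
      using \<sigma> n by (simp add: p field_simps)
    also have "(1 - 2 * \<sigma> / n) * p = 2"
      using \<sigma> n by (simp add: p field_simps)
    finally show ?thesis
      using G by (simp add: mult_ac)
  qed
qed

text \<open>\<open>g\<close> stands for the size of the gradient and \<open>m\<close> for the mean
  of \<open>V\<close> over the top face. Hypothesis \<open>V0\<close> averages over all oblique rays
  from (x, 0) to (y, 1), whose point at height t is (1 - t) x + t y. The average over y spreads the
  rays over a cube of side t, so that at positive heights the energy of a whole slice controls them;
  a vertical ray would only see a single line. The second estimate, in the interior, serves to link
  different boxes.\<close>

lemma box_trace_bound:
  fixes g :: "real ^ 'n::finite \<Rightarrow> real \<Rightarrow> ennreal" and V :: "real ^ 'n \<Rightarrow> real \<Rightarrow> real"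
  assumes g_meas: "case_prod g \<in> borel_measurable (borel \<Otimes>\<^sub>M borel)"
    and V_meas: "case_prod V \<in> borel_measurable (borel \<Otimes>\<^sub>M borel)"
    and \<sigma>: "0 < \<sigma>" "2 * \<sigma> < real CARD('n)"
    and p: "p = 2 * real CARD('n) / (real CARD('n) - 2 * \<sigma>)"
    and e: "0 < e"
    and energy: "(\<integral>\<^sup>+t. ennreal (t powr (1 - 2 * \<sigma>)) * (\<integral>\<^sup>+z. (g z t)\<^sup>2 * indicator unit_cube z \<partial>lborel) *
        indicator {0<..<1} t \<partial>lborel) \<le> ennreal (e\<^sup>2)"
    and V0: "\<And>x. x \<in> unit_cube \<Longrightarrow> ennreal \<bar>V x 0 - m\<bar> \<le>
        (\<integral>\<^sup>+t. (\<integral>\<^sup>+y. g ((1 - t) *\<^sub>R x + t *\<^sub>R y) t * indicator unit_cube y \<partial>lborel) * indicator {0<..<1} t \<partial>lborel)"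
    and Vs: "\<And>x s. x \<in> unit_cube \<Longrightarrow> 0 \<le> s \<Longrightarrow> s \<le> 1 \<Longrightarrow>
        ennreal \<bar>V x s - V x 0\<bar> \<le> (\<integral>\<^sup>+t. g x t * indicator {0<..<1} t \<partial>lborel)"
  shows "(\<integral>\<^sup>+x. ennreal (\<bar>V x 0 - m\<bar> powr p) * indicator unit_cube x \<partial>lborel) \<le>
      ennreal ((sqrt (1 / (2 * \<sigma>)) + sqrt (1 / (real CARD('n) - 2 * \<sigma>))) powr p * 2 ^ CARD('n) * e powr p)"
    and "(\<integral>\<^sup>+x. (\<integral>\<^sup>+s. ennreal \<bar>V x s - m\<bar> * indicator {0..1} s \<partial>lborel) * indicator unit_cube x \<partial>lborel) \<le>
      ennreal ((1 + sqrt (2 ^ CARD('n))) * sqrt (1 / (2 * \<sigma>)) * e)"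
proof -
  let ?n = "real CARD('n)"
  let ?Q = "unit_cube :: (real ^ 'n) set"
  have [measurable]: "(\<lambda>x. g (f x) (h x)) \<in> borel_measurable M"
    if "f \<in> borel_measurable M" "h \<in> borel_measurable M" for f :: "'z \<Rightarrow> real ^ 'n" and h M
    using measurable_compose[OF measurable_Pair[OF that] g_meas] by simp
  have [measurable]: "(\<lambda>x. V (f x) (h x)) \<in> borel_measurable M"
    if "f \<in> borel_measurable M" "h \<in> borel_measurable M" for f :: "'z \<Rightarrow> real ^ 'n" and h M
    using measurable_compose[OF measurable_Pair[OF that] V_meas] by simp
  define w where "w = (\<lambda>t. t powr (1 - 2 * \<sigma>))"
  have w_meas [measurable]: "w \<in> borel_measurable borel"
    by (simp add: w_def)
  have w_pos: "0 < w t" if "0 < t" for t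
    using that by (simp add: w_def)
  define E where "E t = (\<integral>\<^sup>+z. (g z t)\<^sup>2 * indicator ?Q z \<partial>lborel)" for t
  have energy': "(\<integral>\<^sup>+t. ennreal (w t) * E t * indicator {0<..<1} t \<partial>lborel) \<le> ennreal (e\<^sup>2)"
    using energy by (simp add: w_def E_def)
  \<comment> \<open>\<open>\<phi>\<close> and \<open>\<psi>\<close> are the mean and the mean square
    of \<open>g\<close> over the points at height t of the rays from x; \<open>D\<close> bounds the
    oscillation along the rays and \<open>G2\<close> is their weighted energy.\<close>
  define \<phi> where "\<phi> x t = (\<integral>\<^sup>+y. g ((1 - t) *\<^sub>R x + t *\<^sub>R y) t * indicator ?Q y \<partial>lborel)" for x t
  define \<psi> where "\<psi> x t = (\<integral>\<^sup>+y. (g ((1 - t) *\<^sub>R x + t *\<^sub>R y) t)\<^sup>2 * indicator ?Q y \<partial>lborel)" for x t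
  define D where "D x = (\<integral>\<^sup>+t. \<phi> x t * indicator {0<..<1} t \<partial>lborel)" for x
  define G2 where "G2 x = (\<integral>\<^sup>+t. ennreal (w t) * \<psi> x t * indicator {0<..<1} t \<partial>lborel)" for x
  have [measurable]: "(\<lambda>t. E t) \<in> borel_measurable borel"
    unfolding E_def by measurable
  have \<psi>_meas [measurable]: "case_prod \<psi> \<in> borel_measurable (borel \<Otimes>\<^sub>M borel)"
    unfolding \<psi>_def by measurable
  have \<phi>_meas [measurable]: "case_prod \<phi> \<in> borel_measurable (borel \<Otimes>\<^sub>M borel)"
    unfolding \<phi>_def by measurable
  have G2_meas [measurable]: "G2 \<in> borel_measurable borel"
    unfolding G2_def by measurable
  have D_meas [measurable]: "D \<in> borel_measurable borel"
    unfolding D_def by measurable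
  have \<phi>\<psi>: "(\<phi> x t)\<^sup>2 \<le> \<psi> x t" for x t
    unfolding \<phi>_def \<psi>_def by (rule nn_integral_square_le_unit_cube) measurable
  have \<psi>E: "\<psi> x t \<le> ennreal (1 / t ^ CARD('n)) * E t" if "x \<in> ?Q" "0 < t" "t \<le> 1" for x t
    unfolding \<psi>_def E_def using that by (intro nn_integral_cube_dilate) measurable
  \<comment> \<open>Near the boundary the reciprocal weight \<open>t powr (2 * \<sigma> - 1)\<close>
    is integrable; this is where \<sigma> > 0 enters.\<close>
  have low: "(\<integral>\<^sup>+t. \<phi> x t * indicator {0<..<h} t \<partial>lborel)\<^sup>2 \<le> G2 x * ennreal (h powr (2 * \<sigma>) / (2 * \<sigma>))"
    if "0 < h" "h \<le> 1" for x h
  proof -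
    have "(\<integral>\<^sup>+t. \<phi> x t * indicator {0<..<h} t \<partial>lborel)\<^sup>2 \<le>
        (\<integral>\<^sup>+t. ennreal (w t) * (\<phi> x t)\<^sup>2 * indicator {0<..<h} t \<partial>lborel) *
        (\<integral>\<^sup>+t. ennreal (1 / w t) * indicator {0<..<h} t \<partial>lborel)"
      by (rule weighted_Cauchy_Schwarz) (auto simp: w_pos)
    also have "\<dots> \<le> G2 x * ennreal (h powr (2 * \<sigma>) / (2 * \<sigma>))"
    proof (rule mult_mono)
      show "(\<integral>\<^sup>+t. ennreal (w t) * (\<phi> x t)\<^sup>2 * indicator {0<..<h} t \<partial>lborel) \<le> G2 x"
        unfolding G2_def using that \<phi>\<psi>
        by (intro nn_integral_mono) (auto simp: indicator_def intro!: mult_left_mono)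
      have "(\<integral>\<^sup>+t. ennreal (1 / w t) * indicator {0<..<h} t \<partial>lborel) =
          (\<integral>\<^sup>+t. ennreal (t powr (2 * \<sigma> - 1)) * indicator {0<..<h} t \<partial>lborel)"
        by (intro nn_integral_cong) (auto simp: indicator_def w_def powr_minus_divide[symmetric])
      also have "\<dots> \<le> ennreal (h powr (2 * \<sigma>) / (2 * \<sigma>))"
        using \<sigma> that by (intro nn_integral_powr_from_0) auto
      finally show "(\<integral>\<^sup>+t. ennreal (1 / w t) * indicator {0<..<h} t \<partial>lborel) \<le> ennreal (h powr (2 * \<sigma>) / (2 * \<sigma>))" .
    qed auto
    finally show ?thesis .
  qed
  \<comment> \<open>Away from the boundary the weight is multiplied by \<open>t ^ CARD('n)\<close>,
    which cancels the loss in \<open>\<psi>E\<close>. With n = CARD('n), the reciprocal t^(2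
    \<sigma> - n - 1) is then integrated from h on, and 2 \<sigma> < n gives the negative power of
    h.\<close>
  have high: "(\<integral>\<^sup>+t. \<phi> x t * indicator {h..<1} t \<partial>lborel)\<^sup>2 \<le>
      ennreal (e\<^sup>2) * ennreal (h powr (2 * \<sigma> - ?n) / (?n - 2 * \<sigma>))"
    if x: "x \<in> ?Q" and h: "0 < h" "h < 1" for x h
  proof -
    have "(\<integral>\<^sup>+t. \<phi> x t * indicator {h..<1} t \<partial>lborel)\<^sup>2 \<le>
        (\<integral>\<^sup>+t. ennreal (w t * t ^ CARD('n)) * (\<phi> x t)\<^sup>2 * indicator {h..<1} t \<partial>lborel) *
        (\<integral>\<^sup>+t. ennreal (1 / (w t * t ^ CARD('n))) * indicator {h..<1} t \<partial>lborel)"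
      using h by (intro weighted_Cauchy_Schwarz) (auto simp: w_pos)
    also have "\<dots> \<le> ennreal (e\<^sup>2) * ennreal (h powr (2 * \<sigma> - ?n) / (?n - 2 * \<sigma>))"
    proof (rule mult_mono)
      have "(\<integral>\<^sup>+t. ennreal (w t * t ^ CARD('n)) * (\<phi> x t)\<^sup>2 * indicator {h..<1} t \<partial>lborel) \<le>
          (\<integral>\<^sup>+t. ennreal (w t) * E t * indicator {0<..<1} t \<partial>lborel)"
      proof (intro nn_integral_mono)
        fix t :: real
        show "ennreal (w t * t ^ CARD('n)) * (\<phi> x t)\<^sup>2 * indicator {h..<1} t \<le>
          ennreal (w t) * E t * indicator {0<..<1} t"
        proof (cases "t \<in> {h..<1}")
          case True
          then have t: "0 < t" "t < 1" using h by auto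
          have "ennreal (w t * t ^ CARD('n)) * (\<phi> x t)\<^sup>2 \<le>
              ennreal (w t * t ^ CARD('n)) * (ennreal (1 / t ^ CARD('n)) * E t)"
            using t order_trans[OF \<phi>\<psi> \<psi>E[OF x]] by (intro mult_left_mono) auto
          also have "\<dots> = ennreal (w t * t ^ CARD('n) * (1 / t ^ CARD('n))) * E t"
            using t w_pos[of t] by (simp add: ennreal_mult[symmetric] mult.assoc[symmetric])
          also have "w t * t ^ CARD('n) * (1 / t ^ CARD('n)) = w t"
            using t by simp
          finally show ?thesis using t True by simp
        qed simp
      qed
      then show "(\<integral>\<^sup>+t. ennreal (w t * t ^ CARD('n)) * (\<phi> x t)\<^sup>2 * indicator {h..<1} t \<partial>lborel) \<le> ennreal (e\<^sup>2)"
        using energy' by (rule order_trans)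
      have "(\<integral>\<^sup>+t. ennreal (1 / (w t * t ^ CARD('n))) * indicator {h..<1} t \<partial>lborel) =
          (\<integral>\<^sup>+t. ennreal (t powr (- (?n - 2 * \<sigma>) - 1)) * indicator {h..<1} t \<partial>lborel)"
      proof (intro nn_integral_cong)
        fix t :: real
        have "1 / (w t * t ^ CARD('n)) = t powr (- (?n - 2 * \<sigma>) - 1)" if "0 < t"
        proof -
          have "w t * t ^ CARD('n) = t powr (1 - 2 * \<sigma> + ?n)"
            using that by (simp add: w_def powr_add powr_realpow)
          then have "1 / (w t * t ^ CARD('n)) = t powr (- (1 - 2 * \<sigma> + ?n))"
            by (simp only: powr_minus_divide)
          then show ?thesis by (simp add: algebra_simps)
        qed
        then show "ennreal (1 / (w t * t ^ CARD('n))) * indicator {h..<1} t =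
            ennreal (t powr (- (?n - 2 * \<sigma>) - 1)) * indicator {h..<1} t"
          using h by (auto simp: indicator_def)
      qed
      also have "\<dots> \<le> ennreal (h powr (- (?n - 2 * \<sigma>)) / (?n - 2 * \<sigma>))"
        using \<sigma> h by (intro nn_integral_powr_to_1) auto
      finally show "(\<integral>\<^sup>+t. ennreal (1 / (w t * t ^ CARD('n))) * indicator {h..<1} t \<partial>lborel) \<le>
          ennreal (h powr (2 * \<sigma> - ?n) / (?n - 2 * \<sigma>))"
        by simp
    qed auto
    finally show ?thesis .
  qed
  \<comment> \<open>The point (1 - t) x + t y is a dilation in y about x with factor t, and a
    dilation in x about y with factor 1 - t. Whichever factor is at least 1/2 is used, at the cost
    of \<open>2 ^ CARD('n)\<close>; this keeps the integral over x under control down to t =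
    0.\<close>
  have inner: "(\<integral>\<^sup>+x. \<psi> x t * indicator ?Q x \<partial>lborel) \<le> ennreal (2 ^ CARD('n)) * E t" if t: "0 < t" "t < 1" for t
  proof (cases "1 / 2 \<le> t")
    case True
    have "1 / t ^ CARD('n) \<le> 2 ^ CARD('n)"
      using power_mono[of "1 / 2" t "CARD('n)"] True t by (simp add: field_simps)
    then have "\<psi> x t \<le> ennreal (2 ^ CARD('n)) * E t" if "x \<in> ?Q" for x
      using \<psi>E[OF that, of t] t by (meson ennreal_leI less_imp_le mult_right_mono order_trans zero_le)
    then have "(\<integral>\<^sup>+x. \<psi> x t * indicator ?Q x \<partial>lborel) \<le> (\<integral>\<^sup>+x. ennreal (2 ^ CARD('n)) * E t * indicator ?Q x \<partial>lborel)"
      by (intro nn_integral_mono) (auto simp: indicator_def)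
    then show ?thesis
      by (simp add: nn_integral_cmult_indicator emeasure_unit_cube)
  next
    case False
    have "1 / (1 - t) ^ CARD('n) \<le> 2 ^ CARD('n)"
      using power_mono[of "1 / 2" "1 - t" "CARD('n)"] False t by (simp add: field_simps)
    moreover have "(\<integral>\<^sup>+x. (g ((1 - t) *\<^sub>R x + t *\<^sub>R y) t)\<^sup>2 * indicator ?Q x \<partial>lborel) \<le>
        ennreal (1 / (1 - t) ^ CARD('n)) * E t" if "y \<in> ?Q" for y
      using nn_integral_cube_dilate[of "\<lambda>z. (g z t)\<^sup>2" y "1 - t"] that t
      by (simp add: E_def add.commute)
    ultimately have le: "(\<integral>\<^sup>+x. (g ((1 - t) *\<^sub>R x + t *\<^sub>R y) t)\<^sup>2 * indicator ?Q x \<partial>lborel) \<le>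
        ennreal (2 ^ CARD('n)) * E t" if "y \<in> ?Q" for y
      using that by (meson ennreal_leI mult_right_mono order_trans zero_le)
    have "(\<integral>\<^sup>+x. \<psi> x t * indicator ?Q x \<partial>lborel) =
        (\<integral>\<^sup>+x. (\<integral>\<^sup>+y. (g ((1 - t) *\<^sub>R x + t *\<^sub>R y) t)\<^sup>2 * indicator ?Q y * indicator ?Q x \<partial>lborel) \<partial>lborel)"
      unfolding \<psi>_def by (intro nn_integral_cong nn_integral_multc[symmetric]) measurable
    also have "\<dots> = (\<integral>\<^sup>+y. (\<integral>\<^sup>+x. (g ((1 - t) *\<^sub>R x + t *\<^sub>R y) t)\<^sup>2 * indicator ?Q y * indicator ?Q x \<partial>lborel) \<partial>lborel)"
      by (rule lborel_pair.Fubini'[symmetric]) measurable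
    also have "\<dots> = (\<integral>\<^sup>+y. (\<integral>\<^sup>+x. (g ((1 - t) *\<^sub>R x + t *\<^sub>R y) t)\<^sup>2 * indicator ?Q x \<partial>lborel) * indicator ?Q y \<partial>lborel)"
      by (subst nn_integral_multc[symmetric]) (auto simp: mult_ac)
    also have "\<dots> \<le> (\<integral>\<^sup>+y. ennreal (2 ^ CARD('n)) * E t * indicator ?Q y \<partial>lborel)"
      using le by (intro nn_integral_mono) (auto simp: indicator_def)
    finally show ?thesis
      by (simp add: nn_integral_cmult_indicator emeasure_unit_cube)
  qed
  have G2_int: "(\<integral>\<^sup>+x. G2 x * indicator ?Q x \<partial>lborel) \<le> ennreal (2 ^ CARD('n) * e\<^sup>2)"
  proof -
    have "(\<integral>\<^sup>+x. G2 x * indicator ?Q x \<partial>lborel) =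
        (\<integral>\<^sup>+x. (\<integral>\<^sup>+t. ennreal (w t) * \<psi> x t * indicator {0<..<1} t * indicator ?Q x \<partial>lborel) \<partial>lborel)"
      unfolding G2_def by (intro nn_integral_cong nn_integral_multc[symmetric]) measurable
    also have "\<dots> = (\<integral>\<^sup>+t. (\<integral>\<^sup>+x. ennreal (w t) * \<psi> x t * indicator {0<..<1} t * indicator ?Q x \<partial>lborel) \<partial>lborel)"
      by (rule lborel_pair.Fubini'[symmetric]) measurable
    also have "\<dots> = (\<integral>\<^sup>+t. ennreal (w t) * indicator {0<..<1} t * (\<integral>\<^sup>+x. \<psi> x t * indicator ?Q x \<partial>lborel) \<partial>lborel)"
      by (subst nn_integral_cmult[symmetric]) (auto simp: mult_ac)
    also have "\<dots> \<le> (\<integral>\<^sup>+t. ennreal (2 ^ CARD('n)) * (ennreal (w t) * E t * indicator {0<..<1} t) \<partial>lborel)"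
    proof (intro nn_integral_mono)
      fix t :: real
      show "ennreal (w t) * indicator {0<..<1} t * (\<integral>\<^sup>+x. \<psi> x t * indicator ?Q x \<partial>lborel) \<le>
        ennreal (2 ^ CARD('n)) * (ennreal (w t) * E t * indicator {0<..<1} t)"
        using mult_left_mono[OF inner[of t], of "ennreal (w t)"]
        by (auto simp: indicator_def mult_ac)
    qed
    also have "\<dots> = ennreal (2 ^ CARD('n)) * (\<integral>\<^sup>+t. ennreal (w t) * E t * indicator {0<..<1} t \<partial>lborel)"
      by (rule nn_integral_cmult) measurable
    also have "\<dots> \<le> ennreal (2 ^ CARD('n)) * ennreal (e\<^sup>2)"
      using energy' by (intro mult_left_mono) auto
    finally show ?thesis
      by (simp add: ennreal_mult)
  qed
  have D_sq: "(D x)\<^sup>2 \<le> ennreal (1 / (2 * \<sigma>)) * G2 x" for x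
    using low[of 1 x] unfolding D_def by (simp add: mult.commute)
  define A where "A = sqrt (1 / (2 * \<sigma>))"
  define B where "B = sqrt (1 / (?n - 2 * \<sigma>))"
  have AB: "0 \<le> A" "0 \<le> B" "A\<^sup>2 = 1 / (2 * \<sigma>)" "B\<^sup>2 = 1 / (?n - 2 * \<sigma>)"
    using \<sigma> by (auto simp: A_def B_def)
  have p0: "0 < p"
    using \<sigma> by (simp add: p)
  \<comment> \<open>After \<open>split_height_bound\<close> the right-hand side is linear in
    \<open>G2 x\<close>, so the integration over x needs nothing beyond
    \<open>G2_int\<close>.\<close>
  have pointwise: "ennreal (\<bar>V x 0 - m\<bar> powr p) \<le> ennreal ((A + B) powr p * e powr (p - 2)) * G2 x"
    if x: "x \<in> ?Q" for x
  proof (cases "G2 x")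
    case (real r)
    define G where "G = sqrt r"
    have G: "0 \<le> G" "G2 x = ennreal (G\<^sup>2)"
      using real by (auto simp: G_def)
    have VD: "ennreal \<bar>V x 0 - m\<bar> \<le> D x"
      using V0[OF x] by (simp add: D_def \<phi>_def)
    have lowG: "(\<integral>\<^sup>+t. \<phi> x t * indicator {0<..<h} t \<partial>lborel) \<le> ennreal (A * h powr \<sigma> * G)"
      if h: "0 < h" "h \<le> 1" for h
    proof (rule ennreal_le_of_square_le)
      have "(\<integral>\<^sup>+t. \<phi> x t * indicator {0<..<h} t \<partial>lborel)\<^sup>2 \<le> ennreal (G\<^sup>2) * ennreal (h powr (2 * \<sigma>) / (2 * \<sigma>))"
        using low[OF h, of x] G by simp
      also have "\<dots> = ennreal (G\<^sup>2 * (h powr (2 * \<sigma>) / (2 * \<sigma>)))"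
        by (rule ennreal_mult[symmetric]) (use \<sigma> in auto)
      also have "G\<^sup>2 * (h powr (2 * \<sigma>) / (2 * \<sigma>)) = (A * h powr \<sigma> * G)\<^sup>2"
        using h by (simp add: power_mult_distrib AB powr_power mult.commute)
      finally show "(\<integral>\<^sup>+t. \<phi> x t * indicator {0<..<h} t \<partial>lborel)\<^sup>2 \<le> ennreal ((A * h powr \<sigma> * G)\<^sup>2)" .
    qed (use AB G in auto)
    have "\<bar>V x 0 - m\<bar> powr p \<le> (A + B) powr p * e powr (p - 2) * G\<^sup>2"
    proof (rule split_height_bound[OF \<sigma> p AB(1,2) G(1) e])
      have "ennreal \<bar>V x 0 - m\<bar> \<le> ennreal (A * G)"
        using VD lowG[of 1] unfolding D_def by (simp add: order_trans)
      then show "\<bar>V x 0 - m\<bar> \<le> A * G"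
        using AB G by (subst (asm) ennreal_le_iff) auto
      fix h :: real assume h: "0 < h" "h < 1"
      have highG: "(\<integral>\<^sup>+t. \<phi> x t * indicator {h..<1} t \<partial>lborel) \<le> ennreal (B * h powr (\<sigma> - ?n / 2) * e)"
      proof (rule ennreal_le_of_square_le)
        have "ennreal (e\<^sup>2) * ennreal (h powr (2 * \<sigma> - ?n) / (?n - 2 * \<sigma>)) =
            ennreal (e\<^sup>2 * (h powr (2 * \<sigma> - ?n) / (?n - 2 * \<sigma>)))"
          by (rule ennreal_mult[symmetric]) (use \<sigma> in auto)
        also have "e\<^sup>2 * (h powr (2 * \<sigma> - ?n) / (?n - 2 * \<sigma>)) = (B * h powr (\<sigma> - ?n / 2) * e)\<^sup>2"
          using h by (simp add: power_mult_distrib AB powr_power algebra_simps)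
        finally show "(\<integral>\<^sup>+t. \<phi> x t * indicator {h..<1} t \<partial>lborel)\<^sup>2 \<le> ennreal ((B * h powr (\<sigma> - ?n / 2) * e)\<^sup>2)"
          using high[OF x h] by simp
      qed (use AB e in auto)
      have "D x = (\<integral>\<^sup>+t. \<phi> x t * indicator {0<..<h} t + \<phi> x t * indicator {h..<1} t \<partial>lborel)"
        unfolding D_def using h by (intro nn_integral_cong) (auto simp: indicator_def)
      also have "\<dots> = (\<integral>\<^sup>+t. \<phi> x t * indicator {0<..<h} t \<partial>lborel) + (\<integral>\<^sup>+t. \<phi> x t * indicator {h..<1} t \<partial>lborel)"
        by (rule nn_integral_add) measurable
      also have "\<dots> \<le> ennreal (A * h powr \<sigma> * G) + ennreal (B * h powr (\<sigma> - ?n / 2) * e)"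
        using lowG[of h] highG h by (intro add_mono) auto
      also have "\<dots> = ennreal (A * h powr \<sigma> * G + B * h powr (\<sigma> - ?n / 2) * e)"
        using AB G e by (intro ennreal_plus[symmetric]) auto
      finally have "ennreal \<bar>V x 0 - m\<bar> \<le> ennreal (A * h powr \<sigma> * G + B * h powr (\<sigma> - ?n / 2) * e)"
        using VD by (rule order_trans[rotated])
      then show "\<bar>V x 0 - m\<bar> \<le> A * h powr \<sigma> * G + B * h powr (\<sigma> - ?n / 2) * e"
        using AB G e by (subst (asm) ennreal_le_iff) auto
    qed simp
    then have "ennreal (\<bar>V x 0 - m\<bar> powr p) \<le> ennreal ((A + B) powr p * e powr (p - 2) * G\<^sup>2)"
      by (rule ennreal_leI)
    also have "\<dots> = ennreal ((A + B) powr p * e powr (p - 2)) * G2 x"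
      unfolding G by (rule ennreal_mult) auto
    finally show ?thesis .
  next
    \<comment> \<open>If \<open>G2 x\<close> is infinite the claim is trivial provided its factor is
      not 0: in \<open>ennreal\<close> the product of 0 and infinity is 0.\<close>
    case top
    have "0 < A"
      using \<sigma> by (simp add: A_def)
    then have "A + B \<noteq> 0"
      using AB by linarith
    then have "0 < (A + B) powr p * e powr (p - 2)"
      using e by simp
    then have nz: "ennreal ((A + B) powr p * e powr (p - 2)) \<noteq> 0"
      by (simp only: ennreal_eq_0_iff not_le)
    show ?thesis
      unfolding top ennreal_mult_top by (simp only: nz if_False top_greatest)
  qed
  have "(\<integral>\<^sup>+x. ennreal (\<bar>V x 0 - m\<bar> powr p) * indicator ?Q x \<partial>lborel) \<le>
      (\<integral>\<^sup>+x. ennreal ((A + B) powr p * e powr (p - 2)) * (G2 x * indicator ?Q x) \<partial>lborel)"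
    using pointwise by (intro nn_integral_mono) (auto simp: indicator_def)
  also have "\<dots> = ennreal ((A + B) powr p * e powr (p - 2)) * (\<integral>\<^sup>+x. G2 x * indicator ?Q x \<partial>lborel)"
    by (rule nn_integral_cmult) measurable
  also have "\<dots> \<le> ennreal ((A + B) powr p * e powr (p - 2)) * ennreal (2 ^ CARD('n) * e\<^sup>2)"
    by (intro mult_left_mono G2_int) auto
  also have "\<dots> = ennreal ((A + B) powr p * e powr (p - 2) * (2 ^ CARD('n) * e\<^sup>2))"
    by (rule ennreal_mult[symmetric]) auto
  also have "(A + B) powr p * e powr (p - 2) * (2 ^ CARD('n) * e\<^sup>2) = (A + B) powr p * 2 ^ CARD('n) * e powr p"
    using e by (simp add: powr_diff)
  finally show "(\<integral>\<^sup>+x. ennreal (\<bar>V x 0 - m\<bar> powr p) * indicator unit_cube x \<partial>lborel) \<le>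
      ennreal ((sqrt (1 / (2 * \<sigma>)) + sqrt (1 / (real CARD('n) - 2 * \<sigma>))) powr p * 2 ^ CARD('n) * e powr p)"
    by (simp only: A_def B_def)
  \<comment> \<open>For the second estimate a point (x, s) is first moved vertically down to (x, 0),
    at the cost \<open>\<Gamma> x\<close>, and then compared with \<open>m\<close> at the cost
    \<open>D x\<close>.\<close>
  define \<Gamma> where "\<Gamma> x = (\<integral>\<^sup>+t. g x t * indicator {0<..<1} t \<partial>lborel)" for x
  have [measurable]: "\<Gamma> \<in> borel_measurable borel"
    unfolding \<Gamma>_def by measurable
  have D_int: "(\<integral>\<^sup>+x. D x * indicator ?Q x \<partial>lborel) \<le> ennreal (A * sqrt (2 ^ CARD('n)) * e)"
  proof (rule ennreal_le_of_square_le)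
    have "(\<integral>\<^sup>+x. D x * indicator ?Q x \<partial>lborel)\<^sup>2 \<le> (\<integral>\<^sup>+x. (D x)\<^sup>2 * indicator ?Q x \<partial>lborel)"
      by (rule nn_integral_square_le_unit_cube) measurable
    also have "\<dots> \<le> (\<integral>\<^sup>+x. ennreal (A\<^sup>2) * (G2 x * indicator ?Q x) \<partial>lborel)"
      using D_sq by (intro nn_integral_mono) (auto simp: indicator_def AB)
    also have "\<dots> = ennreal (A\<^sup>2) * (\<integral>\<^sup>+x. G2 x * indicator ?Q x \<partial>lborel)"
      by (rule nn_integral_cmult) measurable
    also have "\<dots> \<le> ennreal (A\<^sup>2) * ennreal (2 ^ CARD('n) * e\<^sup>2)"
      by (intro mult_left_mono G2_int) auto
    also have "\<dots> = ennreal ((A * sqrt (2 ^ CARD('n)) * e)\<^sup>2)"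
      by (simp add: ennreal_mult[symmetric] power_mult_distrib)
    finally show "(\<integral>\<^sup>+x. D x * indicator ?Q x \<partial>lborel)\<^sup>2 \<le> ennreal ((A * sqrt (2 ^ CARD('n)) * e)\<^sup>2)" .
  qed (use AB e in auto)
  have \<Gamma>_int: "(\<integral>\<^sup>+x. \<Gamma> x * indicator ?Q x \<partial>lborel) \<le> ennreal (A * e)"
  proof (rule ennreal_le_of_square_le)
    have \<Gamma>_sq: "(\<Gamma> x)\<^sup>2 \<le> ennreal (A\<^sup>2) * (\<integral>\<^sup>+t. ennreal (w t) * (g x t)\<^sup>2 * indicator {0<..<1} t \<partial>lborel)" for x
    proof -
      have "(\<Gamma> x)\<^sup>2 \<le> (\<integral>\<^sup>+t. ennreal (w t) * (g x t)\<^sup>2 * indicator {0<..<1} t \<partial>lborel) *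
          (\<integral>\<^sup>+t. ennreal (1 / w t) * indicator {0<..<1} t \<partial>lborel)"
        unfolding \<Gamma>_def by (rule weighted_Cauchy_Schwarz) (auto simp: w_pos)
      moreover have "(\<integral>\<^sup>+t. ennreal (1 / w t) * indicator {0<..<1} t \<partial>lborel) \<le> ennreal (A\<^sup>2)"
      proof -
        have "(\<integral>\<^sup>+t. ennreal (1 / w t) * indicator {0<..<1} t \<partial>lborel) =
          (\<integral>\<^sup>+t. ennreal (t powr (2 * \<sigma> - 1)) * indicator {0<..<1} t \<partial>lborel)"
        by (intro nn_integral_cong) (auto simp: indicator_def w_def powr_minus_divide[symmetric])
        also have "\<dots> \<le> ennreal (1 powr (2 * \<sigma>) / (2 * \<sigma>))"
          using \<sigma> by (intro nn_integral_powr_from_0) auto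
        finally show ?thesis
          by (simp add: AB)
      qed
      ultimately show ?thesis
        by (subst mult.commute) (rule order_trans, assumption, rule mult_left_mono, auto)
    qed
    have "(\<integral>\<^sup>+x. \<Gamma> x * indicator ?Q x \<partial>lborel)\<^sup>2 \<le> (\<integral>\<^sup>+x. (\<Gamma> x)\<^sup>2 * indicator ?Q x \<partial>lborel)"
      by (rule nn_integral_square_le_unit_cube) measurable
    also have "\<dots> \<le> (\<integral>\<^sup>+x. ennreal (A\<^sup>2) * ((\<integral>\<^sup>+t. ennreal (w t) * (g x t)\<^sup>2 * indicator {0<..<1} t \<partial>lborel) * indicator ?Q x) \<partial>lborel)"
      using \<Gamma>_sq by (intro nn_integral_mono) (auto simp: indicator_def)
    also have "\<dots> = ennreal (A\<^sup>2) * (\<integral>\<^sup>+x. (\<integral>\<^sup>+t. ennreal (w t) * (g x t)\<^sup>2 * indicator {0<..<1} t \<partial>lborel) * indicator ?Q x \<partial>lborel)"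
      by (rule nn_integral_cmult) measurable
    also have "(\<integral>\<^sup>+x. (\<integral>\<^sup>+t. ennreal (w t) * (g x t)\<^sup>2 * indicator {0<..<1} t \<partial>lborel) * indicator ?Q x \<partial>lborel) =
        (\<integral>\<^sup>+x. (\<integral>\<^sup>+t. ennreal (w t) * (g x t)\<^sup>2 * indicator {0<..<1} t * indicator ?Q x \<partial>lborel) \<partial>lborel)"
      by (intro nn_integral_cong nn_integral_multc[symmetric]) measurable
    also have "\<dots> = (\<integral>\<^sup>+t. (\<integral>\<^sup>+x. ennreal (w t) * (g x t)\<^sup>2 * indicator {0<..<1} t * indicator ?Q x \<partial>lborel) \<partial>lborel)"
      by (rule lborel_pair.Fubini'[symmetric]) measurable
    also have "\<dots> = (\<integral>\<^sup>+t. ennreal (w t) * E t * indicator {0<..<1} t \<partial>lborel)"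
    proof (intro nn_integral_cong)
      fix t :: real
      have "(\<integral>\<^sup>+x. ennreal (w t) * (g x t)\<^sup>2 * indicator {0<..<1} t * indicator ?Q x \<partial>lborel) =
          (\<integral>\<^sup>+x. (ennreal (w t) * indicator {0<..<1} t) * ((g x t)\<^sup>2 * indicator ?Q x) \<partial>lborel)"
        by (intro nn_integral_cong) (simp add: mult_ac)
      also have "\<dots> = (ennreal (w t) * indicator {0<..<1} t) * E t"
        unfolding E_def by (rule nn_integral_cmult) measurable
      finally show "(\<integral>\<^sup>+x. ennreal (w t) * (g x t)\<^sup>2 * indicator {0<..<1} t * indicator ?Q x \<partial>lborel) =
          ennreal (w t) * E t * indicator {0<..<1} t"
        by (simp add: mult_ac)
    qed
    also have "ennreal (A\<^sup>2) * \<dots> \<le> ennreal (A\<^sup>2) * ennreal (e\<^sup>2)"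
      by (intro mult_left_mono energy') auto
    also have "\<dots> = ennreal ((A * e)\<^sup>2)"
      by (simp add: ennreal_mult[symmetric] power_mult_distrib)
    finally show "(\<integral>\<^sup>+x. \<Gamma> x * indicator ?Q x \<partial>lborel)\<^sup>2 \<le> ennreal ((A * e)\<^sup>2)" .
  qed (use AB e in auto)
  have "(\<integral>\<^sup>+s. ennreal \<bar>V x s - m\<bar> * indicator {0..1} s \<partial>lborel) \<le> \<Gamma> x + D x" if x: "x \<in> ?Q" for x
  proof -
    have "ennreal \<bar>V x s - m\<bar> \<le> \<Gamma> x + D x" if s: "s \<in> {0..1}" for s
    proof -
      have "ennreal \<bar>V x s - m\<bar> \<le> ennreal (\<bar>V x s - V x 0\<bar> + \<bar>V x 0 - m\<bar>)"
        by (intro ennreal_leI) simp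
      also have "\<dots> = ennreal \<bar>V x s - V x 0\<bar> + ennreal \<bar>V x 0 - m\<bar>"
        by simp
      also have "\<dots> \<le> \<Gamma> x + D x"
        using Vs[OF x, of s] V0[OF x] s by (intro add_mono) (auto simp: \<Gamma>_def D_def \<phi>_def)
      finally show ?thesis .
    qed
    then have "(\<integral>\<^sup>+s. ennreal \<bar>V x s - m\<bar> * indicator {0..1} s \<partial>lborel) \<le>
        (\<integral>\<^sup>+s. (\<Gamma> x + D x) * indicator {0..1} s \<partial>(lborel :: real measure))"
      by (intro nn_integral_mono) (auto simp: indicator_def)
    also have "\<dots> = \<Gamma> x + D x"
      by (subst nn_integral_cmult_indicator) auto
    finally show ?thesis .
  qed
  then have "(\<integral>\<^sup>+x. (\<integral>\<^sup>+s. ennreal \<bar>V x s - m\<bar> * indicator {0..1} s \<partial>lborel) * indicator unit_cube x \<partial>lborel) \<le>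
      (\<integral>\<^sup>+x. \<Gamma> x * indicator ?Q x + D x * indicator ?Q x \<partial>lborel)"
    by (intro nn_integral_mono) (auto simp: indicator_def)
  also have "\<dots> = (\<integral>\<^sup>+x. \<Gamma> x * indicator ?Q x \<partial>lborel) + (\<integral>\<^sup>+x. D x * indicator ?Q x \<partial>lborel)"
    by (rule nn_integral_add) measurable
  also have "\<dots> \<le> ennreal (A * e) + ennreal (A * sqrt (2 ^ CARD('n)) * e)"
    by (intro add_mono \<Gamma>_int D_int)
  also have "\<dots> = ennreal (A * e + A * sqrt (2 ^ CARD('n)) * e)"
    using AB e by (intro ennreal_plus[symmetric]) auto
  also have "A * e + A * sqrt (2 ^ CARD('n)) * e = (1 + sqrt (2 ^ CARD('n))) * A * e"
    by (simp add: algebra_simps)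
  finally show "(\<integral>\<^sup>+x. (\<integral>\<^sup>+s. ennreal \<bar>V x s - m\<bar> * indicator {0..1} s \<partial>lborel) * indicator unit_cube x \<partial>lborel) \<le>
      ennreal ((1 + sqrt (2 ^ CARD('n))) * sqrt (1 / (2 * \<sigma>)) * e)"
    by (simp only: A_def)
qed

section \<open>Calculus and linear algebra up to the boundary of the half-space\<close>

section \<open>Smooth functions on the half-space\<close>

lemma Ck_on_subset: "Ck_on k f S \<Longrightarrow> T \<subseteq> S \<Longrightarrow> Ck_on k f T"
  by (induction k arbitrary: f) (auto intro: continuous_on_subset)

lemma Ck_on_cong:
  assumes "open S" "\<And>x. x \<in> S \<Longrightarrow> f x = g x"
  shows "Ck_on k f S \<longleftrightarrow> Ck_on k g S"
  using assms(2)
proof (induction k arbitrary: f g)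
  case 0
  then show ?case
    by (auto cong: continuous_on_cong)
next
  case (Suc k)
  have d: "(f has_derivative D) (at x) \<longleftrightarrow> (g has_derivative D) (at x)" if "x \<in> S" for x D
    using that Suc.prems assms(1)
    by (metis has_derivative_transform_within_open)
  have "frechet_derivative f (at x) = frechet_derivative g (at x)" if "x \<in> S" for x
    unfolding frechet_derivative_def using d[OF that] by simp
  then have "Ck_on k (\<lambda>x. frechet_derivative f (at x) v) S \<longleftrightarrow>
      Ck_on k (\<lambda>x. frechet_derivative g (at x) v) S" for v
    by (intro Suc.IH) simp
  moreover have "(\<forall>x\<in>S. f differentiable (at x)) \<longleftrightarrow> (\<forall>x\<in>S. g differentiable (at x))"
    using d by (auto simp: differentiable_def)
  ultimately show ?case by simp
qed

lemma smooth_onE: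
  assumes "smooth_on f A" "x \<in> A"
  obtains S h where "open S" "x \<in> S" "\<And>k. Ck_on k h S" "\<And>y. y \<in> A \<inter> S \<Longrightarrow> f y = h y"
proof -
  have "\<exists>S h. open S \<and> x \<in> S \<and> (\<forall>k. Ck_on k h S) \<and> (\<forall>y\<in>A \<inter> S. f y = h y)"
    using assms unfolding smooth_on_def by (rule bspec)
  then obtain S h where *: "open S \<and> x \<in> S \<and> (\<forall>k. Ck_on k h S) \<and> (\<forall>y\<in>A \<inter> S. f y = h y)"
    by (elim exE)
  show thesis
    using * by (intro that[of S h]) simp_all
qed

text \<open>Uniqueness needs admissible increments in every coordinate direction. At a boundary
  point only nonnegative steps in the normal direction stay in the half-space, so the positive step
  e / 2 is used throughout.\<close>

lemma half_space_derivative_unique: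
  fixes f :: "'n::finite model \<Rightarrow> 'b::real_normed_vector"
  assumes x: "x \<in> half_space"
    and f: "(f has_derivative F) (at x within half_space)" "(f has_derivative F') (at x within half_space)"
  shows "F = F'"
proof (rule frechet_derivative_unique_within[OF f])
  fix i :: "'n model" and e :: real
  assume i: "i \<in> Basis" and e: "0 < e"
  obtain k where k: "i = axis k 1"
    using i by (auto simp: Basis_vec_def)
  have "x + (e / 2) *\<^sub>R i \<in> half_space"
    using x e by (simp add: k half_space_def axis_def)
  then show "\<exists>d. 0 < \<bar>d\<bar> \<and> \<bar>d\<bar> < e \<and> x + d *\<^sub>R i \<in> half_space"
    using e by (intro exI[of _ "e / 2"]) auto
qed

text \<open>The domain of the extension is intersected with an open set that cuts out
  \<open>A\<close>, so that near x the half-space itself is the domain of \<open>f\<close>. Then the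
  full derivative of the extension \<open>h\<close> is the derivative of \<open>f\<close> within the
  half-space, also at boundary points.\<close>

lemma smooth_on_local:
  fixes f :: "'n::finite model \<Rightarrow> 'b::real_normed_vector"
  assumes f: "smooth_on f A" and A: "openin (top_of_set half_space) A" and x: "x \<in> A"
  obtains S h where "open S" "x \<in> S" "half_space \<inter> S \<subseteq> A" "\<And>k. Ck_on k h S"
    "\<And>y. y \<in> half_space \<inter> S \<Longrightarrow> f y = h y"
    "\<And>y. y \<in> half_space \<inter> S \<Longrightarrow> (f has_derivative frechet_derivative h (at y)) (at y within half_space)"
proof -
  obtain S h where S: "open S" "x \<in> S" "\<And>k. Ck_on k h S" "\<And>y. y \<in> A \<inter> S \<Longrightarrow> f y = h y"
    by (rule smooth_onE[OF f x]) (rule that)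
  obtain T where T: "open T" "A = half_space \<inter> T"
    using A by (auto simp: openin_open)
  have "(f has_derivative frechet_derivative h (at y)) (at y within half_space)"
    if y: "y \<in> half_space \<inter> (S \<inter> T)" for y
  proof -
    have "open (S \<inter> T)" "y \<in> S \<inter> T"
      using S T y by auto
    then obtain d where d: "0 < d" "ball y d \<subseteq> S \<inter> T"
      using open_contains_ball by blast
    have "h differentiable (at y)"
      using S(3)[of "Suc 0"] y by simp
    then have "(h has_derivative frechet_derivative h (at y)) (at y)"
      by (simp only: frechet_derivative_works[symmetric])
    then have "(h has_derivative frechet_derivative h (at y)) (at y within half_space)"
      by (rule has_derivative_at_withinI)
    then show ?thesis
    proof (rule has_derivative_transform_within[OF _ d(1)])
      show "h z = f z" if z: "z \<in> half_space" "dist z y < d" for z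
      proof -
        have "z \<in> ball y d"
          using z by (simp add: dist_commute)
        then have "z \<in> S \<inter> T"
          using d(2) by (rule subsetD[rotated])
        then show ?thesis
          using S(4)[of z] T(2) z(1) by simp
      qed
    qed (use y in auto)
  qed
  moreover have "half_space \<inter> (S \<inter> T) \<subseteq> A" "open (S \<inter> T)" "x \<in> S \<inter> T"
    using S T x by auto
  ultimately show ?thesis
    using that[of "S \<inter> T" h] S(4) Ck_on_subset[OF S(3), of "S \<inter> T"] by auto
qed

lemma smooth_on_imp_continuous_on:
  assumes "smooth_on f A"
  shows "continuous_on A f"
  unfolding continuous_on_eq_continuous_within
proof
  fix x assume x: "x \<in> A"
  obtain S h where S: "open S" "x \<in> S" "\<And>k. Ck_on k h S" "\<And>y. y \<in> A \<inter> S \<Longrightarrow> f y = h y"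
    by (rule smooth_onE[OF assms x]) (rule that)
  have "continuous_on S h"
    using S(3)[of 0] by simp
  then have "isCont h x"
    using S(1,2) by (simp add: continuous_on_eq_continuous_at)
  then have "(h \<longlongrightarrow> h x) (at x within A)"
    unfolding isCont_def by (rule tendsto_within_subset) simp
  then have "(f \<longlongrightarrow> h x) (at x within A)"
    by (rule Lim_transform_eventually)
      (unfold eventually_at_topological, use S(1,2,4) in \<open>intro exI[of _ S], simp\<close>)
  then show "continuous (at x within A) f"
    using S(4)[of x] S(2) x by (simp add: continuous_within)
qed

lemma smooth_on_has_derivative:
  fixes f :: "'n::finite model \<Rightarrow> 'b::real_normed_vector"
  assumes f: "smooth_on f A" and A: "openin (top_of_set half_space) A" and x: "x \<in> A"
  shows "(f has_derivative frechet_derivative f (at x within half_space)) (at x within half_space)"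
proof (rule smooth_on_local[OF f A x])
  fix S h
  assume S: "x \<in> S" and h: "\<And>y. y \<in> half_space \<inter> S \<Longrightarrow> (f has_derivative frechet_derivative h (at y)) (at y within half_space)"
  have "x \<in> half_space"
    using A x openin_imp_subset by blast
  with S have "(f has_derivative frechet_derivative h (at x)) (at x within half_space)"
    by (intro h) simp
  then have "f differentiable (at x within half_space)"
    by (rule differentiableI)
  then show ?thesis
    by (simp only: frechet_derivative_works[symmetric])
qed

text \<open>By uniqueness the derivative within the half-space agrees with that of any local
  extension, which is continuous as part of \<open>Ck_on\<close>.\<close>

lemma smooth_on_continuous_derivative:
  fixes f :: "'n::finite model \<Rightarrow> 'b::real_normed_vector"
  assumes f: "smooth_on f A" and A: "openin (top_of_set half_space) A"
  shows "continuous_on A (\<lambda>x. frechet_derivative f (at x within half_space) v)"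
  unfolding continuous_on_eq_continuous_within
proof
  fix x assume x: "x \<in> A"
  have A_half: "A \<subseteq> half_space"
    using A openin_imp_subset by blast
  let ?D = "\<lambda>x. frechet_derivative f (at x within half_space) v"
  obtain S h where S: "open S" "x \<in> S" "half_space \<inter> S \<subseteq> A" "\<And>k. Ck_on k h S"
    "\<And>y. y \<in> half_space \<inter> S \<Longrightarrow> (f has_derivative frechet_derivative h (at y)) (at y within half_space)"
    by (rule smooth_on_local[OF f A x]) (rule that)
  have D: "?D y = frechet_derivative h (at y) v" if "y \<in> A \<inter> S" for y
    using half_space_derivative_unique[OF _ smooth_on_has_derivative[OF f A] S(5)] that A_half by auto
  have "continuous_on S (\<lambda>y. frechet_derivative h (at y) v)"
    using S(4)[of "Suc 0"] by simp
  then have "isCont (\<lambda>y. frechet_derivative h (at y) v) x"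
    using S(1,2) by (simp add: continuous_on_eq_continuous_at)
  then have "((\<lambda>y. frechet_derivative h (at y) v) \<longlongrightarrow> frechet_derivative h (at x) v) (at x within A)"
    unfolding isCont_def by (rule tendsto_within_subset) simp
  then have "(?D \<longlongrightarrow> frechet_derivative h (at x) v) (at x within A)"
    by (rule Lim_transform_eventually)
      (unfold eventually_at_topological, use S(1,2) D in \<open>intro exI[of _ S], simp\<close>)
  then show "continuous (at x within A) ?D"
    using D[of x] S(2) x by (simp add: continuous_within)
qed

section \<open>Positive definite matrices\<close>

lemma pos_def_invertible:
  fixes G :: "real ^ 'm ^ 'm::finite"
  assumes "\<And>v. v \<noteq> 0 \<Longrightarrow> 0 < v \<bullet> (G *v v)"
  shows "invertible G"
proof -
  have "v = 0" if "G *v v = 0" for v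
    using assms[of v] that by (cases "v = 0") auto
  then show ?thesis
    using matrix_left_invertible_ker invertible_left_inverse by blast
qed

lemma matrix_inv_mult_vec:
  fixes G :: "real ^ 'm ^ 'm::finite"
  assumes "invertible G"
  shows "G *v (matrix_inv G *v w) = w" "matrix_inv G *v (G *v w) = w"
proof -
  have "G ** matrix_inv G = mat 1 \<and> matrix_inv G ** G = mat 1"
    using assms unfolding invertible_def matrix_inv_def by (rule someI_ex)
  then show "G *v (matrix_inv G *v w) = w" "matrix_inv G *v (G *v w) = w"
    by (simp_all add: matrix_vector_mul_assoc)
qed

lemma continuous_on_det:
  fixes G :: "'a::topological_space \<Rightarrow> real ^ 'm ^ 'm::finite"
  assumes "continuous_on K G"
  shows "continuous_on K (\<lambda>x. det (G x))"
  unfolding det_def using assms by (intro continuous_intros)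

lemma continuous_on_matrix_vector_mult:
  fixes G :: "'a::topological_space \<Rightarrow> real ^ 'm ^ 'k::finite" and v :: "'a \<Rightarrow> real ^ 'm::finite"
  assumes "continuous_on K G" "continuous_on K v"
  shows "continuous_on K (\<lambda>x. G x *v v x)"
  unfolding matrix_vector_mult_def using assms
  by (intro continuous_on_vec_lambda continuous_intros)

text \<open>Every matrix on the segment from the identity to \<open>G\<close> is positive definite,
  hence invertible, so the determinant cannot change sign along it.\<close>

lemma pos_def_det_pos:
  fixes G :: "real ^ 'm ^ 'm::finite"
  assumes G: "\<And>v. v \<noteq> 0 \<Longrightarrow> 0 < v \<bullet> (G *v v)"
  shows "0 < det G"
proof (rule ccontr)
  assume neg: "\<not> 0 < det G"
  define P where "P t = (1 - t) *\<^sub>R mat 1 + t *\<^sub>R G" for t :: real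
  have "\<exists>t\<ge>0. t \<le> 1 \<and> det (P t) = 0"
  proof (rule IVT2')
    show "continuous_on {0..1} (\<lambda>t. det (P t))"
      unfolding P_def by (intro continuous_on_det continuous_intros)
  qed (use neg in \<open>auto simp: P_def\<close>)
  then obtain t where t: "0 \<le> t" "t \<le> 1" "det (P t) = 0"
    by blast
  have "0 < v \<bullet> (P t *v v)" if "v \<noteq> 0" for v
  proof -
    have "v \<bullet> (P t *v v) = (1 - t) * (v \<bullet> v) + t * (v \<bullet> (G *v v))"
      by (simp add: P_def matrix_vector_mult_add_rdistrib scaleR_matrix_vector_assoc[symmetric] inner_add_right)
    moreover have "0 < v \<bullet> v" "0 < v \<bullet> (G *v v)"
      using that G by auto
    ultimately show ?thesis
      using t by (cases "t = 0") (auto intro: add_nonneg_pos)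
  qed
  then have "det (P t) \<noteq> 0"
    using pos_def_invertible invertible_det_nz by blast
  with t show False by simp
qed

text \<open>Extrema over \<open>K\<close> times the unit sphere, extended to all vectors by
  homogeneity. A single pair of constants serves both the metric and its volume density.\<close>

lemma pos_def_compact_bounds:
  fixes G :: "'a::metric_space \<Rightarrow> real ^ 'm ^ 'm::finite"
  assumes K: "compact K" and G: "continuous_on K G"
    and pos: "\<And>x v. x \<in> K \<Longrightarrow> v \<noteq> 0 \<Longrightarrow> 0 < v \<bullet> (G x *v v)"
  obtains l L where "0 < l" "0 < L"
    "\<And>x v. x \<in> K \<Longrightarrow> l * (norm v)\<^sup>2 \<le> v \<bullet> (G x *v v)"
    "\<And>x v. x \<in> K \<Longrightarrow> norm (G x *v v) \<le> L * norm v"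
    "\<And>x. x \<in> K \<Longrightarrow> l \<le> sqrt (det (G x))"
    "\<And>x. x \<in> K \<Longrightarrow> sqrt (det (G x)) \<le> L"
proof (cases "K = {}")
  case True
  then show ?thesis by (intro that[of 1 1]) auto
next
  case False
  let ?S = "sphere 0 1 :: (real ^ 'm) set"
  have SK: "compact (K \<times> ?S)" "K \<times> ?S \<noteq> {}"
    using K False by (auto intro: compact_Times)
  have G': "continuous_on (K \<times> ?S) (\<lambda>z. G (fst z))"
    by (rule continuous_on_compose2[OF G]) (auto intro: continuous_intros)
  have cont1: "continuous_on (K \<times> ?S) (\<lambda>z. snd z \<bullet> (G (fst z) *v snd z))"
    by (intro continuous_on_inner continuous_on_matrix_vector_mult G' continuous_on_snd continuous_on_id)
  have cont2: "continuous_on (K \<times> ?S) (\<lambda>z. norm (G (fst z) *v snd z))"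
    by (intro continuous_on_norm continuous_on_matrix_vector_mult G' continuous_on_snd continuous_on_id)
  have cont3: "continuous_on K (\<lambda>x. sqrt (det (G x)))"
    by (intro continuous_on_real_sqrt continuous_on_det G)
  obtain a where a: "a \<in> K \<times> ?S" "\<And>z. z \<in> K \<times> ?S \<Longrightarrow> snd a \<bullet> (G (fst a) *v snd a) \<le> snd z \<bullet> (G (fst z) *v snd z)"
    using continuous_attains_inf[OF SK cont1] by blast
  obtain b where b: "\<And>z. z \<in> K \<times> ?S \<Longrightarrow> norm (G (fst z) *v snd z) \<le> norm (G (fst b) *v snd b)"
    using continuous_attains_sup[OF SK cont2] by blast
  obtain c where c: "c \<in> K" "\<And>x. x \<in> K \<Longrightarrow> sqrt (det (G c)) \<le> sqrt (det (G x))"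
    using continuous_attains_inf[OF K False cont3] by blast
  obtain d where d: "d \<in> K" "\<And>x. x \<in> K \<Longrightarrow> sqrt (det (G x)) \<le> sqrt (det (G d))"
    using continuous_attains_sup[OF K False cont3] by blast
  define la where "la = snd a \<bullet> (G (fst a) *v snd a)"
  define l where "l = min la (sqrt (det (G c)))"
  define Lb where "Lb = norm (G (fst b) *v snd b)"
  define L where "L = Lb + sqrt (det (G d)) + 1"
  have det_pos: "0 < det (G x)" if "x \<in> K" for x
    using pos_def_det_pos pos[OF that] by blast
  have la: "0 < la"
    unfolding la_def using a(1) by (intro pos) auto
  have scale: "v = norm v *\<^sub>R (v /\<^sub>R norm v)" for v :: "real ^ 'm"
    by (cases "v = 0") auto
  have quad: "c\<^sup>2 * (u \<bullet> (G x *v u)) = (c *\<^sub>R u) \<bullet> (G x *v (c *\<^sub>R u))" for x c u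
    by (simp add: matrix_vector_mult_scaleR power2_eq_square)
  have lin: "0 \<le> c \<Longrightarrow> c * norm (G x *v u) = norm (G x *v (c *\<^sub>R u))" for x c u
    by (simp add: matrix_vector_mult_scaleR)
  have unit: "v /\<^sub>R norm v \<in> ?S" if "v \<noteq> 0" for v :: "real ^ 'm"
    using that by simp
  show ?thesis
  proof (rule that[of l L])
    show "0 < l"
      using la det_pos[OF c(1)] by (simp add: l_def)
    show "0 < L"
      using det_pos[OF d(1)] by (simp add: L_def Lb_def add_nonneg_pos)
    fix x assume x: "x \<in> K"
    show "l \<le> sqrt (det (G x))"
      using c(2)[OF x] by (simp add: l_def min.coboundedI2)
    show "sqrt (det (G x)) \<le> L"
      using d(2)[OF x] norm_ge_zero[of "G (fst b) *v snd b"] unfolding L_def Lb_def by linarith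
    fix v :: "real ^ 'm"
    show "l * (norm v)\<^sup>2 \<le> v \<bullet> (G x *v v)"
    proof (cases "v = 0")
      case False
      let ?u = "v /\<^sub>R norm v"
      have "l \<le> ?u \<bullet> (G x *v ?u)"
        using a(2)[of "(x, ?u)"] x unit[OF False] by (simp add: l_def la_def min.coboundedI1)
      then have "l * (norm v)\<^sup>2 \<le> (norm v)\<^sup>2 * (?u \<bullet> (G x *v ?u))"
        by (subst mult.commute) (rule mult_left_mono, simp_all only: zero_le_power2)
      also have "\<dots> = (norm v *\<^sub>R ?u) \<bullet> (G x *v (norm v *\<^sub>R ?u))"
        by (rule quad)
      finally show ?thesis
        by (simp only: scale[symmetric])
    qed simp
    show "norm (G x *v v) \<le> L * norm v"
    proof (cases "v = 0")
      case False
      let ?u = "v /\<^sub>R norm v"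
      have "norm (G x *v ?u) \<le> L"
      proof -
        have "norm (G x *v ?u) \<le> Lb"
          using b[of "(x, ?u)"] x unit[OF False] by (simp add: Lb_def)
        moreover have "0 \<le> sqrt (det (G d))"
          using det_pos[OF d(1)] by simp
        ultimately show ?thesis
          unfolding L_def by linarith
      qed
      then have "norm v * norm (G x *v ?u) \<le> L * norm v"
        by (subst (2) mult.commute) (rule mult_left_mono, simp_all only: norm_ge_zero)
      also have "norm v * norm (G x *v ?u) = norm (G x *v (norm v *\<^sub>R ?u))"
        by (rule lin) simp
      finally show ?thesis
        by (simp only: scale[symmetric])
    qed simp
  qed
qed

text \<open>For \<open>w\<close> the coordinate differential of a function and \<open>u\<close> its
  gradient, the product u \<bullet> w is the squared Riemannian norm of the gradient. It is compared
  with the Euclidean norm of the differential without estimating an inverse matrix.\<close>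

lemma inverse_metric_bounds:
  fixes G :: "real ^ 'm ^ 'm::finite"
  assumes l: "0 < l" "\<And>v. l * (norm v)\<^sup>2 \<le> v \<bullet> (G *v v)" and L: "0 < L" "\<And>v. norm (G *v v) \<le> L * norm v"
    and u: "G *v u = w"
  shows "l / L\<^sup>2 * (norm w)\<^sup>2 \<le> u \<bullet> w" "u \<bullet> w \<le> (norm w)\<^sup>2 / l"
proof -
  have "(norm w)\<^sup>2 \<le> (L * norm u)\<^sup>2"
    using L(2)[of u] u by (intro power_mono) auto
  then have "l / L\<^sup>2 * (norm w)\<^sup>2 \<le> l / L\<^sup>2 * (L * norm u)\<^sup>2"
    using l by (intro mult_left_mono) auto
  also have "\<dots> = l * (norm u)\<^sup>2"
    using L by (simp add: power_mult_distrib)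
  also have "\<dots> \<le> u \<bullet> w"
    using l(2)[of u] u by simp
  finally show "l / L\<^sup>2 * (norm w)\<^sup>2 \<le> u \<bullet> w" .
  have uw: "u \<bullet> w \<le> norm u * norm w"
    by (rule norm_cauchy_schwarz)
  have "l * (norm u)\<^sup>2 \<le> norm u * norm w"
    using l(2)[of u] u uw by simp
  then have "l * norm u \<le> norm w"
    by (cases "u = 0") (auto simp: power2_eq_square field_simps)
  then have "norm u * norm w \<le> norm w / l * norm w"
    using l by (intro mult_right_mono) (auto simp: field_simps)
  with uw show "u \<bullet> w \<le> (norm w)\<^sup>2 / l"
    by (simp add: power2_eq_square)
qed

section \<open>Real inequalities for the shift by a constant\<close>

section \<open>The odd power function\<close>

text \<open>The integrand of the constraint. Up to the factor p it is the derivative of |x|^p; it is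
  odd and, for 2 \<le> p, increasing.\<close>

definition spow :: "real \<Rightarrow> real \<Rightarrow> real" where
  "spow p x = \<bar>x\<bar> powr (p - 2) * x"

lemma spow_minus: "spow p (- x) = - spow p x"
  by (simp add: spow_def)

lemma spow_pos: "0 \<le> x \<Longrightarrow> spow p x = x powr (p - 1)"
  by (cases "x = 0") (auto simp: spow_def powr_mult_base powr_add[symmetric] powr_diff powr_mult field_simps
      simp flip: power2_eq_square powr_numeral)

lemma abs_spow: "\<bar>spow p x\<bar> = \<bar>x\<bar> powr (p - 1)"
proof -
  have "\<bar>spow p x\<bar> = spow p \<bar>x\<bar>"
    by (simp add: spow_def abs_mult)
  then show ?thesis
    by (simp add: spow_pos)
qed

lemma spow_mult_self: "spow p x * x = \<bar>x\<bar> powr p"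
proof (cases "x = 0")
  case False
  then have "spow p x * x = \<bar>x\<bar> powr (p - 2) * \<bar>x\<bar> powr 2"
    by (simp add: spow_def power2_eq_square)
  also have "\<dots> = \<bar>x\<bar> powr p"
    by (simp only: powr_add[symmetric]) simp
  finally show ?thesis .
qed (simp add: spow_def)

lemma borel_measurable_spow [measurable]:
  "f \<in> borel_measurable M \<Longrightarrow> (\<lambda>x. spow p (f x)) \<in> borel_measurable M"
  unfolding spow_def by measurable

lemma isCont_spow:
  assumes "2 < p"
  shows "isCont (spow p) x"
  using assms unfolding isCont_def spow_def
  by (auto intro!: tendsto_intros tendsto_powr')

text \<open>The graph of the convex function |x|^p lies above its tangents. Young's inequality with
  the conjugate exponent \<open>q\<close> bounds the mixed term \<open>spow p x * y\<close>.\<close>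

lemma powr_tangent_le:
  assumes p: "1 < p"
  shows "\<bar>x\<bar> powr p + p * spow p x * (y - x) \<le> \<bar>y\<bar> powr p"
proof -
  define q where "q = p / (p - 1)"
  have q: "1 < q" "1 / q + 1 / p = 1" "(p - 1) * q = p"
    using p by (auto simp: q_def field_simps)
  have "spow p x * y \<le> \<bar>x\<bar> powr (p - 1) * \<bar>y\<bar>"
    by (metis abs_spow abs_mult abs_ge_self)
  also have "\<dots> \<le> (\<bar>x\<bar> powr (p - 1)) powr q / q + \<bar>y\<bar> powr p / p"
    by (rule Youngs_inequality) (use p q in auto)
  also have "(\<bar>x\<bar> powr (p - 1)) powr q = \<bar>x\<bar> powr p"
    using q by (simp add: powr_powr)
  finally have "p * (spow p x * y) \<le> p * (\<bar>x\<bar> powr p / q + \<bar>y\<bar> powr p / p)"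
    using p by simp
  also have "\<dots> = (p - 1) * \<bar>x\<bar> powr p + \<bar>y\<bar> powr p"
    using p by (simp add: q_def field_simps)
  finally show ?thesis
    using spow_mult_self[of p x] by (simp add: algebra_simps)
qed

text \<open>If s and s + c do not have opposite signs, this is superadditivity of t^(p-1) on t \<ge>
  0; if they do, one of |s| and s + c is at least c / 2. The gain does not depend on s, so it
  survives integration with s replaced by the values of a function.\<close>

lemma spow_add_ge:
  assumes p: "2 \<le> p" and c: "0 \<le> c"
  shows "spow p s + (c / 2) powr (p - 1) \<le> spow p (s + c)"
proof -
  have super: "a powr (p - 1) + b powr (p - 1) \<le> (a + b) powr (p - 1)" if "0 \<le> a" "0 \<le> b" for a b :: real
  proof -
    have split: "t powr (p - 1) = t * t powr (p - 2)" if "0 \<le> t" for t :: real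
      using that by (cases "t = 0") (auto simp: powr_mult_base)
    have "a * a powr (p - 2) \<le> a * (a + b) powr (p - 2)" "b * b powr (p - 2) \<le> b * (a + b) powr (p - 2)"
      using that p by (auto intro!: mult_left_mono powr_mono2)
    then show ?thesis
      using that by (simp add: split algebra_simps)
  qed
  have half: "(c / 2) powr (p - 1) \<le> c powr (p - 1)"
    using p c by (intro powr_mono2) auto
  consider "0 \<le> s" | "s + c \<le> 0" | "s < 0" "0 < s + c" by linarith
  then show ?thesis
  proof cases
    case 1
    then show ?thesis
      using super[of s c] c half by (simp add: spow_pos)
  next
    case 2
    have "spow p (- s) = - spow p s" "spow p (- (s + c)) = - spow p (s + c)"
      by (simp_all only: spow_minus)
    then show ?thesis
      using super[of "- (s + c)" c] 2 c half by (simp add: spow_pos)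
  next
    case 3
    have "spow p (- s) = - spow p s"
      by (rule spow_minus)
    moreover have "(c / 2) powr (p - 1) \<le> spow p (- s) + spow p (s + c)"
    proof (cases "c / 2 \<le> - s")
      case True
      then have "(c / 2) powr (p - 1) \<le> (- s) powr (p - 1)"
        using c p by (intro powr_mono2) auto
      then show ?thesis
        using 3 by (simp add: spow_pos add_increasing2)
    next
      case False
      then have "(c / 2) powr (p - 1) \<le> (s + c) powr (p - 1)"
        using c p by (intro powr_mono2) auto
      then show ?thesis
        using 3 by (simp add: spow_pos add_increasing)
    qed
    ultimately show ?thesis by simp
  qed
qed

lemma spow_mono:
  assumes "2 \<le> p" "s \<le> t"
  shows "spow p s \<le> spow p t"
proof -
  have "spow p s + ((t - s) / 2) powr (p - 1) \<le> spow p t"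
    using spow_add_ge[of p "t - s" s] assms by simp
  moreover have "0 \<le> ((t - s) / 2) powr (p - 1)"
    by simp
  ultimately show ?thesis by linarith
qed

text \<open>A fraction t in [0, 1] satisfies t \<le> t^r; this is applied to a / (a + b) and b / (a
  + b), which add up to 1.\<close>

lemma powr_add_le_add_powr:
  fixes a b r :: real
  assumes "0 \<le> a" "0 \<le> b" "0 < r" "r \<le> 1"
  shows "(a + b) powr r \<le> a powr r + b powr r"
proof (cases "a + b = 0")
  case False
  then have ab: "0 < a + b" using assms by simp
  have *: "t powr r \<ge> t / (a + b) * (a + b) powr r" if "0 \<le> t" "t \<le> a + b" for t
  proof -
    have "(t / (a + b)) powr 1 \<le> (t / (a + b)) powr r"
      using that assms ab by (intro powr_mono') auto
    then have "t / (a + b) \<le> t powr r / (a + b) powr r"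
      using that ab by (simp add: powr_divide)
    then show ?thesis
      using ab by (simp add: field_simps)
  qed
  have "(a + b) powr r = a / (a + b) * (a + b) powr r + b / (a + b) * (a + b) powr r"
  proof -
    have "a / (a + b) + b / (a + b) = 1"
      using ab by (simp add: add_divide_distrib[symmetric])
    then show ?thesis
      by (metis distrib_right mult_1)
  qed
  also have "\<dots> \<le> a powr r + b powr r"
    using *[of a] *[of b] assms by simp
  finally show ?thesis .
qed (use assms in auto)

section \<open>Shifting a function to the zero of its odd power integral\<close>

lemma abs_add_powr_le:
  fixes p :: real
  assumes "0 \<le> p"
  shows "\<bar>x + y\<bar> powr p \<le> 2 powr p * (\<bar>x\<bar> powr p + \<bar>y\<bar> powr p)"
proof -
  have "\<bar>x + y\<bar> powr p \<le> (2 * max \<bar>x\<bar> \<bar>y\<bar>) powr p"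
    using assms by (intro powr_mono2) auto
  also have "\<dots> = 2 powr p * max \<bar>x\<bar> \<bar>y\<bar> powr p"
    by (simp add: powr_mult)
  also have "max \<bar>x\<bar> \<bar>y\<bar> powr p \<le> \<bar>x\<bar> powr p + \<bar>y\<bar> powr p"
    by (auto simp: max_def)
  finally show ?thesis by simp
qed

lemma (in finite_measure) integrable_powr_shift:
  fixes f :: "'a \<Rightarrow> real"
  assumes [measurable]: "f \<in> borel_measurable M" and p: "0 \<le> p"
    and f: "integrable M (\<lambda>x. \<bar>f x\<bar> powr p)"
  shows "integrable M (\<lambda>x. \<bar>f x + c\<bar> powr p)"
proof (rule Bochner_Integration.integrable_bound)
  show "integrable M (\<lambda>x. 2 powr p * (\<bar>f x\<bar> powr p + \<bar>c\<bar> powr p))"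
    using f by auto
  show "AE x in M. norm (\<bar>f x + c\<bar> powr p) \<le> norm (2 powr p * (\<bar>f x\<bar> powr p + \<bar>c\<bar> powr p))"
    using abs_add_powr_le[OF p, of "f _" c] by (auto intro!: AE_I2)
qed measurable

lemma (in finite_measure) integrable_spow:
  fixes f :: "'a \<Rightarrow> real"
  assumes [measurable]: "f \<in> borel_measurable M" and p: "2 \<le> p"
    and f: "integrable M (\<lambda>x. \<bar>f x\<bar> powr p)"
  shows "integrable M (\<lambda>x. spow p (f x))"
proof (rule Bochner_Integration.integrable_bound)
  show "integrable M (\<lambda>x. 1 + \<bar>f x\<bar> powr p)"
    using f by auto
  have "t powr (p - 1) \<le> 1 + t powr p" if "0 \<le> t" for t :: real
  proof (cases "t \<le> 1")
    case True
    then have "t powr (p - 1) \<le> 1 powr (p - 1)"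
      using that p by (intro powr_mono2) auto
    then show ?thesis by (simp add: add_increasing2)
  next
    case False
    then have "t powr (p - 1) \<le> t powr p"
      by (intro powr_mono) auto
    then show ?thesis by simp
  qed
  then show "AE x in M. norm (spow p (f x)) \<le> norm (1 + \<bar>f x\<bar> powr p)"
    by (auto simp: abs_spow intro!: AE_I2)
qed measurable

context
  fixes N :: "'a measure" and p :: real and f :: "'a \<Rightarrow> real"
  assumes fin: "finite_measure N" and pos: "0 < measure N (space N)" and p: "2 < p"
    and f_meas [measurable]: "f \<in> borel_measurable N"
    and f_int: "integrable N (\<lambda>x. \<bar>f x\<bar> powr p)"
begin

interpretation finite_measure N by (rule fin)

lemma integrable_spow_shift: "integrable N (\<lambda>x. spow p (f x + c))"
  using p by (intro integrable_spow integrable_powr_shift f_int) auto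

lemma integral_spow_shift_ge:
  assumes "0 \<le> c"
  shows "(\<integral>x. spow p (f x + a) \<partial>N) + (c / 2) powr (p - 1) * measure N (space N)
    \<le> (\<integral>x. spow p (f x + a + c) \<partial>N)"
proof -
  have "(\<integral>x. spow p (f x + a) \<partial>N) + (c / 2) powr (p - 1) * measure N (space N) =
      (\<integral>x. spow p (f x + a) + (c / 2) powr (p - 1) \<partial>N)"
    using integrable_spow_shift[of a] by simp
  also have "\<dots> \<le> (\<integral>x. spow p (f x + a + c) \<partial>N)"
    using integrable_spow_shift[of a] integrable_spow_shift[of "a + c"] p assms
    by (intro integral_mono) (auto simp: add.assoc intro: spow_add_ge[of p c "f _ + a", simplified add.assoc])
  finally show ?thesis .
qed

lemma continuous_integral_spow_shift: "continuous_on UNIV (\<lambda>c. \<integral>x. spow p (f x + c) \<partial>N)"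
proof (rule continuous_at_imp_continuous_on, intro ballI)
  fix c :: real
  show "isCont (\<lambda>c. \<integral>x. spow p (f x + c) \<partial>N) c"
    unfolding continuous_at_sequentially o_def
  proof (intro allI impI)
    fix X assume X: "X \<longlonglongrightarrow> c"
    then obtain K where K: "\<And>n. \<bar>X n\<bar> \<le> K"
      using convergent_imp_Bseq[of X] by (auto simp: convergent_def Bseq_def)
    show "(\<lambda>n. \<integral>x. spow p (f x + X n) \<partial>N) \<longlonglongrightarrow> (\<integral>x. spow p (f x + c) \<partial>N)"
    \<comment> \<open>Since \<open>spow p\<close> is increasing, shifts in [-K, K] are sandwiched
      between the two extreme ones, which gives an integrable majorant.\<close>
    proof (rule integral_dominated_convergence[where w = "\<lambda>x. \<bar>spow p (f x + K)\<bar> + \<bar>spow p (f x - K)\<bar>"])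
      show "integrable N (\<lambda>x. \<bar>spow p (f x + K)\<bar> + \<bar>spow p (f x - K)\<bar>)"
        using integrable_spow_shift[of K] integrable_spow_shift[of "- K"] by auto
      show "AE x in N. (\<lambda>n. spow p (f x + X n)) \<longlonglongrightarrow> spow p (f x + c)"
        using X isCont_spow[OF p] by (auto intro!: AE_I2 isCont_tendsto_compose[of _ "spow p"] tendsto_intros)
      fix n
      have "spow p (f x - K) \<le> spow p (f x + X n)" "spow p (f x + X n) \<le> spow p (f x + K)" for x
        using K[of n] p by (auto intro!: spow_mono)
      then have "\<bar>spow p (f x + X n)\<bar> \<le> \<bar>spow p (f x + K)\<bar> + \<bar>spow p (f x - K)\<bar>" for x
        by (auto simp: abs_if intro: order_trans add_increasing add_increasing2) (smt (verit))+
      then show "AE x in N. norm (spow p (f x + X n)) \<le> \<bar>spow p (f x + K)\<bar> + \<bar>spow p (f x - K)\<bar>"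
        by (auto intro!: AE_I2)
    qed measurable
  qed
qed

lemma ex_spow_shift_zero: "\<exists>c. (\<integral>x. spow p (f x + c) \<partial>N) = 0"
proof -
  define a where "a = (\<lambda>c. \<integral>x. spow p (f x + c) \<partial>N)"
  define V where "V = measure N (space N)"
  \<comment> \<open>Chosen so that the guaranteed growth \<open>(c / 2) powr (p - 1) * V\<close>
    equals |a 0|; the integral is then nonpositive at -c and nonnegative at c.\<close>
  define c where "c = 2 * (\<bar>a 0\<bar> / V) powr (1 / (p - 1))"
  have "(c / 2) powr (p - 1) * V = \<bar>a 0\<bar>" "0 \<le> c"
    using pos p by (simp_all add: c_def V_def powr_powr)
  then have "a 0 + \<bar>a 0\<bar> \<le> a c" "a (- c) + \<bar>a 0\<bar> \<le> a 0"
    using integral_spow_shift_ge[of c 0] integral_spow_shift_ge[of c "- c"]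
    by (simp_all add: a_def V_def)
  then have "a (- c) \<le> 0" "0 \<le> a c"
    by auto
  then have "\<exists>x\<ge>- c. x \<le> c \<and> a x = 0"
    using continuous_integral_spow_shift \<open>0 \<le> c\<close>
    by (intro IVT') (auto simp: a_def intro: continuous_on_subset)
  then show ?thesis
    by (auto simp: a_def)
qed

text \<open>Growth bounds |c| by a multiple of A^(1/(p-1)); the tangent inequality at f x in
  direction c bounds the loss by p |c| A, a multiple of A^(p/(p-1)). Subadditivity of the power 2/p
  < 1 separates the two terms and produces the exponent 2/(p-1).\<close>

lemma norm_le_shift_norm:
  assumes c: "(\<integral>x. spow p (f x + c) \<partial>N) = 0"
  defines "V \<equiv> measure N (space N)" and "A \<equiv> \<bar>\<integral>x. spow p (f x) \<partial>N\<bar>"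
  shows "(\<integral>x. \<bar>f x\<bar> powr p \<partial>N) powr (2 / p) \<le>
    (\<integral>x. \<bar>f x + c\<bar> powr p \<partial>N) powr (2 / p) +
    (2 * p * (1 / V) powr (1 / (p - 1))) powr (2 / p) * A powr (2 / (p - 1))"
proof -
  let ?a = "\<integral>x. spow p (f x) \<partial>N"
  have V: "0 < V" using pos by (simp add: V_def)
  have le: "(\<bar>c\<bar> / 2) powr (p - 1) * V \<le> A"
  proof (cases "0 \<le> c")
    case True
    then show ?thesis
      using integral_spow_shift_ge[of c 0] c by (simp add: V_def A_def)
  next
    case False
    then show ?thesis
      using integral_spow_shift_ge[of "- c" c] c by (simp add: V_def A_def add.assoc)
  qed
  have "\<bar>c\<bar> / 2 = ((\<bar>c\<bar> / 2) powr (p - 1)) powr (1 / (p - 1))"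
    using p by (simp add: powr_powr)
  also have "\<dots> \<le> (A / V) powr (1 / (p - 1))"
    using le V p by (intro powr_mono2) (auto simp: field_simps)
  also have "\<dots> = (1 / V) powr (1 / (p - 1)) * A powr (1 / (p - 1))"
    using V by (simp add: A_def powr_divide)
  finally have c_le: "\<bar>c\<bar> \<le> 2 * ((1 / V) powr (1 / (p - 1)) * A powr (1 / (p - 1)))"
    by simp
  have "(\<integral>x. \<bar>f x\<bar> powr p + p * c * spow p (f x) \<partial>N) \<le> (\<integral>x. \<bar>f x + c\<bar> powr p \<partial>N)"
  proof (rule integral_mono)
    show "integrable N (\<lambda>x. \<bar>f x\<bar> powr p + p * c * spow p (f x))"
      using f_int integrable_spow_shift[of 0] by simp
    show "integrable N (\<lambda>x. \<bar>f x + c\<bar> powr p)"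
      using p by (intro integrable_powr_shift f_int) auto
    show "\<bar>f x\<bar> powr p + p * c * spow p (f x) \<le> \<bar>f x + c\<bar> powr p" for x
      using powr_tangent_le[of p "f x" "f x + c"] p by (simp add: mult.commute mult.left_commute)
  qed
  then have "(\<integral>x. \<bar>f x\<bar> powr p \<partial>N) \<le> (\<integral>x. \<bar>f x + c\<bar> powr p \<partial>N) + (- (p * c * ?a))"
    using f_int integrable_spow_shift[of 0] by simp
  also have "- (p * c * ?a) \<le> \<bar>p * c * ?a\<bar>"
    by simp
  also have "\<bar>p * c * ?a\<bar> = p * \<bar>c\<bar> * A"
    using p by (simp add: abs_mult A_def)
  also have "\<dots> \<le> p * (2 * ((1 / V) powr (1 / (p - 1)) * A powr (1 / (p - 1)))) * A"
    using c_le p by (intro mult_right_mono mult_left_mono) (auto simp: A_def)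
  also have "\<dots> = 2 * p * (1 / V) powr (1 / (p - 1)) * A powr (p / (p - 1))"
  proof -
    have "A powr (1 / (p - 1)) * A = A powr (1 / (p - 1) + 1)"
      by (cases "A = 0") (auto simp: A_def powr_add)
    also have "1 / (p - 1) + 1 = p / (p - 1)"
      using p by (simp add: field_simps)
    finally show ?thesis by (simp add: mult_ac)
  qed
  finally have "(\<integral>x. \<bar>f x\<bar> powr p \<partial>N) powr (2 / p) \<le>
      ((\<integral>x. \<bar>f x + c\<bar> powr p \<partial>N) + 2 * p * (1 / V) powr (1 / (p - 1)) * A powr (p / (p - 1))) powr (2 / p)"
    using p by (intro powr_mono2) auto
  also have "\<dots> \<le> (\<integral>x. \<bar>f x + c\<bar> powr p \<partial>N) powr (2 / p) +
      (2 * p * (1 / V) powr (1 / (p - 1)) * A powr (p / (p - 1))) powr (2 / p)"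
    using p by (intro powr_add_le_add_powr) auto
  also have "(2 * p * (1 / V) powr (1 / (p - 1)) * A powr (p / (p - 1))) powr (2 / p) =
      (2 * p * (1 / V) powr (1 / (p - 1))) powr (2 / p) * A powr (2 / (p - 1))"
    using p by (simp add: powr_mult powr_powr)
  finally show ?thesis .
qed

text \<open>The tangent term integrates to 0, so among all constants m the value 0 minimises the
  integral of |f - m|^p. The unknown constant of the trace inequality can therefore be dropped for
  functions that satisfy the constraint.\<close>

lemma integral_powr_le_shift:
  assumes "(\<integral>x. spow p (f x) \<partial>N) = 0"
  shows "(\<integral>x. \<bar>f x\<bar> powr p \<partial>N) \<le> (\<integral>x. \<bar>f x - m\<bar> powr p \<partial>N)"
proof -
  have "(\<integral>x. \<bar>f x\<bar> powr p + p * (- m) * spow p (f x) \<partial>N) \<le> (\<integral>x. \<bar>f x + (- m)\<bar> powr p \<partial>N)"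
  proof (rule integral_mono)
    show "integrable N (\<lambda>x. \<bar>f x\<bar> powr p + p * (- m) * spow p (f x))"
      using f_int integrable_spow_shift[of 0] by simp
    show "integrable N (\<lambda>x. \<bar>f x + (- m)\<bar> powr p)"
      using p by (intro integrable_powr_shift f_int) auto
    show "\<bar>f x\<bar> powr p + p * (- m) * spow p (f x) \<le> \<bar>f x + (- m)\<bar> powr p" for x
      using powr_tangent_le[of p "f x" "f x + (- m)"] p by (simp add: mult.commute mult.left_commute)
  qed
  then show ?thesis
    using f_int integrable_spow_shift[of 0] assms by simp
qed

end

section \<open>Charts, gradients and Riemannian measures of the manifold\<close>

section \<open>Charts\<close>

lemma closed_half_space: "closed half_space"
  unfolding half_space_def by (rule closed_halfspace_component_ge_cart)

lemma at_within_openin: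
  assumes "openin (top_of_set S) T" "x \<in> T"
  shows "at x within T = at x within S"
proof -
  obtain U where "open U" "T = S \<inter> U"
    using assms(1) by (auto simp: openin_open)
  with assms(2) show ?thesis
    by (intro at_within_nhd[of _ U]) auto
qed

locale riem_mfd =
  fixes M :: "('a, 'n::finite) riem_data"
  assumes M: "compact_connected_riemannian_manifold_with_boundary M"
begin

abbreviation "X \<equiv> mfd_top M"
abbreviation "At \<equiv> mfd_atlas M"

lemma Hausdorff: "Hausdorff_space X" and compact: "compact_space X" and connected: "connected_space X"
  and charts_cover: "(\<Union>c\<in>At. fst c) = topspace X"
  using M unfolding compact_connected_riemannian_manifold_with_boundary_def by simp_all

lemma is_chartD: "c \<in> At \<Longrightarrow> is_chart X c"
  using M unfolding compact_connected_riemannian_manifold_with_boundary_def by blast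

lemma smooth_transition:
  "c \<in> At \<Longrightarrow> c' \<in> At \<Longrightarrow> smooth_on (snd c' \<circ> chart_inv c) (snd c ` (fst c \<inter> fst c'))"
  using M unfolding compact_connected_riemannian_manifold_with_boundary_def by blast

lemma smooth_metric: "c \<in> At \<Longrightarrow> smooth_on (mfd_metric M c \<circ> chart_inv c) (chart_img c)"
  using M unfolding compact_connected_riemannian_manifold_with_boundary_def by blast

lemma metric_pos: "c \<in> At \<Longrightarrow> p \<in> fst c \<Longrightarrow> v \<noteq> 0 \<Longrightarrow> 0 < v \<bullet> (mfd_metric M c p *v v)"
  using M unfolding compact_connected_riemannian_manifold_with_boundary_def by blast

lemma metric_transition:
  "c \<in> At \<Longrightarrow> c' \<in> At \<Longrightarrow> p \<in> fst c \<Longrightarrow> p \<in> fst c' \<Longrightarrow>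
    mfd_metric M c p = transpose (transition_jac c c' p) ** mfd_metric M c' p ** transition_jac c c' p"
  using M unfolding compact_connected_riemannian_manifold_with_boundary_def by blast

lemma openin_chart: "c \<in> At \<Longrightarrow> openin X (fst c)"
  and openin_chart_img: "c \<in> At \<Longrightarrow> openin (top_of_set half_space) (chart_img c)"
  and chart_homeo: "c \<in> At \<Longrightarrow> homeomorphic_map (subtopology X (fst c)) (top_of_set (chart_img c)) (snd c)"
  using is_chartD unfolding is_chart_def by blast+

lemma chart_subset: "c \<in> At \<Longrightarrow> fst c \<subseteq> mfd_pts M"
  unfolding mfd_pts_def by (rule openin_subset[OF openin_chart])

lemma chart_img_half_space: "c \<in> At \<Longrightarrow> chart_img c \<subseteq> half_space"
  using openin_imp_subset[OF openin_chart_img] .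

lemma chart_half_space: "c \<in> At \<Longrightarrow> p \<in> fst c \<Longrightarrow> snd c p \<in> half_space"
  using chart_img_half_space[of c] by (auto simp: chart_img_def)

lemma topspace_chart: "c \<in> At \<Longrightarrow> topspace (subtopology X (fst c)) = fst c"
  using chart_subset[of c] by (simp add: mfd_pts_def Int_absorb1)

lemma inj_on_chart: "c \<in> At \<Longrightarrow> inj_on (snd c) (fst c)"
  using homeomorphic_imp_injective_map[OF chart_homeo] by (simp only: topspace_chart)

lemma chart_inv_chart [simp]: "c \<in> At \<Longrightarrow> p \<in> fst c \<Longrightarrow> chart_inv c (snd c p) = p"
  unfolding chart_inv_def by (rule inv_into_f_f[OF inj_on_chart])

lemma chart_chart_inv [simp]: "x \<in> chart_img c \<Longrightarrow> snd c (chart_inv c x) = x"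
  unfolding chart_inv_def chart_img_def by (rule f_inv_into_f)

lemma chart_inv_in [simp]: "x \<in> chart_img c \<Longrightarrow> chart_inv c x \<in> fst c"
  unfolding chart_inv_def chart_img_def by (rule inv_into_into)

lemma chart_in_img [simp]: "p \<in> fst c \<Longrightarrow> snd c p \<in> chart_img c"
  unfolding chart_img_def by (rule imageI)

lemma mem_chart_image_iff: "c \<in> At \<Longrightarrow> E \<subseteq> fst c \<Longrightarrow> x \<in> snd c ` E \<longleftrightarrow> x \<in> chart_img c \<and> chart_inv c x \<in> E"
  by (auto intro!: image_eqI[of x "snd c" "chart_inv c x"])

lemma chart_image_eq: "c \<in> At \<Longrightarrow> E \<subseteq> fst c \<Longrightarrow> snd c ` E = {x \<in> chart_img c. chart_inv c x \<in> E}"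
  using mem_chart_image_iff by blast

lemma continuous_chart: "c \<in> At \<Longrightarrow> continuous_map (subtopology X (fst c)) euclidean (snd c)"
  using homeomorphic_imp_continuous_map[OF chart_homeo] continuous_map_into_fulltopology by blast

lemma continuous_chart_inv: "c \<in> At \<Longrightarrow> continuous_map (top_of_set (chart_img c)) (subtopology X (fst c)) (chart_inv c)"
proof -
  assume c: "c \<in> At"
  obtain g where g: "homeomorphic_maps (subtopology X (fst c)) (top_of_set (chart_img c)) (snd c) g"
    using chart_homeo[OF c] unfolding homeomorphic_map_maps by blast
  have "g x = chart_inv c x" if "x \<in> chart_img c" for x
  proof -
    have "g (snd c (chart_inv c x)) = chart_inv c x"
    proof -
      have "\<forall>q\<in>topspace (subtopology X (fst c)). g (snd c q) = q"
        using g unfolding homeomorphic_maps_def by blast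
      then show ?thesis
        unfolding topspace_chart[OF c] by (rule bspec) (rule chart_inv_in[OF that])
    qed
    then show ?thesis using that by simp
  qed
  moreover have "continuous_map (top_of_set (chart_img c)) (subtopology X (fst c)) g"
    using g unfolding homeomorphic_maps_def by blast
  ultimately show ?thesis
    by (rule continuous_map_eq[rotated]) simp
qed

lemma openin_chart_preimage: "c \<in> At \<Longrightarrow> open V \<Longrightarrow> openin X {p \<in> fst c. snd c p \<in> V}"
proof -
  assume c: "c \<in> At" and V: "open V"
  have "openin (subtopology X (fst c)) {p \<in> topspace (subtopology X (fst c)). snd c p \<in> V}"
    by (rule openin_continuous_map_preimage[OF continuous_chart[OF c]]) (use V in simp)
  then show ?thesis
    using c openin_trans_full[OF _ openin_chart[OF c]] by (simp only: topspace_chart)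
qed

lemma openin_chart_inv_preimage:
  "c \<in> At \<Longrightarrow> openin X O' \<Longrightarrow> openin (top_of_set half_space) {x \<in> chart_img c. chart_inv c x \<in> O'}"
proof -
  assume c: "c \<in> At" and O': "openin X O'"
  have "continuous_map (top_of_set (chart_img c)) X (chart_inv c)"
    using continuous_chart_inv[OF c] continuous_map_into_fulltopology by blast
  then have "openin (top_of_set (chart_img c)) {x \<in> topspace (top_of_set (chart_img c)). chart_inv c x \<in> O'}"
    using O' by (rule openin_continuous_map_preimage)
  then show ?thesis
    using openin_trans[OF _ openin_chart_img[OF c]] by simp
qed

lemma openin_overlap:
  assumes "c \<in> At" "c' \<in> At"
  shows "openin (top_of_set half_space) (snd c ` (fst c \<inter> fst c'))"
proof -
  have "snd c ` (fst c \<inter> fst c') = {x \<in> chart_img c. chart_inv c x \<in> fst c \<inter> fst c'}"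
    using assms(1) by (rule chart_image_eq) simp
  moreover have "openin X (fst c \<inter> fst c')"
    using assms openin_chart by blast
  ultimately show ?thesis
    using openin_chart_inv_preimage[OF assms(1), of "fst c \<inter> fst c'"] by simp
qed

lemma chart_img_borel: "c \<in> At \<Longrightarrow> chart_img c \<in> sets borel"
proof -
  assume c: "c \<in> At"
  obtain U where "open U" "chart_img c = half_space \<inter> U"
    using openin_chart_img[OF c] by (auto simp: openin_open)
  then show ?thesis
    using sets.Int[OF borel_closed[OF closed_half_space] borel_open] by simp
qed

lemma finite_chart_cover: obtains F where "finite F" "F \<subseteq> At" "(\<Union>c\<in>F. fst c) = mfd_pts M"
proof -
  have "compactin X (topspace X)"
    using compact by (simp add: compact_space_def)
  then obtain \<F> where \<F>: "finite \<F>" "\<F> \<subseteq> fst ` At" "topspace X \<subseteq> \<Union>\<F>"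
    using charts_cover openin_chart unfolding compactin_def
    by (metis (no_types, lifting) imageE subset_refl)
  then obtain F where F: "F \<subseteq> At" "finite F" "\<F> = fst ` F"
    by (meson finite_subset_image)
  moreover have "(\<Union>c\<in>F. fst c) \<subseteq> mfd_pts M"
    using F chart_subset by blast
  ultimately show ?thesis
    using \<F>(3) that[of F] by (simp add: mfd_pts_def subset_antisym)
qed

lemma chart_at: "p \<in> mfd_pts M \<Longrightarrow> chart_at M p \<in> At \<and> p \<in> fst (chart_at M p)"
proof -
  assume "p \<in> mfd_pts M"
  then have "p \<in> (\<Union>c\<in>At. fst c)"
    by (simp only: charts_cover mfd_pts_def)
  then have "\<exists>c. c \<in> At \<and> p \<in> fst c"
    by blast
  then show ?thesis
    unfolding chart_at_def by (rule someI_ex)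
qed

section \<open>Transition maps\<close>

lemma transition_in_img:
  "c \<in> At \<Longrightarrow> c' \<in> At \<Longrightarrow> x \<in> snd c ` (fst c \<inter> fst c') \<Longrightarrow>
    (snd c' \<circ> chart_inv c) x \<in> snd c' ` (fst c' \<inter> fst c)"
  by auto

lemma has_derivative_transition:
  assumes c: "c \<in> At" "c' \<in> At" "p \<in> fst c" "p \<in> fst c'"
  shows "(snd c' \<circ> chart_inv c has_derivative (\<lambda>v. transition_jac c c' p *v v)) (at (snd c p) within half_space)"
proof -
  let ?D = "frechet_derivative (snd c' \<circ> chart_inv c) (at (snd c p) within half_space)"
  have d: "(snd c' \<circ> chart_inv c has_derivative ?D) (at (snd c p) within half_space)"
    by (rule smooth_on_has_derivative[OF smooth_transition openin_overlap]) (use c in auto)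
  have "transition_jac c c' p *v v = ?D v" for v
    unfolding transition_jac_def jacobian_def
    by (rule matrix_works)
      (use has_derivative_linear[OF d] in \<open>simp add: linear_def scalar_mult_eq_scaleR[abs_def]\<close>)
  then have "(\<lambda>v. transition_jac c c' p *v v) = ?D" by (rule ext)
  with d show ?thesis by simp
qed

text \<open>Derivatives within the half-space compose only after restriction to the overlap, which
  is relatively open and is mapped into the half-space.\<close>

lemma transition_chain:
  fixes f :: "'n model \<Rightarrow> 'b::real_normed_vector"
  assumes c: "c \<in> At" "c' \<in> At" "p \<in> fst c" "p \<in> fst c'"
    and f: "(f has_derivative D) (at (snd c' p) within half_space)"
  shows "((\<lambda>x. f (snd c' (chart_inv c x))) has_derivative (\<lambda>v. D (transition_jac c c' p *v v))) (at (snd c p) within half_space)"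
proof -
  let ?T = "snd c ` (fst c \<inter> fst c')"
  have at: "at (snd c p) within ?T = at (snd c p) within half_space"
    by (rule at_within_openin[OF openin_overlap]) (use c in auto)
  have 1: "(snd c' \<circ> chart_inv c has_derivative (\<lambda>v. transition_jac c c' p *v v)) (at (snd c p) within ?T)"
    unfolding at by (rule has_derivative_transition[OF c])
  have "(snd c' \<circ> chart_inv c) ` ?T \<subseteq> half_space"
    using transition_in_img[OF c(1,2)] openin_imp_subset[OF openin_overlap[OF c(2,1)]] by blast
  then have "(f has_derivative D) (at ((snd c' \<circ> chart_inv c) (snd c p)) within (snd c' \<circ> chart_inv c) ` ?T)"
    using has_derivative_subset[OF f] c by simp
  from diff_chain_within[OF 1 this] show ?thesis
    unfolding at by (simp add: o_def)
qed

lemma transition_jac_inverse: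
  assumes c: "c \<in> At" "c' \<in> At" "p \<in> fst c" "p \<in> fst c'"
  shows "transition_jac c' c p ** transition_jac c c' p = mat 1"
proof -
  let ?T = "snd c ` (fst c \<inter> fst c')"
  have x: "snd c p \<in> half_space"
    using c chart_half_space by blast
  have "((\<lambda>x. (snd c \<circ> chart_inv c') (snd c' (chart_inv c x))) has_derivative
      (\<lambda>v. transition_jac c' c p *v (transition_jac c c' p *v v))) (at (snd c p) within half_space)"
    by (rule transition_chain[OF c has_derivative_transition]) (use c in auto)
  moreover have "((\<lambda>x. (snd c \<circ> chart_inv c') (snd c' (chart_inv c x))) has_derivative (\<lambda>v. v)) (at (snd c p) within ?T)"
    by (rule has_derivative_transform[OF _ _ has_derivative_ident]) (use c in auto)
  moreover have at: "at (snd c p) within ?T = at (snd c p) within half_space"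
    by (rule at_within_openin[OF openin_overlap]) (use c in auto)
  ultimately have "(\<lambda>v. transition_jac c' c p *v (transition_jac c c' p *v v)) = (\<lambda>v. v)"
    using half_space_derivative_unique[OF x] by simp
  then have "(transition_jac c' c p ** transition_jac c c' p) *v v = mat 1 *v v" for v
    by (simp add: matrix_vector_mul_assoc[symmetric] fun_eq_iff)
  then show ?thesis
    by (intro matrix_eq[THEN iffD2] allI)
qed

text \<open>Invariance of domain: the interior points of the overlap have an open image in the full
  space. An image point with normal coordinate 0 would have neighbours in that image with negative
  normal coordinate, outside the half-space.\<close>

lemma transition_interior:
  assumes c: "c \<in> At" "c' \<in> At" "p \<in> fst c" "p \<in> fst c'" and pos: "0 < snd c p $ None"
  shows "0 < snd c' p $ None"
proof (rule ccontr)
  assume "\<not> 0 < snd c' p $ None"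
  moreover have "snd c' p \<in> half_space"
    using c chart_half_space by blast
  ultimately have zero: "snd c' p $ None = 0"
    by (simp add: half_space_def)
  let ?\<tau> = "snd c' \<circ> chart_inv c" and ?T = "snd c ` (fst c \<inter> fst c')"
  let ?S = "?T \<inter> {x. 0 < x $ None}"
  obtain U where U: "open U" "?T = half_space \<inter> U"
    using openin_overlap[OF c(1,2)] by (auto simp: openin_open)
  have S_eq: "?S = U \<inter> {x. 0 < x $ None}"
    using U by (auto simp: half_space_def)
  have S: "open ?S"
    unfolding S_eq by (rule open_Int[OF U(1) open_halfspace_component_gt_cart])
  have "open (?\<tau> ` ?S)"
  proof (rule invariance_of_domain[OF _ S])
    show "continuous_on ?S ?\<tau>"
      by (rule continuous_on_subset[OF smooth_on_imp_continuous_on[OF smooth_transition[OF c(1,2)]]]) simp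
    have "inj_on ?\<tau> ?T"
    proof (rule inj_onI)
      fix x y assume "x \<in> ?T" "y \<in> ?T" and eq: "?\<tau> x = ?\<tau> y"
      then obtain a b where ab: "x = snd c a" "y = snd c b" "a \<in> fst c" "a \<in> fst c'" "b \<in> fst c" "b \<in> fst c'"
        by auto
      then have "snd c' a = snd c' b"
        using eq c by simp
      then show "x = y"
        using inj_onD[OF inj_on_chart[OF c(2)] _ ab(4) ab(6)] ab(1,2) by simp
    qed
    then show "inj_on ?\<tau> ?S"
      by (rule inj_on_subset) simp
  qed
  moreover have "snd c' p \<in> ?\<tau> ` ?S"
    using c pos by (intro image_eqI[of _ _ "snd c p"]) auto
  ultimately obtain e where e: "0 < e" "ball (snd c' p) e \<subseteq> ?\<tau> ` ?S"
    using open_contains_ball by blast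
  \<comment> \<open>A point of the open image that lies half a radius below the boundary of the
    half-space.\<close>
  let ?y = "snd c' p - (e / 2) *\<^sub>R axis None 1"
  have "?y \<in> ball (snd c' p) e"
    using e by (simp add: dist_norm norm_axis_1)
  then have "?y \<in> ?\<tau> ` ?S"
    using e by blast
  then obtain x where x: "x \<in> ?T" "?y = ?\<tau> x"
    by blast
  have "?y \<in> half_space"
    unfolding x(2) by (rule subsetD[OF openin_imp_subset[OF openin_overlap[OF c(2,1)]] transition_in_img[OF c(1,2) x(1)]])
  then have "0 \<le> ?y $ None"
    unfolding half_space_def by (rule CollectD)
  moreover have "?y $ None = snd c' p $ None - e / 2"
    by (simp add: axis_def)
  ultimately show False
    using zero e by linarith
qed

text \<open>\<open>mfd_bdry\<close> asks for some chart only; by \<open>transition_interior\<close>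
  every chart around p gives the same answer.\<close>

lemma mem_bdry_iff:
  assumes "c \<in> At" "p \<in> fst c"
  shows "p \<in> mfd_bdry M \<longleftrightarrow> snd c p $ None = 0"
proof
  assume "snd c p $ None = 0"
  then show "p \<in> mfd_bdry M"
    using assms chart_subset unfolding mfd_bdry_def by blast
next
  assume "p \<in> mfd_bdry M"
  then obtain c' where c': "c' \<in> At" "p \<in> fst c'" "snd c' p $ None = 0"
    unfolding mfd_bdry_def by blast
  then have "\<not> 0 < snd c p $ None"
    using transition_interior[OF assms(1) c'(1) assms(2) c'(2)] by auto
  moreover have "snd c p \<in> half_space"
    using assms by (rule chart_half_space)
  ultimately show "snd c p $ None = 0"
    by (simp add: half_space_def)
qed

lemma bdry_subset: "mfd_bdry M \<subseteq> mfd_pts M"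
  unfolding mfd_bdry_def by blast

section \<open>Gradients of smooth functions\<close>

text \<open>The coordinate differential, a covector; \<open>gradient\<close> applies the inverse
  metric to it.\<close>

definition chart_grad :: "('a, 'n) chart \<Rightarrow> ('a \<Rightarrow> real) \<Rightarrow> 'n model \<Rightarrow> 'n model" where
  "chart_grad c u x = (\<chi> a. pderiv_within half_space a (u \<circ> chart_inv c) x)"

lemma gradient_eq: "gradient M u c p = matrix_inv (mfd_metric M c p) *v chart_grad c u (snd c p)"
  unfolding gradient_def chart_grad_def ..

lemma metric_gradient: "c \<in> At \<Longrightarrow> p \<in> fst c \<Longrightarrow> mfd_metric M c p *v gradient M u c p = chart_grad c u (snd c p)"
  unfolding gradient_eq by (rule matrix_inv_mult_vec(1)[OF pos_def_invertible[OF metric_pos]])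

lemma smooth_funD: "smooth_fun M u \<Longrightarrow> c \<in> At \<Longrightarrow> smooth_on (u \<circ> chart_inv c) (chart_img c)"
  unfolding smooth_fun_def by blast

lemma has_derivative_chart_grad:
  assumes u: "smooth_fun M u" and c: "c \<in> At" and x: "x \<in> chart_img c"
  shows "(u \<circ> chart_inv c has_derivative (\<lambda>v. chart_grad c u x \<bullet> v)) (at x within half_space)"
proof -
  let ?D = "frechet_derivative (u \<circ> chart_inv c) (at x within half_space)"
  have d: "(u \<circ> chart_inv c has_derivative ?D) (at x within half_space)"
    by (rule smooth_on_has_derivative[OF smooth_funD[OF u c] openin_chart_img[OF c] x])
  have "chart_grad c u x \<bullet> v = ?D v" for v
  proof -
    interpret D: linear ?D
      by (rule has_derivative_linear[OF d])
    have "?D v = ?D (\<Sum>a\<in>UNIV. v $ a *\<^sub>R axis a 1)"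
      by (simp add: basis_expansion scalar_mult_eq_scaleR[symmetric])
    also have "\<dots> = (\<Sum>a\<in>UNIV. v $ a * ?D (axis a 1))"
      by (simp add: D.sum D.scale)
    finally show ?thesis
      by (simp add: inner_vec_def chart_grad_def pderiv_within_def mult.commute)
  qed
  then have "(\<lambda>v. chart_grad c u x \<bullet> v) = ?D" by (rule ext)
  with d show ?thesis by simp
qed

lemma continuous_on_chart_grad:
  assumes u: "smooth_fun M u" and c: "c \<in> At"
  shows "continuous_on (chart_img c) (chart_grad c u)"
  unfolding chart_grad_def pderiv_within_def
  by (intro continuous_on_vec_lambda smooth_on_continuous_derivative[OF smooth_funD[OF u c] openin_chart_img[OF c]])

lemma chart_grad_transition:
  assumes u: "smooth_fun M u" and c: "c \<in> At" "c' \<in> At" "p \<in> fst c" "p \<in> fst c'"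
  shows "chart_grad c u (snd c p) = transpose (transition_jac c c' p) *v chart_grad c' u (snd c' p)"
proof -
  let ?T = "snd c ` (fst c \<inter> fst c')" and ?J = "transition_jac c c' p"
  have x: "snd c p \<in> half_space"
    using c chart_half_space by blast
  have at: "at (snd c p) within ?T = at (snd c p) within half_space"
    by (rule at_within_openin[OF openin_overlap]) (use c in auto)
  have "((\<lambda>x. (u \<circ> chart_inv c') (snd c' (chart_inv c x))) has_derivative
      (\<lambda>v. chart_grad c' u (snd c' p) \<bullet> (?J *v v))) (at (snd c p) within half_space)"
    by (rule transition_chain[OF c has_derivative_chart_grad[OF u c(2)]]) (use c in auto)
  then have "(u \<circ> chart_inv c has_derivative
      (\<lambda>v. chart_grad c' u (snd c' p) \<bullet> (?J *v v))) (at (snd c p) within half_space)"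
    unfolding at[symmetric]
    by (rule has_derivative_transform[rotated 2]) (use c in auto)
  then have "(\<lambda>v. chart_grad c u (snd c p) \<bullet> v) = (\<lambda>v. chart_grad c' u (snd c' p) \<bullet> (?J *v v))"
    using has_derivative_chart_grad[OF u c(1), of "snd c p"] c
    by (intro half_space_derivative_unique[OF x]) auto
  then have "chart_grad c u (snd c p) \<bullet> v = (transpose ?J *v chart_grad c' u (snd c' p)) \<bullet> v" for v
    by (simp add: fun_eq_iff dot_lmul_matrix[symmetric] vector_transpose_matrix)
  then show ?thesis
    using vector_eq_rdot by blast
qed

text \<open>The differential transforms with the transposed Jacobian and the metric as a bilinear
  form. Both candidates for the gradient in the second chart therefore have the same image under the
  metric and the transposed Jacobian, and both of these are injective.\<close>

lemma is_vector_field_gradient: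
  assumes u: "smooth_fun M u"
  shows "is_vector_field M (gradient M u)"
  unfolding is_vector_field_def
proof (intro ballI)
  fix c c' p assume c: "c \<in> At" "c' \<in> At" and p: "p \<in> fst c \<inter> fst c'"
  let ?J = "transition_jac c c' p" and ?K = "transition_jac c' c p"
  have p': "p \<in> fst c" "p \<in> fst c'" using p by auto
  have KJ: "?J ** ?K = mat 1"
    by (rule transition_jac_inverse[OF c(2,1) p'(2,1)])
  have tinj: "v = w" if "transpose ?J *v v = transpose ?J *v w" for v w
  proof -
    have "transpose ?K *v (transpose ?J *v v) = v" for v
      unfolding matrix_vector_mul_assoc matrix_transpose_mul[symmetric] KJ by simp
    then show ?thesis
      using that by metis
  qed
  have "transpose ?J *v (mfd_metric M c' p *v (?J *v gradient M u c p)) = mfd_metric M c p *v gradient M u c p"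
    unfolding metric_transition[OF c p'] by (simp add: matrix_vector_mul_assoc matrix_mul_assoc)
  also have "\<dots> = chart_grad c u (snd c p)"
    by (rule metric_gradient[OF c(1) p'(1)])
  also have "\<dots> = transpose ?J *v chart_grad c' u (snd c' p)"
    by (rule chart_grad_transition[OF u c p'])
  finally have "mfd_metric M c' p *v (?J *v gradient M u c p) = chart_grad c' u (snd c' p)"
    by (rule tinj)
  then have "gradient M u c' p = matrix_inv (mfd_metric M c' p) *v (mfd_metric M c' p *v (?J *v gradient M u c p))"
    unfolding gradient_eq[of _ c'] by simp
  also have "\<dots> = ?J *v gradient M u c p"
    by (rule matrix_inv_mult_vec(2)[OF pos_def_invertible[OF metric_pos[OF c(2) p'(2)]]])
  finally show "gradient M u c' p = ?J *v gradient M u c p" .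
qed

lemma vnorm_sq_chart:
  assumes Y: "is_vector_field M Y" and c: "c \<in> At" and p: "p \<in> fst c"
  shows "vnorm_sq M Y p = Y c p \<bullet> (mfd_metric M c p *v Y c p)"
proof -
  let ?c = "chart_at M p"
  have c': "?c \<in> At" "p \<in> fst ?c"
    using chart_at chart_subset[OF c] p by auto
  let ?J = "transition_jac c ?c p"
  have eq: "Y ?c p = ?J *v Y c p"
    using Y c c' p unfolding is_vector_field_def by blast
  have "Y c p \<bullet> (mfd_metric M c p *v Y c p) = Y c p \<bullet> (transpose ?J *v (mfd_metric M ?c p *v (?J *v Y c p)))"
    unfolding metric_transition[OF c c'(1) p c'(2)] by (simp add: matrix_vector_mul_assoc matrix_mul_assoc)
  also have "\<dots> = (?J *v Y c p) \<bullet> (mfd_metric M ?c p *v (?J *v Y c p))"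
    by (simp only: dot_lmul_matrix[symmetric] vector_transpose_matrix)
  finally show ?thesis
    by (simp add: vnorm_sq_def Let_def eq)
qed

lemma vnorm_sq_nonneg: "p \<in> mfd_pts M \<Longrightarrow> 0 \<le> vnorm_sq M Y p"
  using chart_at metric_pos[of "chart_at M p" p "Y (chart_at M p) p"]
  by (cases "Y (chart_at M p) p = 0") (auto simp: vnorm_sq_def Let_def)

lemma vnorm_sq_gradient:
  assumes u: "smooth_fun M u" and c: "c \<in> At" "p \<in> fst c"
  shows "vnorm_sq M (gradient M u) p = gradient M u c p \<bullet> chart_grad c u (snd c p)"
  unfolding vnorm_sq_chart[OF is_vector_field_gradient[OF u] c] metric_gradient[OF c] ..

end

section \<open>The boundary of the half-space\<close>

lemma sum_option: "(\<Sum>a\<in>(UNIV :: 'n::finite option set). f a) = f None + (\<Sum>i\<in>UNIV. f (Some i))"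
  by (simp add: UNIV_option_conv sum.reindex)

lemma bdry_pt_None [simp]: "bdry_pt y $ None = 0"
  and bdry_pt_Some [simp]: "bdry_pt y $ Some i = y $ i"
  by (simp_all add: bdry_pt_def)

lemma tang_part_nth [simp]: "tang_part x $ i = x $ Some i"
  by (simp add: tang_part_def)

lemma tang_part_bdry_pt [simp]: "tang_part (bdry_pt y) = y"
  by (simp add: vec_eq_iff)

lemma bdry_pt_tang_part: "x $ None = 0 \<Longrightarrow> bdry_pt (tang_part x) = x"
  unfolding vec_eq_iff by (auto simp: split_option_all)

lemma bdry_pt_half_space [simp]: "bdry_pt y \<in> half_space"
  by (simp add: half_space_def)

lemma linear_bdry_pt: "linear bdry_pt"
  by (rule linearI) (simp_all add: vec_eq_iff split_option_all)

lemma linear_tang_part: "linear tang_part"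
  by (rule linearI) (simp_all add: vec_eq_iff)

lemma bounded_linear_bdry_pt: "bounded_linear bdry_pt"
  using linear_bdry_pt linear_conv_bounded_linear by blast

lemma bounded_linear_tang_part: "bounded_linear tang_part"
  using linear_tang_part linear_conv_bounded_linear by blast

lemma continuous_on_bdry_pt: "continuous_on S bdry_pt"
  by (rule linear_continuous_on[OF bounded_linear_bdry_pt])

lemma inner_bdry_pt: "bdry_pt v \<bullet> x = v \<bullet> tang_part x"
  by (simp add: inner_vec_def sum_option)

lemma tang_part_mult_bdry_pt: "tang_part (A *v bdry_pt w) = (\<chi> i j. A $ Some i $ Some j) *v w"
  by (simp add: vec_eq_iff matrix_vector_mult_def sum_option)

section \<open>The Riemannian measures\<close>

context riem_mfd
begin

abbreviation "Bm \<equiv> borel_of_mfd M"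
abbreviation "Bb \<equiv> borel_of_bdry M"

lemma space_Bm [simp]: "space Bm = mfd_pts M"
  unfolding borel_of_mfd_def by (rule space_measure_of) (auto simp: mfd_pts_def dest: openin_subset)

lemma sets_Bm_openin: "openin X S \<Longrightarrow> S \<in> sets Bm"
  unfolding borel_of_mfd_def by (rule in_measure_of) (auto simp: mfd_pts_def dest: openin_subset)

lemma measurable_into_Bm:
  assumes "f \<in> space K \<rightarrow> mfd_pts M" "\<And>S. openin X S \<Longrightarrow> f -` S \<inter> space K \<in> sets K"
  shows "f \<in> measurable K Bm"
  unfolding borel_of_mfd_def
  by (rule measurable_measure_of) (use assms in \<open>auto simp: mfd_pts_def dest: openin_subset\<close>)

lemma space_Bb [simp]: "space Bb = mfd_bdry M"
  unfolding borel_of_bdry_def by (rule space_measure_of) (auto simp: openin_subtopology)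

lemma sets_Bb_openin: "openin X S \<Longrightarrow> S \<inter> mfd_bdry M \<in> sets Bb"
  unfolding borel_of_bdry_def by (rule in_measure_of) (auto simp: openin_subtopology)

lemma measurable_into_Bb:
  assumes "f \<in> space K \<rightarrow> mfd_bdry M" "\<And>S. openin X S \<Longrightarrow> f -` S \<inter> space K \<in> sets K"
  shows "f \<in> measurable K Bb"
  unfolding borel_of_bdry_def
proof (rule measurable_measure_of)
  fix S assume "S \<in> {S. openin (subtopology X (mfd_bdry M)) S}"
  then obtain T where T: "openin X T" "S = T \<inter> mfd_bdry M"
    by (auto simp: openin_subtopology)
  then have "f -` S \<inter> space K = f -` T \<inter> space K"
    using assms(1) by auto
  then show "f -` S \<inter> space K \<in> sets K"
    using assms(2)[OF T(1)] by simp
qed (use assms(1) in \<open>auto simp: openin_subtopology\<close>)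

lemma measurable_bdry_inclusion: "(\<lambda>p. p) \<in> measurable Bb Bm"
proof (rule measurable_into_Bm)
  fix S assume "openin X S"
  then have "S \<inter> mfd_bdry M \<in> sets Bb"
    by (rule sets_Bb_openin)
  then show "(\<lambda>p. p) -` S \<inter> space Bb \<in> sets Bb"
    by simp
qed (use bdry_subset in auto)

lemma measurable_Bb: "f \<in> measurable Bm K \<Longrightarrow> f \<in> measurable Bb K"
  using measurable_compose[OF measurable_bdry_inclusion] .

lemma chart_sets_Bm: "c \<in> At \<Longrightarrow> fst c \<in> sets Bm"
  by (rule sets_Bm_openin[OF openin_chart])

lemma chart_inv_preimage_borel:
  assumes "c \<in> At" "openin X S"
  shows "{x \<in> chart_img c. chart_inv c x \<in> S} \<in> sets borel"
proof -
  obtain U where "open U" "{x \<in> chart_img c. chart_inv c x \<in> S} = half_space \<inter> U"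
    using openin_chart_inv_preimage[OF assms] by (auto simp: openin_open)
  then show ?thesis
    using sets.Int[OF borel_closed[OF closed_half_space] borel_open] by simp
qed

lemma measurable_chart_inv:
  assumes c: "c \<in> At"
  shows "chart_inv c \<in> measurable (restrict_space borel (chart_img c)) Bm"
proof (rule measurable_into_Bm)
  show "chart_inv c \<in> space (restrict_space borel (chart_img c)) \<rightarrow> mfd_pts M"
    using chart_subset[OF c] by (auto simp: space_restrict_space)
  fix S assume "openin X S"
  then have "{x \<in> chart_img c. chart_inv c x \<in> S} \<in> sets borel"
    by (rule chart_inv_preimage_borel[OF c])
  moreover have "chart_inv c -` S \<inter> space (restrict_space borel (chart_img c)) = {x \<in> chart_img c. chart_inv c x \<in> S}"
    by (auto simp: space_restrict_space)
  ultimately show "chart_inv c -` S \<inter> space (restrict_space borel (chart_img c)) \<in> sets (restrict_space borel (chart_img c))"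
    using chart_img_borel[OF c] by (simp add: sets_restrict_space_iff)
qed

lemma measurable_chart:
  assumes c: "c \<in> At"
  shows "snd c \<in> measurable (restrict_space Bm (fst c)) (restrict_space borel (chart_img c))"
proof (rule measurable_restrict_space2)
  show "snd c \<in> space (restrict_space Bm (fst c)) \<rightarrow> chart_img c"
    by (auto simp: space_restrict_space)
  show "snd c \<in> borel_measurable (restrict_space Bm (fst c))"
  proof (rule borel_measurableI)
    fix V :: "'n model set" assume V: "open V"
    have "snd c -` V \<inter> space (restrict_space Bm (fst c)) = {p \<in> fst c. snd c p \<in> V}"
      using chart_subset[OF c] by (auto simp: space_restrict_space)
    moreover have "{p \<in> fst c. snd c p \<in> V} \<in> sets Bm"
      by (rule sets_Bm_openin[OF openin_chart_preimage[OF c V]])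
    moreover have "fst c \<inter> space Bm \<in> sets Bm"
      by (intro sets.Int chart_sets_Bm[OF c] sets.top)
    ultimately show "snd c -` V \<inter> space (restrict_space Bm (fst c)) \<in> sets (restrict_space Bm (fst c))"
      by (auto simp: sets_restrict_space_iff)
  qed
qed

lemma measurable_from_Bm:
  assumes "\<And>c. c \<in> At \<Longrightarrow> f \<in> measurable (restrict_space Bm (fst c)) K"
  shows "f \<in> measurable Bm K"
proof -
  obtain F where F: "finite F" "F \<subseteq> At" "(\<Union>c\<in>F. fst c) = mfd_pts M"
    by (rule finite_chart_cover)
  show ?thesis
  proof (rule measurable_piecewise_restrict[of "fst ` F"])
    show "countable (fst ` F)"
      using F by (simp add: countable_finite)
    show "space Bm \<subseteq> \<Union> (fst ` F)"
      using F by simp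
    fix \<Omega> assume "\<Omega> \<in> fst ` F"
    then obtain c where c: "c \<in> At" "\<Omega> = fst c"
      using F by blast
    show "\<Omega> \<inter> space Bm \<in> sets Bm" "f \<in> measurable (restrict_space Bm \<Omega>) K"
      using c assms chart_sets_Bm[OF c(1)] chart_subset[OF c(1)] by (simp_all add: Int_absorb2)
  qed
qed

lemma measurable_Bm_chart:
  assumes "\<And>c. c \<in> At \<Longrightarrow> (\<lambda>x. f (chart_inv c x)) \<in> measurable (restrict_space borel (chart_img c)) K"
  shows "f \<in> measurable Bm K"
proof (rule measurable_from_Bm)
  fix c assume c: "c \<in> At"
  have "(\<lambda>p. f (chart_inv c (snd c p))) \<in> measurable (restrict_space Bm (fst c)) K"
    by (rule measurable_compose[OF measurable_chart[OF c] assms[OF c]])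
  then show "f \<in> measurable (restrict_space Bm (fst c)) K"
    by (rule measurable_cong[THEN iffD1, rotated]) (use c in \<open>simp add: space_restrict_space\<close>)
qed

lemma continuous_on_chart_measurable:
  assumes c: "c \<in> At" and f: "continuous_on (chart_img c) f"
  shows "f \<in> borel_measurable (restrict_space borel (chart_img c))"
  by (rule borel_measurable_continuous_on_restrict[OF f])

lemma smooth_fun_measurable: "smooth_fun M u \<Longrightarrow> u \<in> borel_measurable Bm"
proof (rule measurable_Bm_chart)
  fix c assume u: "smooth_fun M u" and c: "c \<in> At"
  have "continuous_on (chart_img c) (u \<circ> chart_inv c)"
    by (rule smooth_on_imp_continuous_on[OF smooth_funD[OF u c]])
  from continuous_on_chart_measurable[OF c this]
  show "(\<lambda>x. u (chart_inv c x)) \<in> borel_measurable (restrict_space borel (chart_img c))"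
    by (simp add: o_def)
qed

lemma continuous_on_metric: "c \<in> At \<Longrightarrow> continuous_on (chart_img c) (\<lambda>x. mfd_metric M c (chart_inv c x))"
  using smooth_on_imp_continuous_on[OF smooth_metric] by (simp add: o_def)

definition vol_density :: "('a, 'n) chart \<Rightarrow> 'n model \<Rightarrow> real" where
  "vol_density c x = sqrt (det (mfd_metric M c (chart_inv c x)))"

lemma continuous_on_vol_density: "c \<in> At \<Longrightarrow> continuous_on (chart_img c) (vol_density c)"
  unfolding vol_density_def by (intro continuous_on_real_sqrt continuous_on_det continuous_on_metric)

lemma vol_density_pos: "c \<in> At \<Longrightarrow> x \<in> chart_img c \<Longrightarrow> 0 < vol_density c x"
  unfolding vol_density_def
  by (subst real_sqrt_gt_0_iff) (rule pos_def_det_pos, rule metric_pos, auto)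

lemma vol_density_transition:
  assumes "c \<in> At" "c' \<in> At" "p \<in> fst c" "p \<in> fst c'"
  shows "vol_density c (snd c p) = \<bar>det (transition_jac c c' p)\<bar> * vol_density c' (snd c' p)"
proof -
  have "det (mfd_metric M c p) = (det (transition_jac c c' p))\<^sup>2 * det (mfd_metric M c' p)"
    unfolding metric_transition[OF assms] by (simp add: det_mul det_transpose power2_eq_square)
  then show ?thesis
    using assms by (simp add: vol_density_def real_sqrt_mult)
qed

text \<open>A measure on all of M with no mass outside the domain of \<open>c\<close>; only its
  values on subsets of that domain enter.\<close>

definition chart_vol :: "('a, 'n) chart \<Rightarrow> 'a measure" where
  "chart_vol c = param_measure Bm (chart_img c) (chart_inv c) (\<lambda>x. ennreal (vol_density c x))"

lemma measurable_vol_density: "c \<in> At \<Longrightarrow> (\<lambda>x. ennreal (vol_density c x)) \<in> borel_measurable (restrict_space borel (chart_img c))"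
  by (intro measurable_compose[OF continuous_on_chart_measurable[OF _ continuous_on_vol_density]] measurable_ennreal)

lemma emeasure_chart_vol:
  assumes c: "c \<in> At" and E: "E \<in> sets Bm" "E \<subseteq> fst c"
  shows "emeasure (chart_vol c) E = (\<integral>\<^sup>+x. indicator (snd c ` E) x * ennreal (vol_density c x) \<partial>lborel)"
proof -
  have "emeasure (chart_vol c) E = (\<integral>\<^sup>+x. indicator E (chart_inv c x) * ennreal (vol_density c x) * indicator (chart_img c) x \<partial>lborel)"
    unfolding chart_vol_def
    by (rule emeasure_param_measure[OF chart_img_borel measurable_chart_inv measurable_vol_density]) (use c E in auto)
  also have "\<dots> = (\<integral>\<^sup>+x. indicator (snd c ` E) x * ennreal (vol_density c x) \<partial>lborel)"
    by (intro nn_integral_cong) (auto simp: indicator_def mem_chart_image_iff[OF c E(2)])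
  finally show ?thesis .
qed

lemma chart_image_borel:
  assumes c: "c \<in> At" and E: "E \<in> sets Bm" "E \<subseteq> fst c"
  shows "snd c ` E \<in> sets borel"
proof -
  have "chart_inv c -` E \<inter> space (restrict_space borel (chart_img c)) \<in> sets (restrict_space borel (chart_img c))"
    by (rule measurable_sets[OF measurable_chart_inv[OF c] E(1)])
  moreover have "chart_inv c -` E \<inter> space (restrict_space borel (chart_img c)) = snd c ` E"
    unfolding chart_image_eq[OF c E(2)] by (auto simp: space_restrict_space)
  ultimately show ?thesis
    using chart_img_borel[OF c] by (simp add: sets_restrict_space_iff)
qed

text \<open>Under a change of chart the density picks up |det J|, exactly the factor in the change
  of variables.\<close>

lemma chart_vol_compat:
  assumes c: "c \<in> At" "c' \<in> At" and E: "E \<in> sets Bm" "E \<subseteq> fst c \<inter> fst c'"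
  shows "emeasure (chart_vol c) E = emeasure (chart_vol c') E"
proof -
  have E': "E \<subseteq> fst c" "E \<subseteq> fst c'" using E by auto
  let ?\<tau> = "snd c' \<circ> chart_inv c" and ?S = "snd c ` E"
  \<comment> \<open>Extension by zero makes the densities Borel on the whole space, as the change of
    variables expects.\<close>
  define f where "f d x = indicator (chart_img d) x *\<^sub>R vol_density d x" for d x
  have f_meas: "f d \<in> borel_measurable borel" if "d \<in> At" for d
    unfolding f_def
    by (rule borel_measurable_continuous_on_indicator[OF chart_img_borel[OF that] continuous_on_vol_density[OF that]])
  have f_nonneg: "0 \<le> f d x" if "d \<in> At" for d x
    using vol_density_pos[OF that, of x] by (auto simp: f_def indicator_def intro: less_imp_le)
  have image: "?\<tau> ` ?S = snd c' ` E"
    using E' c(1) by (force simp: image_image)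
  have eq: "emeasure (chart_vol d) E = (\<integral>\<^sup>+x. indicator (snd d ` E) x * ennreal (f d x) \<partial>lborel)"
    if "d \<in> At" "E \<subseteq> fst d" for d
    unfolding emeasure_chart_vol[OF that(1) E(1) that(2)]
    using mem_chart_image_iff[OF that] by (intro nn_integral_cong) (auto simp: f_def indicator_def)
  have "(\<integral>\<^sup>+x. indicator ?S x * ennreal (f c x) \<partial>lborel) = (\<integral>\<^sup>+y. indicator (?\<tau> ` ?S) y * ennreal (f c' y) \<partial>lborel)"
  proof (rule nn_integral_change_of_variables[where g' = "\<lambda>x v. transition_jac c c' (chart_inv c x) *v v"])
    show "?S \<in> sets borel" "?\<tau> ` ?S \<in> sets borel"
      unfolding image using chart_image_borel c E E' by auto
    show "inj_on ?\<tau> ?S"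
    proof (rule inj_onI)
      fix x y assume "x \<in> ?S" "y \<in> ?S" and xy: "?\<tau> x = ?\<tau> y"
      then obtain a b where ab: "x = snd c a" "y = snd c b" "a \<in> E" "b \<in> E"
        by blast
      have mem: "a \<in> fst c" "a \<in> fst c'" "b \<in> fst c" "b \<in> fst c'"
        using ab E' by blast+
      then have "snd c' a = snd c' b"
        using xy c(1) by (simp add: ab)
      then show "x = y"
        using inj_onD[OF inj_on_chart[OF c(2)] _ mem(2) mem(4)] by (simp add: ab)
    qed
    fix x assume "x \<in> ?S"
    then obtain p where p: "p \<in> fst c" "p \<in> fst c'" "x = snd c p"
      using E' by blast
    have "(?\<tau> has_derivative (\<lambda>v. transition_jac c c' p *v v)) (at x within half_space)"
      unfolding p by (rule has_derivative_transition[OF c p(1,2)])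
    moreover have "?S \<subseteq> half_space"
      using chart_half_space[OF c(1)] E' by blast
    ultimately show "(?\<tau> has_derivative (\<lambda>v. transition_jac c c' (chart_inv c x) *v v)) (at x within ?S)"
      using p c by (simp add: has_derivative_subset)
    show "f c x = \<bar>det (matrix ((*v) (transition_jac c c' (chart_inv c x))))\<bar> * f c' (?\<tau> x)"
      using vol_density_transition[OF c p(1,2)] p c by (simp add: f_def matrix_of_matrix_vector_mul)
  qed (use c f_meas f_nonneg in auto)
  then show ?thesis
    by (simp only: image eq[OF c(1) E'(1)] eq[OF c(2) E'(2)])
qed

text \<open>Unique existence of the glued measure evaluates the definite description in
  \<open>vol\<close>; its inputs are a finite chart cover and the compatibility of the chart
  measures.\<close>

lemma vol_spec:
  "space (vol M) = mfd_pts M \<and> sets (vol M) = sets Bm \<and>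
    (\<forall>c\<in>At. \<forall>E\<in>sets Bm. E \<subseteq> fst c \<longrightarrow> emeasure (vol M) E = emeasure (chart_vol c) E)"
proof -
  obtain F where F: "finite F" "F \<subseteq> At" "(\<Union>c\<in>F. fst c) = mfd_pts M"
    by (rule finite_chart_cover)
  have "\<exists>!\<mu>. space \<mu> = space Bm \<and> sets \<mu> = sets Bm \<and>
      (\<forall>c\<in>At. \<forall>E\<in>sets Bm. E \<subseteq> fst c \<longrightarrow> emeasure \<mu> E = emeasure (chart_vol c) E)"
  proof (rule ex1_glued_measure[OF F(1,2)])
    show "(\<Union>c\<in>F. fst c) = space Bm"
      using F(3) by simp
    show "sets (chart_vol c) = sets Bm" for c
      unfolding chart_vol_def by (rule sets_param_measure)
  qed (fact chart_sets_Bm chart_vol_compat)+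
  then have ex1: "\<exists>!\<mu>. space \<mu> = mfd_pts M \<and> sets \<mu> = sets Bm \<and>
      (\<forall>c\<in>At. \<forall>E\<in>sets Bm. E \<subseteq> fst c \<longrightarrow> emeasure \<mu> E = emeasure (chart_vol c) E)"
    by simp
  have "vol M = (THE \<mu>. space \<mu> = mfd_pts M \<and> sets \<mu> = sets Bm \<and>
      (\<forall>c\<in>At. \<forall>E\<in>sets Bm. E \<subseteq> fst c \<longrightarrow> emeasure \<mu> E = emeasure (chart_vol c) E))"
    unfolding vol_def
    by (rule arg_cong[where f = The]) (simp add: fun_eq_iff emeasure_chart_vol vol_density_def cong: conj_cong)
  then show ?thesis
    using theI'[OF ex1] by simp
qed

lemma space_vol [simp]: "space (vol M) = mfd_pts M"
  and sets_vol: "sets (vol M) = sets Bm"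
  using vol_spec by blast+

lemma nn_integral_vol_chart:
  assumes c: "c \<in> At" and f: "f \<in> borel_measurable Bm"
  shows "(\<integral>\<^sup>+p. f p * indicator (fst c) p \<partial>vol M) =
    (\<integral>\<^sup>+x. f (chart_inv c x) * ennreal (vol_density c x) * indicator (chart_img c) x \<partial>lborel)"
proof -
  have fc: "(\<lambda>p. f p * indicator (fst c) p) \<in> borel_measurable Bm"
    using f chart_sets_Bm[OF c] by simp
  have "(\<integral>\<^sup>+p. f p * indicator (fst c) p \<partial>vol M) = (\<integral>\<^sup>+p. f p * indicator (fst c) p \<partial>chart_vol c)"
    by (rule nn_integral_eq_on_subset[OF sets_vol _ chart_sets_Bm[OF c] _ f])
      (use vol_spec c in \<open>auto simp: chart_vol_def sets_param_measure\<close>)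
  also have "\<dots> = (\<integral>\<^sup>+x. f (chart_inv c x) * indicator (fst c) (chart_inv c x) * ennreal (vol_density c x) * indicator (chart_img c) x \<partial>lborel)"
    unfolding chart_vol_def
    by (rule nn_integral_param_measure[OF chart_img_borel measurable_chart_inv measurable_vol_density]) (use c fc in auto)
  also have "\<dots> = (\<integral>\<^sup>+x. f (chart_inv c x) * ennreal (vol_density c x) * indicator (chart_img c) x \<partial>lborel)"
    by (intro nn_integral_cong) (simp add: indicator_def)
  finally show ?thesis .
qed

section \<open>The boundary measure\<close>

definition bdry_img :: "('a, 'n) chart \<Rightarrow> (real ^ 'n) set" where
  "bdry_img c = {y. bdry_pt y \<in> chart_img c}"

definition bdry_inv :: "('a, 'n) chart \<Rightarrow> real ^ 'n \<Rightarrow> 'a" where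
  "bdry_inv c y = chart_inv c (bdry_pt y)"

definition bdry_density :: "('a, 'n) chart \<Rightarrow> real ^ 'n \<Rightarrow> real" where
  "bdry_density c y = sqrt (det (bdry_metric M c (bdry_inv c y)))"

lemma open_bdry_preimage:
  assumes "c \<in> At" "openin X S"
  shows "open {y \<in> bdry_img c. bdry_inv c y \<in> S}"
proof -
  obtain U where U: "open U" "{x \<in> chart_img c. chart_inv c x \<in> S} = half_space \<inter> U"
    using openin_chart_inv_preimage[OF assms] by (auto simp: openin_open)
  have "{y \<in> bdry_img c. bdry_inv c y \<in> S} = {y. bdry_pt y \<in> {x \<in> chart_img c. chart_inv c x \<in> S}}"
    by (simp add: bdry_img_def bdry_inv_def)
  also have "\<dots> = bdry_pt -` U"
    unfolding U(2) by auto
  finally show ?thesis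
    using open_vimage[OF U(1) continuous_on_bdry_pt] by simp
qed

lemma open_bdry_img: "c \<in> At \<Longrightarrow> open (bdry_img c)"
proof -
  assume c: "c \<in> At"
  have "{y \<in> bdry_img c. bdry_inv c y \<in> fst c} = bdry_img c"
    by (auto simp: bdry_img_def bdry_inv_def)
  then show ?thesis
    using open_bdry_preimage[OF c openin_chart[OF c]] by simp
qed

lemma bdry_inv_mem: "c \<in> At \<Longrightarrow> y \<in> bdry_img c \<Longrightarrow> bdry_inv c y \<in> fst c \<inter> mfd_bdry M"
  using mem_bdry_iff[of c "bdry_inv c y"] by (simp add: bdry_img_def bdry_inv_def)

lemma measurable_bdry_inv:
  assumes c: "c \<in> At"
  shows "bdry_inv c \<in> measurable (restrict_space borel (bdry_img c)) Bb"
proof (rule measurable_into_Bb)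
  show "bdry_inv c \<in> space (restrict_space borel (bdry_img c)) \<rightarrow> mfd_bdry M"
    using bdry_inv_mem[OF c] by (auto simp: space_restrict_space)
  fix S assume S: "openin X S"
  have "bdry_inv c -` S \<inter> space (restrict_space borel (bdry_img c)) = {y \<in> bdry_img c. bdry_inv c y \<in> S}"
    by (auto simp: space_restrict_space)
  then show "bdry_inv c -` S \<inter> space (restrict_space borel (bdry_img c)) \<in> sets (restrict_space borel (bdry_img c))"
    using open_bdry_preimage[OF c S] open_bdry_img[OF c] by (simp add: sets_restrict_space_iff)
qed

lemma bdry_metric_inner: "v \<bullet> (bdry_metric M c p *v w) = bdry_pt v \<bullet> (mfd_metric M c p *v bdry_pt w)"
  unfolding inner_bdry_pt tang_part_mult_bdry_pt bdry_metric_def ..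

lemma bdry_metric_pos:
  assumes "c \<in> At" "p \<in> fst c" "v \<noteq> 0"
  shows "0 < v \<bullet> (bdry_metric M c p *v v)"
proof -
  have "bdry_pt v \<noteq> 0"
  proof
    assume "bdry_pt v = 0"
    then have "tang_part (bdry_pt v) = tang_part 0"
      by (rule arg_cong)
    also have "tang_part 0 = 0"
      by (rule linear_0[OF linear_tang_part])
    finally show False
      using assms(3) by simp
  qed
  then show ?thesis
    unfolding bdry_metric_inner by (rule metric_pos[OF assms(1,2)])
qed

lemma continuous_on_bdry_metric: "c \<in> At \<Longrightarrow> continuous_on (bdry_img c) (\<lambda>y. bdry_metric M c (bdry_inv c y))"
proof -
  assume c: "c \<in> At"
  have "continuous_on (bdry_img c) (\<lambda>y. mfd_metric M c (chart_inv c (bdry_pt y)))"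
    by (rule continuous_on_compose2[OF continuous_on_metric[OF c] continuous_on_bdry_pt])
      (auto simp: bdry_img_def)
  then show ?thesis
    unfolding bdry_metric_def bdry_inv_def by (intro continuous_on_vec_lambda continuous_on_component)
qed

lemma continuous_on_bdry_density: "c \<in> At \<Longrightarrow> continuous_on (bdry_img c) (bdry_density c)"
  unfolding bdry_density_def by (intro continuous_on_real_sqrt continuous_on_det continuous_on_bdry_metric)

lemma bdry_density_pos: "c \<in> At \<Longrightarrow> y \<in> bdry_img c \<Longrightarrow> 0 < bdry_density c y"
  unfolding bdry_density_def
  by (subst real_sqrt_gt_0_iff) (rule pos_def_det_pos, rule bdry_metric_pos, use bdry_inv_mem in auto)

text \<open>Transition maps preserve the boundary, so their normal coordinate vanishes identically
  along it and the Jacobian takes tangential vectors to tangential ones.\<close>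

lemma transition_jac_bdry:
  assumes c: "c \<in> At" "c' \<in> At" "p \<in> fst c" "p \<in> fst c'" and p: "p \<in> mfd_bdry M"
  defines "J \<equiv> transition_jac c c' p"
  shows "J *v bdry_pt w = bdry_pt (tang_part (J *v bdry_pt w))"
proof -
  define y where "y = tang_part (snd c p)"
  have y: "bdry_pt y = snd c p"
    unfolding y_def using mem_bdry_iff[OF c(1,3)] p by (intro bdry_pt_tang_part) simp
  let ?\<tau> = "snd c' \<circ> chart_inv c"
  let ?V = "{y \<in> bdry_img c. bdry_inv c y \<in> fst c \<inter> fst c'}"
  have V: "open ?V"
    by (rule open_bdry_preimage[OF c(1) openin_Int[OF openin_chart[OF c(1)] openin_chart[OF c(2)]]])
  have yV: "y \<in> ?V"
    using c y by (simp add: bdry_img_def bdry_inv_def)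
  have "(?\<tau> has_derivative (\<lambda>v. J *v v)) (at (bdry_pt y) within range bdry_pt)"
    unfolding y J_def by (rule has_derivative_subset[OF has_derivative_transition[OF c]]) auto
  from diff_chain_within[OF bounded_linear_imp_has_derivative[OF bounded_linear_bdry_pt] this]
  have "(?\<tau> \<circ> bdry_pt has_derivative (\<lambda>v. J *v v) \<circ> bdry_pt) (at y)" .
  then have "((\<lambda>y. (?\<tau> \<circ> bdry_pt) y $ None) has_derivative (\<lambda>w. (J *v bdry_pt w) $ None)) (at y)"
    by (intro bounded_linear.has_derivative[OF bounded_linear_vec_nth]) (simp add: o_def)
  moreover have "((\<lambda>y. (?\<tau> \<circ> bdry_pt) y $ None) has_derivative (\<lambda>w. 0)) (at y)"
  proof (rule has_derivative_transform_within_open[OF has_derivative_const[of 0] V yV])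
    fix z assume z: "z \<in> ?V"
    have "bdry_inv c z \<in> mfd_bdry M"
      using bdry_inv_mem[OF c(1)] z by blast
    then show "0 = (?\<tau> \<circ> bdry_pt) z $ None"
      using mem_bdry_iff[OF c(2), of "bdry_inv c z"] z by (simp add: bdry_inv_def)
  qed
  ultimately have "(\<lambda>w. (J *v bdry_pt w) $ None) = (\<lambda>w. 0)"
    by (rule has_derivative_unique)
  then have "(J *v bdry_pt w) $ None = 0"
    by (rule fun_cong)
  then show ?thesis
    by (rule bdry_pt_tang_part[symmetric])
qed

text \<open>By \<open>transition_jac_bdry\<close> the tangential block \<open>K\<close> of the
  Jacobian alone transforms the boundary metric, again as a bilinear form.\<close>

lemma bdry_density_transition:
  assumes c: "c \<in> At" "c' \<in> At" "p \<in> fst c" "p \<in> fst c'" and p: "p \<in> mfd_bdry M"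
  shows "sqrt (det (bdry_metric M c p)) =
    \<bar>det (\<chi> i j. transition_jac c c' p $ Some i $ Some j)\<bar> * sqrt (det (bdry_metric M c' p))"
proof -
  let ?J = "transition_jac c c' p"
  define K where "K = (\<chi> i j. ?J $ Some i $ Some j)"
  have J: "?J *v bdry_pt w = bdry_pt (K *v w)" for w
    using transition_jac_bdry[OF assms, of w] unfolding tang_part_mult_bdry_pt K_def .
  have "v \<bullet> (bdry_metric M c p *v w) = v \<bullet> ((transpose K ** bdry_metric M c' p ** K) *v w)" for v w
  proof -
    have tr: "a \<bullet> (transpose A *v b) = (A *v a) \<bullet> b" for A :: "real ^ 'z ^ 'z::finite" and a b
      by (simp only: dot_lmul_matrix[symmetric] vector_transpose_matrix)
    have "v \<bullet> (bdry_metric M c p *v w) = bdry_pt v \<bullet> (transpose ?J *v (mfd_metric M c' p *v (?J *v bdry_pt w)))"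
      unfolding bdry_metric_inner metric_transition[OF c] by (simp only: matrix_vector_mul_assoc matrix_mul_assoc)
    also have "\<dots> = (K *v v) \<bullet> (bdry_metric M c' p *v (K *v w))"
      unfolding tr J bdry_metric_inner ..
    also have "\<dots> = v \<bullet> ((transpose K ** bdry_metric M c' p ** K) *v w)"
      unfolding tr[symmetric] by (simp only: matrix_vector_mul_assoc matrix_mul_assoc)
    finally show ?thesis .
  qed
  then have "bdry_metric M c p *v w = (transpose K ** bdry_metric M c' p ** K) *v w" for w
    using vector_eq_ldot by blast
  then have "bdry_metric M c p = transpose K ** bdry_metric M c' p ** K"
    by (intro matrix_eq[THEN iffD2] allI)
  then have "det (bdry_metric M c p) = (det K)\<^sup>2 * det (bdry_metric M c' p)"
    by (simp add: det_mul det_transpose power2_eq_square)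
  then show ?thesis
    by (simp add: real_sqrt_mult K_def)
qed

definition chart_bdry_vol :: "('a, 'n) chart \<Rightarrow> 'a measure" where
  "chart_bdry_vol c = param_measure Bb (bdry_img c) (bdry_inv c) (\<lambda>y. ennreal (bdry_density c y))"

lemma measurable_bdry_density: "c \<in> At \<Longrightarrow> (\<lambda>y. ennreal (bdry_density c y)) \<in> borel_measurable (restrict_space borel (bdry_img c))"
  by (intro measurable_compose[OF borel_measurable_continuous_on_restrict[OF continuous_on_bdry_density]] measurable_ennreal)

lemma mem_bdry_image_iff:
  assumes "c \<in> At" "E \<subseteq> fst c"
  shows "bdry_pt y \<in> snd c ` E \<longleftrightarrow> y \<in> bdry_img c \<and> bdry_inv c y \<in> E"
  using mem_chart_image_iff[OF assms] by (simp add: bdry_img_def bdry_inv_def)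

lemma emeasure_chart_bdry_vol:
  assumes c: "c \<in> At" and E: "E \<in> sets Bb" "E \<subseteq> fst c"
  shows "emeasure (chart_bdry_vol c) E = (\<integral>\<^sup>+y. indicator (snd c ` E) (bdry_pt y) * ennreal (bdry_density c y) \<partial>lborel)"
proof -
  have "emeasure (chart_bdry_vol c) E = (\<integral>\<^sup>+y. indicator E (bdry_inv c y) * ennreal (bdry_density c y) * indicator (bdry_img c) y \<partial>lborel)"
    unfolding chart_bdry_vol_def
    by (rule emeasure_param_measure[OF borel_open[OF open_bdry_img] measurable_bdry_inv measurable_bdry_density]) (use c E in auto)
  also have "\<dots> = (\<integral>\<^sup>+y. indicator (snd c ` E) (bdry_pt y) * ennreal (bdry_density c y) \<partial>lborel)"
    by (intro nn_integral_cong) (auto simp: indicator_def mem_bdry_image_iff[OF c E(2)])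
  finally show ?thesis .
qed

lemma bdry_image_borel:
  assumes c: "c \<in> At" and E: "E \<in> sets Bb" "E \<subseteq> fst c"
  shows "{y. bdry_pt y \<in> snd c ` E} \<in> sets borel"
proof -
  have "bdry_inv c -` E \<inter> space (restrict_space borel (bdry_img c)) \<in> sets (restrict_space borel (bdry_img c))"
    by (rule measurable_sets[OF measurable_bdry_inv[OF c] E(1)])
  moreover have "bdry_inv c -` E \<inter> space (restrict_space borel (bdry_img c)) = {y. bdry_pt y \<in> snd c ` E}"
    using mem_bdry_image_iff[OF c E(2)] by (auto simp: space_restrict_space)
  ultimately show ?thesis
    using open_bdry_img[OF c] by (simp add: sets_restrict_space_iff)
qed

text \<open>The same cancellation of Jacobians as in the interior, now for the transition map
  restricted to the boundary, whose Jacobian matrix is the tangential block.\<close>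

lemma chart_bdry_vol_compat:
  assumes c: "c \<in> At" "c' \<in> At" and E: "E \<in> sets Bb" "E \<subseteq> fst c \<inter> fst c'"
  shows "emeasure (chart_bdry_vol c) E = emeasure (chart_bdry_vol c') E"
proof -
  have E': "E \<subseteq> fst c" "E \<subseteq> fst c'" using E by auto
  have E_bdry: "E \<subseteq> mfd_bdry M"
    using sets.sets_into_space[OF E(1)] by simp
  let ?S = "\<lambda>d. {y. bdry_pt y \<in> snd d ` E}"
  define g where "g y = tang_part (snd c' (bdry_inv c y))" for y
  have S: "y \<in> bdry_img c" "bdry_inv c y \<in> E" if "y \<in> ?S c" for y
    using that mem_bdry_image_iff[OF c(1) E'(1)] by auto
  have g: "bdry_pt (g y) = snd c' (bdry_inv c y)" if "y \<in> ?S c" for y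
    unfolding g_def using S(2)[OF that] E' E_bdry mem_bdry_iff[OF c(2)] by (intro bdry_pt_tang_part) blast
  have c_inv: "snd c (bdry_inv c y) = bdry_pt y" if "y \<in> ?S c" for y
    using S(1)[OF that] by (simp add: bdry_img_def bdry_inv_def)
  define f where "f d y = indicator (bdry_img d) y *\<^sub>R bdry_density d y" for d y
  have f_meas: "f d \<in> borel_measurable borel" if "d \<in> At" for d
    unfolding f_def
    by (rule borel_measurable_continuous_on_indicator[OF borel_open[OF open_bdry_img[OF that]] continuous_on_bdry_density[OF that]])
  have f_nonneg: "0 \<le> f d y" if "d \<in> At" for d y
    using bdry_density_pos[OF that, of y] by (auto simp: f_def indicator_def intro: less_imp_le)
  have image: "g ` ?S c = ?S c'"
  proof (intro set_eqI iffI)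
    fix z assume "z \<in> g ` ?S c"
    then obtain y where y: "y \<in> ?S c" "z = g y" by blast
    show "z \<in> ?S c'"
      using g[OF y(1)] S(2)[OF y(1)] y by simp
  next
    fix z assume "z \<in> ?S c'"
    then obtain p where p: "p \<in> E" "bdry_pt z = snd c' p" by blast
    let ?y = "tang_part (snd c p)"
    have pc: "p \<in> fst c" "p \<in> mfd_bdry M"
      using p E' E_bdry by blast+
    have y: "bdry_pt ?y = snd c p"
      using mem_bdry_iff[OF c(1) pc(1)] pc(2) by (intro bdry_pt_tang_part) simp
    then have "?y \<in> ?S c"
      using p by simp
    moreover have "g ?y = z"
    proof -
      have "bdry_inv c ?y = p"
        using y c pc by (simp add: bdry_inv_def)
      then have "g ?y = tang_part (bdry_pt z)"
        by (simp add: g_def p)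
      then show ?thesis by simp
    qed
    ultimately show "z \<in> g ` ?S c" by blast
  qed
  have eq: "emeasure (chart_bdry_vol d) E = (\<integral>\<^sup>+x. indicator (?S d) x * ennreal (f d x) \<partial>lborel)"
    if "d \<in> At" "E \<subseteq> fst d" for d
    unfolding emeasure_chart_bdry_vol[OF that(1) E(1) that(2)]
    using mem_bdry_image_iff[OF that] by (intro nn_integral_cong) (auto simp: f_def indicator_def)
  let ?J = "\<lambda>y. transition_jac c c' (bdry_inv c y)"
  have "(\<integral>\<^sup>+x. indicator (?S c) x * ennreal (f c x) \<partial>lborel) = (\<integral>\<^sup>+y. indicator (g ` ?S c) y * ennreal (f c' y) \<partial>lborel)"
  proof (rule nn_integral_change_of_variables[where g' = "\<lambda>y w. tang_part (?J y *v bdry_pt w)"])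
    show "?S c \<in> sets borel" "g ` ?S c \<in> sets borel"
      unfolding image using bdry_image_borel c E E' by auto
    show "inj_on g (?S c)"
    proof (rule inj_onI)
      fix x y assume x: "x \<in> ?S c" and y: "y \<in> ?S c" and xy: "g x = g y"
      have "snd c' (bdry_inv c x) = snd c' (bdry_inv c y)"
        using g[OF x] g[OF y] xy by simp
      moreover have "bdry_inv c x \<in> fst c'" "bdry_inv c y \<in> fst c'"
        using S(2)[OF x] S(2)[OF y] E' by blast+
      ultimately have "bdry_inv c x = bdry_inv c y"
        using inj_onD[OF inj_on_chart[OF c(2)]] by blast
      then have "bdry_pt x = bdry_pt y"
        using c_inv[OF x] c_inv[OF y] by simp
      then have "tang_part (bdry_pt x) = tang_part (bdry_pt y)"
        by simp
      then show "x = y" by simp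
    qed
    fix y assume y: "y \<in> ?S c"
    let ?p = "bdry_inv c y"
    have p: "?p \<in> fst c" "?p \<in> fst c'" "?p \<in> mfd_bdry M"
      using S(2)[OF y] E' E_bdry by blast+
    have 1: "(bdry_pt has_derivative bdry_pt) (at y within ?S c)"
      by (rule bounded_linear_imp_has_derivative[OF bounded_linear_bdry_pt])
    have 2: "(snd c' \<circ> chart_inv c has_derivative (\<lambda>v. ?J y *v v)) (at (bdry_pt y) within bdry_pt ` ?S c)"
      using has_derivative_transition[OF c p(1,2)] unfolding c_inv[OF y]
      by (rule has_derivative_subset) (rule image_subsetI, rule bdry_pt_half_space)
    have "(tang_part \<circ> ((snd c' \<circ> chart_inv c) \<circ> bdry_pt) has_derivative tang_part \<circ> ((\<lambda>v. ?J y *v v) \<circ> bdry_pt)) (at y within ?S c)"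
      by (rule diff_chain_within[OF diff_chain_within[OF 1 2] bounded_linear_imp_has_derivative[OF bounded_linear_tang_part]])
    then show "(g has_derivative (\<lambda>w. tang_part (?J y *v bdry_pt w))) (at y within ?S c)"
      by (simp add: g_def[abs_def] o_def bdry_inv_def)
    have "matrix (\<lambda>w. tang_part (?J y *v bdry_pt w)) = (\<chi> i j. ?J y $ Some i $ Some j)"
      unfolding tang_part_mult_bdry_pt by (rule matrix_of_matrix_vector_mul)
    moreover have "bdry_inv c' (g y) = ?p" "g y \<in> bdry_img c'"
      using g[OF y] c p by (simp_all add: bdry_inv_def bdry_img_def)
    ultimately show "f c y = \<bar>det (matrix (\<lambda>w. tang_part (?J y *v bdry_pt w)))\<bar> * f c' (g y)"
      using bdry_density_transition[OF c p] S(1)[OF y] by (simp add: f_def bdry_density_def)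
  qed (use c f_meas f_nonneg in auto)
  then show ?thesis
    using eq[OF c(1) E'(1)] eq[OF c(2) E'(2)] by (simp add: image)
qed

lemma bdry_vol_spec:
  "space (bdry_vol M) = mfd_bdry M \<and> sets (bdry_vol M) = sets Bb \<and>
    (\<forall>c\<in>At. \<forall>E\<in>sets Bb. E \<subseteq> fst c \<longrightarrow> emeasure (bdry_vol M) E = emeasure (chart_bdry_vol c) E)"
proof -
  obtain F where F: "finite F" "F \<subseteq> At" "(\<Union>c\<in>F. fst c) = mfd_pts M"
    by (rule finite_chart_cover)
  have "\<exists>!\<mu>. space \<mu> = space Bb \<and> sets \<mu> = sets Bb \<and>
      (\<forall>c\<in>At. \<forall>E\<in>sets Bb. E \<subseteq> fst c \<inter> mfd_bdry M \<longrightarrow> emeasure \<mu> E = emeasure (chart_bdry_vol c) E)"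
  proof (rule ex1_glued_measure[OF F(1,2)])
    show "(\<Union>c\<in>F. fst c \<inter> mfd_bdry M) = space Bb"
      using F(3) bdry_subset by auto
    show "sets (chart_bdry_vol c) = sets Bb" for c
      unfolding chart_bdry_vol_def by (rule sets_param_measure)
    show "fst c \<inter> mfd_bdry M \<in> sets Bb" if "c \<in> At" for c
      by (rule sets_Bb_openin[OF openin_chart[OF that]])
    show "emeasure (chart_bdry_vol c) E = emeasure (chart_bdry_vol c') E"
      if "c \<in> At" "c' \<in> At" "E \<in> sets Bb" "E \<subseteq> fst c \<inter> mfd_bdry M \<inter> (fst c' \<inter> mfd_bdry M)" for c c' E
      by (rule chart_bdry_vol_compat) (use that in auto)
  qed
  \<comment> \<open>The gluing asks for a cover by sets of the boundary sigma-algebra, hence the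
    intersections with the boundary; for sets in \<open>Bb\<close> they make no difference.\<close>
  moreover have "E \<subseteq> fst c \<inter> mfd_bdry M \<longleftrightarrow> E \<subseteq> fst c" if "E \<in> sets Bb" for E c
    using sets.sets_into_space[OF that] by auto
  then have sub: "(\<forall>E\<in>sets Bb. E \<subseteq> fst c \<inter> mfd_bdry M \<longrightarrow> P E) \<longleftrightarrow> (\<forall>E\<in>sets Bb. E \<subseteq> fst c \<longrightarrow> P E)" for c P
    by blast
  ultimately have ex1: "\<exists>!\<mu>. space \<mu> = mfd_bdry M \<and> sets \<mu> = sets Bb \<and>
      (\<forall>c\<in>At. \<forall>E\<in>sets Bb. E \<subseteq> fst c \<longrightarrow> emeasure \<mu> E = emeasure (chart_bdry_vol c) E)"
    by (simp only: sub space_Bb)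
  have "bdry_vol M = (THE \<mu>. space \<mu> = mfd_bdry M \<and> sets \<mu> = sets Bb \<and>
      (\<forall>c\<in>At. \<forall>E\<in>sets Bb. E \<subseteq> fst c \<longrightarrow> emeasure \<mu> E = emeasure (chart_bdry_vol c) E))"
    unfolding bdry_vol_def
    by (rule arg_cong[where f = The])
      (simp add: fun_eq_iff emeasure_chart_bdry_vol bdry_density_def bdry_inv_def cong: conj_cong)
  then show ?thesis
    using theI'[OF ex1] by simp
qed

lemma space_bdry_vol [simp]: "space (bdry_vol M) = mfd_bdry M"
  and sets_bdry_vol: "sets (bdry_vol M) = sets Bb"
  using bdry_vol_spec by blast+

lemma nn_integral_bdry_vol_chart:
  assumes c: "c \<in> At" and f: "f \<in> borel_measurable Bb"
  shows "(\<integral>\<^sup>+p. f p * indicator (fst c) p \<partial>bdry_vol M) =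
    (\<integral>\<^sup>+y. f (bdry_inv c y) * ennreal (bdry_density c y) * indicator (bdry_img c) y \<partial>lborel)"
proof -
  let ?A = "fst c \<inter> mfd_bdry M"
  have A: "?A \<in> sets Bb"
    by (rule sets_Bb_openin[OF openin_chart[OF c]])
  have fc: "(\<lambda>p. f p * indicator ?A p) \<in> borel_measurable Bb"
    using f A by simp
  have "(\<integral>\<^sup>+p. f p * indicator (fst c) p \<partial>bdry_vol M) = (\<integral>\<^sup>+p. f p * indicator ?A p \<partial>bdry_vol M)"
    by (rule nn_integral_cong) (simp add: indicator_def)
  also have "\<dots> = (\<integral>\<^sup>+p. f p * indicator ?A p \<partial>chart_bdry_vol c)"
    by (rule nn_integral_eq_on_subset[OF sets_bdry_vol _ A _ f])
      (use bdry_vol_spec c in \<open>auto simp: chart_bdry_vol_def sets_param_measure\<close>)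
  also have "\<dots> = (\<integral>\<^sup>+y. f (bdry_inv c y) * indicator ?A (bdry_inv c y) * ennreal (bdry_density c y) * indicator (bdry_img c) y \<partial>lborel)"
    unfolding chart_bdry_vol_def
    by (rule nn_integral_param_measure[OF borel_open[OF open_bdry_img] measurable_bdry_inv measurable_bdry_density]) (use c fc in auto)
  also have "\<dots> = (\<integral>\<^sup>+y. f (bdry_inv c y) * ennreal (bdry_density c y) * indicator (bdry_img c) y \<partial>lborel)"
    using bdry_inv_mem[OF c] by (intro nn_integral_cong) (simp add: indicator_def)
  finally show ?thesis .
qed

end

section \<open>From the flat estimate to coordinate boxes\<close>

section \<open>Boxes in the half-space\<close>

definition model_pt :: "real ^ 'n \<Rightarrow> real \<Rightarrow> 'n::finite model" where
  "model_pt y t = (\<chi> a. case a of None \<Rightarrow> t | Some i \<Rightarrow> y $ i)"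

lemma model_pt_None [simp]: "model_pt y t $ None = t" and model_pt_Some [simp]: "model_pt y t $ Some i = y $ i"
  by (simp_all add: model_pt_def)

lemma continuous_on_model_pt:
  assumes "continuous_on S f" "continuous_on S h"
  shows "continuous_on S (\<lambda>x. model_pt (f x) (h x))"
  unfolding model_pt_def
proof (rule continuous_on_vec_lambda)
  show "continuous_on S (\<lambda>x. case a of None \<Rightarrow> h x | Some i \<Rightarrow> f x $ i)" for a
    using assms by (cases a) (auto intro: continuous_on_component)
qed

text \<open>Both measures agree on boxes. This gives Fubini in the coordinates (y, t), with the
  normal coordinate separated from the tangential ones.\<close>

lemma distr_model_pt: "distr (lborel \<Otimes>\<^sub>M lborel) borel (\<lambda>(y, t). model_pt y t) = (lborel :: ('n::finite model) measure)"
proof (rule lborel_eqI[symmetric])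
  have "continuous_on UNIV (\<lambda>x :: (real ^ 'n) \<times> real. model_pt (fst x) (snd x))"
    by (intro continuous_on_model_pt continuous_intros)
  then have meas: "(\<lambda>(y, t). model_pt y t) \<in> (lborel \<Otimes>\<^sub>M lborel) \<rightarrow>\<^sub>M (borel :: 'n model measure)"
    using borel_measurable_continuous_onI[of "\<lambda>x :: (real ^ 'n) \<times> real. model_pt (fst x) (snd x)"]
    by (simp add: lborel_prod case_prod_beta')
  fix l u :: "'n model"
  assume lu: "\<And>b. b \<in> Basis \<Longrightarrow> l \<bullet> b \<le> u \<bullet> b"
  have le: "l $ i \<le> u $ i" for i
    using lu[of "axis i 1"] by (auto simp: inner_axis Basis_vec_def)
  have pre: "(\<lambda>(y, t). model_pt y t) -` box l u = box (tang_part l) (tang_part u) \<times> {l $ None<..<u $ None}"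
    by (auto simp: mem_box_cart split_option_all)
  have prod: "(\<Prod>b\<in>Basis. (v - w) \<bullet> b) = (\<Prod>i\<in>UNIV. v $ i - w $ i)" for v w :: "real ^ 'm::finite"
    by (simp add: Basis_vec_def UNION_singleton_eq_range prod.reindex inj_on_def axis_eq_axis inner_axis)
  have "emeasure (distr (lborel \<Otimes>\<^sub>M lborel) borel (\<lambda>(y, t). model_pt y t)) (box l u) =
      emeasure (lborel \<Otimes>\<^sub>M lborel) (box (tang_part l) (tang_part u) \<times> {l $ None<..<u $ None})"
    using meas by (subst emeasure_distr) (simp_all add: pre space_pair_measure)
  also have "\<dots> = emeasure lborel (box (tang_part l) (tang_part u)) * emeasure lborel {l $ None<..<u $ None}"
    by (rule lborel.emeasure_pair_measure_Times) auto
  also have "emeasure lborel (box (tang_part l) (tang_part u)) = (\<Prod>b\<in>Basis. (tang_part u - tang_part l) \<bullet> b)"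
    using le by (intro emeasure_lborel_box) (auto simp: Basis_vec_def inner_axis)
  also have "emeasure lborel {l $ None<..<u $ None} = u $ None - l $ None"
    using le by simp
  also have "ennreal (\<Prod>b\<in>Basis. (tang_part u - tang_part l) \<bullet> b) * ennreal (u $ None - l $ None) =
      ennreal ((\<Prod>i\<in>UNIV. u $ Some i - l $ Some i) * (u $ None - l $ None))"
    unfolding prod tang_part_nth using le by (intro ennreal_mult[symmetric] prod_nonneg) auto
  also have "(\<Prod>i\<in>UNIV. u $ Some i - l $ Some i) * (u $ None - l $ None) = (\<Prod>b\<in>Basis. (u - l) \<bullet> b)"
    unfolding prod by (simp add: UNIV_option_conv prod.reindex mult.commute)
  finally show "emeasure (distr (lborel \<Otimes>\<^sub>M lborel) borel (\<lambda>(y, t). model_pt y t)) (box l u) = (\<Prod>b\<in>Basis. (u - l) \<bullet> b)" .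
qed simp

lemma measurable_model_pt: "(\<lambda>(y, t). model_pt y t) \<in> (lborel \<Otimes>\<^sub>M lborel) \<rightarrow>\<^sub>M (borel :: ('n::finite model) measure)"
proof -
  have "continuous_on UNIV (\<lambda>x :: (real ^ 'n) \<times> real. model_pt (fst x) (snd x))"
    by (intro continuous_on_model_pt continuous_intros)
  then show ?thesis
    using borel_measurable_continuous_onI[of "\<lambda>x :: (real ^ 'n) \<times> real. model_pt (fst x) (snd x)"]
    by (simp add: lborel_prod case_prod_beta')
qed

lemma nn_integral_model_pt:
  fixes F :: "'n::finite model \<Rightarrow> ennreal"
  assumes F: "F \<in> borel_measurable borel"
  shows "(\<integral>\<^sup>+x. F x \<partial>lborel) = (\<integral>\<^sup>+y. (\<integral>\<^sup>+t. F (model_pt y t) \<partial>lborel) \<partial>lborel)"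
proof -
  have "(\<integral>\<^sup>+x. F x \<partial>lborel) = (\<integral>\<^sup>+x. F x \<partial>distr (lborel \<Otimes>\<^sub>M lborel) borel (\<lambda>(y, t). model_pt y t))"
    by (simp add: distr_model_pt)
  also have "\<dots> = (\<integral>\<^sup>+x. F (model_pt (fst x) (snd x)) \<partial>(lborel \<Otimes>\<^sub>M lborel))"
    using F measurable_model_pt by (subst nn_integral_distr) (auto simp: case_prod_beta')
  also have "\<dots> = (\<integral>\<^sup>+y. (\<integral>\<^sup>+t. F (model_pt y t) \<partial>lborel) \<partial>lborel)"
    using measurable_compose[OF measurable_model_pt F]
    by (subst lborel.nn_integral_fst[symmetric]) (auto simp: case_prod_beta')
  finally show ?thesis .
qed

text \<open>\<open>z\<close> is the lowest corner and \<open>s\<close> the side length; (y, t) runs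
  over the unit cube times the unit interval, with t in the normal direction.\<close>

definition box_map :: "'n model \<Rightarrow> real \<Rightarrow> real ^ 'n \<Rightarrow> real \<Rightarrow> 'n::finite model" where
  "box_map z s y t = z + s *\<^sub>R model_pt y t"

definition box_img :: "'n model \<Rightarrow> real \<Rightarrow> 'n::finite model set" where
  "box_img z s = {box_map z s y t | y t. y \<in> unit_cube \<and> 0 \<le> t \<and> t \<le> 1}"

lemma box_map_nth [simp]: "box_map z s y t $ None = z $ None + s * t"
  "box_map z s y t $ Some i = z $ Some i + s * y $ i"
  by (simp_all add: box_map_def)

lemma box_map_in: "y \<in> unit_cube \<Longrightarrow> 0 \<le> t \<Longrightarrow> t \<le> 1 \<Longrightarrow> box_map z s y t \<in> box_img z s"
  unfolding box_img_def by blast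

lemma box_map_inj:
  assumes "s \<noteq> 0" "box_map z s y t = box_map z s y' t'"
  shows "y = y' \<and> t = t'"
proof -
  have "box_map z s y t $ None = box_map z s y' t' $ None" "\<And>i. box_map z s y t $ Some i = box_map z s y' t' $ Some i"
    using assms(2) by simp_all
  then show ?thesis
    using assms(1) by (simp add: vec_eq_iff)
qed

lemma box_map_in_iff: "s \<noteq> 0 \<Longrightarrow> box_map z s y t \<in> box_img z s \<longleftrightarrow> y \<in> unit_cube \<and> 0 \<le> t \<and> t \<le> 1"
  unfolding box_img_def using box_map_inj by blast

lemma continuous_on_box_map:
  assumes "continuous_on S f" "continuous_on S h"
  shows "continuous_on S (\<lambda>x. box_map z s (f x) (h x))"
  unfolding box_map_def using assms by (intro continuous_intros continuous_on_model_pt)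

lemma box_img_eq: "box_img z s = (\<lambda>x. box_map z s (fst x) (snd x)) ` (unit_cube \<times> {0..1})"
  unfolding box_img_def by force

lemma compact_box_img: "compact (box_img z s)"
  unfolding box_img_eq
  by (intro compact_continuous_image continuous_on_box_map continuous_intros compact_Times)
    (simp_all add: unit_cube_def)

lemma box_img_borel: "box_img z s \<in> sets borel"
  using compact_box_img by (rule borel_compact)

lemma nn_integral_box_img:
  fixes F :: "'n::finite model \<Rightarrow> ennreal"
  assumes F[measurable]: "F \<in> borel_measurable borel" and s: "0 < s"
  shows "(\<integral>\<^sup>+x. F x * indicator (box_img z s) x \<partial>lborel) = ennreal (s ^ (CARD('n) + 1)) *
    (\<integral>\<^sup>+y. (\<integral>\<^sup>+t. F (box_map z s y t) * indicator {0..1} t \<partial>lborel) * indicator unit_cube y \<partial>lborel)"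
proof -
  note [measurable] = box_img_borel[of z s]
  have "(\<integral>\<^sup>+x. F x * indicator (box_img z s) x \<partial>lborel) =
      (\<integral>\<^sup>+x. F x * indicator (box_img z s) x \<partial>density (distr lborel borel (\<lambda>x. z + s *\<^sub>R x)) (\<lambda>_. ennreal (\<bar>s\<bar> ^ DIM('n model))))"
    using s by (subst lborel_affine[of s z]) auto
  also have "\<dots> = ennreal (s ^ (CARD('n) + 1)) * (\<integral>\<^sup>+x. F (z + s *\<^sub>R x) * indicator (box_img z s) (z + s *\<^sub>R x) \<partial>lborel)"
    using s by (simp add: nn_integral_density nn_integral_distr nn_integral_cmult)
  also have "(\<integral>\<^sup>+x. F (z + s *\<^sub>R x) * indicator (box_img z s) (z + s *\<^sub>R x) \<partial>lborel) =
      (\<integral>\<^sup>+y. (\<integral>\<^sup>+t. F (box_map z s y t) * indicator (box_img z s) (box_map z s y t) \<partial>lborel) \<partial>lborel)"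
    unfolding box_map_def by (rule nn_integral_model_pt) measurable
  also have "\<dots> = (\<integral>\<^sup>+y. (\<integral>\<^sup>+t. F (box_map z s y t) * indicator {0..1} t \<partial>lborel) * indicator unit_cube y \<partial>lborel)"
  proof (rule nn_integral_cong)
    fix y :: "real ^ 'n"
    show "(\<integral>\<^sup>+t. F (box_map z s y t) * indicator (box_img z s) (box_map z s y t) \<partial>lborel) =
        (\<integral>\<^sup>+t. F (box_map z s y t) * indicator {0..1} t \<partial>lborel) * indicator unit_cube y"
    proof (cases "y \<in> unit_cube")
      case True
      then show ?thesis
        using s by (simp add: indicator_def box_map_in_iff)
    next
      case False
      then show ?thesis
        using s by (simp add: indicator_def box_map_in_iff)
    qed
  qed
  finally show ?thesis .
qed

lemma nn_integral_scaled_cube: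
  fixes F :: "real ^ 'n::finite \<Rightarrow> ennreal"
  assumes F[measurable]: "F \<in> borel_measurable borel" and s: "0 < s"
  shows "(\<integral>\<^sup>+x. F x \<partial>lborel) = ennreal (s ^ CARD('n)) * (\<integral>\<^sup>+y. F (z + s *\<^sub>R y) \<partial>lborel)"
proof -
  have "(\<integral>\<^sup>+x. F x \<partial>lborel) =
      (\<integral>\<^sup>+x. F x \<partial>density (distr lborel borel (\<lambda>x. z + s *\<^sub>R x)) (\<lambda>_. ennreal (\<bar>s\<bar> ^ DIM(real ^ 'n))))"
    using s by (subst lborel_affine[of s z]) auto
  then show ?thesis
    using s by (simp add: nn_integral_density nn_integral_distr nn_integral_cmult)
qed

section \<open>Oscillation along a path\<close>

text \<open>Fundamental theorem of calculus. The two end points form a null set, so the majorant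
  \<open>h\<close> is required only on the open interval.\<close>

lemma abs_diff_le_nn_integral:
  fixes f f' :: "real \<Rightarrow> real"
  assumes f: "\<And>t. t \<in> {0..1} \<Longrightarrow> (f has_vector_derivative f' t) (at t within {0..1})"
    and f': "continuous_on {0..1} f'" and b: "0 \<le> b" "b \<le> 1"
    and h: "\<And>t. t \<in> {0<..<1} \<Longrightarrow> ennreal \<bar>f' t\<bar> \<le> h t"
  shows "ennreal \<bar>f b - f 0\<bar> \<le> (\<integral>\<^sup>+t. h t * indicator {0<..<1} t \<partial>lborel)"
proof -
  have sub: "{0..b} \<subseteq> {0..1}" using b by auto
  have f'_int: "(f' has_integral (f b - f 0)) {0..b}"
  proof (rule fundamental_theorem_of_calculus[OF b(1)])
    show "(f has_vector_derivative f' t) (at t within {0..b})" if "t \<in> {0..b}" for t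
      by (rule has_vector_derivative_within_subset[OF f sub]) (use that b in auto)
  qed
  have abs_int: "(\<lambda>t. \<bar>f' t\<bar>) integrable_on {0..b}"
    by (intro integrable_continuous_real continuous_intros continuous_on_subset[OF f' sub])
  have "\<bar>f b - f 0\<bar> = norm (integral {0..b} f')"
    using integral_unique[OF f'_int] by simp
  also have "\<dots> \<le> integral {0..b} (\<lambda>t. \<bar>f' t\<bar>)"
    by (rule integral_norm_bound_integral[OF has_integral_integrable[OF f'_int] abs_int]) simp
  finally have "ennreal \<bar>f b - f 0\<bar> \<le> ennreal (integral {0..b} (\<lambda>t. \<bar>f' t\<bar>))"
    by (rule ennreal_leI)
  also have "\<dots> = (\<integral>\<^sup>+t. ennreal \<bar>f' t\<bar> * indicator {0..b} t \<partial>lborel)"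
    using nn_integral_has_integral_lebesgue'[OF _ integrable_integral[OF abs_int]] by simp
  also have "\<dots> \<le> (\<integral>\<^sup>+t. h t * indicator {0<..<1} t \<partial>lborel)"
  proof (rule nn_integral_mono_AE)
    show "AE t in lborel. ennreal \<bar>f' t\<bar> * indicator {0..b} t \<le> h t * indicator {0<..<1} t"
      using AE_lborel_singleton[of 0] AE_lborel_singleton[of 1]
    proof eventually_elim
      case (elim t)
      then show ?case
        using h[of t] b by (auto simp: indicator_def)
    qed
  qed
  finally show ?thesis .
qed

lemma norm_model_pt_le:
  assumes "\<And>i. \<bar>w $ i\<bar> \<le> 1"
  shows "norm (model_pt w 1 :: 'n::finite model) \<le> real (CARD('n) + 1)"
proof -
  have "norm (model_pt w 1 :: 'n model) \<le> (\<Sum>a\<in>UNIV. \<bar>model_pt w 1 $ a\<bar>)"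
    by (rule norm_le_l1_cart)
  also have "\<dots> = 1 + (\<Sum>i\<in>UNIV. \<bar>w $ i\<bar>)"
    by (simp add: sum_option)
  also have "(\<Sum>i\<in>UNIV. \<bar>w $ i\<bar>) \<le> (\<Sum>i\<in>(UNIV :: 'n set). 1)"
    using assms by (intro sum_mono)
  finally show ?thesis by simp
qed

context riem_mfd
begin

text \<open>In the coordinates (y, t) the path rises at unit speed while drifting by
  \<open>w\<close>; its velocity in the chart is s times (w, 1), of norm at most s (CARD('n) + 1).
  The choice w = 0 gives vertical paths and w = y - x the oblique rays.\<close>

lemma oscillation_along_path:
  assumes u: "smooth_fun M u" and c: "c \<in> At" and s: "0 < s" and box: "box_img z s \<subseteq> chart_img c"
    and path: "\<And>t. 0 \<le> t \<Longrightarrow> t \<le> 1 \<Longrightarrow> a + t *\<^sub>R w \<in> unit_cube"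
    and w: "\<And>i. \<bar>w $ i\<bar> \<le> 1" and b: "0 \<le> b" "b \<le> 1"
  defines "V \<equiv> \<lambda>y t. u (chart_inv c (box_map z s y t))"
  shows "ennreal \<bar>V (a + b *\<^sub>R w) b - V a 0\<bar> \<le>
    (\<integral>\<^sup>+t. ennreal (s * real (CARD('n) + 1) * norm (chart_grad c u (box_map z s (a + t *\<^sub>R w) t))) * indicator {0<..<1} t \<partial>lborel)"
proof -
  let ?\<gamma> = "\<lambda>t. box_map z s (a + t *\<^sub>R w) t"
  let ?d = "s *\<^sub>R model_pt w 1 :: 'n model"
  have \<gamma>_eq: "?\<gamma> t = box_map z s a 0 + t *\<^sub>R ?d" for t
    by (simp add: vec_eq_iff split_option_all algebra_simps)
  have \<gamma>_in: "?\<gamma> t \<in> chart_img c" if "t \<in> {0..1}" for t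
    using box_map_in[OF path] that box by auto
  have \<gamma>_half: "?\<gamma> ` {0..1} \<subseteq> half_space"
    using \<gamma>_in chart_img_half_space[OF c] by blast
  have \<gamma>_der: "(?\<gamma> has_derivative (\<lambda>h. h *\<^sub>R ?d)) (at t within {0..1})" for t
    unfolding \<gamma>_eq by (auto intro!: derivative_eq_intros)
  have \<gamma>_cont: "continuous_on {0..1} ?\<gamma>"
    unfolding \<gamma>_eq by (intro continuous_intros)
  have der: "((\<lambda>t. V (a + t *\<^sub>R w) t) has_vector_derivative (chart_grad c u (?\<gamma> t) \<bullet> ?d)) (at t within {0..1})"
    if t: "t \<in> {0..1}" for t
  proof -
    have "(u \<circ> chart_inv c has_derivative (\<lambda>v. chart_grad c u (?\<gamma> t) \<bullet> v)) (at (?\<gamma> t) within ?\<gamma> ` {0..1})"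
      by (rule has_derivative_subset[OF has_derivative_chart_grad[OF u c \<gamma>_in[OF t]] \<gamma>_half])
    from diff_chain_within[OF \<gamma>_der this]
    show ?thesis
      by (simp add: V_def o_def has_vector_derivative_def mult.assoc)
  qed
  have "ennreal \<bar>V (a + b *\<^sub>R w) b - V (a + 0 *\<^sub>R w) 0\<bar> \<le>
    (\<integral>\<^sup>+t. ennreal (s * real (CARD('n) + 1) * norm (chart_grad c u (?\<gamma> t))) * indicator {0<..<1} t \<partial>lborel)"
  proof (rule abs_diff_le_nn_integral[OF der _ b])
    show "continuous_on {0..1} (\<lambda>t. chart_grad c u (?\<gamma> t) \<bullet> ?d)"
      by (intro continuous_intros continuous_on_compose2[OF continuous_on_chart_grad[OF u c] \<gamma>_cont])
        (use \<gamma>_in in blast)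
    fix t :: real
    have "\<bar>chart_grad c u (?\<gamma> t) \<bullet> ?d\<bar> \<le> norm (chart_grad c u (?\<gamma> t)) * norm ?d"
      by (rule Cauchy_Schwarz_ineq2)
    also have "\<dots> \<le> norm (chart_grad c u (?\<gamma> t)) * (s * real (CARD('n) + 1))"
    proof (rule mult_left_mono)
      show "norm ?d \<le> s * real (CARD('n) + 1)"
        using s norm_model_pt_le[OF w] by simp
    qed simp
    also have "\<dots> = s * real (CARD('n) + 1) * norm (chart_grad c u (?\<gamma> t))"
      by (rule mult.commute)
    finally show "ennreal \<bar>chart_grad c u (?\<gamma> t) \<bullet> ?d\<bar> \<le> ennreal (s * real (CARD('n) + 1) * norm (chart_grad c u (?\<gamma> t)))"
      by (rule ennreal_leI)
  qed
  then show ?thesis by simp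
qed

text \<open>Cramer's rule for the system with the metric as matrix and the differential as
  right-hand side writes each component as a quotient of determinants, so no continuity of matrix
  inversion is invoked.\<close>

lemma continuous_on_gradient:
  assumes u: "smooth_fun M u" and c: "c \<in> At"
  shows "continuous_on (chart_img c) (\<lambda>x. gradient M u c (chart_inv c x))"
proof -
  let ?G = "\<lambda>x. mfd_metric M c (chart_inv c x)" and ?w = "chart_grad c u"
  have det: "0 < det (?G x)" if "x \<in> chart_img c" for x
    by (rule pos_def_det_pos[OF metric_pos[OF c chart_inv_in[OF that]]])
  have eq: "gradient M u c (chart_inv c x) = (\<chi> k. det (\<chi> i j. if j = k then ?w x $ i else ?G x $ i $ j) / det (?G x))"
    if "x \<in> chart_img c" for x
    using cramer[of "?G x" "gradient M u c (chart_inv c x)" "?w x"] det[OF that]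
      metric_gradient[OF c chart_inv_in[OF that]] that by simp
  have "continuous_on (chart_img c) (\<lambda>x. \<chi> k. det (\<chi> i j. if j = k then ?w x $ i else ?G x $ i $ j) / det (?G x))"
  proof (intro continuous_on_vec_lambda continuous_on_divide continuous_on_det continuous_on_metric[OF c] ballI)
    show "det (?G x) \<noteq> 0" if "x \<in> chart_img c" for x
      using det[OF that] by simp
    show "continuous_on (chart_img c) (\<lambda>x. if j = k then ?w x $ i else ?G x $ i $ j)" for i j k
      by (cases "j = k")
        (simp_all add: continuous_on_component continuous_on_chart_grad[OF u c] continuous_on_metric[OF c])
  qed
  then show ?thesis
    using eq by (simp cong: continuous_on_cong)
qed

lemma measurable_vnorm_sq_gradient:
  assumes u: "smooth_fun M u"
  shows "vnorm_sq M (gradient M u) \<in> borel_measurable Bm"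
proof (rule measurable_Bm_chart)
  fix c assume c: "c \<in> At"
  have "continuous_on (chart_img c) (\<lambda>x. gradient M u c (chart_inv c x) \<bullet> chart_grad c u x)"
    by (intro continuous_intros continuous_on_gradient[OF u c] continuous_on_chart_grad[OF u c])
  then have "continuous_on (chart_img c) (\<lambda>x. vnorm_sq M (gradient M u) (chart_inv c x))"
    using vnorm_sq_gradient[OF u c] by (simp cong: continuous_on_cong)
  then show "(\<lambda>x. vnorm_sq M (gradient M u) (chart_inv c x)) \<in> borel_measurable (restrict_space borel (chart_img c))"
    by (rule continuous_on_chart_measurable[OF c])
qed

text \<open>The constants depend on the box and not on the function; the local trace inequality owes
  its uniformity to this.\<close>

lemma box_bounds:
  assumes c: "c \<in> At" and box: "box_img z s \<subseteq> chart_img c"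
  obtains l L where "0 < l" "0 < L"
    "\<And>u x. smooth_fun M u \<Longrightarrow> x \<in> box_img z s \<Longrightarrow>
      l * (norm (chart_grad c u x))\<^sup>2 \<le> vnorm_sq M (gradient M u) (chart_inv c x)"
    "\<And>u x. smooth_fun M u \<Longrightarrow> x \<in> box_img z s \<Longrightarrow>
      vnorm_sq M (gradient M u) (chart_inv c x) \<le> L * (norm (chart_grad c u x))\<^sup>2"
    "\<And>x. x \<in> box_img z s \<Longrightarrow> l \<le> vol_density c x"
    "\<And>x. x \<in> box_img z s \<Longrightarrow> vol_density c x \<le> L"
proof -
  obtain l L where l: "0 < l" and L: "0 < L"
    and b: "\<And>x v. x \<in> box_img z s \<Longrightarrow> l * (norm v)\<^sup>2 \<le> v \<bullet> (mfd_metric M c (chart_inv c x) *v v)"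
    "\<And>x v. x \<in> box_img z s \<Longrightarrow> norm (mfd_metric M c (chart_inv c x) *v v) \<le> L * norm v"
    and d: "\<And>x. x \<in> box_img z s \<Longrightarrow> l \<le> vol_density c x" "\<And>x. x \<in> box_img z s \<Longrightarrow> vol_density c x \<le> L"
  proof (rule pos_def_compact_bounds[OF compact_box_img[of z s] continuous_on_subset[OF continuous_on_metric[OF c] box]])
    show "0 < v \<bullet> (mfd_metric M c (chart_inv c x) *v v)" if "x \<in> box_img z s" "v \<noteq> 0" for x v
      by (rule metric_pos[OF c chart_inv_in]) (use that box in auto)
  qed (unfold vol_density_def, rule that[unfolded vol_density_def])
  have v: "l / L\<^sup>2 * (norm (chart_grad c u x))\<^sup>2 \<le> vnorm_sq M (gradient M u) (chart_inv c x)"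
    "vnorm_sq M (gradient M u) (chart_inv c x) \<le> (norm (chart_grad c u x))\<^sup>2 / l"
    if u: "smooth_fun M u" and x: "x \<in> box_img z s" for u x
  proof -
    have xc: "x \<in> chart_img c" using x box by blast
    have G: "mfd_metric M c (chart_inv c x) *v gradient M u c (chart_inv c x) = chart_grad c u x"
      using metric_gradient[OF c chart_inv_in[OF xc]] xc by simp
    show "l / L\<^sup>2 * (norm (chart_grad c u x))\<^sup>2 \<le> vnorm_sq M (gradient M u) (chart_inv c x)"
      "vnorm_sq M (gradient M u) (chart_inv c x) \<le> (norm (chart_grad c u x))\<^sup>2 / l"
      using inverse_metric_bounds[OF l b(1)[OF x] L b(2)[OF x] G]
        vnorm_sq_gradient[OF u c chart_inv_in[OF xc]] xc by simp_all
  qed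
  show ?thesis
  proof (rule that[of "min l (l / L\<^sup>2)" "max L (1 / l)"])
    show "0 < min l (l / L\<^sup>2)" "0 < max L (1 / l)"
      using l L by simp_all
    show "min l (l / L\<^sup>2) \<le> vol_density c x" "vol_density c x \<le> max L (1 / l)" if "x \<in> box_img z s" for x
      using d that by (simp_all add: min.coboundedI1 max.coboundedI1)
    fix u x assume ux: "smooth_fun M u" "x \<in> box_img z s"
    have "min l (l / L\<^sup>2) * (norm (chart_grad c u x))\<^sup>2 \<le> l / L\<^sup>2 * (norm (chart_grad c u x))\<^sup>2"
      by (intro mult_right_mono) simp_all
    then show "min l (l / L\<^sup>2) * (norm (chart_grad c u x))\<^sup>2 \<le> vnorm_sq M (gradient M u) (chart_inv c x)"
      using v(1)[OF ux] by (rule order_trans)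
    have "1 / l * (norm (chart_grad c u x))\<^sup>2 \<le> max L (1 / l) * (norm (chart_grad c u x))\<^sup>2"
      by (intro mult_right_mono) simp_all
    then show "vnorm_sq M (gradient M u) (chart_inv c x) \<le> max L (1 / l) * (norm (chart_grad c u x))\<^sup>2"
      using v(2)[OF ux] by simp
  qed
qed

end

section \<open>The trace inequality on a coordinate box\<close>

context riem_mfd
begin

text \<open>An \<open>ennreal\<close>, because finiteness is established only in
  \<open>energy_finite\<close>.\<close>

definition energy :: "('a \<Rightarrow> real) \<Rightarrow> real \<Rightarrow> ('a \<Rightarrow> real) \<Rightarrow> ennreal" where
  "energy \<rho> \<sigma> u = (\<integral>\<^sup>+q. ennreal (\<rho> q powr (1 - 2 * \<sigma>) * vnorm_sq M (gradient M u) q) \<partial>vol M)"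

text \<open>Here e bounds the square root of the energy and stays positive even if the energy is 0.
  \<open>m\<close> picks one constant per function and is to be the same for all sets in the end;
  the L^1 bound on the volume is what allows the constants of overlapping sets to be
  compared.\<close>

definition poincare_on ::
    "('a \<Rightarrow> real) \<Rightarrow> real \<Rightarrow> real \<Rightarrow> 'a set \<Rightarrow> real \<Rightarrow> (('a \<Rightarrow> real) \<Rightarrow> real) \<Rightarrow> bool" where
  "poincare_on \<rho> \<sigma> p N C m \<longleftrightarrow> (\<forall>u e. smooth_fun M u \<longrightarrow> 0 < e \<longrightarrow> energy \<rho> \<sigma> u \<le> ennreal (e\<^sup>2) \<longrightarrow>
     (\<integral>\<^sup>+q. ennreal \<bar>u q - m u\<bar> * indicator N q \<partial>vol M) \<le> ennreal (C * e) \<and>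
     (\<integral>\<^sup>+q. ennreal (\<bar>u q - m u\<bar> powr p) * indicator N q \<partial>bdry_vol M) \<le> ennreal (C * e powr p))"

lemma box_preimage_iff:
  assumes "box_img z s \<subseteq> chart_img c" "x \<in> chart_img c"
  shows "chart_inv c x \<in> chart_inv c ` box_img z s \<longleftrightarrow> x \<in> box_img z s"
proof
  assume "chart_inv c x \<in> chart_inv c ` box_img z s"
  then obtain y where y: "y \<in> box_img z s" "chart_inv c x = chart_inv c y" by blast
  have "snd c (chart_inv c x) = snd c (chart_inv c y)"
    using y(2) by (rule arg_cong)
  moreover have "y \<in> chart_img c"
    using y(1) assms(1) by blast
  ultimately show "x \<in> box_img z s"
    using y(1) assms(2) by (simp only: chart_chart_inv)
qed simp

lemma box_sets_Bm:
  assumes c: "c \<in> At" and box: "box_img z s \<subseteq> chart_img c"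
  shows "chart_inv c ` box_img z s \<in> sets Bm" "chart_inv c ` box_img z s \<subseteq> fst c"
proof -
  show sub: "chart_inv c ` box_img z s \<subseteq> fst c"
    using box by auto
  have "snd c -` box_img z s \<inter> space (restrict_space Bm (fst c)) \<in> sets (restrict_space Bm (fst c))"
    using measurable_restrict_space2_iff[of "snd c" _ borel "chart_img c"] measurable_chart[OF c] box_img_borel
    by (intro measurable_sets[of _ _ borel]) auto
  moreover have "snd c -` box_img z s \<inter> space (restrict_space Bm (fst c)) = chart_inv c ` box_img z s"
    using box chart_subset[OF c] sub c by (force simp: space_restrict_space image_iff)
  moreover have "fst c \<inter> space Bm \<in> sets Bm"
    by (intro sets.Int chart_sets_Bm[OF c] sets.top)
  ultimately show "chart_inv c ` box_img z s \<in> sets Bm"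
    by (auto simp: sets_restrict_space_iff)
qed

lemma nn_integral_vol_box:
  assumes c: "c \<in> At" and s: "0 < s" and box: "box_img z s \<subseteq> chart_img c" and f: "f \<in> borel_measurable Bm"
  shows "(\<integral>\<^sup>+q. f q * indicator (chart_inv c ` box_img z s) q \<partial>vol M) = ennreal (s ^ (CARD('n) + 1)) *
    (\<integral>\<^sup>+y. (\<integral>\<^sup>+t. f (chart_inv c (box_map z s y t)) * ennreal (vol_density c (box_map z s y t)) * indicator {0..1} t \<partial>lborel) *
      indicator unit_cube y \<partial>lborel)"
proof -
  let ?N = "chart_inv c ` box_img z s"
  define F where "F x = f (chart_inv c x) * ennreal (vol_density c x) * indicator (chart_img c) x" for x
  have F: "F \<in> borel_measurable borel"
    unfolding F_def
    using measurable_compose[OF measurable_chart_inv[OF c] f] measurable_vol_density[OF c]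
      chart_img_borel[OF c] borel_measurable_restrict_space_iff_ennreal[of "chart_img c" borel
        "\<lambda>x. f (chart_inv c x) * ennreal (vol_density c x)"]
    by simp
  have fN: "(\<lambda>q. f q * indicator ?N q) \<in> borel_measurable Bm"
    using f box_sets_Bm[OF c box] by simp
  have "(\<integral>\<^sup>+q. f q * indicator ?N q \<partial>vol M) = (\<integral>\<^sup>+q. (f q * indicator ?N q) * indicator (fst c) q \<partial>vol M)"
    using box_sets_Bm(2)[OF c box] by (intro nn_integral_cong) (auto simp: indicator_def)
  also have "\<dots> = (\<integral>\<^sup>+x. (f (chart_inv c x) * indicator ?N (chart_inv c x)) * ennreal (vol_density c x) * indicator (chart_img c) x \<partial>lborel)"
    by (rule nn_integral_vol_chart[OF c fN])
  also have "\<dots> = (\<integral>\<^sup>+x. F x * indicator (box_img z s) x \<partial>lborel)"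
  proof (rule nn_integral_cong)
    fix x
    show "(f (chart_inv c x) * indicator ?N (chart_inv c x)) * ennreal (vol_density c x) * indicator (chart_img c) x =
        F x * indicator (box_img z s) x"
      using box_preimage_iff[OF box, of x] by (cases "x \<in> chart_img c") (simp_all add: F_def indicator_def)
  qed
  also have "\<dots> = ennreal (s ^ (CARD('n) + 1)) *
    (\<integral>\<^sup>+y. (\<integral>\<^sup>+t. F (box_map z s y t) * indicator {0..1} t \<partial>lborel) * indicator unit_cube y \<partial>lborel)"
    by (rule nn_integral_box_img[OF F s])
  also have "(\<integral>\<^sup>+y. (\<integral>\<^sup>+t. F (box_map z s y t) * indicator {0..1} t \<partial>lborel) * indicator unit_cube y \<partial>lborel) =
    (\<integral>\<^sup>+y. (\<integral>\<^sup>+t. f (chart_inv c (box_map z s y t)) * ennreal (vol_density c (box_map z s y t)) * indicator {0..1} t \<partial>lborel) *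
      indicator unit_cube y \<partial>lborel)"
  proof (rule nn_integral_cong)
    fix y :: "real ^ 'n"
    show "(\<integral>\<^sup>+t. F (box_map z s y t) * indicator {0..1} t \<partial>lborel) * indicator unit_cube y =
      (\<integral>\<^sup>+t. f (chart_inv c (box_map z s y t)) * ennreal (vol_density c (box_map z s y t)) * indicator {0..1} t \<partial>lborel) *
      indicator unit_cube y"
    proof (cases "y \<in> unit_cube")
      case True
      have "F (box_map z s y t) * indicator {0..1} t =
          f (chart_inv c (box_map z s y t)) * ennreal (vol_density c (box_map z s y t)) * indicator {0..1} t" for t
        using box_map_in[OF True, of t z s] box by (auto simp: F_def indicator_def)
      then show ?thesis by simp
    qed simp
  qed
  finally show ?thesis .
qed

lemma nn_integral_bdry_box_0:
  assumes c: "c \<in> At" and s: "0 < s" and box: "box_img z s \<subseteq> chart_img c" and z: "0 < z $ None"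
  shows "(\<integral>\<^sup>+q. f q * indicator (chart_inv c ` box_img z s) q \<partial>bdry_vol M) = 0"
proof -
  have "(\<integral>\<^sup>+q. f q * indicator (chart_inv c ` box_img z s) q \<partial>bdry_vol M) = (\<integral>\<^sup>+q. 0 \<partial>bdry_vol M)"
  proof (rule nn_integral_cong)
    fix q assume "q \<in> space (bdry_vol M)"
    then have q: "q \<in> mfd_bdry M" by simp
    have "q \<notin> chart_inv c ` box_img z s"
    proof
      assume "q \<in> chart_inv c ` box_img z s"
      then obtain y t where yt: "y \<in> unit_cube" "0 \<le> t" "t \<le> 1" "q = chart_inv c (box_map z s y t)"
        unfolding box_img_def by blast
      then have "box_map z s y t \<in> chart_img c"
        using box_map_in[OF yt(1-3)] box by blast
      then have "box_map z s y t $ None = 0"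
        using mem_bdry_iff[OF c, of q] q yt(4) by simp
      moreover have "0 \<le> s * t"
        using s yt by simp
      ultimately show False
        using z by simp
    qed
    then show "f q * indicator (chart_inv c ` box_img z s) q = 0" by simp
  qed
  then show ?thesis by simp
qed

lemma nn_integral_bdry_box:
  assumes c: "c \<in> At" and s: "0 < s" and box: "box_img z s \<subseteq> chart_img c" and z: "z $ None = 0"
    and f: "f \<in> borel_measurable Bb"
  shows "(\<integral>\<^sup>+q. f q * indicator (chart_inv c ` box_img z s) q \<partial>bdry_vol M) = ennreal (s ^ CARD('n)) *
    (\<integral>\<^sup>+y. f (chart_inv c (box_map z s y 0)) * ennreal (bdry_density c (tang_part z + s *\<^sub>R y)) * indicator unit_cube y \<partial>lborel)"
proof -
  let ?N = "chart_inv c ` box_img z s" and ?T = "\<lambda>y. tang_part z + s *\<^sub>R y"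
  define F where "F y = (f (bdry_inv c y) * indicator ?N (bdry_inv c y)) * ennreal (bdry_density c y) * indicator (bdry_img c) y" for y
  have N: "(\<lambda>q. indicator ?N q :: ennreal) \<in> borel_measurable Bb"
    using box_sets_Bm[OF c box] by (intro measurable_Bb) simp
  have fN: "(\<lambda>q. f q * indicator ?N q) \<in> borel_measurable Bb"
    using f N by simp
  have F: "F \<in> borel_measurable borel"
    unfolding F_def
    using measurable_compose[OF measurable_bdry_inv[OF c] fN] measurable_bdry_density[OF c]
      borel_open[OF open_bdry_img[OF c]] borel_measurable_restrict_space_iff_ennreal[of "bdry_img c" borel
        "\<lambda>y. (f (bdry_inv c y) * indicator ?N (bdry_inv c y)) * ennreal (bdry_density c y)"]
    by simp
  have T: "bdry_pt (?T y) = box_map z s y 0" for y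
    using z by (simp add: vec_eq_iff split_option_all)
  have "(\<integral>\<^sup>+q. f q * indicator ?N q \<partial>bdry_vol M) = (\<integral>\<^sup>+q. (f q * indicator ?N q) * indicator (fst c) q \<partial>bdry_vol M)"
    using box_sets_Bm(2)[OF c box] by (intro nn_integral_cong) (auto simp: indicator_def)
  also have "\<dots> = (\<integral>\<^sup>+y. F y \<partial>lborel)"
    unfolding F_def by (rule nn_integral_bdry_vol_chart[OF c fN])
  also have "\<dots> = ennreal (s ^ CARD('n)) * (\<integral>\<^sup>+y. F (?T y) \<partial>lborel)"
    by (rule nn_integral_scaled_cube[OF F s])
  also have "(\<integral>\<^sup>+y. F (?T y) \<partial>lborel) =
    (\<integral>\<^sup>+y. f (chart_inv c (box_map z s y 0)) * ennreal (bdry_density c (?T y)) * indicator unit_cube y \<partial>lborel)"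
  proof (rule nn_integral_cong)
    fix y :: "real ^ 'n"
    show "F (?T y) = f (chart_inv c (box_map z s y 0)) * ennreal (bdry_density c (?T y)) * indicator unit_cube y"
    proof (cases "y \<in> unit_cube")
      case True
      then have "box_map z s y 0 \<in> box_img z s"
        by (intro box_map_in) auto
      moreover from this have "?T y \<in> bdry_img c"
        using box by (auto simp: bdry_img_def T)
      ultimately show ?thesis
        using True by (simp add: F_def bdry_inv_def T)
    next
      case False
      then have "box_map z s y 0 \<notin> box_img z s"
        using s by (simp add: box_map_in_iff)
      then have "?T y \<in> bdry_img c \<Longrightarrow> bdry_inv c (?T y) \<notin> ?N"
        using box_preimage_iff[OF box, of "box_map z s y 0"] by (simp add: bdry_img_def bdry_inv_def T)
      then show ?thesis
        using False by (auto simp: F_def indicator_def)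
    qed
  qed
  finally show ?thesis .
qed

lemma bdry_density_bound:
  assumes c: "c \<in> At" and box: "box_img z s \<subseteq> chart_img c" and z: "z $ None = 0"
  obtains L where "0 < L" "\<And>y. y \<in> unit_cube \<Longrightarrow> bdry_density c (tang_part z + s *\<^sub>R y) \<le> L"
proof -
  have T: "bdry_pt (tang_part z + s *\<^sub>R y) = box_map z s y 0" for y
    using z by (simp add: vec_eq_iff split_option_all)
  have in_img: "tang_part z + s *\<^sub>R y \<in> bdry_img c" if "y \<in> unit_cube" for y
    using box_map_in[OF that, of 0 z s] box by (auto simp: bdry_img_def T)
  have "continuous_on unit_cube (\<lambda>y. bdry_density c (tang_part z + s *\<^sub>R y))"
    by (rule continuous_on_compose2[OF continuous_on_bdry_density[OF c]])
      (use in_img in \<open>auto intro!: continuous_intros\<close>)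
  moreover have "compact (unit_cube :: (real ^ 'n) set)"
    by (simp add: unit_cube_def)
  moreover have "(unit_cube :: (real ^ 'n) set) \<noteq> {}"
    using mem_unit_cube[of "0 :: real ^ 'n"] by auto
  ultimately obtain a where a: "\<And>y. y \<in> unit_cube \<Longrightarrow> bdry_density c (tang_part z + s *\<^sub>R y) \<le> bdry_density c (tang_part z + s *\<^sub>R a)"
    using continuous_attains_sup[of "unit_cube :: (real ^ 'n) set"] by metis
  then have "bdry_density c (tang_part z + s *\<^sub>R y) \<le> \<bar>bdry_density c (tang_part z + s *\<^sub>R a)\<bar> + 1" if "y \<in> unit_cube" for y
    using a[OF that] by linarith
  then show ?thesis
    using that[of "\<bar>bdry_density c (tang_part z + s *\<^sub>R a)\<bar> + 1"] by force
qed

text \<open>\<open>\<tau>\<close> is the exponent of the weight in box coordinates. On a box that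
  rests on the boundary it must reproduce \<open>p\<close>; a box away from the boundary has no
  trace, so there any \<open>\<tau>\<close> in range will do and only the L^1 estimate carries
  information.\<close>

lemma poincare_on_box:
  assumes \<rho>: "\<rho> \<in> borel_measurable Bm"
    and c: "c \<in> At" and s: "0 < s" and box: "box_img z s \<subseteq> chart_img c"
    and \<tau>: "0 < \<tau>" "2 * \<tau> < real CARD('n)" and \<kappa>: "0 < \<kappa>"
    and weight: "\<And>y t. y \<in> unit_cube \<Longrightarrow> 0 < t \<Longrightarrow> t < 1 \<Longrightarrow>
      \<kappa> * t powr (1 - 2 * \<tau>) \<le> \<rho> (chart_inv c (box_map z s y t)) powr (1 - 2 * \<sigma>)"
    and z: "0 < z $ None \<or> z $ None = 0 \<and> p = 2 * real CARD('n) / (real CARD('n) - 2 * \<tau>)"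
  shows "\<exists>C\<ge>0. \<exists>m. poincare_on \<rho> \<sigma> p (chart_inv c ` box_img z s) C m"
proof -
  obtain l L where lL: "0 < l" "0 < L"
    and grad_le: "\<And>u x. smooth_fun M u \<Longrightarrow> x \<in> box_img z s \<Longrightarrow>
      l * (norm (chart_grad c u x))\<^sup>2 \<le> vnorm_sq M (gradient M u) (chart_inv c x)"
    and dens: "\<And>x. x \<in> box_img z s \<Longrightarrow> l \<le> vol_density c x" "\<And>x. x \<in> box_img z s \<Longrightarrow> vol_density c x \<le> L"
    by (rule box_bounds[OF c box]) (rule that)
  let ?n = "CARD('n)" and ?Q = "unit_cube :: (real ^ 'n) set" and ?N = "chart_inv c ` box_img z s"
  let ?b = "box_map z s"
  \<comment> \<open>The critical exponent that belongs to \<open>\<tau>\<close>; it coincides with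
    \<open>p\<close> for boxes resting on the boundary.\<close>
  define q where "q = 2 * real ?n / (real ?n - 2 * \<tau>)"
  obtain Lb where Lb: "0 < Lb" "\<And>y. z $ None = 0 \<Longrightarrow> y \<in> ?Q \<Longrightarrow> bdry_density c (tang_part z + s *\<^sub>R y) \<le> Lb"
  proof (cases "z $ None = 0")
    case True
    then show ?thesis
      using bdry_density_bound[OF c box True] that by metis
  next
    case False
    then show ?thesis
      using that[of 1] by simp
  qed
  \<comment> \<open>\<open>B\<close> bounds the speed of the paths, \<open>A\<close> converts the
    Riemannian energy density into the squared bound for the derivative along paths, and
    \<open>\<eta> * e\<close> bounds the root of the energy in box coordinates. The added 1 keeps
    \<open>\<eta>\<close> positive.\<close>
  define B where "B = s * real (?n + 1)"
  have B: "0 \<le> B" using s by (simp add: B_def)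
  define A where "A = B\<^sup>2 / (\<kappa> * l * l)"
  define \<eta> where "\<eta> = sqrt (A / s ^ (?n + 1) + 1)"
  have A: "0 \<le> A" using B lL \<kappa> by (simp add: A_def)
  have \<eta>: "0 < \<eta>" "\<eta>\<^sup>2 = A / s ^ (?n + 1) + 1"
    using A s by (auto simp: \<eta>_def add_nonneg_pos)
  define K1 where "K1 = (sqrt (1 / (2 * \<tau>)) + sqrt (1 / (real ?n - 2 * \<tau>))) powr q * 2 ^ ?n"
  define K2 where "K2 = (1 + sqrt (2 ^ ?n)) * sqrt (1 / (2 * \<tau>))"
  have K: "0 \<le> K1" "0 \<le> K2" using \<tau> by (auto simp: K1_def K2_def)
  define m where "m u = (\<integral>y. indicator ?Q y * u (chart_inv c (?b y 1)) \<partial>lborel)" for u :: "'a \<Rightarrow> real"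
  define C where "C = s ^ (?n + 1) * L * K2 * \<eta> + s ^ ?n * Lb * K1 * \<eta> powr q"
  have C1: "s ^ (?n + 1) * L * K2 * \<eta> \<le> C" and C2: "s ^ ?n * Lb * K1 * \<eta> powr q \<le> C" and C0: "0 \<le> C"
    using s lL Lb K \<eta> by (auto simp: C_def)
  have in_img: "?b y t \<in> box_img z s" "?b y t \<in> chart_img c" if "y \<in> ?Q" "0 \<le> t" "t \<le> 1" for y t
    using box_map_in[OF that] box by auto
  have "poincare_on \<rho> \<sigma> p ?N C m"
    unfolding poincare_on_def
  proof (intro allI impI)
    fix u e assume u: "smooth_fun M u" and e: "0 < e" and en: "energy \<rho> \<sigma> u \<le> ennreal (e\<^sup>2)"
    have u_cont: "continuous_on (chart_img c) (\<lambda>x. u (chart_inv c x))"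
      using smooth_on_imp_continuous_on[OF smooth_funD[OF u c]] by (simp add: o_def)
    \<comment> \<open>\<open>V\<close> and \<open>g\<close> will extend \<open>W\<close> and
      \<open>h\<close> by zero outside the closed unit box, which makes them Borel on the whole
      space.\<close>
    define W where "W y t = u (chart_inv c (?b y t))" for y t
    define V where "V y t = indicator (?Q \<times> {0..1}) (y, t) *\<^sub>R W y t" for y t
    define h where "h y t = B * norm (chart_grad c u (?b y t))" for y t
    define g where "g y t = ennreal (indicator (?Q \<times> {0..1}) (y, t) *\<^sub>R h y t)" for y t
    have b_cont: "continuous_on (?Q \<times> {0..1}) (\<lambda>x. ?b (fst x) (snd x))"
      by (intro continuous_on_box_map continuous_intros)
    have b_sub: "(\<lambda>x. ?b (fst x) (snd x)) ` (?Q \<times> {0..1}) \<subseteq> chart_img c"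
      using in_img(2) by auto
    have QI: "?Q \<times> {0..1::real} \<in> sets borel"
      by (intro borel_closed closed_Times) (auto simp: unit_cube_def)
    have V_meas: "case_prod V \<in> borel_measurable (borel \<Otimes>\<^sub>M borel)"
    proof -
      have "continuous_on (?Q \<times> {0..1}) (\<lambda>x. W (fst x) (snd x))"
        unfolding W_def by (rule continuous_on_compose2[OF u_cont b_cont b_sub])
      from borel_measurable_continuous_on_indicator[OF QI this]
      show ?thesis
        by (simp add: V_def borel_prod case_prod_beta')
    qed
    have g_meas: "case_prod g \<in> borel_measurable (borel \<Otimes>\<^sub>M borel)"
    proof -
      have "continuous_on (?Q \<times> {0..1}) (\<lambda>x. h (fst x) (snd x))"
        unfolding h_def
        by (intro continuous_intros continuous_on_compose2[OF continuous_on_chart_grad[OF u c] b_cont b_sub])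
      from measurable_compose[OF borel_measurable_continuous_on_indicator[OF QI this] measurable_ennreal]
      show ?thesis
        by (simp add: g_def borel_prod case_prod_beta')
    qed
    have [measurable]: "(\<lambda>x. g (f x) (k x)) \<in> borel_measurable K"
      if "f \<in> borel_measurable K" "k \<in> borel_measurable K" for f :: "'z \<Rightarrow> real ^ 'n" and k K
      using measurable_compose[OF measurable_Pair[OF that] g_meas] by simp
    have V_eq: "V y t = W y t" "g y t = ennreal (h y t)" if "y \<in> ?Q" "0 \<le> t" "t \<le> 1" for y t
      using that by (simp_all add: V_def g_def)
    have osc: "ennreal \<bar>V (a + b *\<^sub>R w) b - V a 0\<bar> \<le> (\<integral>\<^sup>+t. g (a + t *\<^sub>R w) t * indicator {0<..<1} t \<partial>lborel)"
      if path: "\<And>t. 0 \<le> t \<Longrightarrow> t \<le> 1 \<Longrightarrow> a + t *\<^sub>R w \<in> ?Q" and w: "\<And>i. \<bar>w $ i\<bar> \<le> 1" and b: "0 \<le> b" "b \<le> 1" for a w b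
    proof -
      have "V (a + b *\<^sub>R w) b = W (a + b *\<^sub>R w) b" "V a 0 = W a 0"
        using V_eq(1) path[of b] path[of 0] b by simp_all
      moreover have "ennreal \<bar>W (a + b *\<^sub>R w) b - W a 0\<bar> \<le> (\<integral>\<^sup>+t. ennreal (h (a + t *\<^sub>R w) t) * indicator {0<..<1} t \<partial>lborel)"
        unfolding W_def h_def B_def by (rule oscillation_along_path[OF u c s box path w b])
      moreover have "(\<integral>\<^sup>+t. ennreal (h (a + t *\<^sub>R w) t) * indicator {0<..<1} t \<partial>lborel) =
          (\<integral>\<^sup>+t. g (a + t *\<^sub>R w) t * indicator {0<..<1} t \<partial>lborel)"
      proof (rule nn_integral_cong)
        fix t :: real
        show "ennreal (h (a + t *\<^sub>R w) t) * indicator {0<..<1} t = g (a + t *\<^sub>R w) t * indicator {0<..<1} t"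
          using V_eq(2)[OF path[of t]] by (cases "t \<in> {0<..<1}") auto
      qed
      ultimately show ?thesis by simp
    qed
    have Vs: "ennreal \<bar>V x t - V x 0\<bar> \<le> (\<integral>\<^sup>+t. g x t * indicator {0<..<1} t \<partial>lborel)"
      if "x \<in> ?Q" "0 \<le> t" "t \<le> 1" for x t
      using osc[of x 0 t] that by simp
    have Vd: "ennreal \<bar>V x 0 - V y 1\<bar> \<le> (\<integral>\<^sup>+t. g ((1 - t) *\<^sub>R x + t *\<^sub>R y) t * indicator {0<..<1} t \<partial>lborel)"
      if x: "x \<in> ?Q" and y: "y \<in> ?Q" for x y
    proof -
      have eq: "x + t *\<^sub>R (y - x) = (1 - t) *\<^sub>R x + t *\<^sub>R y" for t
        by (simp add: algebra_simps)
      have "ennreal \<bar>V (x + 1 *\<^sub>R (y - x)) 1 - V x 0\<bar> \<le> (\<integral>\<^sup>+t. g (x + t *\<^sub>R (y - x)) t * indicator {0<..<1} t \<partial>lborel)"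
      proof (rule osc)
        show "x + t *\<^sub>R (y - x) \<in> ?Q" if "0 \<le> t" "t \<le> 1" for t
          unfolding eq by (rule convex_comb_unit_cube[OF x y that])
        show "\<bar>(y - x) $ i\<bar> \<le> 1" for i
        proof -
          have "0 \<le> x $ i" "x $ i \<le> 1" "0 \<le> y $ i" "y $ i \<le> 1"
            using x y unfolding mem_unit_cube by blast+
          then show ?thesis by simp
        qed
      qed simp_all
      then show ?thesis
        unfolding eq by (simp add: abs_minus_commute)
    qed
    \<comment> \<open>The bound along the ray to (y, 1), averaged over y; the average of
      \<open>V y 1\<close> is \<open>m u\<close>.\<close>
    have V0: "ennreal \<bar>V x 0 - m u\<bar> \<le>
        (\<integral>\<^sup>+t. (\<integral>\<^sup>+y. g ((1 - t) *\<^sub>R x + t *\<^sub>R y) t * indicator ?Q y \<partial>lborel) * indicator {0<..<1} t \<partial>lborel)"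
      if x: "x \<in> ?Q" for x
    proof -
      have cont1: "continuous_on ?Q (\<lambda>y. u (chart_inv c (?b y 1)))"
        by (rule continuous_on_compose2[OF u_cont])
          (use in_img(2) in \<open>auto intro!: continuous_on_box_map continuous_intros\<close>)
      have comp: "compact ?Q" by (simp add: unit_cube_def)
      have int1: "integrable lborel (\<lambda>y. indicator ?Q y * u (chart_inv c (?b y 1)))"
        using borel_integrable_compact[OF comp cont1] by (simp add: indicator_scaleR_eq_if[symmetric])
      have int0: "integrable lborel (\<lambda>y. indicator ?Q y * V x 0)"
        by (simp add: integrable_real_indicator emeasure_unit_cube)
      have "(\<integral>y. indicator ?Q y * V x 0 \<partial>lborel) = V x 0"
        by (simp add: measure_def emeasure_unit_cube)
      then have "V x 0 - m u = (\<integral>y. indicator ?Q y * V x 0 - indicator ?Q y * u (chart_inv c (?b y 1)) \<partial>lborel)"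
        unfolding m_def using int0 int1 by simp
      then have "ennreal \<bar>V x 0 - m u\<bar> =
          ennreal (norm (\<integral>y. indicator ?Q y * V x 0 - indicator ?Q y * u (chart_inv c (?b y 1)) \<partial>lborel))"
        by simp
      also have "\<dots> \<le> (\<integral>\<^sup>+y. ennreal (norm (indicator ?Q y * V x 0 - indicator ?Q y * u (chart_inv c (?b y 1)))) \<partial>lborel)"
        by (rule integral_norm_bound_ennreal) (intro Bochner_Integration.integrable_diff int0 int1)
      also have "\<dots> \<le> (\<integral>\<^sup>+y. (\<integral>\<^sup>+t. g ((1 - t) *\<^sub>R x + t *\<^sub>R y) t * indicator {0<..<1} t * indicator ?Q y \<partial>lborel) \<partial>lborel)"
      proof (rule nn_integral_mono)
        fix y :: "real ^ 'n"
        show "ennreal (norm (indicator ?Q y * V x 0 - indicator ?Q y * u (chart_inv c (?b y 1)))) \<le>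
            (\<integral>\<^sup>+t. g ((1 - t) *\<^sub>R x + t *\<^sub>R y) t * indicator {0<..<1} t * indicator ?Q y \<partial>lborel)"
        proof (cases "y \<in> ?Q")
          case True
          then show ?thesis
            using Vd[OF x True] V_eq(1)[OF True, of 1] by (simp add: W_def)
        qed simp
      qed
      also have "\<dots> = (\<integral>\<^sup>+t. (\<integral>\<^sup>+y. g ((1 - t) *\<^sub>R x + t *\<^sub>R y) t * indicator {0<..<1} t * indicator ?Q y \<partial>lborel) \<partial>lborel)"
        by (rule lborel_pair.Fubini'[symmetric]) measurable
      also have "\<dots> = (\<integral>\<^sup>+t. (\<integral>\<^sup>+y. g ((1 - t) *\<^sub>R x + t *\<^sub>R y) t * indicator ?Q y \<partial>lborel) * indicator {0<..<1} t \<partial>lborel)"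
      proof (rule nn_integral_cong)
        fix t :: real
        show "(\<integral>\<^sup>+y. g ((1 - t) *\<^sub>R x + t *\<^sub>R y) t * indicator {0<..<1} t * indicator ?Q y \<partial>lborel) =
          (\<integral>\<^sup>+y. g ((1 - t) *\<^sub>R x + t *\<^sub>R y) t * indicator ?Q y \<partial>lborel) * indicator {0<..<1} t"
          by (cases "t \<in> {0<..<1}") simp_all
      qed
      finally show ?thesis .
    qed
    define f where "f r = ennreal (\<rho> r powr (1 - 2 * \<sigma>) * vnorm_sq M (gradient M u) r)" for r
    have f_meas: "f \<in> borel_measurable Bm"
      unfolding f_def using \<rho> measurable_vnorm_sq_gradient[OF u] by measurable
    define I where "I = (\<integral>\<^sup>+y. (\<integral>\<^sup>+t. f (chart_inv c (?b y t)) * ennreal (vol_density c (?b y t)) * indicator {0..1} t \<partial>lborel) *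
        indicator ?Q y \<partial>lborel)"
    have I: "ennreal (s ^ (?n + 1)) * I \<le> ennreal (e\<^sup>2)"
    proof -
      have "ennreal (s ^ (?n + 1)) * I = (\<integral>\<^sup>+r. f r * indicator ?N r \<partial>vol M)"
        unfolding I_def by (rule nn_integral_vol_box[OF c s box f_meas, symmetric])
      also have "\<dots> \<le> energy \<rho> \<sigma> u"
        unfolding energy_def f_def by (intro nn_integral_mono) (simp add: indicator_def)
      finally show ?thesis using en by (rule order_trans)
    qed
    have energy: "(\<integral>\<^sup>+t. ennreal (t powr (1 - 2 * \<tau>)) * (\<integral>\<^sup>+y. (g y t)\<^sup>2 * indicator ?Q y \<partial>lborel) * indicator {0<..<1} t \<partial>lborel)
        \<le> ennreal ((\<eta> * e)\<^sup>2)"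
    proof -
      have "(\<integral>\<^sup>+t. ennreal (t powr (1 - 2 * \<tau>)) * (\<integral>\<^sup>+y. (g y t)\<^sup>2 * indicator ?Q y \<partial>lborel) * indicator {0<..<1} t \<partial>lborel) =
          (\<integral>\<^sup>+t. (\<integral>\<^sup>+y. ennreal (t powr (1 - 2 * \<tau>)) * indicator {0<..<1} t * ((g y t)\<^sup>2 * indicator ?Q y) \<partial>lborel) \<partial>lborel)"
        by (intro nn_integral_cong, subst nn_integral_cmult) (auto simp: mult_ac unit_cube_def)
      also have "\<dots> = (\<integral>\<^sup>+y. (\<integral>\<^sup>+t. ennreal (t powr (1 - 2 * \<tau>)) * indicator {0<..<1} t * ((g y t)\<^sup>2 * indicator ?Q y) \<partial>lborel) \<partial>lborel)"
        by (rule lborel_pair.Fubini') measurable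
      also have "\<dots> \<le> (\<integral>\<^sup>+y. ennreal A * ((\<integral>\<^sup>+t. f (chart_inv c (?b y t)) * ennreal (vol_density c (?b y t)) * indicator {0..1} t \<partial>lborel) *
        indicator ?Q y) \<partial>lborel)"
      proof (rule nn_integral_mono)
        fix y :: "real ^ 'n"
        show "(\<integral>\<^sup>+t. ennreal (t powr (1 - 2 * \<tau>)) * indicator {0<..<1} t * ((g y t)\<^sup>2 * indicator ?Q y) \<partial>lborel) \<le>
          ennreal A * ((\<integral>\<^sup>+t. f (chart_inv c (?b y t)) * ennreal (vol_density c (?b y t)) * indicator {0..1} t \<partial>lborel) * indicator ?Q y)"
        proof (cases "y \<in> ?Q")
          case True
          have b_meas: "(\<lambda>t. f (chart_inv c (?b y t)) * ennreal (vol_density c (?b y t)) * indicator {0..1} t) \<in> borel_measurable borel"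
          proof -
            have "(\<lambda>t. ?b y t) \<in> measurable (restrict_space borel {0..1}) (restrict_space borel (chart_img c))"
              by (rule measurable_restrict_space3)
                (auto intro!: borel_measurable_continuous_onI continuous_on_box_map continuous_intros in_img(2)[OF True])
            from measurable_compose[OF this borel_measurable_times_ennreal[OF measurable_compose[OF measurable_chart_inv[OF c] f_meas] measurable_vol_density[OF c]]]
            show ?thesis
              using borel_measurable_restrict_space_iff_ennreal[of "{0..1::real}" borel
                "\<lambda>t. f (chart_inv c (?b y t)) * ennreal (vol_density c (?b y t))"] by simp
          qed
          \<comment> \<open>The value of \<open>A\<close> cancels the lower bounds for the weight,
            for the gradient and for the density: \<open>\<kappa>\<close> for the first and a factor
            \<open>l\<close> for each of the others.\<close>
          have pt: "ennreal (t powr (1 - 2 * \<tau>)) * (g y t)\<^sup>2 \<le> ennreal A * (f (chart_inv c (?b y t)) * ennreal (vol_density c (?b y t)))"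
            if t: "0 < t" "t < 1" for t
          proof -
            let ?x = "?b y t" and ?v = "vnorm_sq M (gradient M u) (chart_inv c (?b y t))"
            let ?r = "\<rho> (chart_inv c (?b y t)) powr (1 - 2 * \<sigma>)"
            have x: "?x \<in> box_img z s"
              using in_img(1)[OF True] t by simp
            have "0 \<le> l * (norm (chart_grad c u ?x))\<^sup>2"
              using lL by simp
            then have v: "l * (norm (chart_grad c u ?x))\<^sup>2 \<le> ?v" "0 \<le> ?v" "l \<le> vol_density c ?x"
              using grad_le[OF u x] dens(1)[OF x] by linarith+
            have "\<kappa> * t powr (1 - 2 * \<tau>) * (l * (norm (chart_grad c u ?x))\<^sup>2) * l \<le> ?r * ?v * vol_density c ?x"
              using weight[OF True t] v \<kappa> lL by (intro mult_mono) auto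
            then have "A / B\<^sup>2 * (B\<^sup>2 * (\<kappa> * t powr (1 - 2 * \<tau>) * (l * (norm (chart_grad c u ?x))\<^sup>2) * l)) \<le>
                A / B\<^sup>2 * (B\<^sup>2 * (?r * ?v * vol_density c ?x))"
              using A by (intro mult_left_mono) auto
            moreover have "A / B\<^sup>2 * (B\<^sup>2 * (\<kappa> * t powr (1 - 2 * \<tau>) * (l * (norm (chart_grad c u ?x))\<^sup>2) * l)) = t powr (1 - 2 * \<tau>) * (h y t)\<^sup>2"
              using \<kappa> lL s by (simp add: A_def h_def B_def power_mult_distrib)
            moreover have "A / B\<^sup>2 * (B\<^sup>2 * (?r * ?v * vol_density c ?x)) = A * (?r * ?v * vol_density c ?x)"
              using s by (simp add: B_def)
            ultimately have "t powr (1 - 2 * \<tau>) * (h y t)\<^sup>2 \<le> A * (?r * ?v * vol_density c ?x)"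
              by simp
            then have "ennreal (t powr (1 - 2 * \<tau>) * (h y t)\<^sup>2) \<le> ennreal (A * (?r * ?v * vol_density c ?x))"
              by (rule ennreal_leI)
            moreover have "ennreal (t powr (1 - 2 * \<tau>) * (h y t)\<^sup>2) = ennreal (t powr (1 - 2 * \<tau>)) * (g y t)\<^sup>2"
            proof -
              have "0 \<le> h y t"
                using B by (simp add: h_def)
              then have "(g y t)\<^sup>2 = ennreal ((h y t)\<^sup>2)"
                using V_eq(2)[OF True, of t] t by (simp add: ennreal_power)
              then show ?thesis
                by (simp add: ennreal_mult)
            qed
            moreover have "ennreal (A * (?r * ?v * vol_density c ?x)) = ennreal A * (f (chart_inv c ?x) * ennreal (vol_density c ?x))"
              using v lL A by (simp add: f_def ennreal_mult)
            ultimately show ?thesis by simp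
          qed
          have "(\<integral>\<^sup>+t. ennreal (t powr (1 - 2 * \<tau>)) * indicator {0<..<1} t * ((g y t)\<^sup>2 * indicator ?Q y) \<partial>lborel) \<le>
            (\<integral>\<^sup>+t. ennreal A * (f (chart_inv c (?b y t)) * ennreal (vol_density c (?b y t)) * indicator {0..1} t) \<partial>lborel)"
          proof (rule nn_integral_mono)
            fix t :: real
            show "ennreal (t powr (1 - 2 * \<tau>)) * indicator {0<..<1} t * ((g y t)\<^sup>2 * indicator ?Q y) \<le>
              ennreal A * (f (chart_inv c (?b y t)) * ennreal (vol_density c (?b y t)) * indicator {0..1} t)"
              using pt[of t] True by (cases "t \<in> {0<..<1}") auto
          qed
          also have "\<dots> = ennreal A * (\<integral>\<^sup>+t. f (chart_inv c (?b y t)) * ennreal (vol_density c (?b y t)) * indicator {0..1} t \<partial>lborel)"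
            by (rule nn_integral_cmult) (use b_meas in simp)
          finally show ?thesis using True by simp
        qed simp
      qed
      also have "\<dots> = ennreal A * I"
      proof -
        \<comment> \<open>Outside the chart image nothing is known about \<open>chart_inv\<close>,
          so joint measurability is shown for the integrand cut off by
          \<open>indicator (chart_img c)\<close>, which changes nothing on the box.\<close>
        have "(\<lambda>x. f (chart_inv c x) * ennreal (vol_density c x) * indicator (chart_img c) x) \<in> borel_measurable borel"
          using measurable_compose[OF measurable_chart_inv[OF c] f_meas] measurable_vol_density[OF c]
            chart_img_borel[OF c] borel_measurable_restrict_space_iff_ennreal[of "chart_img c" borel
              "\<lambda>x. f (chart_inv c x) * ennreal (vol_density c x)"]
          by simp
        then have "(\<lambda>w. f (chart_inv c (?b (fst w) (snd w))) * ennreal (vol_density c (?b (fst w) (snd w))) *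
            indicator (chart_img c) (?b (fst w) (snd w))) \<in> borel_measurable (borel :: ((real ^ 'n) \<times> real) measure)"
          by (rule measurable_compose[rotated])
            (intro borel_measurable_continuous_onI continuous_on_box_map continuous_intros)
        then have [measurable]: "(\<lambda>(y, t). f (chart_inv c (?b y t)) * ennreal (vol_density c (?b y t)) *
            indicator (chart_img c) (?b y t)) \<in> borel_measurable (borel \<Otimes>\<^sub>M borel)"
          by (simp add: borel_prod case_prod_beta')
        have "(\<lambda>y. (\<integral>\<^sup>+t. f (chart_inv c (?b y t)) * ennreal (vol_density c (?b y t)) * indicator (chart_img c) (?b y t) * indicator {0..1} t \<partial>lborel) *
          indicator ?Q y) \<in> borel_measurable borel"
          by measurable
        moreover have "(\<integral>\<^sup>+t. f (chart_inv c (?b y t)) * ennreal (vol_density c (?b y t)) * indicator (chart_img c) (?b y t) * indicator {0..1} t \<partial>lborel) *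
          indicator ?Q y =
          (\<integral>\<^sup>+t. f (chart_inv c (?b y t)) * ennreal (vol_density c (?b y t)) * indicator {0..1} t \<partial>lborel) * indicator ?Q y" for y
        proof (cases "y \<in> ?Q")
          case True
          then have "f (chart_inv c (?b y t)) * ennreal (vol_density c (?b y t)) * indicator (chart_img c) (?b y t) * indicator {0..1} t =
            f (chart_inv c (?b y t)) * ennreal (vol_density c (?b y t)) * indicator {0..1} t" for t
            using in_img(2)[OF True, of t] by (auto simp: indicator_def)
          then show ?thesis by simp
        qed simp
        ultimately have "(\<lambda>y. (\<integral>\<^sup>+t. f (chart_inv c (?b y t)) * ennreal (vol_density c (?b y t)) * indicator {0..1} t \<partial>lborel) *
          indicator ?Q y) \<in> borel_measurable borel"
          by simp
        then show ?thesis
          unfolding I_def by (intro nn_integral_cmult) simp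
      qed
      also have "\<dots> = ennreal (A / s ^ (?n + 1)) * (ennreal (s ^ (?n + 1)) * I)"
        using A s by (simp add: mult.assoc[symmetric] ennreal_mult[symmetric] del: power_Suc)
      also have "\<dots> \<le> ennreal (A / s ^ (?n + 1)) * ennreal (e\<^sup>2)"
        by (intro mult_left_mono I) simp
      also have "\<dots> \<le> ennreal (\<eta>\<^sup>2) * ennreal (e\<^sup>2)"
        unfolding \<eta>(2) by (intro mult_right_mono ennreal_leI) auto
      also have "\<dots> = ennreal ((\<eta> * e)\<^sup>2)"
        by (simp add: ennreal_mult[symmetric] power_mult_distrib)
      finally show ?thesis .
    qed
    have e': "0 < \<eta> * e" using \<eta> e by simp
    note bounds = box_trace_bound[OF g_meas V_meas \<tau> q_def e' energy V0 Vs, folded K1_def K2_def]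
    show "(\<integral>\<^sup>+r. ennreal \<bar>u r - m u\<bar> * indicator ?N r \<partial>vol M) \<le> ennreal (C * e) \<and>
        (\<integral>\<^sup>+r. ennreal (\<bar>u r - m u\<bar> powr p) * indicator ?N r \<partial>bdry_vol M) \<le> ennreal (C * e powr p)"
    proof
      note [measurable] = smooth_fun_measurable[OF u]
      have "(\<integral>\<^sup>+r. ennreal \<bar>u r - m u\<bar> * indicator ?N r \<partial>vol M) = ennreal (s ^ (?n + 1)) *
        (\<integral>\<^sup>+y. (\<integral>\<^sup>+t. ennreal \<bar>W y t - m u\<bar> * ennreal (vol_density c (?b y t)) * indicator {0..1} t \<partial>lborel) * indicator ?Q y \<partial>lborel)"
        unfolding W_def by (rule nn_integral_vol_box[OF c s box]) measurable
      also have "\<dots> \<le> ennreal (s ^ (?n + 1)) *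
        (\<integral>\<^sup>+y. ennreal L * ((\<integral>\<^sup>+t. ennreal \<bar>V y t - m u\<bar> * indicator {0..1} t \<partial>lborel) * indicator ?Q y) \<partial>lborel)"
      proof (intro mult_left_mono nn_integral_mono)
        fix y :: "real ^ 'n"
        show "(\<integral>\<^sup>+t. ennreal \<bar>W y t - m u\<bar> * ennreal (vol_density c (?b y t)) * indicator {0..1} t \<partial>lborel) * indicator ?Q y \<le>
          ennreal L * ((\<integral>\<^sup>+t. ennreal \<bar>V y t - m u\<bar> * indicator {0..1} t \<partial>lborel) * indicator ?Q y)"
        proof (cases "y \<in> ?Q")
          case True
          have Vm: "(\<lambda>t. ennreal \<bar>V y t - m u\<bar> * indicator {0..1} t) \<in> borel_measurable borel"
            using measurable_compose[OF measurable_Pair[OF measurable_const measurable_ident] V_meas, of y] by simp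
          have "(\<integral>\<^sup>+t. ennreal \<bar>W y t - m u\<bar> * ennreal (vol_density c (?b y t)) * indicator {0..1} t \<partial>lborel) \<le>
            (\<integral>\<^sup>+t. ennreal L * (ennreal \<bar>V y t - m u\<bar> * indicator {0..1} t) \<partial>lborel)"
          proof (rule nn_integral_mono)
            fix t :: real
            show "ennreal \<bar>W y t - m u\<bar> * ennreal (vol_density c (?b y t)) * indicator {0..1} t \<le>
              ennreal L * (ennreal \<bar>V y t - m u\<bar> * indicator {0..1} t)"
            proof (cases "t \<in> {0..1}")
              case t: True
              then have "ennreal (vol_density c (?b y t)) \<le> ennreal L"
                by (intro ennreal_leI dens(2) in_img(1)[OF True]) auto
              then have "ennreal \<bar>V y t - m u\<bar> * ennreal (vol_density c (?b y t)) \<le> ennreal \<bar>V y t - m u\<bar> * ennreal L"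
                by (rule mult_left_mono) simp
              then show ?thesis
                using t V_eq(1)[OF True, of t] by (simp add: mult.commute)
            qed simp
          qed
          also have "\<dots> = ennreal L * (\<integral>\<^sup>+t. ennreal \<bar>V y t - m u\<bar> * indicator {0..1} t \<partial>lborel)"
            by (rule nn_integral_cmult) (use Vm in simp)
          finally show ?thesis using True by simp
        qed simp
      qed simp
      also have "\<dots> = ennreal (s ^ (?n + 1)) * (ennreal L *
          (\<integral>\<^sup>+y. (\<integral>\<^sup>+t. ennreal \<bar>V y t - m u\<bar> * indicator {0..1} t \<partial>lborel) * indicator ?Q y \<partial>lborel))"
      proof -
        note [measurable] = V_meas
        have "(\<lambda>y. (\<integral>\<^sup>+t. ennreal \<bar>V y t - m u\<bar> * indicator {0..1} t \<partial>lborel) * indicator ?Q y) \<in> borel_measurable borel"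
          by measurable
        then show ?thesis
          by (subst nn_integral_cmult) auto
      qed
      also have "\<dots> \<le> ennreal (s ^ (?n + 1)) * (ennreal L * ennreal (K2 * (\<eta> * e)))"
        by (intro mult_left_mono bounds(2)) simp_all
      also have "\<dots> = ennreal (s ^ (?n + 1) * L * K2 * \<eta> * e)"
        using s lL K \<eta> e by (simp add: ennreal_mult[symmetric] mult.assoc del: power_Suc)
      also have "\<dots> \<le> ennreal (C * e)"
        using C1 e by (intro ennreal_leI mult_right_mono) auto
      finally show "(\<integral>\<^sup>+r. ennreal \<bar>u r - m u\<bar> * indicator ?N r \<partial>vol M) \<le> ennreal (C * e)" .
    next
      note [measurable] = measurable_Bb[OF smooth_fun_measurable[OF u]]
      show "(\<integral>\<^sup>+r. ennreal (\<bar>u r - m u\<bar> powr p) * indicator ?N r \<partial>bdry_vol M) \<le> ennreal (C * e powr p)"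
      proof (cases "0 < z $ None")
        case True
        then show ?thesis
          by (simp add: nn_integral_bdry_box_0[OF c s box True])
      next
        case False
        then have z0: "z $ None = 0" and pq: "p = q"
          using z by (auto simp: q_def)
        have "(\<integral>\<^sup>+r. ennreal (\<bar>u r - m u\<bar> powr p) * indicator ?N r \<partial>bdry_vol M) = ennreal (s ^ ?n) *
          (\<integral>\<^sup>+y. ennreal (\<bar>W y 0 - m u\<bar> powr p) * ennreal (bdry_density c (tang_part z + s *\<^sub>R y)) * indicator ?Q y \<partial>lborel)"
          unfolding W_def by (rule nn_integral_bdry_box[OF c s box z0]) measurable
        also have "\<dots> \<le> ennreal (s ^ ?n) * (\<integral>\<^sup>+y. ennreal Lb * (ennreal (\<bar>V y 0 - m u\<bar> powr q) * indicator ?Q y) \<partial>lborel)"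
        proof (intro mult_left_mono nn_integral_mono)
          fix y :: "real ^ 'n"
          show "ennreal (\<bar>W y 0 - m u\<bar> powr p) * ennreal (bdry_density c (tang_part z + s *\<^sub>R y)) * indicator ?Q y \<le>
            ennreal Lb * (ennreal (\<bar>V y 0 - m u\<bar> powr q) * indicator ?Q y)"
          proof (cases "y \<in> ?Q")
            case True
            have "ennreal (\<bar>V y 0 - m u\<bar> powr q) * ennreal (bdry_density c (tang_part z + s *\<^sub>R y)) \<le>
              ennreal (\<bar>V y 0 - m u\<bar> powr q) * ennreal Lb"
              by (intro mult_left_mono ennreal_leI Lb(2)[OF z0 True]) simp
            then show ?thesis
              using True V_eq(1)[OF True, of 0] pq by (simp add: mult.commute)
          qed simp
        qed simp
        also have "\<dots> = ennreal (s ^ ?n) * (ennreal Lb * (\<integral>\<^sup>+y. ennreal (\<bar>V y 0 - m u\<bar> powr q) * indicator ?Q y \<partial>lborel))"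
        proof -
          have [measurable]: "(\<lambda>y. V y 0) \<in> borel_measurable borel"
            using measurable_compose[OF measurable_Pair[OF measurable_ident measurable_const] V_meas, of 0] by simp
          have "(\<lambda>y. ennreal (\<bar>V y 0 - m u\<bar> powr q) * indicator ?Q y) \<in> borel_measurable borel"
            by measurable
          then show ?thesis
            by (subst nn_integral_cmult) auto
        qed
        also have "\<dots> \<le> ennreal (s ^ ?n) * (ennreal Lb * ennreal (K1 * (\<eta> * e) powr q))"
          by (intro mult_left_mono bounds(1)) simp_all
        also have "\<dots> = ennreal (s ^ ?n * Lb * K1 * \<eta> powr q * e powr p)"
          using s Lb(1) K \<eta> e by (simp add: ennreal_mult[symmetric] mult.assoc powr_mult pq)
        also have "\<dots> \<le> ennreal (C * e powr p)"
          using C2 by (intro ennreal_leI mult_right_mono) auto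
        finally show ?thesis .
      qed
    qed
  qed
  with C0 show ?thesis by blast
qed

end

section \<open>Adapted boxes\<close>

context riem_mfd
begin

lemma has_derivative_vertical:
  assumes u: "smooth_fun M u" and c: "c \<in> At" and box: "box_img z s \<subseteq> chart_img c"
    and y: "y \<in> unit_cube" and t: "0 \<le> t" "t \<le> 1"
  shows "((\<lambda>t. u (chart_inv c (box_map z s y t))) has_derivative
    (\<lambda>h. h * (s * (chart_grad c u (box_map z s y t) $ None)))) (at t within {0..1})"
proof -
  let ?d = "s *\<^sub>R axis None 1 :: 'n model"
  define a where "a = box_map z s y 0"
  have eq: "box_map z s y t = a + t *\<^sub>R ?d" for t
    by (simp add: vec_eq_iff split_option_all axis_def a_def)
  have der: "(box_map z s y has_derivative (\<lambda>h. h *\<^sub>R ?d)) (at t within {0..1})"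
    unfolding eq[abs_def] by (auto intro!: derivative_eq_intros)
  have in_img: "box_map z s y t \<in> chart_img c" if "t \<in> {0..1}" for t
    using box_map_in[OF y, of t z s] that box by auto
  then have half: "box_map z s y ` {0..1} \<subseteq> half_space"
    using chart_img_half_space[OF c] by blast
  have "(u \<circ> chart_inv c has_derivative (\<lambda>v. chart_grad c u (box_map z s y t) \<bullet> v)) (at (box_map z s y t) within box_map z s y ` {0..1})"
    by (rule has_derivative_subset[OF has_derivative_chart_grad[OF u c in_img] half]) (use t in simp)
  from diff_chain_within[OF der this] show ?thesis
    by (simp add: o_def inner_axis mult.assoc)
qed

text \<open>Along the boundary u is constantly 0. For \<open>\<rho>\<close> this leaves only the
  normal component of the differential, so that a nonzero gradient becomes a nonzero normal
  derivative.\<close>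

lemma chart_grad_tangential:
  assumes u: "smooth_fun M u" and c: "c \<in> At" and zero: "\<And>q. q \<in> mfd_bdry M \<Longrightarrow> u q = 0"
    and y: "y \<in> bdry_img c"
  shows "chart_grad c u (bdry_pt y) $ Some i = 0"
proof -
  have x: "bdry_pt y \<in> chart_img c"
    using y by (simp add: bdry_img_def)
  have "(u \<circ> chart_inv c has_derivative (\<lambda>v. chart_grad c u (bdry_pt y) \<bullet> v)) (at (bdry_pt y) within range bdry_pt)"
    by (rule has_derivative_subset[OF has_derivative_chart_grad[OF u c x]]) auto
  from diff_chain_within[OF bounded_linear_imp_has_derivative[OF bounded_linear_bdry_pt] this]
  have "(u \<circ> chart_inv c \<circ> bdry_pt has_derivative (\<lambda>v. chart_grad c u (bdry_pt y) \<bullet> v) \<circ> bdry_pt) (at y)" .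
  moreover have "(u \<circ> chart_inv c \<circ> bdry_pt has_derivative (\<lambda>w. 0)) (at y)"
  proof (rule has_derivative_transform_within_open[OF has_derivative_const[of 0] open_bdry_img[OF c] y])
    fix w assume "w \<in> bdry_img c"
    then have "bdry_inv c w \<in> mfd_bdry M"
      using bdry_inv_mem[OF c] by blast
    then show "0 = (u \<circ> chart_inv c \<circ> bdry_pt) w"
      using zero by (simp add: bdry_inv_def)
  qed
  ultimately have "(\<lambda>v. chart_grad c u (bdry_pt y) \<bullet> v) \<circ> bdry_pt = (\<lambda>w. 0)"
    by (rule has_derivative_unique)
  then have "chart_grad c u (bdry_pt y) \<bullet> bdry_pt (axis i 1) = 0"
    by (metis comp_apply)
  then show ?thesis
    by (simp add: inner_commute[of _ "bdry_pt (axis i 1)"] inner_bdry_pt inner_axis')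
qed

lemma box_around:
  assumes c: "c \<in> At" and P: "P \<in> fst c" and V: "open V" "snd c P \<in> V"
  obtains z s where "0 < s" "box_img z s \<subseteq> chart_img c \<inter> V"
    "\<exists>U. openin X U \<and> P \<in> U \<and> U \<subseteq> chart_inv c ` box_img z s"
    "0 < z $ None \<or> z $ None = 0" "z $ None = 0 \<longleftrightarrow> snd c P $ None = 0"
proof -
  let ?x = "snd c P"
  have x_half: "0 \<le> ?x $ None"
    using chart_half_space[OF c P] by (simp add: half_space_def)
  obtain U where U: "open U" "chart_img c = half_space \<inter> U"
    using openin_chart_img[OF c] by (auto simp: openin_open)
  have "open (U \<inter> V)" "?x \<in> U \<inter> V"
    using U V chart_in_img[OF P] by auto
  then obtain r where r: "0 < r" "ball ?x r \<subseteq> U \<inter> V"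
    using open_contains_ball by blast
  let ?N = "real (CARD('n) + 1)"
  \<comment> \<open>With r / (4 N) the box of side 2 \<delta> stays in the ball of radius r, the
    norm being estimated by the sum of N coordinates; half of the height of P keeps it off the
    boundary when P is an interior point.\<close>
  define \<delta> where "\<delta> = (if ?x $ None = 0 then r / (4 * ?N) else min (r / (4 * ?N)) (?x $ None / 2))"
  have \<delta>: "0 < \<delta>" "\<delta> \<le> r / (4 * ?N)"
    using r x_half by (auto simp: \<delta>_def)
  \<comment> \<open>For a boundary point the box has to rest on the boundary, so its corner has
    normal coordinate 0 instead of -\<delta>.\<close>
  define z where "z = (\<chi> a. if a = None \<and> ?x $ None = 0 then 0 else ?x $ a - \<delta>)"
  have z_Some: "z $ Some i = ?x $ Some i - \<delta>" for i
    by (simp add: z_def)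
  have z_None: "z $ None = 0 \<and> ?x $ None = 0 \<or> 0 < z $ None \<and> z $ None = ?x $ None - \<delta> \<and> ?x $ None \<noteq> 0"
  proof (cases "?x $ None = 0")
    case False
    then have "0 < ?x $ None" "\<delta> \<le> ?x $ None / 2"
      using x_half unfolding \<delta>_def by (simp, simp only: if_False min.cobounded2)
    then have "0 < ?x $ None - \<delta>" by linarith
    then show ?thesis
      using False by (simp add: z_def)
  qed (simp add: z_def)
  have near: "box_map z (2 * \<delta>) y t \<in> ball ?x r \<and> box_map z (2 * \<delta>) y t \<in> half_space"
    if y: "y \<in> unit_cube" and t: "0 \<le> t" "t \<le> 1" for y t
  proof
    let ?b = "box_map z (2 * \<delta>) y t"
    have comp: "\<bar>(?b - ?x) $ a\<bar> \<le> 2 * \<delta>" for a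
    proof (cases a)
      case None
      have "0 \<le> 2 * \<delta> * t" "2 * \<delta> * t \<le> 2 * \<delta>"
        using \<delta> t by (auto simp: mult_left_le)
      then show ?thesis
        using z_None None by auto
    next
      case (Some i)
      have "0 \<le> 2 * \<delta> * y $ i" "2 * \<delta> * y $ i \<le> 2 * \<delta>"
        using \<delta> y by (auto simp: mult_left_le mem_unit_cube)
      then show ?thesis
        using Some z_Some[of i] by auto
    qed
    have "norm (?b - ?x) \<le> (\<Sum>a\<in>UNIV. \<bar>(?b - ?x) $ a\<bar>)"
      by (rule norm_le_l1_cart)
    also have "\<dots> \<le> (\<Sum>a\<in>(UNIV :: 'n option set). 2 * \<delta>)"
      by (intro sum_mono comp)
    also have "\<dots> = ?N * (2 * \<delta>)"
      by simp
    also have "\<dots> \<le> ?N * (2 * (r / (4 * ?N)))"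
      using \<delta>(2) by (intro mult_left_mono) auto
    also have "\<dots> = r / 2"
    proof -
      have *: "N * (2 * (r / (4 * N))) = r / 2" if "N \<noteq> 0" for N :: real
        using that by simp
      show ?thesis
        by (rule *) simp
    qed
    also have "\<dots> < r"
      using r by simp
    finally show "?b \<in> ball ?x r"
      by (simp add: dist_norm norm_minus_commute)
    have "0 \<le> 2 * \<delta> * t"
      using \<delta> t by simp
    then show "?b \<in> half_space"
      using z_None by (auto simp: half_space_def)
  qed
  let ?W = "{x. \<forall>a. \<bar>x $ a - ?x $ a\<bar> < \<delta>}"
  have "open ?W"
  proof -
    have "?W = (\<Inter>a\<in>UNIV. {x. \<bar>x $ a - ?x $ a\<bar> < \<delta>})"
      by auto
    moreover have "open {x :: 'n model. \<bar>x $ a - ?x $ a\<bar> < \<delta>}" for a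
      by (intro open_Collect_less continuous_intros)
    ultimately show ?thesis
      by (auto intro: open_INT)
  qed
  then have O1: "openin X {p \<in> fst c. snd c p \<in> ?W}"
    by (rule openin_chart_preimage[OF c])
  have O2: "P \<in> {p \<in> fst c. snd c p \<in> ?W}"
    using P \<delta> by simp
  have O3: "{p \<in> fst c. snd c p \<in> ?W} \<subseteq> chart_inv c ` box_img z (2 * \<delta>)"
  proof
    fix p assume "p \<in> {p \<in> fst c. snd c p \<in> ?W}"
    then have p: "p \<in> fst c" and W: "\<And>a. \<bar>snd c p $ a - ?x $ a\<bar> < \<delta>"
      by auto
    let ?y = "snd c p"
    have y_half: "0 \<le> ?y $ None"
      using chart_half_space[OF c p] by (simp add: half_space_def)
    define y where "y = (\<chi> i. (?y $ Some i - z $ Some i) / (2 * \<delta>))"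
    define t where "t = (?y $ None - z $ None) / (2 * \<delta>)"
    have "?y = box_map z (2 * \<delta>) y t"
      using \<delta> by (simp add: vec_eq_iff split_option_all y_def t_def)
    moreover have "y \<in> unit_cube"
      unfolding mem_unit_cube
    proof
      fix i
      have "0 \<le> ?y $ Some i - z $ Some i" "?y $ Some i - z $ Some i \<le> 2 * \<delta>"
        using W[of "Some i"] z_Some[of i] by linarith+
      then show "0 \<le> y $ i \<and> y $ i \<le> 1"
        using \<delta> by (simp add: y_def)
    qed
    moreover have "0 \<le> t" "t \<le> 1"
    proof -
      have "0 \<le> ?y $ None - z $ None" "?y $ None - z $ None \<le> 2 * \<delta>"
        using W[of None] z_None y_half \<delta> by linarith+
      then show "0 \<le> t" "t \<le> 1"
        using \<delta> by (simp_all add: t_def)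
    qed
    ultimately have "?y \<in> box_img z (2 * \<delta>)"
      by (simp add: box_map_in)
    then show "p \<in> chart_inv c ` box_img z (2 * \<delta>)"
      using c p by (intro image_eqI[of _ _ ?y]) auto
  qed
  show ?thesis
  proof (rule that[of "2 * \<delta>" z])
    show "box_img z (2 * \<delta>) \<subseteq> chart_img c \<inter> V"
      using near r(2) U(2) unfolding box_img_def by blast
    show "\<exists>U. openin X U \<and> P \<in> U \<and> U \<subseteq> chart_inv c ` box_img z (2 * \<delta>)"
      using O1 O2 O3 by blast
  qed (use \<delta> z_None in auto)
qed

text \<open>The exponent 1 - 2 \<sigma> may have either sign, so the two constants may swap roles;
  minimum and maximum cover both cases.\<close>

lemma powr_comparison:
  fixes a :: real
  assumes "0 < c1" "0 < t" "c1 * t \<le> r" "r \<le> c2 * t"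
  shows "min (c1 powr a) (c2 powr a) * t powr a \<le> r powr a"
    "r powr a \<le> max (c1 powr a) (c2 powr a) * t powr a"
proof -
  have c2: "0 < c2"
  proof -
    have "0 < c1 * t" using assms by simp
    then have "0 < c2 * t" using assms by linarith
    then show ?thesis using assms(2) by (simp add: zero_less_mult_iff)
  qed
  have r: "0 < r" using assms(3) mult_pos_pos[OF assms(1,2)] by linarith
  have eq: "c1 powr a * t powr a = (c1 * t) powr a" "c2 powr a * t powr a = (c2 * t) powr a"
    using assms c2 by (simp_all add: powr_mult)
  have "min (c1 powr a) (c2 powr a) * t powr a \<le> r powr a \<and> r powr a \<le> max (c1 powr a) (c2 powr a) * t powr a"
  proof (cases "0 \<le> a")
    case True
    have "(c1 * t) powr a \<le> r powr a" "r powr a \<le> (c2 * t) powr a"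
      using True assms r by (auto intro!: powr_mono2)
    moreover have "min (c1 powr a) (c2 powr a) * t powr a \<le> c1 powr a * t powr a"
      "c2 powr a * t powr a \<le> max (c1 powr a) (c2 powr a) * t powr a"
      by (intro mult_right_mono; simp)+
    ultimately show ?thesis
      unfolding eq by linarith
  next
    case False
    have "(c2 * t) powr a \<le> r powr a" "r powr a \<le> (c1 * t) powr a"
      using False assms r by (auto intro!: powr_mono2')
    moreover have "min (c1 powr a) (c2 powr a) * t powr a \<le> c2 powr a * t powr a"
      "c1 powr a * t powr a \<le> max (c1 powr a) (c2 powr a) * t powr a"
      by (intro mult_right_mono; simp)+
    ultimately show ?thesis
      unfolding eq by linarith
  qed
  then show "min (c1 powr a) (c2 powr a) * t powr a \<le> r powr a"
    "r powr a \<le> max (c1 powr a) (c2 powr a) * t powr a"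
    by auto
qed

text \<open>Comparability of the weight with a power of the height in box coordinates: from below
  for the trace inequality, from above for the finiteness of energies.\<close>

definition adapted_box ::
    "('a \<Rightarrow> real) \<Rightarrow> real \<Rightarrow> ('a, 'n) chart \<Rightarrow> 'n model \<Rightarrow> real \<Rightarrow> real \<Rightarrow> real \<Rightarrow> real \<Rightarrow> bool" where
  "adapted_box \<rho> \<sigma> c z s \<tau> \<kappa> \<kappa>' \<longleftrightarrow> c \<in> At \<and> 0 < s \<and> box_img z s \<subseteq> chart_img c \<and>
     0 < \<tau> \<and> \<tau> < 1 \<and> 0 < \<kappa> \<and> (0 < z $ None \<or> z $ None = 0 \<and> \<tau> = \<sigma>) \<and>
     (\<forall>y t. y \<in> unit_cube \<longrightarrow> 0 < t \<longrightarrow> t < 1 \<longrightarrow>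
       \<kappa> * t powr (1 - 2 * \<tau>) \<le> \<rho> (chart_inv c (box_map z s y t)) powr (1 - 2 * \<sigma>) \<and>
       \<rho> (chart_inv c (box_map z s y t)) powr (1 - 2 * \<sigma>) \<le> \<kappa>' * t powr (1 - 2 * \<tau>))"

text \<open>Near an interior point \<open>\<rho>\<close> lies between positive constants. Near a
  boundary point it vanishes exactly to first order, because its normal derivative is not 0, so it
  is comparable to the height.\<close>

lemma ex_adapted_box:
  assumes \<rho>: "defining_function M \<rho>" and \<sigma>: "0 < \<sigma>" "\<sigma> < 1" and P: "P \<in> mfd_pts M"
  obtains c z s \<tau> \<kappa> \<kappa>' U where "adapted_box \<rho> \<sigma> c z s \<tau> \<kappa> \<kappa>'"
    "openin X U" "P \<in> U" "U \<subseteq> chart_inv c ` box_img z s"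
proof -
  have \<rho>_smooth: "smooth_fun M \<rho>" and \<rho>_pos: "\<And>q. q \<in> mfd_pts M \<Longrightarrow> q \<notin> mfd_bdry M \<Longrightarrow> 0 < \<rho> q"
    and \<rho>_zero: "\<And>q. q \<in> mfd_bdry M \<Longrightarrow> \<rho> q = 0"
    and \<rho>_grad: "\<And>q. q \<in> mfd_bdry M \<Longrightarrow> gradient M \<rho> (chart_at M q) q \<noteq> 0"
    using \<rho> unfolding defining_function_def by auto
  define c where "c = chart_at M P"
  have c: "c \<in> At" "P \<in> fst c"
    using chart_at[OF P] by (auto simp: c_def)
  have cont: "continuous_on (chart_img c) (\<lambda>x. \<rho> (chart_inv c x))"
    using smooth_on_imp_continuous_on[OF smooth_funD[OF \<rho>_smooth c(1)]] by (simp add: o_def)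
  have pos: "0 < \<rho> (chart_inv c x)" if "x \<in> chart_img c" "0 < x $ None" for x
  proof (rule \<rho>_pos)
    show "chart_inv c x \<in> mfd_pts M"
      using chart_subset[OF c(1)] chart_inv_in[OF that(1)] by blast
    show "chart_inv c x \<notin> mfd_bdry M"
      using mem_bdry_iff[OF c(1) chart_inv_in[OF that(1)]] that by simp
  qed
  show ?thesis
  proof (cases "snd c P $ None = 0")
    case False
    obtain z s where s: "0 < s" and box: "box_img z s \<subseteq> chart_img c \<inter> UNIV"
      and U: "\<exists>U. openin X U \<and> P \<in> U \<and> U \<subseteq> chart_inv c ` box_img z s"
      and z: "0 < z $ None \<or> z $ None = 0" "z $ None = 0 \<longleftrightarrow> snd c P $ None = 0"
      by (rule box_around[OF c open_UNIV UNIV_I]) (rule that)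
    have z0: "0 < z $ None" using z False by simp
    have box': "box_img z s \<subseteq> chart_img c" using box by simp
    have comp: "compact (box_img z s)" by (rule compact_box_img)
    have ne: "box_img z s \<noteq> {}"
      using box_map_in[of 0 0 z s] by (auto simp: mem_unit_cube)
    have cont': "continuous_on (box_img z s) (\<lambda>x. \<rho> (chart_inv c x))"
      by (rule continuous_on_subset[OF cont box'])
    obtain a where a: "a \<in> box_img z s" "\<And>x. x \<in> box_img z s \<Longrightarrow> \<rho> (chart_inv c a) \<le> \<rho> (chart_inv c x)"
      using continuous_attains_inf[OF comp ne cont'] by blast
    obtain b where b: "b \<in> box_img z s" "\<And>x. x \<in> box_img z s \<Longrightarrow> \<rho> (chart_inv c x) \<le> \<rho> (chart_inv c b)"
      using continuous_attains_sup[OF comp ne cont'] by blast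
    have box_pos: "0 < \<rho> (chart_inv c x)" if x: "x \<in> box_img z s" for x
    proof (rule pos)
      show "x \<in> chart_img c" using x box' by blast
      obtain y t where "0 \<le> t" "x = box_map z s y t"
        using x unfolding box_img_def by blast
      then show "0 < x $ None"
        using z0 s by (simp add: add_pos_nonneg)
    qed
    let ?m = "\<rho> (chart_inv c a)" and ?M = "\<rho> (chart_inv c b)" and ?e = "1 - 2 * \<sigma>"
    \<comment> \<open>For \<tau> = 1/2 the exponent 1 - 2 \<tau> is 0, which expresses a weight
      bounded above and below.\<close>
    have "adapted_box \<rho> \<sigma> c z s (1 / 2) (min (?m powr ?e) (?M powr ?e)) (max (?m powr ?e) (?M powr ?e))"
      unfolding adapted_box_def
    proof (intro conjI allI impI)
      show "0 < min (?m powr ?e) (?M powr ?e)"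
        using box_pos[OF a(1)] box_pos[OF b(1)] by simp
      fix y :: "real ^ 'n" and t :: real
      assume y: "y \<in> unit_cube" and t: "0 < t" "t < 1"
      let ?r = "\<rho> (chart_inv c (box_map z s y t))"
      have x: "box_map z s y t \<in> box_img z s"
        using y t by (intro box_map_in) auto
      have "?m * 1 \<le> ?r" "?r \<le> ?M * 1"
        using a(2)[OF x] b(2)[OF x] by simp_all
      from powr_comparison[OF box_pos[OF a(1)] zero_less_one this, of ?e]
      show "min (?m powr ?e) (?M powr ?e) * t powr (1 - 2 * (1 / 2)) \<le> ?r powr ?e"
        "?r powr ?e \<le> max (?m powr ?e) (?M powr ?e) * t powr (1 - 2 * (1 / 2))"
        using t by simp_all
    qed (use c s box' z0 in auto)
    then show ?thesis
      using U that by blast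
  next
    case True
    have P_bdry: "P \<in> mfd_bdry M"
      using True mem_bdry_iff[OF c] by simp
    define h where "h x = chart_grad c \<rho> x $ None" for x
    define h0 where "h0 = h (snd c P)"
    have h_cont: "continuous_on (chart_img c) h"
      unfolding h_def by (intro continuous_on_component continuous_on_chart_grad[OF \<rho>_smooth c(1)])
    have h0: "h0 \<noteq> 0"
    proof
      assume "h0 = 0"
      have y: "bdry_pt (tang_part (snd c P)) = snd c P"
        by (rule bdry_pt_tang_part[OF True])
      then have "chart_grad c \<rho> (snd c P) $ Some i = 0" for i
        using chart_grad_tangential[OF \<rho>_smooth c(1) \<rho>_zero, of "tang_part (snd c P)" i] c(2)
        by (simp add: bdry_img_def)
      then have "chart_grad c \<rho> (snd c P) = 0"
        using \<open>h0 = 0\<close> by (simp add: vec_eq_iff split_option_all h0_def h_def)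
      then have "gradient M \<rho> c P = 0"
        unfolding gradient_eq by simp
      then show False
        using \<rho>_grad[OF P_bdry] by (simp add: c_def)
    qed
    \<comment> \<open>The box is shrunk until the normal derivative of \<open>\<rho>\<close> differs
      from its value at P by less than half the absolute value, so that it keeps its sign and
      size.\<close>
    have "openin (top_of_set (chart_img c)) (chart_img c \<inter> h -` {h0 - \<bar>h0\<bar> / 2<..<h0 + \<bar>h0\<bar> / 2})"
      by (rule continuous_openin_preimage_gen[OF h_cont]) simp
    then obtain V where V: "open V" "chart_img c \<inter> h -` {h0 - \<bar>h0\<bar> / 2<..<h0 + \<bar>h0\<bar> / 2} = chart_img c \<inter> V"
      by (auto simp: openin_open)
    have "snd c P \<in> V"
    proof -
      have "snd c P \<in> chart_img c \<inter> h -` {h0 - \<bar>h0\<bar> / 2<..<h0 + \<bar>h0\<bar> / 2}"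
        using h0 c by (simp add: h0_def)
      then show ?thesis unfolding V(2) by blast
    qed
    with V(1) obtain z s where s: "0 < s" and box: "box_img z s \<subseteq> chart_img c \<inter> V"
      and U: "\<exists>U. openin X U \<and> P \<in> U \<and> U \<subseteq> chart_inv c ` box_img z s"
      and z: "0 < z $ None \<or> z $ None = 0" "z $ None = 0 \<longleftrightarrow> snd c P $ None = 0"
      by (rule box_around[OF c]) (rule that)
    have z0: "z $ None = 0" using z(2) True by simp
    have box': "box_img z s \<subseteq> chart_img c" using box by simp
    have h_near: "h0 - \<bar>h0\<bar> / 2 < h x" "h x < h0 + \<bar>h0\<bar> / 2" if "x \<in> box_img z s" for x
    proof -
      have "x \<in> chart_img c \<inter> V" using that box by blast
      then have "x \<in> chart_img c \<inter> h -` {h0 - \<bar>h0\<bar> / 2<..<h0 + \<bar>h0\<bar> / 2}"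
        by (simp only: V(2))
      then show "h0 - \<bar>h0\<bar> / 2 < h x" "h x < h0 + \<bar>h0\<bar> / 2"
        by auto
    qed
    \<comment> \<open>Mean value theorem on the vertical segment that starts on the boundary, where
      \<open>\<rho>\<close> is 0.\<close>
    have mvt: "\<exists>x\<in>box_img z s. \<rho> (chart_inv c (box_map z s y t)) = t * (s * h x)"
      if y: "y \<in> unit_cube" and t: "0 < t" "t \<le> 1" for y t
    proof -
      have b0: "\<rho> (chart_inv c (box_map z s y 0)) = 0"
      proof (rule \<rho>_zero)
        have "box_map z s y 0 \<in> chart_img c"
          using box_map_in[OF y, of 0 z s] box' by auto
        then show "chart_inv c (box_map z s y 0) \<in> mfd_bdry M"
          using mem_bdry_iff[OF c(1), of "chart_inv c (box_map z s y 0)"] z0 by simp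
      qed
      have "\<exists>x\<in>{0<..<t}. \<rho> (chart_inv c (box_map z s y t)) - \<rho> (chart_inv c (box_map z s y 0)) =
          (\<lambda>h'. h' * (s * (chart_grad c \<rho> (box_map z s y x) $ None))) (t - 0)"
      proof (rule mvt_simple[OF t(1)])
        show "((\<lambda>t. \<rho> (chart_inv c (box_map z s y t))) has_derivative
            (\<lambda>h'. h' * (s * (chart_grad c \<rho> (box_map z s y x) $ None)))) (at x within {0..t})"
          if "0 \<le> x" "x \<le> t" for x
          by (rule has_derivative_subset[OF has_derivative_vertical[OF \<rho>_smooth c(1) box' y]])
            (use that t in auto)
      qed
      then obtain x where x: "x \<in> {0<..<t}" "\<rho> (chart_inv c (box_map z s y t)) = t * (s * h (box_map z s y x))"
        using b0 by (auto simp: h_def)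
      moreover have "box_map z s y x \<in> box_img z s"
        using x t y by (intro box_map_in) auto
      ultimately show ?thesis by blast
    qed
    \<comment> \<open>The definition of a defining function does not give this sign directly; it
      follows from \<open>\<rho>\<close> being positive at a point on the top face.\<close>
    have h0_pos: "0 < h0"
    proof -
      have y0: "0 \<in> (unit_cube :: (real ^ 'n) set)"
        by (simp add: mem_unit_cube)
      obtain x where x: "x \<in> box_img z s" "\<rho> (chart_inv c (box_map z s 0 1)) = 1 * (s * h x)"
        using mvt[OF y0, of 1] by auto
      have "0 < \<rho> (chart_inv c (box_map z s 0 1))"
        using box_map_in[OF y0, of 1 z s] box' s z0 by (intro pos) auto
      then have "0 < h x"
        using x s by (simp add: zero_less_mult_iff)
      then show ?thesis
        using h_near(2)[OF x(1)] by (auto simp: abs_if split: if_splits)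
    qed
    let ?c1 = "s * (h0 / 2)" and ?c2 = "s * (2 * h0)" and ?e = "1 - 2 * \<sigma>"
    have c1: "0 < ?c1" using s h0_pos by simp
    have "adapted_box \<rho> \<sigma> c z s \<sigma> (min (?c1 powr ?e) (?c2 powr ?e)) (max (?c1 powr ?e) (?c2 powr ?e))"
      unfolding adapted_box_def
    proof (intro conjI allI impI)
      show "0 < min (?c1 powr ?e) (?c2 powr ?e)"
        using s h0_pos by simp
      fix y :: "real ^ 'n" and t :: real
      assume y: "y \<in> unit_cube" and t: "0 < t" "t < 1"
      let ?r = "\<rho> (chart_inv c (box_map z s y t))"
      obtain x where x: "x \<in> box_img z s" "?r = t * (s * h x)"
        using mvt[OF y t(1)] t by auto
      have "h0 / 2 \<le> h x" "h x \<le> 2 * h0"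
        using h_near[OF x(1)] h0_pos by auto
      then have "t * (s * (h0 / 2)) \<le> t * (s * h x)" "t * (s * h x) \<le> t * (s * (2 * h0))"
        using s t by (auto intro!: mult_left_mono)
      then have "?c1 * t \<le> ?r" "?r \<le> ?c2 * t"
        unfolding x(2) by (simp_all add: mult_ac)
      from powr_comparison[OF c1 t(1) this, of ?e]
      show "min (?c1 powr ?e) (?c2 powr ?e) * t powr ?e \<le> ?r powr ?e"
        "?r powr ?e \<le> max (?c1 powr ?e) (?c2 powr ?e) * t powr ?e"
        by simp_all
    qed (use c s box' z0 \<sigma> in auto)
    then show ?thesis
      using U that by blast
  qed
qed

end

section \<open>From boxes to the whole manifold\<close>

section \<open>Finiteness and positivity\<close>

context riem_mfd
begin

lemma adapted_box_finite:
  assumes ab: "adapted_box \<rho> \<sigma> c z s \<tau> \<kappa> \<kappa>'" and \<rho>: "\<rho> \<in> borel_measurable Bm"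
  defines "N \<equiv> chart_inv c ` box_img z s"
  shows "(\<integral>\<^sup>+q. indicator N q \<partial>vol M) < \<infinity>"
    and "(\<integral>\<^sup>+q. indicator N q \<partial>bdry_vol M) < \<infinity>"
    and "smooth_fun M u \<Longrightarrow>
      (\<integral>\<^sup>+q. ennreal (\<rho> q powr (1 - 2 * \<sigma>) * vnorm_sq M (gradient M u) q) * indicator N q \<partial>vol M) < \<infinity>"
proof -
  have c: "c \<in> At" and s: "0 < s" and box: "box_img z s \<subseteq> chart_img c" and \<tau>: "0 < \<tau>" "\<tau> < 1"
    and z: "0 < z $ None \<or> z $ None = 0"
    and upper: "\<And>y t. y \<in> unit_cube \<Longrightarrow> 0 < t \<Longrightarrow> t < 1 \<Longrightarrow>
      \<rho> (chart_inv c (box_map z s y t)) powr (1 - 2 * \<sigma>) \<le> \<kappa>' * t powr (1 - 2 * \<tau>)"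
    using ab unfolding adapted_box_def by blast+
  let ?Q = "unit_cube :: (real ^ 'n) set"
  obtain l L where lL: "0 < l" "0 < L"
    and grad: "\<And>u x. smooth_fun M u \<Longrightarrow> x \<in> box_img z s \<Longrightarrow>
      l * (norm (chart_grad c u x))\<^sup>2 \<le> vnorm_sq M (gradient M u) (chart_inv c x)"
      "\<And>u x. smooth_fun M u \<Longrightarrow> x \<in> box_img z s \<Longrightarrow>
      vnorm_sq M (gradient M u) (chart_inv c x) \<le> L * (norm (chart_grad c u x))\<^sup>2"
    and dens: "\<And>x. x \<in> box_img z s \<Longrightarrow> l \<le> vol_density c x" "\<And>x. x \<in> box_img z s \<Longrightarrow> vol_density c x \<le> L"
    by (rule box_bounds[OF c box]) (rule that)
  \<comment> \<open>One estimate for volume and energy: the exponent a is 1 for the former and 2 - 2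
    \<tau> for the latter.\<close>
  have bound: "(\<integral>\<^sup>+q. f q * indicator N q \<partial>vol M) < \<infinity>"
    if f: "f \<in> borel_measurable Bm" and a: "0 < a" and D: "0 \<le> D"
      and le: "\<And>y t. y \<in> ?Q \<Longrightarrow> 0 < t \<Longrightarrow> t < 1 \<Longrightarrow> f (chart_inv c (box_map z s y t)) \<le> ennreal (D * t powr (a - 1))" for f a D
  proof -
    have inner: "(\<integral>\<^sup>+t. f (chart_inv c (box_map z s y t)) * ennreal (vol_density c (box_map z s y t)) * indicator {0..1} t \<partial>lborel)
        \<le> ennreal (D * L) * ennreal (1 / a)" if y: "y \<in> ?Q" for y
    proof -
      have "(\<integral>\<^sup>+t. f (chart_inv c (box_map z s y t)) * ennreal (vol_density c (box_map z s y t)) * indicator {0..1} t \<partial>lborel) \<le>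
          (\<integral>\<^sup>+t. ennreal (D * L) * (ennreal (t powr (a - 1)) * indicator {0<..<1} t) \<partial>lborel)"
      proof (rule nn_integral_mono_AE)
        show "AE t in lborel. f (chart_inv c (box_map z s y t)) * ennreal (vol_density c (box_map z s y t)) * indicator {0..1} t
            \<le> ennreal (D * L) * (ennreal (t powr (a - 1)) * indicator {0<..<1} t)"
          using AE_lborel_singleton[of 0] AE_lborel_singleton[of 1]
        proof eventually_elim
          case (elim t)
          show ?case
          proof (cases "t \<in> {0..1}")
            case True
            then have t: "0 < t" "t < 1" using elim by auto
            have "f (chart_inv c (box_map z s y t)) * ennreal (vol_density c (box_map z s y t)) \<le>
                ennreal (D * t powr (a - 1)) * ennreal L"
              using t by (intro mult_mono le[OF y] ennreal_leI dens box_map_in[OF y]) auto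
            also have "\<dots> = ennreal (D * L) * ennreal (t powr (a - 1))"
              using D lL by (simp add: ennreal_mult[symmetric] mult_ac)
            finally show ?thesis using t by simp
          qed simp
        qed
      qed
      also have "\<dots> = ennreal (D * L) * (\<integral>\<^sup>+t. ennreal (t powr (a - 1)) * indicator {0<..<1} t \<partial>lborel)"
        by (rule nn_integral_cmult) measurable
      also have "\<dots> \<le> ennreal (D * L) * ennreal (1 / a)"
        using nn_integral_powr_from_0[OF a, of 1] by (intro mult_left_mono) auto
      finally show ?thesis .
    qed
    have "(\<integral>\<^sup>+q. f q * indicator N q \<partial>vol M) \<le> ennreal (s ^ (CARD('n) + 1)) *
        (\<integral>\<^sup>+y. ennreal (D * L) * ennreal (1 / a) * indicator ?Q y \<partial>lborel)"
      unfolding N_def nn_integral_vol_box[OF c s box f]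
    proof (intro mult_left_mono nn_integral_mono)
      show "(\<integral>\<^sup>+t. f (chart_inv c (box_map z s y t)) * ennreal (vol_density c (box_map z s y t)) * indicator {0..1} t \<partial>lborel) *
          indicator ?Q y \<le> ennreal (D * L) * ennreal (1 / a) * indicator ?Q y" for y
        using mult_right_mono[OF inner[of y], of "indicator ?Q y"] by (cases "y \<in> ?Q") simp_all
    qed simp
    also have "\<dots> = ennreal (s ^ (CARD('n) + 1)) * (ennreal (D * L) * ennreal (1 / a))"
      by (simp add: nn_integral_cmult_indicator emeasure_unit_cube)
    also have "\<dots> < \<infinity>"
      by (simp add: ennreal_mult_less_top)
    finally show ?thesis .
  qed
  show "(\<integral>\<^sup>+q. indicator N q \<partial>vol M) < \<infinity>"
    using bound[of "\<lambda>_. 1" 1 1] by simp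
  show "(\<integral>\<^sup>+q. indicator N q \<partial>bdry_vol M) < \<infinity>"
  proof (cases "0 < z $ None")
    case True
    then show ?thesis
      using nn_integral_bdry_box_0[OF c s box True, of "\<lambda>_. 1"] by (simp add: N_def)
  next
    case False
    then have z0: "z $ None = 0" using z by simp
    obtain Lb where Lb: "0 < Lb" "\<And>y. y \<in> ?Q \<Longrightarrow> bdry_density c (tang_part z + s *\<^sub>R y) \<le> Lb"
      by (rule bdry_density_bound[OF c box z0]) (rule that)
    have "(\<integral>\<^sup>+q. 1 * indicator N q \<partial>bdry_vol M) = ennreal (s ^ CARD('n)) *
      (\<integral>\<^sup>+y. 1 * ennreal (bdry_density c (tang_part z + s *\<^sub>R y)) * indicator ?Q y \<partial>lborel)"
      unfolding N_def by (rule nn_integral_bdry_box[OF c s box z0]) simp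
    also have "\<dots> \<le> ennreal (s ^ CARD('n)) * (\<integral>\<^sup>+y. ennreal Lb * indicator ?Q y \<partial>lborel)"
      using Lb by (intro mult_left_mono nn_integral_mono) (auto simp: indicator_def intro: ennreal_leI)
    also have "\<dots> < \<infinity>"
      by (simp add: nn_integral_cmult_indicator emeasure_unit_cube ennreal_mult_less_top)
    finally show ?thesis by simp
  qed
  assume u: "smooth_fun M u"
  have ne: "box_img z s \<noteq> {}"
    using box_map_in[of 0 0 z s] by (auto simp: mem_unit_cube)
  have "continuous_on (box_img z s) (\<lambda>x. norm (chart_grad c u x))"
    by (intro continuous_on_norm continuous_on_subset[OF continuous_on_chart_grad[OF u c] box])
  then obtain b where b: "\<And>x. x \<in> box_img z s \<Longrightarrow> norm (chart_grad c u x) \<le> norm (chart_grad c u b)"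
    using continuous_attains_sup[OF compact_box_img ne] by blast
  let ?G = "norm (chart_grad c u b)"
  show "(\<integral>\<^sup>+q. ennreal (\<rho> q powr (1 - 2 * \<sigma>) * vnorm_sq M (gradient M u) q) * indicator N q \<partial>vol M) < \<infinity>"
  proof (rule bound)
    show "(\<lambda>q. ennreal (\<rho> q powr (1 - 2 * \<sigma>) * vnorm_sq M (gradient M u) q)) \<in> borel_measurable Bm"
      using \<rho> measurable_vnorm_sq_gradient[OF u] by measurable
    \<comment> \<open>The weight t^(1 - 2 \<tau>) is integrable at 0 because \<tau> < 1.\<close>
    show "0 < 2 - 2 * \<tau>" using \<tau> by simp
    show "0 \<le> \<bar>\<kappa>'\<bar> * (L * ?G\<^sup>2)" using lL by simp
    fix y :: "real ^ 'n" and t :: real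
    assume y: "y \<in> ?Q" and t: "0 < t" "t < 1"
    let ?x = "box_map z s y t"
    have x: "?x \<in> box_img z s" using y t by (intro box_map_in) auto
    have "\<rho> (chart_inv c ?x) powr (1 - 2 * \<sigma>) \<le> \<bar>\<kappa>'\<bar> * t powr (1 - 2 * \<tau>)"
      using upper[OF y t] by (rule order_trans) (intro mult_right_mono, simp_all)
    moreover have "vnorm_sq M (gradient M u) (chart_inv c ?x) \<le> L * ?G\<^sup>2"
      using grad(2)[OF u x] by (rule order_trans) (intro mult_left_mono power_mono b[OF x], use lL in simp_all)
    moreover have "0 \<le> vnorm_sq M (gradient M u) (chart_inv c ?x)"
    proof -
      have "?x \<in> chart_img c"
        using x box by blast
      then show ?thesis
        using chart_subset[OF c] chart_inv_in by (intro vnorm_sq_nonneg) blast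
    qed
    ultimately have "\<rho> (chart_inv c ?x) powr (1 - 2 * \<sigma>) * vnorm_sq M (gradient M u) (chart_inv c ?x) \<le>
        (\<bar>\<kappa>'\<bar> * t powr (1 - 2 * \<tau>)) * (L * ?G\<^sup>2)"
      by (intro mult_mono) auto
    also have "\<dots> = \<bar>\<kappa>'\<bar> * (L * ?G\<^sup>2) * t powr (2 - 2 * \<tau> - 1)"
      by (simp add: mult_ac)
    finally show "ennreal (\<rho> (chart_inv c ?x) powr (1 - 2 * \<sigma>) * vnorm_sq M (gradient M u) (chart_inv c ?x)) \<le>
        ennreal (\<bar>\<kappa>'\<bar> * (L * ?G\<^sup>2) * t powr (2 - 2 * \<tau> - 1))"
      by (rule ennreal_leI)
  qed
qed

text \<open>Positivity comes from a nonempty open subset of the full coordinate space. A relatively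
  open set at a boundary point contains one, as the point can be pushed inward.\<close>

lemma openin_vol_pos:
  assumes U: "openin X U" "P \<in> U"
  shows "0 < (\<integral>\<^sup>+q. indicator U q \<partial>vol M)"
proof -
  have P: "P \<in> mfd_pts M"
    using openin_subset[OF U(1)] U(2) by (auto simp: mfd_pts_def)
  define c where "c = chart_at M P"
  have c: "c \<in> At" "P \<in> fst c"
    using chart_at[OF P] by (auto simp: c_def)
  obtain V where V: "open V" "{x \<in> chart_img c. chart_inv c x \<in> U} = half_space \<inter> V"
    using openin_chart_inv_preimage[OF c(1) U(1)] by (auto simp: openin_open)
  let ?G = "V \<inter> {x. 0 < x $ None}"
  have G: "open ?G"
    by (rule open_Int[OF V(1) open_halfspace_component_gt_cart])
  have G_sub: "?G \<subseteq> {x \<in> chart_img c. chart_inv c x \<in> U}"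
    unfolding V(2) by (auto simp: half_space_def)
  have "snd c P \<in> {x \<in> chart_img c. chart_inv c x \<in> U}"
    using c U(2) by simp
  then have x: "snd c P \<in> V" "0 \<le> snd c P $ None"
    unfolding V(2) by (auto simp: half_space_def)
  obtain r where r: "0 < r" "ball (snd c P) r \<subseteq> V"
    using V(1) x(1) open_contains_ball by blast
  have "snd c P + (r / 2) *\<^sub>R axis None 1 \<in> ball (snd c P) r"
    using r by (simp add: dist_norm norm_axis_1)
  then have "snd c P + (r / 2) *\<^sub>R axis None 1 \<in> ?G"
    using r x by (auto simp: axis_def add_nonneg_pos)
  then have G_ne: "?G \<noteq> {}" by blast
  have U_meas: "(\<lambda>q. indicator U q :: ennreal) \<in> borel_measurable Bm"
    using sets_Bm_openin[OF U(1)] by simp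
  let ?f = "\<lambda>x. indicator U (chart_inv c x) * ennreal (vol_density c x) * indicator (chart_img c) x"
  have f_meas: "?f \<in> borel_measurable lborel"
    using measurable_compose[OF measurable_chart_inv[OF c(1)] U_meas] measurable_vol_density[OF c(1)]
      chart_img_borel[OF c(1)] borel_measurable_restrict_space_iff_ennreal[of "chart_img c" borel
        "\<lambda>x. indicator U (chart_inv c x) * ennreal (vol_density c x)"]
    by simp
  have "(\<integral>\<^sup>+x. ?f x \<partial>lborel) \<noteq> 0"
  proof
    assume "(\<integral>\<^sup>+x. ?f x \<partial>lborel) = 0"
    then have "AE x in lborel. ?f x = 0"
      using f_meas by (simp add: nn_integral_0_iff_AE)
    then have "AE x in lborel. x \<notin> ?G"
    proof eventually_elim
      case (elim x)
      show ?case
      proof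
        assume "x \<in> ?G"
        then have "x \<in> chart_img c" "chart_inv c x \<in> U"
          using G_sub by auto
        then show False
          using elim vol_density_pos[OF c(1), of x] by simp
      qed
    qed
    moreover have "?G \<in> sets lborel"
      using borel_open[OF G] by simp
    ultimately have "?G \<in> null_sets lborel"
      using AE_iff_null_sets by blast
    then have "negligible ?G"
      using negligible_iff_null_sets null_sets_completionI by blast
    then show False
      using open_not_negligible[OF G G_ne] by blast
  qed
  then have "0 < (\<integral>\<^sup>+q. indicator U q * indicator (fst c) q \<partial>vol M)"
    unfolding nn_integral_vol_chart[OF c(1) U_meas] by (simp add: zero_less_iff_neq_zero)
  also have "\<dots> \<le> (\<integral>\<^sup>+q. indicator U q \<partial>vol M)"
    by (intro nn_integral_mono) (simp add: indicator_def)
  finally show ?thesis .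
qed

lemma openin_bdry_vol_pos:
  assumes U: "openin X U" "P \<in> U" and P: "P \<in> mfd_bdry M"
  shows "0 < (\<integral>\<^sup>+q. indicator U q \<partial>bdry_vol M)"
proof -
  define c where "c = chart_at M P"
  have c: "c \<in> At" "P \<in> fst c"
    using chart_at P bdry_subset by (auto simp: c_def)
  let ?G = "{y \<in> bdry_img c. bdry_inv c y \<in> U}"
  have G: "open ?G"
    by (rule open_bdry_preimage[OF c(1) U(1)])
  have "bdry_pt (tang_part (snd c P)) = snd c P"
    using mem_bdry_iff[OF c] P by (intro bdry_pt_tang_part) simp
  then have "tang_part (snd c P) \<in> ?G"
    using c U(2) by (simp add: bdry_img_def bdry_inv_def)
  then have G_ne: "?G \<noteq> {}" by blast
  have U_meas: "(\<lambda>q. indicator U q :: ennreal) \<in> borel_measurable Bb"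
    using sets_Bm_openin[OF U(1)] by (intro measurable_Bb) simp
  let ?f = "\<lambda>y. indicator U (bdry_inv c y) * ennreal (bdry_density c y) * indicator (bdry_img c) y"
  have f_meas: "?f \<in> borel_measurable lborel"
    using measurable_compose[OF measurable_bdry_inv[OF c(1)] U_meas] measurable_bdry_density[OF c(1)]
      borel_open[OF open_bdry_img[OF c(1)]] borel_measurable_restrict_space_iff_ennreal[of "bdry_img c" borel
        "\<lambda>y. indicator U (bdry_inv c y) * ennreal (bdry_density c y)"]
    by simp
  have "(\<integral>\<^sup>+y. ?f y \<partial>lborel) \<noteq> 0"
  proof
    assume "(\<integral>\<^sup>+y. ?f y \<partial>lborel) = 0"
    then have "AE y in lborel. ?f y = 0"
      using f_meas by (simp add: nn_integral_0_iff_AE)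
    then have "AE y in lborel. y \<notin> ?G"
    proof eventually_elim
      case (elim y)
      show ?case
      proof
        assume "y \<in> ?G"
        then show False
          using elim bdry_density_pos[OF c(1), of y] by simp
      qed
    qed
    moreover have "?G \<in> sets lborel"
      using borel_open[OF G] by simp
    ultimately have "?G \<in> null_sets lborel"
      using AE_iff_null_sets by blast
    then have "negligible ?G"
      using negligible_iff_null_sets null_sets_completionI by blast
    then show False
      using open_not_negligible[OF G G_ne] by blast
  qed
  then have "0 < (\<integral>\<^sup>+q. indicator U q * indicator (fst c) q \<partial>bdry_vol M)"
    unfolding nn_integral_bdry_vol_chart[OF c(1) U_meas] by (simp add: zero_less_iff_neq_zero)
  also have "\<dots> \<le> (\<integral>\<^sup>+q. indicator U q \<partial>bdry_vol M)"
    by (intro nn_integral_mono) (simp add: indicator_def)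
  finally show ?thesis .
qed

section \<open>Chaining the local inequalities\<close>

lemma poincare_on_subset:
  assumes "poincare_on \<rho> \<sigma> p N C m" "N' \<subseteq> N" "C \<le> C'"
  shows "poincare_on \<rho> \<sigma> p N' C' m"
  unfolding poincare_on_def
proof (intro allI impI)
  fix u e assume "smooth_fun M u" "0 < (e :: real)" "energy \<rho> \<sigma> u \<le> ennreal (e\<^sup>2)"
  then have *: "(\<integral>\<^sup>+q. ennreal \<bar>u q - m u\<bar> * indicator N q \<partial>vol M) \<le> ennreal (C * e)"
     "(\<integral>\<^sup>+q. ennreal (\<bar>u q - m u\<bar> powr p) * indicator N q \<partial>bdry_vol M) \<le> ennreal (C * e powr p)"
    using assms(1) unfolding poincare_on_def by blast+
  have mono: "(\<integral>\<^sup>+q. f q * indicator N' q \<partial>K) \<le> (\<integral>\<^sup>+q. f q * indicator N q \<partial>K)" for f and K :: "'a measure"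
    using assms(2) by (intro nn_integral_mono mult_left_mono) (auto simp: indicator_def)
  have "ennreal (C * e) \<le> ennreal (C' * e)" "ennreal (C * e powr p) \<le> ennreal (C' * e powr p)"
    using assms(3) \<open>0 < e\<close> by (auto intro!: ennreal_leI mult_right_mono)
  then show "(\<integral>\<^sup>+q. ennreal \<bar>u q - m u\<bar> * indicator N' q \<partial>vol M) \<le> ennreal (C' * e) \<and>
     (\<integral>\<^sup>+q. ennreal (\<bar>u q - m u\<bar> powr p) * indicator N' q \<partial>bdry_vol M) \<le> ennreal (C' * e powr p)"
    using order_trans[OF mono order_trans[OF *(1)]] order_trans[OF mono order_trans[OF *(2)]] by blast
qed

text \<open>Both hypotheses share the same \<open>m\<close>; this is why the constants of different
  boxes have to be unified before taking unions.\<close>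

lemma poincare_on_Un:
  assumes 1: "poincare_on \<rho> \<sigma> p N C m" and 2: "poincare_on \<rho> \<sigma> p N' C' m" and C: "0 \<le> C" "0 \<le> C'"
    and N: "N \<in> sets Bm" "N' \<in> sets Bm"
  shows "poincare_on \<rho> \<sigma> p (N \<union> N') (C + C') m"
  unfolding poincare_on_def
proof (intro allI impI)
  fix u e assume u: "smooth_fun M u" and e: "0 < (e :: real)" "energy \<rho> \<sigma> u \<le> ennreal (e\<^sup>2)"
  have b: "(\<integral>\<^sup>+q. ennreal \<bar>u q - m u\<bar> * indicator N q \<partial>vol M) \<le> ennreal (C * e)"
     "(\<integral>\<^sup>+q. ennreal (\<bar>u q - m u\<bar> powr p) * indicator N q \<partial>bdry_vol M) \<le> ennreal (C * e powr p)"
     "(\<integral>\<^sup>+q. ennreal \<bar>u q - m u\<bar> * indicator N' q \<partial>vol M) \<le> ennreal (C' * e)"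
     "(\<integral>\<^sup>+q. ennreal (\<bar>u q - m u\<bar> powr p) * indicator N' q \<partial>bdry_vol M) \<le> ennreal (C' * e powr p)"
    using 1 2 u e unfolding poincare_on_def by blast+
  have split: "(\<integral>\<^sup>+q. f q * indicator (N \<union> N') q \<partial>K) \<le> (\<integral>\<^sup>+q. f q * indicator N q \<partial>K) + (\<integral>\<^sup>+q. f q * indicator N' q \<partial>K)"
    if "f \<in> borel_measurable K" "(indicator N :: 'a \<Rightarrow> ennreal) \<in> borel_measurable K" "(indicator N' :: 'a \<Rightarrow> ennreal) \<in> borel_measurable K" for f and K :: "'a measure"
  proof -
    have "(\<integral>\<^sup>+q. f q * indicator (N \<union> N') q \<partial>K) \<le> (\<integral>\<^sup>+q. f q * indicator N q + f q * indicator N' q \<partial>K)"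
      by (intro nn_integral_mono) (auto simp: indicator_def)
    also have "\<dots> = (\<integral>\<^sup>+q. f q * indicator N q \<partial>K) + (\<integral>\<^sup>+q. f q * indicator N' q \<partial>K)"
    proof -
      note [measurable] = that
      show ?thesis
        by (rule nn_integral_add) measurable
    qed
    finally show ?thesis .
  qed
  have mv: "h \<in> borel_measurable (vol M)" "h \<in> borel_measurable (bdry_vol M)" if "h \<in> borel_measurable Bm" for h :: "'a \<Rightarrow> ennreal"
    using that measurable_Bb[OF that] by (auto simp: sets_vol sets_bdry_vol cong: measurable_cong_sets)
  note [measurable] = smooth_fun_measurable[OF u]
  have f: "(\<lambda>q. ennreal \<bar>u q - m u\<bar>) \<in> borel_measurable Bm" "(\<lambda>q. ennreal (\<bar>u q - m u\<bar> powr p)) \<in> borel_measurable Bm"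
    by measurable
  have i: "(indicator N :: 'a \<Rightarrow> ennreal) \<in> borel_measurable Bm" "(indicator N' :: 'a \<Rightarrow> ennreal) \<in> borel_measurable Bm"
    using N by auto
  have "(\<integral>\<^sup>+q. ennreal \<bar>u q - m u\<bar> * indicator (N \<union> N') q \<partial>vol M) \<le> ennreal (C * e) + ennreal (C' * e)"
    using split[OF mv(1)[OF f(1)] mv(1)[OF i(1)] mv(1)[OF i(2)]] add_mono[OF b(1,3)] by (rule order_trans)
  moreover have "(\<integral>\<^sup>+q. ennreal (\<bar>u q - m u\<bar> powr p) * indicator (N \<union> N') q \<partial>bdry_vol M) \<le> ennreal (C * e powr p) + ennreal (C' * e powr p)"
    using split[OF mv(2)[OF f(2)] mv(2)[OF i(1)] mv(2)[OF i(2)]] add_mono[OF b(2,4)] by (rule order_trans)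
  ultimately show "(\<integral>\<^sup>+q. ennreal \<bar>u q - m u\<bar> * indicator (N \<union> N') q \<partial>vol M) \<le> ennreal ((C + C') * e) \<and>
     (\<integral>\<^sup>+q. ennreal (\<bar>u q - m u\<bar> powr p) * indicator (N \<union> N') q \<partial>bdry_vol M) \<le> ennreal ((C + C') * e powr p)"
    using C e by (simp add: distrib_right)
qed

text \<open>On the overlap \<open>W\<close> both constants are close to u in L^1, hence |m u - m' u|
  is at most a multiple of e; the triangle inequality then replaces m' by m on \<open>N'\<close>.
  The overlap is measured by volume, since it may miss the boundary.\<close>

lemma poincare_on_transfer:
  assumes 1: "poincare_on \<rho> \<sigma> p N C m" and 2: "poincare_on \<rho> \<sigma> p N' C' m'" and C: "0 \<le> C" "0 \<le> C'"
    and N: "N \<in> sets Bm" "N' \<in> sets Bm" and p: "0 < p"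
    and W: "W \<in> sets Bm" "W \<subseteq> N \<inter> N'" and W_pos: "0 < (\<integral>\<^sup>+q. indicator W q \<partial>vol M)"
    and fin: "(\<integral>\<^sup>+q. indicator N' q \<partial>vol M) < \<infinity>" "(\<integral>\<^sup>+q. indicator N' q \<partial>bdry_vol M) < \<infinity>"
  shows "\<exists>C''\<ge>0. poincare_on \<rho> \<sigma> p N' C'' m"
proof -
  have mv: "h \<in> borel_measurable (vol M)" "h \<in> borel_measurable (bdry_vol M)" if "h \<in> borel_measurable Bm" for h :: "'a \<Rightarrow> ennreal"
    using that measurable_Bb[OF that] by (auto simp: sets_vol sets_bdry_vol cong: measurable_cong_sets)
  have "(\<integral>\<^sup>+q. indicator W q \<partial>vol M) \<le> (\<integral>\<^sup>+q. indicator N' q \<partial>vol M)"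
    using W by (intro nn_integral_mono) (auto simp: indicator_def)
  then have "(\<integral>\<^sup>+q. indicator W q \<partial>vol M) < \<infinity>"
    using fin(1) by (rule le_less_trans)
  then obtain v where v: "(\<integral>\<^sup>+q. indicator W q \<partial>vol M) = ennreal v" "0 \<le> v"
    by (cases "\<integral>\<^sup>+q. indicator W q \<partial>vol M") auto
  with W_pos have v_pos: "0 < v" by simp
  obtain a where a: "(\<integral>\<^sup>+q. indicator N' q \<partial>vol M) = ennreal a" "0 \<le> a"
    using fin(1) by (cases "\<integral>\<^sup>+q. indicator N' q \<partial>vol M") auto
  obtain b where b: "(\<integral>\<^sup>+q. indicator N' q \<partial>bdry_vol M) = ennreal b" "0 \<le> b"
    using fin(2) by (cases "\<integral>\<^sup>+q. indicator N' q \<partial>bdry_vol M") auto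
  \<comment> \<open>With v the volume of the overlap, |m u - m' u| will be at most k e. In
    \<open>C''\<close> below, the first summand pays for the L^1 bound and the second for the
    boundary bound.\<close>
  define k where "k = (C + C') / v"
  have k: "0 \<le> k" using C v_pos by (simp add: k_def)
  define C'' where "C'' = (C' + k * a) + 2 powr p * (C' + k powr p * b)"
  have C'': "0 \<le> C''" using C k a b by (simp add: C''_def)
  have "poincare_on \<rho> \<sigma> p N' C'' m"
    unfolding poincare_on_def
  proof (intro allI impI)
    fix u e assume u: "smooth_fun M u" and e: "0 < (e :: real)" "energy \<rho> \<sigma> u \<le> ennreal (e\<^sup>2)"
    have bd: "(\<integral>\<^sup>+q. ennreal \<bar>u q - m u\<bar> * indicator N q \<partial>vol M) \<le> ennreal (C * e)"
       "(\<integral>\<^sup>+q. ennreal \<bar>u q - m' u\<bar> * indicator N' q \<partial>vol M) \<le> ennreal (C' * e)"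
       "(\<integral>\<^sup>+q. ennreal (\<bar>u q - m' u\<bar> powr p) * indicator N' q \<partial>bdry_vol M) \<le> ennreal (C' * e powr p)"
      using 1 2 u e unfolding poincare_on_def by blast+
    note [measurable] = smooth_fun_measurable[OF u]
    have f: "(\<lambda>q. ennreal \<bar>u q - x\<bar>) \<in> borel_measurable Bm" "(\<lambda>q. ennreal (\<bar>u q - x\<bar> powr p)) \<in> borel_measurable Bm" for x
      by measurable
    have i: "(indicator N :: 'a \<Rightarrow> ennreal) \<in> borel_measurable Bm" "(indicator N' :: 'a \<Rightarrow> ennreal) \<in> borel_measurable Bm"
      "(indicator W :: 'a \<Rightarrow> ennreal) \<in> borel_measurable Bm"
      using N W by auto
    note [measurable] = mv(1)[OF f(1)] mv(1)[OF f(2)] mv(2)[OF f(1)] mv(2)[OF f(2)]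
      mv(1)[OF i(1)] mv(1)[OF i(2)] mv(1)[OF i(3)] mv(2)[OF i(2)]
    define d where "d = \<bar>m u - m' u\<bar>"
    have "ennreal d * ennreal v = (\<integral>\<^sup>+q. ennreal d * indicator W q \<partial>vol M)"
      unfolding v(1)[symmetric] by (rule nn_integral_cmult[symmetric]) measurable
    also have "\<dots> \<le> (\<integral>\<^sup>+q. ennreal \<bar>u q - m u\<bar> * indicator N q + ennreal \<bar>u q - m' u\<bar> * indicator N' q \<partial>vol M)"
    proof (rule nn_integral_mono)
      fix q
      have "ennreal d \<le> ennreal (\<bar>u q - m u\<bar> + \<bar>u q - m' u\<bar>)"
        unfolding d_def by (intro ennreal_leI) linarith
      then show "ennreal d * indicator W q \<le> ennreal \<bar>u q - m u\<bar> * indicator N q + ennreal \<bar>u q - m' u\<bar> * indicator N' q"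
        using W(2) by (auto simp: indicator_def)
    qed
    also have "\<dots> = (\<integral>\<^sup>+q. ennreal \<bar>u q - m u\<bar> * indicator N q \<partial>vol M) + (\<integral>\<^sup>+q. ennreal \<bar>u q - m' u\<bar> * indicator N' q \<partial>vol M)"
      by (rule nn_integral_add) measurable
    also have "\<dots> \<le> ennreal (C * e) + ennreal (C' * e)"
      by (intro add_mono bd)
    also have "\<dots> = ennreal ((C + C') * e)"
      using C e by (simp add: distrib_right)
    finally have "ennreal (d * v) \<le> ennreal ((C + C') * e)"
      using v_pos by (simp add: d_def ennreal_mult)
    then have "d * v \<le> (C + C') * e"
      using C e by (subst (asm) ennreal_le_iff) auto
    then have d: "d \<le> k * e"
      using v_pos by (simp add: k_def field_simps)
    have "(\<integral>\<^sup>+q. ennreal \<bar>u q - m u\<bar> * indicator N' q \<partial>vol M) \<le>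
        (\<integral>\<^sup>+q. ennreal \<bar>u q - m' u\<bar> * indicator N' q + ennreal d * indicator N' q \<partial>vol M)"
    proof (rule nn_integral_mono)
      fix q
      have "ennreal \<bar>u q - m u\<bar> \<le> ennreal (\<bar>u q - m' u\<bar> + d)"
        unfolding d_def by (intro ennreal_leI) linarith
      then show "ennreal \<bar>u q - m u\<bar> * indicator N' q \<le> ennreal \<bar>u q - m' u\<bar> * indicator N' q + ennreal d * indicator N' q"
        by (auto simp: indicator_def d_def)
    qed
    also have "\<dots> = (\<integral>\<^sup>+q. ennreal \<bar>u q - m' u\<bar> * indicator N' q \<partial>vol M) + (\<integral>\<^sup>+q. ennreal d * indicator N' q \<partial>vol M)"
      by (rule nn_integral_add) measurable
    also have "(\<integral>\<^sup>+q. ennreal d * indicator N' q \<partial>vol M) = ennreal d * ennreal a"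
      unfolding a(1)[symmetric] by (rule nn_integral_cmult) measurable
    also have "(\<integral>\<^sup>+q. ennreal \<bar>u q - m' u\<bar> * indicator N' q \<partial>vol M) + ennreal d * ennreal a \<le>
        ennreal (C' * e) + ennreal (k * e) * ennreal a"
      by (intro add_mono bd mult_right_mono ennreal_leI d) simp
    also have "\<dots> = ennreal ((C' + k * a) * e)"
      using C k e a by (simp add: ennreal_mult[symmetric] algebra_simps flip: ennreal_plus)
    also have "\<dots> \<le> ennreal (C'' * e)"
      using e C k b by (intro ennreal_leI mult_right_mono) (auto simp: C''_def)
    finally have first: "(\<integral>\<^sup>+q. ennreal \<bar>u q - m u\<bar> * indicator N' q \<partial>vol M) \<le> ennreal (C'' * e)" .
    have "(\<integral>\<^sup>+q. ennreal (\<bar>u q - m u\<bar> powr p) * indicator N' q \<partial>bdry_vol M) \<le>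
        (\<integral>\<^sup>+q. ennreal (2 powr p) * (ennreal (\<bar>u q - m' u\<bar> powr p) * indicator N' q + ennreal (d powr p) * indicator N' q) \<partial>bdry_vol M)"
    proof (rule nn_integral_mono)
      fix q
      have "\<bar>u q - m u\<bar> powr p \<le> 2 powr p * (\<bar>u q - m' u\<bar> powr p + d powr p)"
        using abs_add_powr_le[of p "u q - m' u" "m' u - m u"] p by (simp add: d_def abs_minus_commute)
      then have "ennreal (\<bar>u q - m u\<bar> powr p) \<le> ennreal (2 powr p) * (ennreal (\<bar>u q - m' u\<bar> powr p) + ennreal (d powr p))"
        by (simp add: ennreal_mult[symmetric] ennreal_leI flip: ennreal_plus)
      then show "ennreal (\<bar>u q - m u\<bar> powr p) * indicator N' q \<le>
          ennreal (2 powr p) * (ennreal (\<bar>u q - m' u\<bar> powr p) * indicator N' q + ennreal (d powr p) * indicator N' q)"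
        by (cases "q \<in> N'") simp_all
    qed
    also have "\<dots> = ennreal (2 powr p) * (\<integral>\<^sup>+q. ennreal (\<bar>u q - m' u\<bar> powr p) * indicator N' q + ennreal (d powr p) * indicator N' q \<partial>bdry_vol M)"
      by (rule nn_integral_cmult) measurable
    also have "(\<integral>\<^sup>+q. ennreal (\<bar>u q - m' u\<bar> powr p) * indicator N' q + ennreal (d powr p) * indicator N' q \<partial>bdry_vol M) =
        (\<integral>\<^sup>+q. ennreal (\<bar>u q - m' u\<bar> powr p) * indicator N' q \<partial>bdry_vol M) + (\<integral>\<^sup>+q. ennreal (d powr p) * indicator N' q \<partial>bdry_vol M)"
      by (rule nn_integral_add) measurable
    also have "(\<integral>\<^sup>+q. ennreal (d powr p) * indicator N' q \<partial>bdry_vol M) = ennreal (d powr p) * ennreal b"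
      unfolding b(1)[symmetric] by (rule nn_integral_cmult) measurable
    also have "ennreal (2 powr p) * ((\<integral>\<^sup>+q. ennreal (\<bar>u q - m' u\<bar> powr p) * indicator N' q \<partial>bdry_vol M) + ennreal (d powr p) * ennreal b) \<le>
        ennreal (2 powr p) * (ennreal (C' * e powr p) + ennreal ((k * e) powr p) * ennreal b)"
      using d p by (intro mult_left_mono add_mono bd mult_right_mono ennreal_leI powr_mono2) (auto simp: d_def)
    also have "\<dots> = ennreal (2 powr p * (C' * e powr p + (k * e) powr p * b))"
      using C b by (simp add: ennreal_mult ennreal_plus)
    also have "2 powr p * (C' * e powr p + (k * e) powr p * b) = 2 powr p * (C' + k powr p * b) * e powr p"
      using k e by (simp add: powr_mult algebra_simps)
    also have "ennreal \<dots> \<le> ennreal (C'' * e powr p)"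
      using C k a by (intro ennreal_leI mult_right_mono) (auto simp: C''_def)
    finally show "(\<integral>\<^sup>+q. ennreal \<bar>u q - m u\<bar> * indicator N' q \<partial>vol M) \<le> ennreal (C'' * e) \<and>
        (\<integral>\<^sup>+q. ennreal (\<bar>u q - m u\<bar> powr p) * indicator N' q \<partial>bdry_vol M) \<le> ennreal (C'' * e powr p)"
      using first by blast
  qed
  with C'' show ?thesis by blast
qed

end

locale weighted_mfd = riem_mfd M
  for M :: "('a, 'n::finite) riem_data" +
  fixes \<rho> :: "'a \<Rightarrow> real" and \<sigma> p :: real
  assumes \<rho>: "defining_function M \<rho>" and \<sigma>: "0 < \<sigma>" "\<sigma> < 1" and n: "2 \<le> CARD('n)"
    and p: "p = 2 * real CARD('n) / (real CARD('n) - 2 * \<sigma>)"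
begin

lemma \<sigma>_n: "2 * \<sigma> < real CARD('n)"
  using \<sigma> n by linarith

lemma p_gt_2: "2 < p"
  using \<sigma> \<sigma>_n by (simp add: p field_simps)

lemma smooth_\<rho>: "smooth_fun M \<rho>"
  using \<rho> unfolding defining_function_def by blast

lemma measurable_\<rho>: "\<rho> \<in> borel_measurable Bm"
  by (rule smooth_fun_measurable[OF smooth_\<rho>])

text \<open>Packages everything a small box provides, so that the globalisation works with
  neighbourhoods only.\<close>

lemma ex_local_poincare:
  assumes P: "P \<in> mfd_pts M"
  obtains N U C m where "openin X U" "P \<in> U" "U \<subseteq> N" "N \<in> sets Bm" "0 \<le> C" "poincare_on \<rho> \<sigma> p N C m"
    "(\<integral>\<^sup>+q. indicator N q \<partial>vol M) < \<infinity>" "(\<integral>\<^sup>+q. indicator N q \<partial>bdry_vol M) < \<infinity>"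
    "\<And>u. smooth_fun M u \<Longrightarrow>
      (\<integral>\<^sup>+q. ennreal (\<rho> q powr (1 - 2 * \<sigma>) * vnorm_sq M (gradient M u) q) * indicator N q \<partial>vol M) < \<infinity>"
proof (rule ex_adapted_box[OF \<rho> \<sigma> P])
  fix c z s \<tau> \<kappa> \<kappa>' U
  assume ab: "adapted_box \<rho> \<sigma> c z s \<tau> \<kappa> \<kappa>'" and U: "openin X U" "P \<in> U" "U \<subseteq> chart_inv c ` box_img z s"
  have c: "c \<in> At" and s: "0 < s" and box: "box_img z s \<subseteq> chart_img c" and \<tau>: "0 < \<tau>" "\<tau> < 1" and \<kappa>: "0 < \<kappa>"
    and z: "0 < z $ None \<or> z $ None = 0 \<and> \<tau> = \<sigma>"
    and lower: "\<And>y t. y \<in> unit_cube \<Longrightarrow> 0 < t \<Longrightarrow> t < 1 \<Longrightarrow>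
      \<kappa> * t powr (1 - 2 * \<tau>) \<le> \<rho> (chart_inv c (box_map z s y t)) powr (1 - 2 * \<sigma>)"
    using ab unfolding adapted_box_def by blast+
  have \<tau>n: "2 * \<tau> < real CARD('n)"
    using \<tau> n by linarith
  have z': "0 < z $ None \<or> z $ None = 0 \<and> p = 2 * real CARD('n) / (real CARD('n) - 2 * \<tau>)"
    using z p by auto
  obtain C m where "0 \<le> C" "poincare_on \<rho> \<sigma> p (chart_inv c ` box_img z s) C m"
    using poincare_on_box[OF measurable_\<rho> c s box \<tau>(1) \<tau>n \<kappa> lower z'] by blast
  then show thesis
    using that[OF U box_sets_Bm(1)[OF c box]] adapted_box_finite[OF ab measurable_\<rho>] by blast
qed

text \<open>Stated for an arbitrary property, because finiteness of measures and energies spreads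
  from neighbourhoods to M by the same finite subcover argument.\<close>

lemma poincare_finite_cover:
  assumes local: "\<And>P. P \<in> mfd_pts M \<Longrightarrow> \<exists>U. openin X U \<and> P \<in> U \<and> Q U"
    and union: "\<And>A B. A \<in> sets Bm \<Longrightarrow> B \<in> sets Bm \<Longrightarrow> Q A \<Longrightarrow> Q B \<Longrightarrow> Q (A \<union> B)" and empty: "Q {}"
  shows "Q (mfd_pts M)"
proof -
  have "compactin X (topspace X)"
    using compact by (simp add: compact_space_def)
  moreover have "\<forall>U\<in>{U. openin X U \<and> Q U}. openin X U"
    by blast
  moreover have "topspace X \<subseteq> \<Union>{U. openin X U \<and> Q U}"
    using local unfolding mfd_pts_def by blast
  ultimately obtain \<F> where \<F>: "finite \<F>" "\<F> \<subseteq> {U. openin X U \<and> Q U}" "topspace X \<subseteq> \<Union>\<F>"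
    unfolding compactin_def by (meson subset_refl)
  have "Q (\<Union>\<G>) \<and> \<Union>\<G> \<in> sets Bm" if "finite \<G>" "\<G> \<subseteq> {U. openin X U \<and> Q U}" for \<G>
    using that
  proof (induction \<G> rule: finite_induct)
    case (insert U \<G>)
    then have "U \<in> sets Bm" "Q U" "Q (\<Union>\<G>)" "\<Union>\<G> \<in> sets Bm"
      using sets_Bm_openin by auto
    then show ?case
      using union[of U "\<Union>\<G>"] by simp
  qed (simp add: empty)
  then have "Q (\<Union>\<F>)"
    using \<F> by blast
  moreover have "\<Union>\<F> = mfd_pts M"
  proof
    show "\<Union>\<F> \<subseteq> mfd_pts M"
      using \<F>(2) openin_subset unfolding mfd_pts_def by blast
  qed (use \<F>(3) in \<open>simp add: mfd_pts_def\<close>)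
  ultimately show ?thesis by simp
qed

text \<open>The set of points near which the inequality holds with the constant of a fixed starting box is
  open and closed.\<close>

lemma ex_global_poincare:
  assumes ne: "mfd_pts M \<noteq> {}"
  shows "\<exists>C\<ge>0. \<exists>m. poincare_on \<rho> \<sigma> p (mfd_pts M) C m"
proof -
  obtain P0 where P0: "P0 \<in> mfd_pts M" using ne by blast
  obtain N0 U0 C0 m where 0: "openin X U0" "P0 \<in> U0" "U0 \<subseteq> N0" "0 \<le> C0" "poincare_on \<rho> \<sigma> p N0 C0 m"
    by (rule ex_local_poincare[OF P0]) (rule that)
  \<comment> \<open>The function \<open>m\<close> is fixed from here on; only the constant C may
    depend on the set.\<close>
  define Q where "Q U \<longleftrightarrow> (\<exists>C\<ge>0. poincare_on \<rho> \<sigma> p U C m)" for U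
  define S where "S = {P. \<exists>U. openin X U \<and> P \<in> U \<and> Q U}"
  have S_eq: "S = \<Union>{U. openin X U \<and> Q U}"
    by (auto simp: S_def)
  have S_open: "openin X S"
    unfolding S_eq by (rule openin_Union) blast
  have P0_S: "P0 \<in> S"
  proof -
    have "Q U0"
      unfolding Q_def using poincare_on_subset[OF 0(5,3) order_refl] 0(4) by blast
    then show ?thesis
      using 0 by (auto simp: S_def)
  qed
  \<comment> \<open>Closedness: if the neighbourhood U of P met S, the constant m could be carried
    over from a good set V to N across the overlap of V and U, and P would lie in S.\<close>
  have "\<exists>U. openin X U \<and> P \<in> U \<and> U \<subseteq> mfd_pts M - S" if P: "P \<in> mfd_pts M - S" for P
  proof -
    have P': "P \<in> mfd_pts M" using P by blast
    obtain N U C m' where N: "openin X U" "P \<in> U" "U \<subseteq> N" "N \<in> sets Bm" "0 \<le> C" "poincare_on \<rho> \<sigma> p N C m'"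
      "(\<integral>\<^sup>+q. indicator N q \<partial>vol M) < \<infinity>" "(\<integral>\<^sup>+q. indicator N q \<partial>bdry_vol M) < \<infinity>"
      by (rule ex_local_poincare[OF P']) (rule that)
    have "U \<inter> S = {}"
    proof (rule ccontr)
      assume "U \<inter> S \<noteq> {}"
      then obtain R V where V: "R \<in> U" "openin X V" "R \<in> V" "Q V"
        by (auto simp: S_def)
      then obtain C1 where C1: "0 \<le> C1" "poincare_on \<rho> \<sigma> p V C1 m"
        by (auto simp: Q_def)
      have VU: "openin X (V \<inter> U)" "R \<in> V \<inter> U"
        using V N by auto
      have "\<exists>C''\<ge>0. poincare_on \<rho> \<sigma> p N C'' m"
        by (rule poincare_on_transfer[OF C1(2) N(6) C1(1) N(5) sets_Bm_openin[OF V(2)] N(4) _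
            sets_Bm_openin[OF VU(1)] _ openin_vol_pos[OF VU] N(7,8)]) (use p_gt_2 N(3) in auto)
      then obtain C'' where "0 \<le> C''" "poincare_on \<rho> \<sigma> p N C'' m" by blast
      then have "Q U"
        unfolding Q_def using poincare_on_subset[OF _ N(3) order_refl] by blast
      then have "P \<in> S"
        using N by (auto simp: S_def)
      then show False using P by blast
    qed
    moreover have "U \<subseteq> mfd_pts M"
      using openin_subset[OF N(1)] by (simp add: mfd_pts_def)
    ultimately show ?thesis
      using N(1,2) by blast
  qed
  then have T_open: "openin X (mfd_pts M - S)"
    by (subst openin_subopen) blast
  have "mfd_pts M - S = {}"
  proof (rule ccontr)
    assume "mfd_pts M - S \<noteq> {}"
    moreover have "topspace X \<subseteq> S \<union> (mfd_pts M - S)" "S \<inter> (mfd_pts M - S) = {}" "S \<noteq> {}"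
      using P0_S by (auto simp: mfd_pts_def)
    ultimately show False
      using connected S_open T_open unfolding connected_space_def by blast
  qed
  then have "\<exists>U. openin X U \<and> P \<in> U \<and> Q U" if "P \<in> mfd_pts M" for P
    using that by (auto simp: S_def)
  moreover have "Q (A \<union> B)" if AB: "A \<in> sets Bm" "B \<in> sets Bm" "Q A" "Q B" for A B
  proof -
    obtain C C' where "0 \<le> C" "poincare_on \<rho> \<sigma> p A C m" "0 \<le> C'" "poincare_on \<rho> \<sigma> p B C' m"
      using AB(3,4) unfolding Q_def by blast
    then show ?thesis
      unfolding Q_def using poincare_on_Un[of \<rho> \<sigma> p A C m B C'] AB(1,2) by (intro exI[of _ "C + C'"]) simp
  qed
  moreover have "Q {}"
    unfolding Q_def poincare_on_def by (intro exI[of _ 0]) simp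
  ultimately have "Q (mfd_pts M)"
    by (rule poincare_finite_cover)
  then show ?thesis
    unfolding Q_def by blast
qed

lemma finite_integral_of_local:
  assumes "\<And>P. P \<in> mfd_pts M \<Longrightarrow> \<exists>U. openin X U \<and> P \<in> U \<and> (\<integral>\<^sup>+q. f q * indicator U q \<partial>K) < \<infinity>"
    and f: "f \<in> borel_measurable K" and K: "\<And>A. A \<in> sets Bm \<Longrightarrow> (indicator A :: 'a \<Rightarrow> ennreal) \<in> borel_measurable K"
    and space: "space K \<subseteq> mfd_pts M"
  shows "(\<integral>\<^sup>+q. f q \<partial>K) < \<infinity>"
proof -
  have "(\<integral>\<^sup>+q. f q * indicator (mfd_pts M) q \<partial>K) < \<infinity>"
  proof (rule poincare_finite_cover[of "\<lambda>U. (\<integral>\<^sup>+q. f q * indicator U q \<partial>K) < \<infinity>"])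
    fix A B assume AB: "A \<in> sets Bm" "B \<in> sets Bm"
      "(\<integral>\<^sup>+q. f q * indicator A q \<partial>K) < \<infinity>" "(\<integral>\<^sup>+q. f q * indicator B q \<partial>K) < \<infinity>"
    note [measurable] = f K[OF AB(1)] K[OF AB(2)]
    have "(\<integral>\<^sup>+q. f q * indicator (A \<union> B) q \<partial>K) \<le> (\<integral>\<^sup>+q. f q * indicator A q + f q * indicator B q \<partial>K)"
      by (intro nn_integral_mono) (auto simp: indicator_def)
    also have "\<dots> = (\<integral>\<^sup>+q. f q * indicator A q \<partial>K) + (\<integral>\<^sup>+q. f q * indicator B q \<partial>K)"
      by (rule nn_integral_add) measurable
    finally show "(\<integral>\<^sup>+q. f q * indicator (A \<union> B) q \<partial>K) < \<infinity>"
      using AB(3,4) by (simp add: le_less_trans)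
  qed (use assms(1) in auto)
  moreover have "(\<integral>\<^sup>+q. f q * indicator (mfd_pts M) q \<partial>K) = (\<integral>\<^sup>+q. f q \<partial>K)"
    using space by (intro nn_integral_cong) (auto simp: indicator_def)
  ultimately show ?thesis by simp
qed

lemma finite_bdry_vol: "finite_measure (bdry_vol M)"
proof
  have "(\<integral>\<^sup>+q. 1 \<partial>bdry_vol M) < \<infinity>"
  proof (rule finite_integral_of_local)
    fix P assume P: "P \<in> mfd_pts M"
    obtain N U where N: "openin X U" "P \<in> U" "U \<subseteq> N" "(\<integral>\<^sup>+q. indicator N q \<partial>bdry_vol M) < \<infinity>"
      by (rule ex_local_poincare[OF P]) (rule that)
    have "(\<integral>\<^sup>+q. 1 * indicator U q \<partial>bdry_vol M) \<le> (\<integral>\<^sup>+q. indicator N q \<partial>bdry_vol M)"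
      using N(3) by (intro nn_integral_mono) (auto simp: indicator_def)
    then show "\<exists>U. openin X U \<and> P \<in> U \<and> (\<integral>\<^sup>+q. 1 * indicator U q \<partial>bdry_vol M) < \<infinity>"
      using N le_less_trans by blast
  next
    show "(indicator A :: 'a \<Rightarrow> ennreal) \<in> borel_measurable (bdry_vol M)" if "A \<in> sets Bm" for A
    proof -
      have "(indicator A :: 'a \<Rightarrow> ennreal) \<in> borel_measurable Bb"
        using that by (intro measurable_Bb) simp
      then show ?thesis
        by (simp add: sets_bdry_vol cong: measurable_cong_sets)
    qed
  qed (use bdry_subset in auto)
  then show "emeasure (bdry_vol M) (space (bdry_vol M)) \<noteq> \<infinity>"
    by simp
qed

lemma energy_finite:
  assumes u: "smooth_fun M u"
  shows "energy \<rho> \<sigma> u < \<infinity>"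
  unfolding energy_def
proof (rule finite_integral_of_local)
  fix P assume P: "P \<in> mfd_pts M"
  let ?f = "\<lambda>q. ennreal (\<rho> q powr (1 - 2 * \<sigma>) * vnorm_sq M (gradient M u) q)"
  obtain N U where N: "openin X U" "P \<in> U" "U \<subseteq> N" "(\<integral>\<^sup>+q. ?f q * indicator N q \<partial>vol M) < \<infinity>"
    by (rule ex_local_poincare[OF P]) (rule that, use u in auto)
  have "(\<integral>\<^sup>+q. ?f q * indicator U q \<partial>vol M) \<le> (\<integral>\<^sup>+q. ?f q * indicator N q \<partial>vol M)"
    using N(3) by (intro nn_integral_mono) (auto simp: indicator_def)
  then show "\<exists>U. openin X U \<and> P \<in> U \<and> (\<integral>\<^sup>+q. ?f q * indicator U q \<partial>vol M) < \<infinity>"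
    using N le_less_trans by blast
next
  have "(\<lambda>q. ennreal (\<rho> q powr (1 - 2 * \<sigma>) * vnorm_sq M (gradient M u) q)) \<in> borel_measurable Bm"
    using measurable_\<rho> measurable_vnorm_sq_gradient[OF u] by measurable
  then show "(\<lambda>q. ennreal (\<rho> q powr (1 - 2 * \<sigma>) * vnorm_sq M (gradient M u) q)) \<in> borel_measurable (vol M)"
    by (simp add: sets_vol cong: measurable_cong_sets)
  show "(indicator A :: 'a \<Rightarrow> ennreal) \<in> borel_measurable (vol M)" if "A \<in> sets Bm" for A
    using that by (intro borel_measurable_indicator) (simp add: sets_vol)
qed simp

end

section \<open>From smooth functions to Sobolev pairs\<close>

section \<open>Passing to the Sobolev space\<close>

context riem_mfd
begin

text \<open>Parallelogram law, discarding the squared norm of the difference.\<close>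

lemma vnorm_sq_add_le:
  assumes "q \<in> mfd_pts M" "\<And>c. Y c q = Y1 c q + Y2 c q"
  shows "vnorm_sq M Y q \<le> 2 * vnorm_sq M Y1 q + 2 * vnorm_sq M Y2 q"
proof -
  let ?c = "chart_at M q"
  let ?A = "mfd_metric M ?c q" and ?a = "Y1 ?c q" and ?b = "Y2 ?c q"
  have "(?a + ?b) \<bullet> (?A *v (?a + ?b)) + (?a - ?b) \<bullet> (?A *v (?a - ?b)) =
      2 * (?a \<bullet> (?A *v ?a)) + 2 * (?b \<bullet> (?A *v ?b))"
    by (simp add: matrix_vector_right_distrib matrix_vector_mult_diff_distrib inner_add_left inner_add_right
        inner_diff_left inner_diff_right)
  moreover have "0 \<le> (?a - ?b) \<bullet> (?A *v (?a - ?b))"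
    using vnorm_sq_nonneg[OF assms(1), of "\<lambda>c q. Y1 c q - Y2 c q"] by (simp add: vnorm_sq_def Let_def)
  ultimately show ?thesis
    using assms(2) by (simp add: vnorm_sq_def Let_def)
qed

lemma measurable_metric:
  assumes c: "c \<in> At"
  shows "mfd_metric M c \<in> borel_measurable (restrict_space Bm (fst c))"
proof -
  have "(\<lambda>q. mfd_metric M c (chart_inv c (snd c q))) \<in> borel_measurable (restrict_space Bm (fst c))"
    by (rule measurable_compose[OF measurable_chart[OF c] borel_measurable_continuous_on_restrict[OF continuous_on_metric[OF c]]])
  then show ?thesis
    by (rule measurable_cong[THEN iffD1, rotated]) (use c in \<open>simp add: space_restrict_space\<close>)
qed

lemma measurable_vnorm_sq:
  assumes Y: "is_vector_field M Y" and meas: "\<And>c. c \<in> At \<Longrightarrow> Y c \<in> borel_measurable (restrict_space Bm (fst c))"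
  shows "vnorm_sq M Y \<in> borel_measurable Bm"
proof (rule measurable_from_Bm)
  fix c assume c: "c \<in> At"
  have "(\<lambda>q. Y c q \<bullet> (mfd_metric M c q *v Y c q)) \<in> borel_measurable (restrict_space Bm (fst c))"
  proof (rule borel_measurable_continuous_Pair[OF measurable_metric[OF c] meas[OF c]])
    show "continuous_on UNIV (\<lambda>x. snd x \<bullet> (fst x *v snd x :: 'n model))"
      by (intro continuous_on_inner continuous_on_matrix_vector_mult continuous_intros)
  qed
  then show "vnorm_sq M Y \<in> borel_measurable (restrict_space Bm (fst c))"
    by (rule measurable_cong[THEN iffD1, rotated])
      (simp add: space_restrict_space vnorm_sq_chart[OF Y c])
qed

lemma measurable_gradient:
  assumes u: "smooth_fun M u" and c: "c \<in> At"
  shows "gradient M u c \<in> borel_measurable (restrict_space Bm (fst c))"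
proof -
  have "(\<lambda>q. gradient M u c (chart_inv c (snd c q))) \<in> borel_measurable (restrict_space Bm (fst c))"
    by (rule measurable_compose[OF measurable_chart[OF c] borel_measurable_continuous_on_restrict[OF continuous_on_gradient[OF u c]]])
  then show ?thesis
    by (rule measurable_cong[THEN iffD1, rotated]) (use c in \<open>simp add: space_restrict_space\<close>)
qed

lemma is_vector_field_diff:
  assumes "is_vector_field M Y" "is_vector_field M Z"
  shows "is_vector_field M (\<lambda>c q. Y c q - Z c q)"
  unfolding is_vector_field_def
proof (intro ballI)
  fix c c' p assume c: "c \<in> At" "c' \<in> At" "p \<in> fst c \<inter> fst c'"
  have "Y c' p = transition_jac c c' p *v Y c p" "Z c' p = transition_jac c c' p *v Z c p"
    using assms c unfolding is_vector_field_def by meson+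
  then show "Y c' p - Z c' p = transition_jac c c' p *v (Y c p - Z c p)"
    by (simp add: matrix_vector_mult_diff_distrib)
qed

end

lemma has_derivative_diff_const_iff:
  "((\<lambda>x. f x - c) has_derivative D) F \<longleftrightarrow> (f has_derivative D) F"
proof
  assume "((\<lambda>x. f x - c) has_derivative D) F"
  from has_derivative_add[OF this has_derivative_const[of c]] show "(f has_derivative D) F"
    by simp
next
  assume "(f has_derivative D) F"
  from has_derivative_diff[OF this has_derivative_const[of c]] show "((\<lambda>x. f x - c) has_derivative D) F"
    by simp
qed

lemma frechet_derivative_diff_const: "frechet_derivative (\<lambda>x. f x - c) F = frechet_derivative f F"
  unfolding frechet_derivative_def has_derivative_diff_const_iff ..

lemma Ck_on_diff_const:
  assumes f: "Ck_on k f S"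
  shows "Ck_on k (\<lambda>x. f x - c) S"
proof (cases k)
  case 0
  then show ?thesis
    using f continuous_on_diff[OF _ continuous_on_const[of S c]] by simp
next
  case (Suc j)
  show ?thesis
    using f unfolding Suc Ck_on.simps frechet_derivative_diff_const differentiable_def has_derivative_diff_const_iff
    by assumption
qed

lemma smooth_on_diff_const:
  assumes "smooth_on f A"
  shows "smooth_on (\<lambda>x. f x - c) A"
  unfolding smooth_on_def
proof
  fix x assume x: "x \<in> A"
  obtain S h where S: "open S" "x \<in> S" "\<And>k. Ck_on k h S" "\<And>y. y \<in> A \<inter> S \<Longrightarrow> f y = h y"
    by (rule smooth_onE[OF assms x]) (rule that)
  then show "\<exists>S h. open S \<and> x \<in> S \<and> (\<forall>k. Ck_on k h S) \<and> (\<forall>y\<in>A \<inter> S. f y - c = h y)"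
    by (intro exI[of _ S] exI[of _ "\<lambda>x. h x - c"] conjI allI ballI Ck_on_diff_const) simp_all
qed

context riem_mfd
begin

lemma smooth_fun_diff_const: "smooth_fun M u \<Longrightarrow> smooth_fun M (\<lambda>q. u q - c)"
  unfolding smooth_fun_def
proof
  fix d assume u: "\<forall>c\<in>At. smooth_on (u \<circ> chart_inv c) (chart_img c)" and "d \<in> At"
  then have "smooth_on (u \<circ> chart_inv d) (chart_img d)"
    by (rule bspec)
  from smooth_on_diff_const[OF this, of c] show "smooth_on ((\<lambda>q. u q - c) \<circ> chart_inv d) (chart_img d)"
    by (simp add: o_def)
qed

lemma gradient_diff_const: "gradient M (\<lambda>q. u q - c) = gradient M u"
  unfolding gradient_def[abs_def] pderiv_within_def o_def frechet_derivative_diff_const ..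

end

context weighted_mfd
begin

definition field_energy :: "('a, 'n) vfield \<Rightarrow> ennreal" where
  "field_energy Y = (\<integral>\<^sup>+q. ennreal (\<rho> q powr (1 - 2 * \<sigma>) * vnorm_sq M Y q) \<partial>vol M)"

lemma energy_eq: "energy \<rho> \<sigma> u = field_energy (gradient M u)"
  unfolding energy_def field_energy_def ..

lemma measurable_field_energy:
  assumes "vnorm_sq M Y \<in> borel_measurable Bm"
  shows "(\<lambda>q. \<rho> q powr (1 - 2 * \<sigma>) * vnorm_sq M Y q) \<in> borel_measurable (vol M)"
proof -
  note [measurable] = assms measurable_\<rho>
  have "(\<lambda>q. \<rho> q powr (1 - 2 * \<sigma>) * vnorm_sq M Y q) \<in> borel_measurable Bm"
    by measurable
  then show ?thesis
    by (simp add: sets_vol cong: measurable_cong_sets)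
qed

lemma field_energy_add_le:
  assumes meas: "vnorm_sq M Y1 \<in> borel_measurable Bm" "vnorm_sq M Y2 \<in> borel_measurable Bm"
    and Y: "\<And>c q. Y c q = Y1 c q + Y2 c q"
  shows "field_energy Y \<le> 2 * field_energy Y1 + 2 * field_energy Y2"
proof -
  note [measurable] = measurable_field_energy[OF meas(1)] measurable_field_energy[OF meas(2)]
  have "field_energy Y \<le> (\<integral>\<^sup>+q. 2 * ennreal (\<rho> q powr (1 - 2 * \<sigma>) * vnorm_sq M Y1 q) +
      2 * ennreal (\<rho> q powr (1 - 2 * \<sigma>) * vnorm_sq M Y2 q) \<partial>vol M)"
    unfolding field_energy_def
  proof (rule nn_integral_mono)
    fix q assume "q \<in> space (vol M)"
    then have q: "q \<in> mfd_pts M" by simp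
    let ?r = "\<rho> q powr (1 - 2 * \<sigma>)"
    have "?r * vnorm_sq M Y q \<le> ?r * (2 * vnorm_sq M Y1 q + 2 * vnorm_sq M Y2 q)"
      by (intro mult_left_mono vnorm_sq_add_le[OF q Y]) simp
    then have "ennreal (?r * vnorm_sq M Y q) \<le> ennreal (2 * (?r * vnorm_sq M Y1 q) + 2 * (?r * vnorm_sq M Y2 q))"
      by (intro ennreal_leI) (simp add: algebra_simps)
    also have "\<dots> = 2 * ennreal (?r * vnorm_sq M Y1 q) + 2 * ennreal (?r * vnorm_sq M Y2 q)"
      using vnorm_sq_nonneg[OF q] by (simp add: ennreal_plus ennreal_mult)
    finally show "ennreal (?r * vnorm_sq M Y q) \<le> 2 * ennreal (?r * vnorm_sq M Y1 q) + 2 * ennreal (?r * vnorm_sq M Y2 q)" .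
  qed
  also have "\<dots> = 2 * field_energy Y1 + 2 * field_energy Y2"
    unfolding field_energy_def by (subst nn_integral_add) (auto simp: nn_integral_cmult)
  finally show ?thesis .
qed

text \<open>The factors 2 come from \<open>vnorm_sq_add_le\<close>. They are harmless: approximation
  only has to produce some constant in the trace inequality, while the sharp inequality is never
  passed to the limit.\<close>

lemma weighted_sobolevE:
  assumes u: "u \<in> weighted_sobolev M \<rho> \<sigma>"
  obtains U where "vnorm_sq M (weak_grad u) \<in> borel_measurable Bm" "trace_of u \<in> borel_measurable (bdry_vol M)"
    "\<And>k. smooth_fun M (U k)" "(\<lambda>k. sobolev_dist_sq M \<rho> \<sigma> (U k) u) \<longlonglongrightarrow> 0"
    "\<And>k. energy \<rho> \<sigma> (U k) \<le> 2 * sobolev_dist_sq M \<rho> \<sigma> (U k) u + 2 * field_energy (weak_grad u)"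
    "\<And>k. field_energy (weak_grad u) \<le> 2 * sobolev_dist_sq M \<rho> \<sigma> (U k) u + 2 * energy \<rho> \<sigma> (U k)"
    "\<And>k. (\<integral>\<^sup>+q. ennreal ((U k q - trace_of u q)\<^sup>2) \<partial>bdry_vol M) \<le> sobolev_dist_sq M \<rho> \<sigma> (U k) u"
proof -
  let ?G = "weak_grad u" and ?f = "trace_of u"
  have G: "is_vector_field M ?G" "\<And>c. c \<in> At \<Longrightarrow> ?G c \<in> borel_measurable (restrict_space Bm (fst c))"
    and f: "?f \<in> borel_measurable Bb"
    using u unfolding weighted_sobolev_def by blast+
  obtain U where U: "\<And>k. smooth_fun M (U k)" "(\<lambda>k. sobolev_dist_sq M \<rho> \<sigma> (U k) u) \<longlonglongrightarrow> 0"
    using u unfolding weighted_sobolev_def by blast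
  have mG: "vnorm_sq M ?G \<in> borel_measurable Bm"
    by (rule measurable_vnorm_sq[OF G])
  define D where "D k = (\<lambda>c q. gradient M (U k) c q - ?G c q)" for k
  have D_vf: "is_vector_field M (D k)" for k
    unfolding D_def by (rule is_vector_field_diff[OF is_vector_field_gradient[OF U(1)] G(1)])
  have mD: "vnorm_sq M (D k) \<in> borel_measurable Bm" for k
  proof (rule measurable_vnorm_sq[OF D_vf])
    fix c assume c: "c \<in> At"
    show "D k c \<in> borel_measurable (restrict_space Bm (fst c))"
      unfolding D_def using measurable_gradient[OF U(1) c] G(2)[OF c] by (rule borel_measurable_diff)
  qed
  have neg: "vnorm_sq M (\<lambda>c q. - Y c q) q = vnorm_sq M Y q" for Y q
    using matrix_vector_mult_scaleR[of "mfd_metric M (chart_at M q) q" "- 1" "Y (chart_at M q) q"]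
    by (simp add: vnorm_sq_def Let_def)
  have mD': "vnorm_sq M (\<lambda>c q. - D k c q) \<in> borel_measurable Bm" for k
    using mD by (simp add: neg[abs_def])
  have dist: "sobolev_dist_sq M \<rho> \<sigma> (U k) u = field_energy (D k) + (\<integral>\<^sup>+q. ennreal ((U k q - ?f q)\<^sup>2) \<partial>bdry_vol M)" for k
    unfolding sobolev_dist_sq_def field_energy_def D_def ..
  have le: "field_energy (D k) \<le> sobolev_dist_sq M \<rho> \<sigma> (U k) u" for k
    unfolding dist by simp
  show ?thesis
  proof (rule that[OF mG _ U])
    show "?f \<in> borel_measurable (bdry_vol M)"
      using f by (simp add: sets_bdry_vol cong: measurable_cong_sets)
    fix k
    have "energy \<rho> \<sigma> (U k) \<le> 2 * field_energy (D k) + 2 * field_energy ?G"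
      unfolding energy_eq by (rule field_energy_add_le[OF mD mG]) (simp add: D_def)
    also have "\<dots> \<le> 2 * sobolev_dist_sq M \<rho> \<sigma> (U k) u + 2 * field_energy ?G"
      by (intro add_mono mult_left_mono le) simp_all
    finally show "energy \<rho> \<sigma> (U k) \<le> 2 * sobolev_dist_sq M \<rho> \<sigma> (U k) u + 2 * field_energy ?G" .
    have "field_energy ?G \<le> 2 * field_energy (\<lambda>c q. - D k c q) + 2 * field_energy (gradient M (U k))"
      by (rule field_energy_add_le[OF mD' measurable_vnorm_sq_gradient[OF U(1)]]) (simp add: D_def)
    also have "field_energy (\<lambda>c q. - D k c q) = field_energy (D k)"
      unfolding field_energy_def neg ..
    also have "2 * field_energy (D k) + 2 * field_energy (gradient M (U k)) \<le>
        2 * sobolev_dist_sq M \<rho> \<sigma> (U k) u + 2 * energy \<rho> \<sigma> (U k)"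
      unfolding energy_eq by (intro add_mono mult_left_mono le) simp_all
    finally show "field_energy ?G \<le> 2 * sobolev_dist_sq M \<rho> \<sigma> (U k) u + 2 * energy \<rho> \<sigma> (U k)" .
    show "(\<integral>\<^sup>+q. ennreal ((U k q - ?f q)\<^sup>2) \<partial>bdry_vol M) \<le> sobolev_dist_sq M \<rho> \<sigma> (U k) u"
      unfolding dist by simp
  qed
qed

text \<open>A smooth function at finite distance has finite energy. Without finiteness the Bochner
  integral in \<open>weighted_energy\<close> could take its default value 0 and would carry no
  information.\<close>

lemma field_energy_eq_weighted_energy:
  assumes u: "u \<in> weighted_sobolev M \<rho> \<sigma>"
  shows "field_energy (weak_grad u) = ennreal (weighted_energy M \<rho> \<sigma> u)" "0 \<le> weighted_energy M \<rho> \<sigma> u"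
proof -
  obtain U where U: "vnorm_sq M (weak_grad u) \<in> borel_measurable Bm" "\<And>k. smooth_fun M (U k)"
    "(\<lambda>k. sobolev_dist_sq M \<rho> \<sigma> (U k) u) \<longlonglongrightarrow> 0"
    "\<And>k. field_energy (weak_grad u) \<le> 2 * sobolev_dist_sq M \<rho> \<sigma> (U k) u + 2 * energy \<rho> \<sigma> (U k)"
    by (rule weighted_sobolevE[OF u]) (rule that)
  have "\<forall>\<^sub>F k in sequentially. sobolev_dist_sq M \<rho> \<sigma> (U k) u < 1"
    by (rule order_tendstoD(2)[OF U(3)]) simp
  then obtain k where "sobolev_dist_sq M \<rho> \<sigma> (U k) u < 1"
    using eventually_happens' sequentially_bot by blast
  then have "sobolev_dist_sq M \<rho> \<sigma> (U k) u < \<infinity>"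
    by (rule less_trans) simp
  then have "2 * sobolev_dist_sq M \<rho> \<sigma> (U k) u + 2 * energy \<rho> \<sigma> (U k) < \<infinity>"
    using energy_finite[OF U(2)] by (simp add: ennreal_mult_less_top)
  then have fin: "field_energy (weak_grad u) < \<infinity>"
    using U(4)[of k] by (rule le_less_trans[rotated])
  have nonneg: "AE q in vol M. 0 \<le> \<rho> q powr (1 - 2 * \<sigma>) * vnorm_sq M (weak_grad u) q"
    by (rule AE_I2) (simp add: vnorm_sq_nonneg)
  have "weighted_energy M \<rho> \<sigma> u = enn2real (field_energy (weak_grad u))"
    unfolding weighted_energy_def field_energy_def
    by (rule integral_eq_nn_integral[OF measurable_field_energy[OF U(1)] nonneg])
  then show "field_energy (weak_grad u) = ennreal (weighted_energy M \<rho> \<sigma> u)" "0 \<le> weighted_energy M \<rho> \<sigma> u"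
    using fin by (simp_all add: ennreal_enn2real)
qed

text \<open>The approximating functions satisfy the inequality with their own constants. These stay
  bounded, because the traces converge in L^2 on a boundary of positive finite measure. Along a
  subsequence the constants converge, the traces converge almost everywhere, and Fatou's lemma gives
  the claim. The strict bound on the energy leaves room for the approximation error.\<close>

lemma sobolev_trace_limit:
  assumes C: "0 \<le> C" "poincare_on \<rho> \<sigma> p (mfd_pts M) C m"
    and b: "0 < measure (bdry_vol M) (space (bdry_vol M))"
    and u: "u \<in> weighted_sobolev M \<rho> \<sigma>" and e: "0 < e" "2 * weighted_energy M \<rho> \<sigma> u < e\<^sup>2"
  shows "\<exists>a. (\<integral>\<^sup>+q. ennreal (\<bar>trace_of u q - a\<bar> powr p) \<partial>bdry_vol M) \<le> ennreal (C * e powr p)"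
proof -
  interpret finite_measure "bdry_vol M" by (rule finite_bdry_vol)
  let ?K = "bdry_vol M" and ?f = "trace_of u" and ?E = "weighted_energy M \<rho> \<sigma> u"
  obtain U where U: "vnorm_sq M (weak_grad u) \<in> borel_measurable Bm" "?f \<in> borel_measurable ?K"
    "\<And>k. smooth_fun M (U k)" "(\<lambda>k. sobolev_dist_sq M \<rho> \<sigma> (U k) u) \<longlonglongrightarrow> 0"
    "\<And>k. energy \<rho> \<sigma> (U k) \<le> 2 * sobolev_dist_sq M \<rho> \<sigma> (U k) u + 2 * field_energy (weak_grad u)"
    "\<And>k. (\<integral>\<^sup>+q. ennreal ((U k q - ?f q)\<^sup>2) \<partial>?K) \<le> sobolev_dist_sq M \<rho> \<sigma> (U k) u"
    by (rule weighted_sobolevE[OF u]) (rule that)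
  note [measurable] = U(2)
  \<comment> \<open>Small enough for twice the distance to fit into the gap below e^2, and at most 1
    to bound the squared L^2 distances of the traces.\<close>
  define \<delta> where "\<delta> = min 1 ((e\<^sup>2 - 2 * ?E) / 2)"
  have \<delta>: "0 < \<delta>" "\<delta> \<le> 1" "2 * \<delta> + 2 * ?E \<le> e\<^sup>2"
    using e by (auto simp: \<delta>_def min_def field_simps)
  have "\<forall>\<^sub>F k in sequentially. sobolev_dist_sq M \<rho> \<sigma> (U k) u < ennreal \<delta>"
    by (rule order_tendstoD(2)[OF U(4)]) (use \<delta> in simp)
  then obtain k0 where k0: "\<And>k. k0 \<le> k \<Longrightarrow> sobolev_dist_sq M \<rho> \<sigma> (U k) u < ennreal \<delta>"
    by (auto simp: eventually_sequentially)
  define V where "V k = U (k + k0)" for k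
  have V_smooth: "smooth_fun M (V k)" for k
    unfolding V_def by (rule U(3))
  have V_meas [measurable]: "V k \<in> borel_measurable ?K" for k
    using measurable_Bb[OF smooth_fun_measurable[OF V_smooth]] by (simp add: sets_bdry_vol cong: measurable_cong_sets)
  have dist: "sobolev_dist_sq M \<rho> \<sigma> (V k) u \<le> ennreal \<delta>" for k
    using k0[of "k + k0"] by (simp add: V_def less_imp_le)
  have V_energy: "energy \<rho> \<sigma> (V k) \<le> ennreal (e\<^sup>2)" for k
  proof -
    have "energy \<rho> \<sigma> (V k) \<le> 2 * sobolev_dist_sq M \<rho> \<sigma> (V k) u + 2 * field_energy (weak_grad u)"
      using U(5)[of "k + k0"] by (simp add: V_def)
    also have "\<dots> \<le> 2 * ennreal \<delta> + 2 * ennreal ?E"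
      unfolding field_energy_eq_weighted_energy(1)[OF u] by (intro add_mono mult_left_mono dist) simp_all
    also have "\<dots> = ennreal (2 * \<delta> + 2 * ?E)"
      using \<delta> field_energy_eq_weighted_energy(2)[OF u] by (simp add: ennreal_plus ennreal_mult)
    also have "\<dots> \<le> ennreal (e\<^sup>2)"
      by (rule ennreal_leI[OF \<delta>(3)])
    finally show ?thesis .
  qed
  define c where "c k = m (V k)" for k
  have V_p: "(\<integral>\<^sup>+q. ennreal (\<bar>V k q - c k\<bar> powr p) \<partial>?K) \<le> ennreal (C * e powr p)" for k
  proof -
    have "(\<integral>\<^sup>+q. ennreal (\<bar>V k q - c k\<bar> powr p) * indicator (mfd_pts M) q \<partial>?K) \<le> ennreal (C * e powr p)"
      using C(2) V_smooth[of k] e(1) V_energy[of k] unfolding poincare_on_def c_def by blast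
    moreover have "(\<integral>\<^sup>+q. ennreal (\<bar>V k q - c k\<bar> powr p) * indicator (mfd_pts M) q \<partial>?K) = (\<integral>\<^sup>+q. ennreal (\<bar>V k q - c k\<bar> powr p) \<partial>?K)"
      using bdry_subset by (intro nn_integral_cong) (auto simp: indicator_def)
    ultimately show ?thesis by simp
  qed
  have V_2: "(\<integral>\<^sup>+q. ennreal ((V k q - ?f q)\<^sup>2) \<partial>?K) \<le> sobolev_dist_sq M \<rho> \<sigma> (V k) u" for k
    unfolding V_def by (rule U(6))
  have V_2_le: "(\<integral>\<^sup>+q. ennreal ((V k q - ?f q)\<^sup>2) \<partial>?K) \<le> 1" for k
  proof -
    have "(\<integral>\<^sup>+q. ennreal ((V k q - ?f q)\<^sup>2) \<partial>?K) \<le> ennreal \<delta>"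
      using V_2 dist by (rule order_trans)
    also have "\<dots> \<le> 1"
      using \<delta>(2) by simp
    finally show ?thesis .
  qed
  have V_2_lim: "(\<lambda>k. \<integral>\<^sup>+q. ennreal ((V k q - ?f q)\<^sup>2) \<partial>?K) \<longlonglongrightarrow> 0"
  proof (rule tendsto_sandwich[OF _ _ tendsto_const])
    show "(\<lambda>k. sobolev_dist_sq M \<rho> \<sigma> (V k) u) \<longlonglongrightarrow> 0"
      unfolding V_def by (rule LIMSEQ_ignore_initial_segment[OF U(4)])
  qed (use V_2 in auto)
  define \<beta> where "\<beta> = measure ?K (space ?K)"
  have \<beta>: "0 < \<beta>" "emeasure ?K (space ?K) = ennreal \<beta>"
    using b by (simp_all add: \<beta>_def emeasure_eq_measure)
  \<comment> \<open>Obtained by integrating a triangle inequality with four distances, each bounded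
    by 1 + t^p or 1 + t^2: four units, two boundary bounds and two squared L^2 distances of at most
    1.\<close>
  define R where "R = (4 * \<beta> + 2 * (C * e powr p) + 2) / \<beta>"
  have small: "t \<le> 1 + t powr p" "t \<le> 1 + t\<^sup>2" if "0 \<le> t" for t :: real
  proof -
    show "t \<le> 1 + t powr p"
    proof (cases "t \<le> 1")
      case False
      then have "t powr 1 \<le> t powr p"
        using p_gt_2 by (intro powr_mono) auto
      then show ?thesis using False by simp
    qed (simp add: add_increasing2)
    have "0 \<le> (t - 1)\<^sup>2" by simp
    then show "t \<le> 1 + t\<^sup>2"
      using that by (simp add: power2_diff)
  qed
  have c_bound: "\<bar>c k - c 0\<bar> \<le> R" for k
  proof -
    let ?h = "\<lambda>k q. \<bar>V k q - c k\<bar> powr p" and ?l = "\<lambda>k q. (V k q - ?f q)\<^sup>2"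
    have "ennreal \<bar>c k - c 0\<bar> * ennreal \<beta> = (\<integral>\<^sup>+q. ennreal \<bar>c k - c 0\<bar> \<partial>?K)"
      by (simp only: nn_integral_const \<beta>(2))
    also have "\<dots> \<le> (\<integral>\<^sup>+q. 4 + (ennreal (?h k q) + (ennreal (?l k q) + (ennreal (?l 0 q) + ennreal (?h 0 q)))) \<partial>?K)"
    proof (rule nn_integral_mono)
      fix q
      have "\<bar>c k - c 0\<bar> \<le> \<bar>V k q - c k\<bar> + \<bar>V k q - ?f q\<bar> + \<bar>V 0 q - ?f q\<bar> + \<bar>V 0 q - c 0\<bar>"
        by linarith
      also have "\<dots> \<le> (1 + ?h k q) + (1 + ?l k q) + (1 + ?l 0 q) + (1 + ?h 0 q)"
        using small(1)[of "\<bar>V k q - c k\<bar>"] small(2)[of "\<bar>V k q - ?f q\<bar>"]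
          small(1)[of "\<bar>V 0 q - c 0\<bar>"] small(2)[of "\<bar>V 0 q - ?f q\<bar>"]
        by (intro add_mono) auto
      finally have "ennreal \<bar>c k - c 0\<bar> \<le> ennreal (4 + (?h k q + (?l k q + (?l 0 q + ?h 0 q))))"
        by (intro ennreal_leI) simp
      then show "ennreal \<bar>c k - c 0\<bar> \<le> 4 + (ennreal (?h k q) + (ennreal (?l k q) + (ennreal (?l 0 q) + ennreal (?h 0 q))))"
        by (simp add: ennreal_plus)
    qed
    also have "\<dots> = 4 * ennreal \<beta> + ((\<integral>\<^sup>+q. ennreal (?h k q) \<partial>?K) + ((\<integral>\<^sup>+q. ennreal (?l k q) \<partial>?K) +
        ((\<integral>\<^sup>+q. ennreal (?l 0 q) \<partial>?K) + (\<integral>\<^sup>+q. ennreal (?h 0 q) \<partial>?K))))"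
      using \<beta>(2) by (simp add: nn_integral_add)
    also have "\<dots> \<le> 4 * ennreal \<beta> + (ennreal (C * e powr p) + (1 + (1 + ennreal (C * e powr p))))"
      by (intro add_mono V_p V_2_le order_refl)
    also have "\<dots> = ennreal (4 * \<beta> + 2 * (C * e powr p) + 2)"
    proof -
      have sum: "4 * ennreal \<beta> + (ennreal a + (ennreal x + (ennreal y + ennreal z))) =
          ennreal (4 * \<beta> + (a + (x + (y + z))))" if "0 \<le> a" "0 \<le> x" "0 \<le> y" "0 \<le> z" for a x y z :: real
        using that \<beta>(1) by (simp add: ennreal_plus ennreal_mult)
      have eq: "4 * \<beta> + (C * e powr p + (1 + (1 + C * e powr p))) = 4 * \<beta> + 2 * (C * e powr p) + 2"
        by simp
      have "0 \<le> C * e powr p" using C by simp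
      from sum[OF this zero_le_one zero_le_one this] show ?thesis
        unfolding eq ennreal_1 .
    qed
    finally have "ennreal (\<bar>c k - c 0\<bar> * \<beta>) \<le> ennreal (4 * \<beta> + 2 * (C * e powr p) + 2)"
      using \<beta>(1) by (simp add: ennreal_mult)
    then have "\<bar>c k - c 0\<bar> * \<beta> \<le> 4 * \<beta> + 2 * (C * e powr p) + 2"
      using C \<beta>(1) by (subst (asm) ennreal_le_iff) auto
    then show ?thesis
      using \<beta>(1) by (simp add: R_def field_simps)
  qed
  have "bounded (range c)"
  proof (rule boundedI)
    fix x assume "x \<in> range c"
    then obtain k where "x = c k" by blast
    then show "norm x \<le> \<bar>c 0\<bar> + R"
      using c_bound[of k] unfolding real_norm_def by linarith
  qed
  then obtain a r where r: "strict_mono r" "(c \<circ> r) \<longlonglongrightarrow> a"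
    using bounded_imp_convergent_subsequence by blast
  have int: "integrable ?K (\<lambda>q. (V (r k) q - ?f q)\<^sup>2)" for k
  proof (rule integrableI_nonneg)
    show "(\<integral>\<^sup>+q. ennreal ((V (r k) q - ?f q)\<^sup>2) \<partial>?K) < \<infinity>"
      using V_2_le[of "r k"] by (rule le_less_trans) simp
  qed auto
  have "(\<lambda>k. \<integral>q. norm ((V (r k) q - ?f q)\<^sup>2) \<partial>?K) \<longlonglongrightarrow> 0"
  proof -
    have eq: "(\<integral>q. norm ((V (r k) q - ?f q)\<^sup>2) \<partial>?K) = enn2real (\<integral>\<^sup>+q. ennreal ((V (r k) q - ?f q)\<^sup>2) \<partial>?K)" for k
      by (subst integral_eq_nn_integral) auto
    have "(\<lambda>k. \<integral>\<^sup>+q. ennreal ((V (r k) q - ?f q)\<^sup>2) \<partial>?K) \<longlonglongrightarrow> ennreal 0"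
      using LIMSEQ_subseq_LIMSEQ[OF V_2_lim r(1)] by (simp add: o_def)
    then show ?thesis
      unfolding eq by (rule tendsto_enn2real) simp
  qed
  \<comment> \<open>L^2 convergence is L^1 convergence of the squares, which gives convergence
    almost everywhere along a further subsequence.\<close>
  from tendsto_L1_AE_subseq[OF int this]
  obtain r' where r': "strict_mono r'" "AE q in ?K. (\<lambda>k. (V (r (r' k)) q - ?f q)\<^sup>2) \<longlonglongrightarrow> 0"
    by blast
  define s where "s k = r (r' k)" for k
  have c_lim: "(\<lambda>k. c (s k)) \<longlonglongrightarrow> a"
    using LIMSEQ_subseq_LIMSEQ[OF r(2) r'(1)] by (simp add: o_def s_def)
  have ae: "AE q in ?K. ennreal (\<bar>?f q - a\<bar> powr p) = liminf (\<lambda>k. ennreal (\<bar>V (s k) q - c (s k)\<bar> powr p))"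
    using r'(2)
  proof eventually_elim
    case (elim q)
    have "(\<lambda>k. sqrt ((V (s k) q - ?f q)\<^sup>2)) \<longlonglongrightarrow> sqrt 0"
      unfolding s_def by (rule tendsto_real_sqrt[OF elim])
    then have "(\<lambda>k. V (s k) q - ?f q) \<longlonglongrightarrow> 0"
      by (simp add: tendsto_rabs_zero_iff)
    then have "(\<lambda>k. V (s k) q) \<longlonglongrightarrow> ?f q"
      by (simp add: LIM_zero_iff)
    then have "(\<lambda>k. \<bar>V (s k) q - c (s k)\<bar> powr p) \<longlonglongrightarrow> \<bar>?f q - a\<bar> powr p"
      using p_gt_2 c_lim by (intro tendsto_powr' tendsto_intros) auto
    then have "(\<lambda>k. ennreal (\<bar>V (s k) q - c (s k)\<bar> powr p)) \<longlonglongrightarrow> ennreal (\<bar>?f q - a\<bar> powr p)"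
      by (rule tendsto_ennrealI)
    then show ?case
      by (intro lim_imp_Liminf[symmetric]) auto
  qed
  have "(\<integral>\<^sup>+q. ennreal (\<bar>?f q - a\<bar> powr p) \<partial>?K) = (\<integral>\<^sup>+q. liminf (\<lambda>k. ennreal (\<bar>V (s k) q - c (s k)\<bar> powr p)) \<partial>?K)"
    by (rule nn_integral_cong_AE[OF ae])
  also have "\<dots> \<le> liminf (\<lambda>k. \<integral>\<^sup>+q. ennreal (\<bar>V (s k) q - c (s k)\<bar> powr p) \<partial>?K)"
    by (rule nn_integral_liminf) measurable
  also have "\<dots> \<le> liminf (\<lambda>k. ennreal (C * e powr p))"
    by (rule Liminf_mono) (simp add: V_p)
  also have "\<dots> = ennreal (C * e powr p)"
    by (simp add: Liminf_const)
  finally show ?thesis by blast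
qed

text \<open>The trace minus a constant is in L^p by the limit argument, and on a finite measure
  space the constant can be added back. Only then does the Bochner integral of |u|^p represent the
  norm.\<close>

lemma sobolev_integrable_powr:
  assumes b: "0 < measure (bdry_vol M) (space (bdry_vol M))" and u: "u \<in> weighted_sobolev M \<rho> \<sigma>"
  shows "integrable (bdry_vol M) (\<lambda>q. \<bar>trace_of u q\<bar> powr p)"
proof -
  interpret finite_measure "bdry_vol M" by (rule finite_bdry_vol)
  have ne: "mfd_pts M \<noteq> {}"
    using b bdry_subset by (auto simp: measure_def)
  obtain C m where C: "0 \<le> C" "poincare_on \<rho> \<sigma> p (mfd_pts M) C m"
    using ex_global_poincare[OF ne] by blast
  \<comment> \<open>The added 1 makes the energy bound strict and e positive.\<close>
  define e where "e = sqrt (2 * weighted_energy M \<rho> \<sigma> u + 1)"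
  have e: "0 < e" "2 * weighted_energy M \<rho> \<sigma> u < e\<^sup>2"
    using field_energy_eq_weighted_energy(2)[OF u] by (auto simp: e_def)
  obtain a where a: "(\<integral>\<^sup>+q. ennreal (\<bar>trace_of u q - a\<bar> powr p) \<partial>bdry_vol M) \<le> ennreal (C * e powr p)"
    using sobolev_trace_limit[OF C b u e] by blast
  have f: "trace_of u \<in> borel_measurable (bdry_vol M)"
    by (rule weighted_sobolevE[OF u])
  note [measurable] = f
  have "integrable (bdry_vol M) (\<lambda>q. \<bar>trace_of u q - a\<bar> powr p)"
    by (rule integrableI_nonneg) (use a in \<open>auto intro: le_less_trans\<close>)
  from integrable_powr_shift[OF _ _ this, of a] show ?thesis
    using p_gt_2 by simp
qed

text \<open>The constraint removes the constant a by \<open>integral_powr_le_shift\<close>. The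
  slack x > 0 in the energy, forced by the strict bound, is then sent to 0, which also covers zero
  energy.\<close>

lemma sobolev_trace_inequality:
  assumes b: "0 < measure (bdry_vol M) (space (bdry_vol M))"
  shows "\<exists>K>0. \<forall>u\<in>weighted_sobolev M \<rho> \<sigma>. (\<integral>q. spow p (trace_of u q) \<partial>bdry_vol M) = 0 \<longrightarrow>
    (\<integral>q. \<bar>trace_of u q\<bar> powr p \<partial>bdry_vol M) powr (2 / p) \<le> K * weighted_energy M \<rho> \<sigma> u"
proof -
  interpret finite_measure "bdry_vol M" by (rule finite_bdry_vol)
  have ne: "mfd_pts M \<noteq> {}"
    using b bdry_subset by (auto simp: measure_def)
  obtain C m where C: "0 \<le> C" "poincare_on \<rho> \<sigma> p (mfd_pts M) C m"
    using ex_global_poincare[OF ne] by blast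
  define K where "K = 2 * C powr (2 / p) + 1"
  have "(\<integral>q. \<bar>trace_of u q\<bar> powr p \<partial>bdry_vol M) powr (2 / p) \<le> K * weighted_energy M \<rho> \<sigma> u"
    if u: "u \<in> weighted_sobolev M \<rho> \<sigma>" and zero: "(\<integral>q. spow p (trace_of u q) \<partial>bdry_vol M) = 0" for u
  proof -
    let ?f = "trace_of u" and ?E = "weighted_energy M \<rho> \<sigma> u"
    have E: "0 \<le> ?E" by (rule field_energy_eq_weighted_energy(2)[OF u])
    have f: "?f \<in> borel_measurable (bdry_vol M)"
      by (rule weighted_sobolevE[OF u])
    note [measurable] = f
    have f_int: "integrable (bdry_vol M) (\<lambda>q. \<bar>?f q\<bar> powr p)"
      by (rule sobolev_integrable_powr[OF b u])
    have le: "(\<integral>q. \<bar>?f q\<bar> powr p \<partial>bdry_vol M) powr (2 / p) \<le> C powr (2 / p) * (2 * ?E + x)" if x: "0 < x" for x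
    proof -
      define e where "e = sqrt (2 * ?E + x)"
      have e: "0 < e" "2 * ?E < e\<^sup>2" "e\<^sup>2 = 2 * ?E + x"
        using E x by (auto simp: e_def)
      obtain a where a: "(\<integral>\<^sup>+q. ennreal (\<bar>?f q - a\<bar> powr p) \<partial>bdry_vol M) \<le> ennreal (C * e powr p)"
        using sobolev_trace_limit[OF C b u e(1,2)] by blast
      have "(\<integral>q. \<bar>?f q\<bar> powr p \<partial>bdry_vol M) \<le> (\<integral>q. \<bar>?f q - a\<bar> powr p \<partial>bdry_vol M)"
        by (rule integral_powr_le_shift[OF finite_bdry_vol b p_gt_2 f f_int zero])
      also have "\<dots> = enn2real (\<integral>\<^sup>+q. ennreal (\<bar>?f q - a\<bar> powr p) \<partial>bdry_vol M)"
        by (rule integral_eq_nn_integral) auto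
      also have "\<dots> \<le> enn2real (ennreal (C * e powr p))"
        by (rule enn2real_mono[OF a]) simp
      also have "\<dots> = C * e powr p"
        using C by simp
      finally have "(\<integral>q. \<bar>?f q\<bar> powr p \<partial>bdry_vol M) powr (2 / p) \<le> (C * e powr p) powr (2 / p)"
        using p_gt_2 by (intro powr_mono2) auto
      also have "\<dots> = C powr (2 / p) * e\<^sup>2"
        using C e p_gt_2 by (simp add: powr_mult powr_powr)
      finally show ?thesis
        unfolding e(3) .
    qed
    have "(\<integral>q. \<bar>?f q\<bar> powr p \<partial>bdry_vol M) powr (2 / p) \<le> C powr (2 / p) * (2 * ?E)"
    proof (rule field_le_epsilon)
      fix y :: real assume y: "0 < y"
      \<comment> \<open>Makes the contribution of the slack at most y; the added 1 avoids a division
        by 0 for C = 0.\<close>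
      define x where "x = y / (C powr (2 / p) + 1)"
      have C1: "0 < C powr (2 / p) + 1"
        by (simp add: add_nonneg_pos)
      then have "0 < x" "(C powr (2 / p) + 1) * x = y"
        using y by (simp_all add: x_def)
      then have x: "0 < x" "C powr (2 / p) * x \<le> y"
        by (simp_all add: distrib_right)
      show "(\<integral>q. \<bar>?f q\<bar> powr p \<partial>bdry_vol M) powr (2 / p) \<le> C powr (2 / p) * (2 * ?E) + y"
        using le[OF x(1)] x(2) by (simp add: distrib_left)
    qed
    also have "\<dots> \<le> K * ?E"
      using E by (simp add: K_def algebra_simps)
    finally show ?thesis .
  qed
  moreover have "0 < K" by (simp add: K_def add_nonneg_pos)
  ultimately show ?thesis by blast
qed

text \<open>The approximating functions are shifted along; their gradients do not change, so neither
  does the distance.\<close>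

lemma sobolev_shift:
  assumes u: "u \<in> weighted_sobolev M \<rho> \<sigma>"
  shows "(weak_grad u, \<lambda>q. trace_of u q + c) \<in> weighted_sobolev M \<rho> \<sigma>"
    "weighted_energy M \<rho> \<sigma> (weak_grad u, \<lambda>q. trace_of u q + c) = weighted_energy M \<rho> \<sigma> u"
proof -
  let ?v = "(weak_grad u, \<lambda>q. trace_of u q + c)"
  show "weighted_energy M \<rho> \<sigma> ?v = weighted_energy M \<rho> \<sigma> u"
    by (simp add: weighted_energy_def)
  obtain U where U: "\<And>k. smooth_fun M (U k)" "(\<lambda>k. sobolev_dist_sq M \<rho> \<sigma> (U k) u) \<longlonglongrightarrow> 0"
    using u unfolding weighted_sobolev_def by blast
  have "sobolev_dist_sq M \<rho> \<sigma> (\<lambda>q. U k q - (- c)) ?v = sobolev_dist_sq M \<rho> \<sigma> (U k) u" for k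
    unfolding sobolev_dist_sq_def gradient_diff_const by simp
  then have "(\<lambda>k. sobolev_dist_sq M \<rho> \<sigma> (\<lambda>q. U k q - (- c)) ?v) \<longlonglongrightarrow> 0"
    using U(2) by (simp only:)
  moreover have "smooth_fun M (\<lambda>q. U k q - (- c))" for k
    by (rule smooth_fun_diff_const[OF U(1)])
  ultimately have ex: "\<exists>U. (\<forall>k. smooth_fun M (U k)) \<and> (\<lambda>k. sobolev_dist_sq M \<rho> \<sigma> (U k) ?v) \<longlonglongrightarrow> 0"
    by (intro exI[of _ "\<lambda>k q. U k q - (- c)"] conjI allI)
  have "(\<lambda>q. trace_of u q + c) \<in> borel_measurable Bb"
    using u unfolding weighted_sobolev_def by (auto intro: borel_measurable_add)
  then show "?v \<in> weighted_sobolev M \<rho> \<sigma>"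
    using u ex unfolding weighted_sobolev_def by simp
qed

lemma smooth_fun_in_sobolev:
  assumes u: "smooth_fun M u"
  shows "(gradient M u, u) \<in> weighted_sobolev M \<rho> \<sigma>"
proof -
  have "sobolev_dist_sq M \<rho> \<sigma> u (gradient M u, u) = 0"
    by (simp add: sobolev_dist_sq_def vnorm_sq_def Let_def)
  then have "\<exists>U. (\<forall>k::nat. smooth_fun M (U k)) \<and> (\<lambda>k. sobolev_dist_sq M \<rho> \<sigma> (U k) (gradient M u, u)) \<longlonglongrightarrow> 0"
    using u by (intro exI[of _ "\<lambda>k. u"]) simp
  then show ?thesis
    unfolding weighted_sobolev_def
    using is_vector_field_gradient[OF u] measurable_gradient[OF u] measurable_Bb[OF smooth_fun_measurable[OF u]]
    by simp
qed

end

section \<open>Nonconstant smooth traces on the boundary\<close>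

section \<open>A bump function\<close>

text \<open>The classical exp(-1/x) times powers of 1/x, extended by 0. The powers are included
  because differentiation produces them: derivatives are combinations of members of the
  family.\<close>

definition flat :: "nat \<Rightarrow> real \<Rightarrow> real" where
  "flat j x = (if 0 < x then exp (- inverse x) * inverse x ^ j else 0)"

lemma flat_tendsto_0: "(flat j \<longlongrightarrow> 0) (at 0)"
proof (rule filterlim_split_at)
  show "(flat j \<longlongrightarrow> 0) (at_left 0)"
    by (rule tendsto_eventually) (simp add: flat_def eventually_at_filter)
  have "((\<lambda>x. inverse x ^ j / exp (inverse x)) \<longlongrightarrow> (0::real)) (at_right 0)"
    by (rule filterlim_compose[OF tendsto_power_div_exp_0 filterlim_inverse_at_top_right])
  then show "(flat j \<longlongrightarrow> 0) (at_right 0)"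
    by (rule Lim_transform_eventually) (simp add: flat_def eventually_at_filter exp_minus field_simps)
qed

lemma has_real_derivative_flat:
  "(flat j has_real_derivative flat (j + 2) x - real j * flat (j + 1) x) (at x)"
proof -
  consider "x < 0" | "x = 0" | "0 < x" by linarith
  then show ?thesis
  proof cases
    case 1
    have "\<forall>\<^sub>F y in nhds x. flat j y = 0"
      by (rule eventually_nhds_in_open[of "{..<0}", THEN eventually_mono]) (use 1 in \<open>auto simp: flat_def\<close>)
    then have "(flat j has_real_derivative 0) (at x)"
      using DERIV_cong_ev[of x x "flat j" "\<lambda>x. 0" 0 0] by simp
    then show ?thesis using 1 by (simp add: flat_def)
  next
    case 2
    \<comment> \<open>At 0 the difference quotient is itself a member of the family, so the
      derivative there is its limit 0.\<close>
    have "(\<lambda>h. (flat j (0 + h) - flat j 0) / h) = flat (j + 1)"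
      by (auto simp: flat_def field_simps)
    then show ?thesis
      using flat_tendsto_0[of "j + 1"] 2 by (simp add: DERIV_def flat_def)
  next
    case 3
    have "((\<lambda>x. exp (- inverse x) * inverse x ^ j) has_real_derivative flat (j + 2) x - real j * flat (j + 1) x) (at x)"
      using 3 by (cases j; (auto intro!: derivative_eq_intros)) 
        (simp_all add: flat_def field_simps power2_eq_square,
          metis One_nat_def mult.commute not_gr_zero power_minus_mult)
    moreover have "\<forall>\<^sub>F y in nhds x. flat j y = exp (- inverse y) * inverse y ^ j"
      by (rule eventually_nhds_in_open[of "{0<..}", THEN eventually_mono]) (use 3 in \<open>auto simp: flat_def\<close>)
    ultimately show ?thesis
      using DERIV_cong_ev[of x x "flat j" "\<lambda>y. exp (- inverse y) * inverse y ^ j"] by simp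
  qed
qed

lemma flat_mono: "0 < x \<Longrightarrow> x < y \<Longrightarrow> flat 0 x < flat 0 y"
  by (simp add: flat_def)

text \<open>A class of functions closed under directional derivatives, so that membership alone gives
  smoothness.\<close>

inductive flat_alg :: "'a::euclidean_space set \<Rightarrow> ('a \<Rightarrow> real) \<Rightarrow> bool" for S where
  base: "\<forall>k. Ck_on k w S \<Longrightarrow> flat_alg S w"
| const: "flat_alg S (\<lambda>x. c)"
| flat: "flat_alg S w \<Longrightarrow> flat_alg S (\<lambda>x. flat j (w x))"
| add: "flat_alg S u \<Longrightarrow> flat_alg S w \<Longrightarrow> flat_alg S (\<lambda>x. u x + w x)"
| mult: "flat_alg S u \<Longrightarrow> flat_alg S w \<Longrightarrow> flat_alg S (\<lambda>x. u x * w x)"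

text \<open>Derivatives are asked to be members only up to equality on S, which is enough for
  \<open>Ck_on_cong\<close> on an open set.\<close>

lemma flat_alg_derivative:
  assumes "flat_alg S g"
  shows "(\<forall>x\<in>S. g differentiable (at x)) \<and>
    (\<forall>v. \<exists>g'. flat_alg S g' \<and> (\<forall>x\<in>S. frechet_derivative g (at x) v = g' x))"
  using assms
proof induction
  case (base w)
  have "\<forall>k. Ck_on k (\<lambda>x. frechet_derivative w (at x) v) S" for v
    using base[rule_format, of "Suc _"] by simp
  then have "flat_alg S (\<lambda>x. frechet_derivative w (at x) v)" for v
    by (rule flat_alg.base)
  moreover have "\<forall>x\<in>S. w differentiable (at x)"
    using base[rule_format, of "Suc 0"] by simp
  ultimately show ?case by blast
next
  case (const c)
  show ?case
    using flat_alg.const[of S 0] by (auto simp: frechet_derivative_const)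
next
  case (flat w j)
  have d: "((\<lambda>x. flat j (w x)) has_derivative (\<lambda>v. frechet_derivative w (at x) v *
      (flat (j + 2) (w x) - real j * flat (j + 1) (w x)))) (at x)" if "x \<in> S" for x
    by (rule DERIV_compose_FDERIV[OF has_real_derivative_flat])
      (use that flat.IH in \<open>simp add: frechet_derivative_works[symmetric]\<close>)
  have "\<exists>g'. flat_alg S g' \<and> (\<forall>x\<in>S. frechet_derivative (\<lambda>x. flat j (w x)) (at x) v = g' x)" for v
  proof -
    obtain w' where w': "flat_alg S w'" "\<forall>x\<in>S. frechet_derivative w (at x) v = w' x"
      using flat.IH by blast
    have "flat_alg S (\<lambda>x. w' x * (flat (j + 2) (w x) + (- real j) * flat (j + 1) (w x)))"
      by (intro flat_alg.mult flat_alg.add flat_alg.flat flat_alg.const w'(1) flat.hyps)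
    moreover have "frechet_derivative (\<lambda>x. flat j (w x)) (at x) v =
        w' x * (flat (j + 2) (w x) + (- real j) * flat (j + 1) (w x))" if "x \<in> S" for x
      using frechet_derivative_at[OF d[OF that], symmetric] w'(2) that by simp
    ultimately show ?thesis by blast
  qed
  then show ?case
    using d differentiableI by blast
next
  case (add u w)
  have d: "((\<lambda>x. u x + w x) has_derivative
      (\<lambda>v. frechet_derivative u (at x) v + frechet_derivative w (at x) v)) (at x)" if "x \<in> S" for x
    by (rule has_derivative_add) (use that add.IH in \<open>simp_all add: frechet_derivative_works[symmetric]\<close>)
  have "\<exists>g'. flat_alg S g' \<and> (\<forall>x\<in>S. frechet_derivative (\<lambda>x. u x + w x) (at x) v = g' x)" for v
  proof -
    obtain u' w' where u': "flat_alg S u'" "\<forall>x\<in>S. frechet_derivative u (at x) v = u' x"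
      and w': "flat_alg S w'" "\<forall>x\<in>S. frechet_derivative w (at x) v = w' x"
      using add.IH by meson
    have "frechet_derivative (\<lambda>x. u x + w x) (at x) v = u' x + w' x" if "x \<in> S" for x
      using frechet_derivative_at[OF d[OF that], symmetric] u'(2) w'(2) that by simp
    then show ?thesis
      using flat_alg.add[OF u'(1) w'(1)] by blast
  qed
  then show ?case
    using d differentiableI by blast
next
  case (mult u w)
  have d: "((\<lambda>x. u x * w x) has_derivative
      (\<lambda>v. u x * frechet_derivative w (at x) v + frechet_derivative u (at x) v * w x)) (at x)" if "x \<in> S" for x
    by (rule has_derivative_mult) (use that mult.IH in \<open>simp_all add: frechet_derivative_works[symmetric]\<close>)
  have "\<exists>g'. flat_alg S g' \<and> (\<forall>x\<in>S. frechet_derivative (\<lambda>x. u x * w x) (at x) v = g' x)" for v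
  proof -
    obtain u' w' where u': "flat_alg S u'" "\<forall>x\<in>S. frechet_derivative u (at x) v = u' x"
      and w': "flat_alg S w'" "\<forall>x\<in>S. frechet_derivative w (at x) v = w' x"
      using mult.IH by meson
    have "frechet_derivative (\<lambda>x. u x * w x) (at x) v = u x * w' x + u' x * w x" if "x \<in> S" for x
      using frechet_derivative_at[OF d[OF that], symmetric] u'(2) w'(2) that by simp
    then show ?thesis
      using flat_alg.add[OF flat_alg.mult[OF mult.hyps(1) w'(1)] flat_alg.mult[OF u'(1) mult.hyps(2)]] by blast
  qed
  then show ?case
    using d differentiableI by blast
qed

lemma flat_alg_Ck_on:
  assumes S: "open S"
  shows "flat_alg S g \<Longrightarrow> Ck_on k g S"
proof (induction k arbitrary: g)
  case 0
  then show ?case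
    using flat_alg_derivative[OF 0]
    by (auto intro!: continuous_at_imp_continuous_on differentiable_imp_continuous_within)
next
  case (Suc k)
  have "Ck_on k (\<lambda>x. frechet_derivative g (at x) v) S" for v
  proof -
    obtain g' where g': "flat_alg S g'" "\<forall>x\<in>S. frechet_derivative g (at x) v = g' x"
      using flat_alg_derivative[OF Suc.prems] by blast
    show ?thesis
      using Ck_on_cong[OF S, of "\<lambda>x. frechet_derivative g (at x) v" g' k] g'(2) Suc.IH[OF g'(1)] by simp
  qed
  then show ?case
    using flat_alg_derivative[OF Suc.prems] by simp
qed

lemma flat_alg_sum:
  assumes "finite I" "\<And>i. i \<in> I \<Longrightarrow> flat_alg S (f i)"
  shows "flat_alg S (\<lambda>x. \<Sum>i\<in>I. f i x)"
  using assms by (induction I) (simp_all add: flat_alg.const flat_alg.add)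

lemma Ck_on_inner_left:
  assumes S: "open S"
  shows "Ck_on k h S \<Longrightarrow> Ck_on k (\<lambda>x. h x \<bullet> b) S"
proof (induction k arbitrary: h)
  case 0
  then show ?case by (simp add: continuous_on_inner)
next
  case (Suc k)
  have d: "((\<lambda>x. h x \<bullet> b) has_derivative (\<lambda>v. frechet_derivative h (at x) v \<bullet> b)) (at x)" if "x \<in> S" for x
    by (rule has_derivative_inner_left) (use that Suc.prems in \<open>simp add: frechet_derivative_works[symmetric]\<close>)
  have "Ck_on k (\<lambda>x. frechet_derivative (\<lambda>x. h x \<bullet> b) (at x) v) S" for v
  proof (rule Ck_on_cong[OF S, THEN iffD1, rotated])
    show "Ck_on k (\<lambda>x. frechet_derivative h (at x) v \<bullet> b) S"
      using Suc.prems by (intro Suc.IH) simp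
    show "frechet_derivative h (at x) v \<bullet> b = frechet_derivative (\<lambda>x. h x \<bullet> b) (at x) v" if "x \<in> S" for x
      using frechet_derivative_at[OF d[OF that]] by metis
  qed
  moreover have "(\<lambda>x. h x \<bullet> b) differentiable (at x)" if "x \<in> S" for x
    by (rule differentiableI[OF d[OF that]])
  ultimately show ?case by simp
qed

text \<open>The squared norm is a polynomial in the coordinates, so the bump is smooth at 0 as well;
  the flatness of \<open>flat 0\<close> makes it smooth across the sphere of radius r.\<close>

definition bump :: "real \<Rightarrow> 'a::euclidean_space \<Rightarrow> real" where
  "bump r y = flat 0 (r\<^sup>2 - (norm y)\<^sup>2)"

lemma bump_eq_0: "0 < r \<Longrightarrow> r \<le> norm y \<Longrightarrow> bump r y = 0"
  using power_mono[of r "norm y" 2] by (simp add: bump_def flat_def not_less)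

lemma bump_strict_mono: "norm y < norm z \<Longrightarrow> norm z < r \<Longrightarrow> bump r z < bump r y"
  unfolding bump_def by (intro flat_mono) (simp_all add: power_strict_mono)

lemma Ck_on_bump_comp:
  fixes h :: "'a::euclidean_space \<Rightarrow> 'b::euclidean_space"
  assumes S: "open S" and h: "\<And>k. Ck_on k h S"
  shows "Ck_on k (\<lambda>x. bump r (h x - x0)) S"
proof (rule flat_alg_Ck_on[OF S])
  have "flat_alg S (\<lambda>x. h x \<bullet> b)" for b
    using Ck_on_inner_left[OF S h] by (intro flat_alg.base) simp
  \<comment> \<open>The squared distance is written out in coordinates, and differences as sums with
    constants, to match the generators of \<open>flat_alg\<close>.\<close>
  then have "flat_alg S (\<lambda>x. flat 0 (r\<^sup>2 + (- 1) * (\<Sum>b\<in>Basis. (h x \<bullet> b + - (x0 \<bullet> b)) * (h x \<bullet> b + - (x0 \<bullet> b)))))"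
    by (intro flat_alg.flat flat_alg.add flat_alg.mult flat_alg.const flat_alg_sum finite_Basis)
  moreover have "(\<Sum>b\<in>Basis. (h x \<bullet> b + - (x0 \<bullet> b)) * (h x \<bullet> b + - (x0 \<bullet> b))) = (norm (h x - x0))\<^sup>2" for x
    using euclidean_inner[of "h x - x0" "h x - x0"] by (simp add: power2_norm_eq_inner inner_diff_left)
  ultimately show "flat_alg S (\<lambda>x. bump r (h x - x0))"
    by (simp add: bump_def)
qed

context riem_mfd
begin

definition chart_bump :: "('a, 'n) chart \<Rightarrow> real \<Rightarrow> 'n model \<Rightarrow> 'a \<Rightarrow> real" where
  "chart_bump c r x0 p = (if p \<in> fst c then bump r (snd c p - x0) else 0)"

text \<open>At points in the domain of c the function is locally a bump composed with a transition
  map. At any other point it must vanish nearby: it is 0 off the image of a compact piece of a ball,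
  which is closed because M is Hausdorff.\<close>

lemma smooth_chart_bump:
  assumes c: "c \<in> At" and r: "0 < r" "cball x0 r \<inter> half_space \<subseteq> chart_img c"
  shows "smooth_fun M (chart_bump c r x0)"
  unfolding smooth_fun_def smooth_on_def
proof (intro ballI)
  fix d x assume d: "d \<in> At" and x: "x \<in> chart_img d"
  let ?U = "chart_bump c r x0 \<circ> chart_inv d"
  show "\<exists>S h. open S \<and> x \<in> S \<and> (\<forall>k. Ck_on k h S) \<and> (\<forall>y\<in>chart_img d \<inter> S. ?U y = h y)"
  proof (cases "chart_inv d x \<in> fst c")
    case True
    have x': "x \<in> snd d ` (fst d \<inter> fst c)"
      using True x by (intro image_eqI[of _ _ "chart_inv d x"]) simp_all
    obtain S h where S: "open S" "x \<in> S" "half_space \<inter> S \<subseteq> snd d ` (fst d \<inter> fst c)"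
      "\<And>k. Ck_on k h S" "\<And>y. y \<in> half_space \<inter> S \<Longrightarrow> (snd c \<circ> chart_inv d) y = h y"
      by (rule smooth_on_local[OF smooth_transition[OF d c] openin_overlap[OF d c] x']) (rule that)
    have "?U y = bump r (h y - x0)" if y: "y \<in> chart_img d \<inter> S" for y
    proof -
      have y': "y \<in> half_space \<inter> S" using y chart_img_half_space[OF d] by blast
      then obtain q where q: "q \<in> fst d" "q \<in> fst c" "y = snd d q" using S(3) by blast
      then have "chart_inv d y \<in> fst c" using d by simp
      then show ?thesis using S(5)[OF y'] by (simp add: chart_bump_def)
    qed
    with S(1,2) Ck_on_bump_comp[OF S(1,4)] show ?thesis
      by (intro exI[of _ S] exI[of _ "\<lambda>y. bump r (h y - x0)"]) simp
  next
    case False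
    let ?K = "chart_inv c ` (cball x0 r \<inter> half_space)"
    have "compactin (top_of_set (chart_img c)) (cball x0 r \<inter> half_space)"
      using r(2) compact_Int_closed[OF compact_cball closed_half_space] by (simp add: compactin_subtopology)
    from image_compactin[OF this continuous_chart_inv[OF c]]
    have "closedin X ?K"
      using Hausdorff by (intro compactin_imp_closedin) (simp_all add: compactin_subtopology)
    then have "openin X (topspace X - ?K)" by (rule openin_diff[OF openin_topspace])
    from openin_chart_inv_preimage[OF d this]
    obtain S where S: "open S" "{y \<in> chart_img d. chart_inv d y \<in> topspace X - ?K} = half_space \<inter> S"
      by (auto simp: openin_open)
    have "?K \<subseteq> fst c" using r(2) by auto
    then have "x \<in> {y \<in> chart_img d. chart_inv d y \<in> topspace X - ?K}"
      using False x chart_inv_in[OF x] chart_subset[OF d] unfolding mfd_pts_def by blast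
    then have "x \<in> S" unfolding S(2) by blast
    moreover have "?U y = 0" if y: "y \<in> chart_img d \<inter> S" for y
    proof -
      have ny: "chart_inv d y \<notin> ?K"
        using y chart_img_half_space[OF d] S(2) by blast
      have "bump r (snd c (chart_inv d y) - x0) = 0" if "chart_inv d y \<in> fst c"
      proof (rule bump_eq_0[OF r(1)], rule ccontr)
        assume "\<not> r \<le> norm (snd c (chart_inv d y) - x0)"
        then have "snd c (chart_inv d y) \<in> cball x0 r \<inter> half_space"
          using chart_half_space[OF c that] by (simp add: dist_norm norm_minus_commute)
        from imageI[OF this, of "chart_inv c"] ny show False
          using c that by simp
      qed
      then show ?thesis by (simp add: chart_bump_def)
    qed
    moreover have "Ck_on k (\<lambda>y. 0 :: real) S" for k
      by (rule flat_alg_Ck_on[OF S(1) flat_alg.const])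
    ultimately show ?thesis
      using S(1) by (intro exI[of _ S] exI[of _ "\<lambda>y. 0"]) simp
  qed
qed

end

context weighted_mfd
begin

text \<open>Nonconstancy, stronger than not vanishing, is needed because the function is shifted by
  a constant afterwards. A bump around P is large near P and small near a second boundary point Q of
  the same chart.\<close>

lemma ex_smooth_nonconstant_trace:
  assumes P: "P \<in> mfd_bdry M"
  obtains U where "smooth_fun M U" "\<And>k. \<not> (AE q in bdry_vol M. U q = k)"
proof -
  define c where "c = chart_at M P"
  have c: "c \<in> At" and Pc: "P \<in> fst c"
    using chart_at[of P] P bdry_subset by (auto simp: c_def)
  define x0 where "x0 = snd c P"
  have x0_0: "x0 $ None = 0" using mem_bdry_iff[OF c Pc] P by (simp add: x0_def)
  obtain W where W: "open W" "chart_img c = half_space \<inter> W"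
    using openin_chart_img[OF c] by (auto simp: openin_open)
  have "x0 \<in> W" using chart_in_img[OF Pc] W(2) by (simp add: x0_def)
  then obtain r where r: "0 < r" "cball x0 r \<subseteq> W"
    using W(1) open_contains_cball by blast
  let ?U = "chart_bump c r x0"
  have smooth: "smooth_fun M ?U"
    by (rule smooth_chart_bump[OF c r(1)]) (use r(2) W(2) in blast)
  \<comment> \<open>A point at radius 3/4 r in a tangential direction, so that Q lies on the
    boundary; \<open>undefined\<close> merely selects some index.\<close>
  define y :: "'n model" where "y = x0 + (3/4 * r) *\<^sub>R axis (Some undefined) 1"
  have y_norm: "norm (y - x0) = 3/4 * r" using r(1) by (simp add: y_def norm_axis_1)
  have y0: "y $ None = 0" using x0_0 by (simp add: y_def axis_def)
  have y_img: "y \<in> chart_img c"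
    using r y_norm y0 W(2) by (auto simp: half_space_def dist_norm norm_minus_commute subset_iff)
  define Q where "Q = chart_inv c y"
  have Q: "Q \<in> fst c" "snd c Q = y" using y_img by (simp_all add: Q_def)
  have QB: "Q \<in> mfd_bdry M" using mem_bdry_iff[OF c Q(1)] Q(2) y0 by simp
  let ?A = "{p \<in> fst c. snd c p \<in> ball x0 (r/4)}"
  let ?B = "{p \<in> fst c. snd c p \<in> ball x0 r - cball x0 (r/2)}"
  have A: "openin X ?A" by (rule openin_chart_preimage[OF c open_ball])
  have B: "openin X ?B" by (rule openin_chart_preimage[OF c open_Diff[OF open_ball closed_cball]])
  have PA: "P \<in> ?A" using Pc r(1) by (simp add: x0_def)
  have QB': "Q \<in> ?B" using Q y_norm r(1) by (simp add: dist_norm norm_minus_commute)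
  \<comment> \<open>The value at radius r/3 separates the two neighbourhoods, which lie within
    radius r/4 and beyond radius r/2.\<close>
  have UA: "m < ?U p" if "p \<in> ?A" and m: "m = bump r ((r/3) *\<^sub>R axis None (1::real) :: 'n model)" for p m
    unfolding m using that r(1) by (auto simp: chart_bump_def norm_axis_1 dist_norm norm_minus_commute intro!: bump_strict_mono)
  have UB: "?U p < m" if "p \<in> ?B" and m: "m = bump r ((r/3) *\<^sub>R axis None (1::real) :: 'n model)" for p m
    unfolding m using that r(1) by (auto simp: chart_bump_def norm_axis_1 dist_norm norm_minus_commute intro!: bump_strict_mono)
  have not_ae: False if O': "openin X O'" "p \<in> O'" "p \<in> mfd_bdry M" "\<And>q. q \<in> O' \<Longrightarrow> ?U q \<noteq> k"
    and ae: "AE q in bdry_vol M. ?U q = k" for O' p k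
  proof -
    have "AE q in bdry_vol M. indicator O' q = (0::ennreal)"
      using ae by eventually_elim (use O'(4) in \<open>auto simp: indicator_def\<close>)
    then have "(\<integral>\<^sup>+q. indicator O' q \<partial>bdry_vol M) = (\<integral>\<^sup>+q. 0 \<partial>bdry_vol M)"
      by (rule nn_integral_cong_AE)
    then show False using openin_bdry_vol_pos[OF O'(1-3)] by simp
  qed
  show thesis
  proof (rule that[OF smooth])
    fix k
    show "\<not> (AE q in bdry_vol M. ?U q = k)"
    proof
      assume ae: "AE q in bdry_vol M. ?U q = k"
      show False
      \<comment> \<open>A constant k up to the threshold is avoided on \<open>?A\<close>, a larger
        one on \<open>?B\<close>, and both sets meet the boundary in positive measure.\<close>
      proof (cases "k \<le> bump r ((r/3) *\<^sub>R axis None (1::real) :: 'n model)")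
        case True
        show False
          by (rule not_ae[OF A PA P _ ae]) (use UA[OF _ refl] True in fastforce)
      next
        case False
        show False
          by (rule not_ae[OF B QB' QB _ ae]) (use UB[OF _ refl] False in fastforce)
      qed
    qed
  qed
qed

section \<open>The variational quotient and the sharp inequality\<close>

lemma bdry_measure_pos:
  assumes "P \<in> mfd_bdry M"
  shows "0 < measure (bdry_vol M) (space (bdry_vol M))"
proof -
  interpret finite_measure "bdry_vol M" by (rule finite_bdry_vol)
  have "0 < (\<integral>\<^sup>+q. indicator (topspace X) q \<partial>bdry_vol M)"
    using assms bdry_subset by (intro openin_bdry_vol_pos[OF openin_topspace _ assms]) (auto simp: mfd_pts_def)
  also have "\<dots> \<le> (\<integral>\<^sup>+q. 1 \<partial>bdry_vol M)"
    by (intro nn_integral_mono) (simp add: indicator_def)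
  finally show ?thesis
    by (simp add: emeasure_eq_measure)
qed

definition admissible :: "('a, 'n) sobolev set" where
  "admissible = {u \<in> weighted_sobolev M \<rho> \<sigma>. (\<integral>q. spow p (trace_of u q) \<partial>bdry_vol M) = 0 \<and>
    \<not> (AE q in bdry_vol M. trace_of u q = 0)}"

definition quotient :: "('a, 'n) sobolev \<Rightarrow> real" where
  "quotient u = weighted_energy M \<rho> \<sigma> u / (\<integral>q. \<bar>trace_of u q\<bar> powr p \<partial>bdry_vol M) powr (2 / p)"

text \<open>Integrability excludes that the denominator of the quotient is 0 by default; it then
  vanishes only for a trace that is 0 almost everywhere.\<close>

lemma trace_norm_pos:
  assumes P: "P \<in> mfd_bdry M" and u: "u \<in> weighted_sobolev M \<rho> \<sigma>" "\<not> (AE q in bdry_vol M. trace_of u q = 0)"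
  shows "0 < (\<integral>q. \<bar>trace_of u q\<bar> powr p \<partial>bdry_vol M) powr (2 / p)"
proof -
  have "(\<integral>q. \<bar>trace_of u q\<bar> powr p \<partial>bdry_vol M) \<noteq> 0"
    using integral_nonneg_eq_0_iff_AE[OF sobolev_integrable_powr[OF bdry_measure_pos[OF P] u(1)]] u(2) by simp
  then show ?thesis by simp
qed

lemma quotient_nonneg: "u \<in> admissible \<Longrightarrow> 0 \<le> quotient u"
  unfolding quotient_def admissible_def using field_energy_eq_weighted_energy(2) by simp

lemma trace_shift:
  assumes P: "P \<in> mfd_bdry M" and u: "u \<in> weighted_sobolev M \<rho> \<sigma>"
  obtains c where "(\<integral>q. spow p (trace_of u q + c) \<partial>bdry_vol M) = 0"
    "(\<integral>q. \<bar>trace_of u q\<bar> powr p \<partial>bdry_vol M) powr (2 / p) \<le>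
      (\<integral>q. \<bar>trace_of u q + c\<bar> powr p \<partial>bdry_vol M) powr (2 / p) +
      (2 * p * (1 / measure (bdry_vol M) (space (bdry_vol M))) powr (1 / (p - 1))) powr (2 / p) *
        \<bar>\<integral>q. spow p (trace_of u q) \<partial>bdry_vol M\<bar> powr (2 / (p - 1))"
proof -
  note pos = bdry_measure_pos[OF P]
  have meas: "trace_of u \<in> borel_measurable (bdry_vol M)"
    by (rule weighted_sobolevE[OF u])
  note * = finite_bdry_vol pos p_gt_2 meas sobolev_integrable_powr[OF pos u]
  obtain c where c: "(\<integral>q. spow p (trace_of u q + c) \<partial>bdry_vol M) = 0"
    using ex_spow_shift_zero[OF *] by blast
  show thesis
    by (rule that[OF c norm_le_shift_norm[OF * c]])
qed

text \<open>An infimum over the empty set would be an unspecified real number. The nonconstant trace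
  stays nonzero under every shift, so the shift that meets the constraint gives an admissible
  element.\<close>

lemma admissible_nonempty:
  assumes P: "P \<in> mfd_bdry M"
  shows "admissible \<noteq> {}"
proof -
  obtain U where U: "smooth_fun M U" "\<And>k. \<not> (AE q in bdry_vol M. U q = k)"
    by (rule ex_smooth_nonconstant_trace[OF P]) (rule that)
  note u = smooth_fun_in_sobolev[OF U(1)]
  obtain c where c: "(\<integral>q. spow p (trace_of (gradient M U, U) q + c) \<partial>bdry_vol M) = 0"
    by (rule trace_shift[OF P u]) (rule that)
  have "\<not> (AE q in bdry_vol M. U q + c = 0)"
    using U(2)[of "- c"] by (simp add: eq_neg_iff_add_eq_0)
  then have "(gradient M U, \<lambda>q. U q + c) \<in> admissible"
    using sobolev_shift(1)[OF u, of c] c by (simp add: admissible_def)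
  then show ?thesis by blast
qed

lemma infimum_pos:
  assumes P: "P \<in> mfd_bdry M"
  shows "0 < (INF u\<in>admissible. quotient u)"
proof -
  obtain K where K: "0 < K" "\<forall>u\<in>weighted_sobolev M \<rho> \<sigma>. (\<integral>q. spow p (trace_of u q) \<partial>bdry_vol M) = 0 \<longrightarrow>
      (\<integral>q. \<bar>trace_of u q\<bar> powr p \<partial>bdry_vol M) powr (2 / p) \<le> K * weighted_energy M \<rho> \<sigma> u"
    using sobolev_trace_inequality[OF bdry_measure_pos[OF P]] by blast
  have "1 / K \<le> (INF u\<in>admissible. quotient u)"
  proof (rule cINF_greatest[OF admissible_nonempty[OF P]])
    fix u assume "u \<in> admissible"
    then have "(\<integral>q. \<bar>trace_of u q\<bar> powr p \<partial>bdry_vol M) powr (2 / p) \<le> K * weighted_energy M \<rho> \<sigma> u"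
      "0 < (\<integral>q. \<bar>trace_of u q\<bar> powr p \<partial>bdry_vol M) powr (2 / p)"
      using K(2) trace_norm_pos[OF P, of u] by (simp_all add: admissible_def)
    then show "1 / K \<le> quotient u"
      using K(1) by (simp add: quotient_def field_simps)
  qed
  with K(1) show ?thesis
    by (meson divide_pos_pos less_le_trans zero_less_one)
qed

lemma sharp_trace_inequality:
  assumes P: "P \<in> mfd_bdry M"
  shows "\<exists>B>0. \<forall>u\<in>weighted_sobolev M \<rho> \<sigma>.
    (\<integral>q. \<bar>trace_of u q\<bar> powr p \<partial>bdry_vol M) powr (2 / p) \<le>
      inverse (INF u\<in>admissible. quotient u) * weighted_energy M \<rho> \<sigma> u +
      B * \<bar>\<integral>q. spow p (trace_of u q) \<partial>bdry_vol M\<bar> powr (2 / (p - 1))"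
proof -
  define \<mu> where "\<mu> = (INF u\<in>admissible. quotient u)"
  have \<mu>: "0 < \<mu>" unfolding \<mu>_def by (rule infimum_pos[OF P])
  define B where "B = (2 * p * (1 / measure (bdry_vol M) (space (bdry_vol M))) powr (1 / (p - 1))) powr (2 / p)"
  have B: "0 < B"
    using bdry_measure_pos[OF P] p_gt_2 by (simp add: B_def)
  have "(\<integral>q. \<bar>trace_of u q\<bar> powr p \<partial>bdry_vol M) powr (2 / p) \<le>
      inverse \<mu> * weighted_energy M \<rho> \<sigma> u + B * \<bar>\<integral>q. spow p (trace_of u q) \<partial>bdry_vol M\<bar> powr (2 / (p - 1))"
    if u: "u \<in> weighted_sobolev M \<rho> \<sigma>" for u
  proof -
    obtain c where c: "(\<integral>q. spow p (trace_of u q + c) \<partial>bdry_vol M) = 0"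
      "(\<integral>q. \<bar>trace_of u q\<bar> powr p \<partial>bdry_vol M) powr (2 / p) \<le>
        (\<integral>q. \<bar>trace_of u q + c\<bar> powr p \<partial>bdry_vol M) powr (2 / p) +
        B * \<bar>\<integral>q. spow p (trace_of u q) \<partial>bdry_vol M\<bar> powr (2 / (p - 1))"
      by (rule trace_shift[OF P u, folded B_def]) (rule that)
    define v where "v = (weak_grad u, \<lambda>q. trace_of u q + c)"
    have v: "v \<in> weighted_sobolev M \<rho> \<sigma>" "weighted_energy M \<rho> \<sigma> v = weighted_energy M \<rho> \<sigma> u"
      "trace_of v = (\<lambda>q. trace_of u q + c)"
      using sobolev_shift[OF u] by (simp_all add: v_def)
    have "(\<integral>q. \<bar>trace_of v q\<bar> powr p \<partial>bdry_vol M) powr (2 / p) \<le> inverse \<mu> * weighted_energy M \<rho> \<sigma> v"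
    \<comment> \<open>If the shifted trace vanishes almost everywhere, \<open>v\<close> does not
      compete for the infimum, but the left-hand side is 0.\<close>
    proof (cases "AE q in bdry_vol M. trace_of v q = 0")
      case True
      then have "(\<integral>q. \<bar>trace_of v q\<bar> powr p \<partial>bdry_vol M) = 0"
        by (intro integral_eq_zero_AE) (auto elim: eventually_mono)
      then show ?thesis
        using \<mu> field_energy_eq_weighted_energy(2)[OF v(1)] by simp
    next
      case False
      then have adm: "v \<in> admissible"
        using v(1,3) c(1) by (simp add: admissible_def)
      have "\<mu> \<le> quotient v"
        unfolding \<mu>_def by (rule cINF_lower[OF _ adm]) (use quotient_nonneg in \<open>auto intro!: bdd_belowI\<close>)
      then show ?thesis
        using \<mu> trace_norm_pos[OF P v(1) False] by (simp add: quotient_def field_simps)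
    qed
    with c(2) show ?thesis unfolding v(2,3) by simp
  qed
  with B show ?thesis unfolding \<mu>_def by blast
qed

end

theorem theorem1p1:
  fixes M :: "('a, 'n::finite) riem_data"
    and n :: nat and \<sigma> p \<mu> :: real and \<rho> :: "'a \<Rightarrow> real"
    and \<Lambda> :: "('a, 'n) sobolev set"
  assumes M: "compact_connected_riemannian_manifold_with_boundary M"
    and n: "n = CARD('n)" "n \<ge> 2"
    and \<sigma>: "0 < \<sigma>" "\<sigma> < 1"
    and p: "p = 2 * real n / (real n - 2 * \<sigma>)"
    and \<rho>: "defining_function M \<rho>"
           "\<forall>x\<in>mfd_bdry M. sqrt (vnorm_sq M (gradient M \<rho>) x) = 1"
    and \<Lambda>: "\<Lambda> = {u \<in> weighted_sobolev M \<rho> \<sigma>.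
               (\<integral>x. \<bar>trace_of u x\<bar> powr (p - 2) * trace_of u x \<partial>bdry_vol M) = 0 \<and>
               \<not> (AE x in bdry_vol M. trace_of u x = 0)}"
    and \<mu>: "\<mu> = (INF u\<in>\<Lambda>. weighted_energy M \<rho> \<sigma> u /
                     (\<integral>x. \<bar>trace_of u x\<bar> powr p \<partial>bdry_vol M) powr (2 / p))"
    and cond:
      "(n = 3 \<and> \<sigma> < 1 / 2 \<and> (\<exists>P\<in>mfd_bdry M. mean_curv M P > 0)) \<or>
       (n \<ge> 4 \<and> (\<exists>P\<in>mfd_bdry M. mean_curv M P > 0)) \<or>
       (n \<ge> 5 \<and> (\<exists>P\<in>mfd_bdry M. mean_curv M P = 0 \<and>
          (3 * (real n)\<^sup>2 - 6 * real n - 4 * \<sigma>\<^sup>2 + 4) /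
              (12 * (1 - \<sigma>) * (real n - 1) * (real n - 2 - 2 * \<sigma>)) * bdry_scalar_curv M P
            + second_ff_norm_sq M P
            + (3 * real n - 2 - 2 * \<sigma>) / (3 * real n - 6 - 6 * \<sigma>) * ricci_normal M P > 0))"
  shows "\<exists>B>0. \<forall>u\<in>weighted_sobolev M \<rho> \<sigma>.
           integrable (bdry_vol M) (\<lambda>x. \<bar>trace_of u x\<bar> powr p) \<and>
           (\<integral>x. \<bar>trace_of u x\<bar> powr p \<partial>bdry_vol M) powr (2 / p)
             \<le> inverse \<mu> * weighted_energy M \<rho> \<sigma> u
                + B * \<bar>\<integral>x. \<bar>trace_of u x\<bar> powr (p - 2) * trace_of u x \<partial>bdry_vol M\<bar> powr (2 / (p - 1))"
proof -
  \<comment> \<open>Each of the three alternatives exhibits a boundary point, which makes the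
    boundary measure positive.\<close>
  obtain P where P: "P \<in> mfd_bdry M"
    using cond by blast
  interpret weighted_mfd M \<rho> \<sigma> p
    using M \<rho>(1) \<sigma> n p by unfold_locales auto
  have \<Lambda>': "\<Lambda> = admissible"
    unfolding \<Lambda> admissible_def spow_def ..
  have \<mu>': "\<mu> = (INF u\<in>admissible. quotient u)"
    unfolding \<mu> \<Lambda>' quotient_def ..
  show ?thesis
    using sharp_trace_inequality[OF P] sobolev_integrable_powr[OF bdry_measure_pos[OF P]]
    unfolding \<mu>' spow_def by blast
qed

end
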